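(* Let $p>m$ and $n\ge p$, and let $X$ ($m\times p$) and $S$ ($p\times p$) be independent with $X\sim \mathcal N_{m\times p}(\Theta, I_m\otimes\Sigma)$ and $S\sim\mathcal W_p(n,\Sigma)$. Let $R$ be an $m\times m$ orthogonal matrix with $XS^{-1}X^\top=RFR^\top$, $F=\mathrm{diag}(f_1,\dots,f_m)$, $f_1>\cdots>f_m>0$. (1) Assume $-2<c<a+p$ and $b>-n-m-1$. Then the generalized Bayes estimator of $\Theta$ against the hierarchical prior with parameters $(a,b,c)$ described in the context is $$\widehat\Theta^{GB1}=X-R F^{-1}E[\Lambda\mid F]\,\{F^{-1}(I_m+F)-E[\Lambda\mid F]\}^{-1}R^\top X,$$ where $E[\Lambda\mid F]$ is the expectation of the random $m\times m$ symmetric matrix $\Lambda$ with respect to the density $$\pi(\Lambda\mid F)\propto |\Lambda|^{(a-c+m+p-1)/2-(m+1)/2}\,|I_m-\Lambda|^{(c+m+1)/2-(m+1)/2}\,|I_m-F(I_m+F)^{-1}\Lambda|^{(b-a-m+n)/2}\,I(0<\Lambda<I_m).$$ (2) When $b=a+m-n$, assume $-2<c<a+p$ and $a>-2m-1$. Then the generalized Bayes estimator of $\Theta$ has the closed form $$\widehat\Theta^{GB}=X-k_0\{I_m+(1-k_0)XS^{-1}X^\top\}^{-1}X=X-k_0X\{I_p+(1-k_0)S^{-1}X^\top X\}^{-1},$$ where $k_0=\dfrac{a-c+p+m-1}{a+2m+p}$.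
   Context: $\mathcal N_{m\times p}(M,A\otimes\Sigma)$ denotes the matrix normal distribution with density proportional to $\exp[-\tfrac12\mathrm{tr}\{A^{-1}(X-M)\Sigma^{-1}(X-M)^\top\}]$; $\mathcal W_p(n,\Sigma)$ is the Wishart distribution with $n$ degrees of freedom and scale matrix $\Sigma$ (positive definite $p\times p$). Both $\Theta$ and $\Sigma$ are unknown. Hierarchical (possibly improper) prior with real parameters $a,b,c$: $\Theta\mid\Sigma,\Omega\sim\mathcal N_{m\times p}(0,\Omega\otimes\Sigma)$ with $\Omega$ a positive definite $m\times m$ matrix; $\pi(\Omega)\propto|I_m+\Omega|^{-a/2-m}|\Omega|^{c/2}$; $\pi(\Sigma^{-1})\propto|\Sigma^{-1}|^{(b-1)/2}$ (densities with respect to Lebesgue measure on positive definite symmetric $m\times m$, resp. $p\times p$, matrices). The generalized Bayes estimator of $\Theta$ (for both the matrix loss $(\widehat\Theta-\Theta)\Sigma^{-1}(\widehat\Theta-\Theta)^\top$ and its trace) is $E[\Theta\Sigma^{-1}\mid X,S]\{E[\Sigma^{-1}\mid X,S]\}^{-1}$, where the expectations are under the posterior distribution given $(X,S)$. $|\cdot|$ is the determinant, $I(\cdot)$ the indicator function, and $A<B$ for symmetric matrices means $B-A$ is positive definite. The decomposition with distinct positive $f_i$ exists almost surely. *)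

theory Defs
  imports "HOL-Probability.Probability"
begin

text \<open>
  An \<open>m \<times> p\<close> real matrix has type \<open>real^'p^'m\<close>; throughout \<open>m = CARD('m)\<close> and \<open>p = CARD('p)\<close>.
\<close>

definition pos_def :: "real^'n^'n \<Rightarrow> bool" where
  "pos_def A \<longleftrightarrow> transpose A = A \<and> (\<forall>x. x \<noteq> 0 \<longrightarrow> x \<bullet> (A *v x) > 0)"

definition loewner_less :: "real^'n^'n \<Rightarrow> real^'n^'n \<Rightarrow> bool" (infix "\<prec>" 50) where
  "A \<prec> B \<longleftrightarrow> pos_def (B - A)"

definition diag_mat :: "('n \<Rightarrow> real) \<Rightarrow> real^'n^'n" where
  "diag_mat f = (\<chi> i j. if i = j then f i else 0)"

text \<open>
  Lebesgue measure on the symmetric matrices, \<open>\<Prod>\<^bsub>i \<le> j\<^esub> dA\<^bsub>ij\<^esub>\<close>, as a measure on all square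
  matrices. The free entries are indexed by the unordered pairs \<open>{i, j}\<close> (with \<open>i = j\<close> allowed).
\<close>

definition sym_lborel :: "(real^'n^'n) measure" where
  "sym_lborel =
     distr (\<Pi>\<^sub>M e \<in> {{i, j} |i j :: 'n. True}. lborel) borel (\<lambda>v. \<chi> i j. v {i, j})"

text \<open>
  The probability measure whose density with respect to \<open>\<mu>\<close> is proportional to \<open>g\<close>. If the total
  mass of \<open>g\<close> is \<open>0\<close> or \<open>\<infinity>\<close> this is the null measure, hence not a \<open>prob_space\<close>.
\<close>

definition normalized :: "'a measure \<Rightarrow> ('a \<Rightarrow> real) \<Rightarrow> 'a measure" where
  "normalized \<mu> g = density \<mu> (\<lambda>x. ennreal (g x) / (\<integral>\<^sup>+y. ennreal (g y) \<partial>\<mu>))"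

text \<open>Density of \<open>N(M, A \<otimes> \<Sigma>)\<close> with respect to \<open>lborel\<close>, with its normalizing constant.\<close>

definition matrix_normal_density ::
    "real^'p^'m \<Rightarrow> real^'m^'m \<Rightarrow> real^'p^'p \<Rightarrow> real^'p^'m \<Rightarrow> real" where
  "matrix_normal_density M A \<Sigma> X =
     (2 * pi) powr (- real (CARD('m) * CARD('p)) / 2) *
     det A powr (- real CARD('p) / 2) * det \<Sigma> powr (- real CARD('m) / 2) *
     exp (- trace (matrix_inv A ** (X - M) ** matrix_inv \<Sigma> ** transpose (X - M)) / 2)"

definition multivariate_Gamma :: "nat \<Rightarrow> real \<Rightarrow> real" where
  "multivariate_Gamma p x =
     pi powr (real p * (real p - 1) / 4) * (\<Prod>j=1..p. Gamma (x + (1 - real j) / 2))"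

text \<open>Density of the Wishart distribution with respect to \<open>sym_lborel\<close>.\<close>

definition wishart_density :: "nat \<Rightarrow> real^'p^'p \<Rightarrow> real^'p^'p \<Rightarrow> real" where
  "wishart_density n \<Sigma> S =
     (if pos_def S then
        det S powr ((real n - real CARD('p) - 1) / 2) * exp (- trace (matrix_inv \<Sigma> ** S) / 2) /
        (2 powr (real n * real CARD('p) / 2) * det \<Sigma> powr (real n / 2) *
         multivariate_Gamma CARD('p) (real n / 2))
      else 0)"

definition prior_Omega :: "real \<Rightarrow> real \<Rightarrow> real^'m^'m \<Rightarrow> real" where
  "prior_Omega a c \<Omega> =
     (if pos_def \<Omega> then
        det (mat 1 + \<Omega>) powr (- a / 2 - real CARD('m)) * det \<Omega> powr (c / 2)
      else 0)"

definition prior_precision :: "real \<Rightarrow> real^'p^'p \<Rightarrow> real" where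
  "prior_precision b Q = (if pos_def Q then det Q powr ((b - 1) / 2) else 0)"

text \<open>
  Posterior of \<open>(\<Theta>, \<Omega>, Q)\<close> with \<open>Q = \<Sigma>\<^sup>-\<^sup>1\<close> given the independent observations \<open>X = x\<close> and
  \<open>S = s\<close>. The variable is the precision matrix \<open>Q\<close>, not \<open>\<Sigma>\<close>, because the prior is a density in
  \<open>\<Sigma>\<^sup>-\<^sup>1\<close>.
\<close>

definition posterior_kernel ::
    "nat \<Rightarrow> real \<Rightarrow> real \<Rightarrow> real \<Rightarrow> real^'p^'m \<Rightarrow> real^'p^'p \<Rightarrow>
     (real^'p^'m) \<times> (real^'m^'m) \<times> (real^'p^'p) \<Rightarrow> real" where
  "posterior_kernel n a b c x s = (\<lambda>(\<Theta>, \<Omega>, Q).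
     matrix_normal_density \<Theta> (mat 1) (matrix_inv Q) x * wishart_density n (matrix_inv Q) s *
     matrix_normal_density 0 \<Omega> (matrix_inv Q) \<Theta> * prior_Omega a c \<Omega> * prior_precision b Q)"

definition posterior ::
    "nat \<Rightarrow> real \<Rightarrow> real \<Rightarrow> real \<Rightarrow> real^'p^'m \<Rightarrow> real^'p^'p \<Rightarrow>
     ((real^'p^'m) \<times> (real^'m^'m) \<times> (real^'p^'p)) measure" where
  "posterior n a b c x s =
     normalized (lborel \<Otimes>\<^sub>M sym_lborel \<Otimes>\<^sub>M sym_lborel) (posterior_kernel n a b c x s)"

text \<open>
  The generalized Bayes estimator \<open>E[\<Theta>\<Sigma>\<^sup>-\<^sup>1 | X, S] {E[\<Sigma>\<^sup>-\<^sup>1 | X, S]}\<^sup>-\<^sup>1\<close>. Since \<open>integral\<^sup>L\<close> and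
  \<open>matrix_inv\<close> are total, the conditions under which the expression is meaningful are separate.
\<close>

definition gen_bayes_exists ::
    "nat \<Rightarrow> real \<Rightarrow> real \<Rightarrow> real \<Rightarrow> real^'p^'m \<Rightarrow> real^'p^'p \<Rightarrow> bool" where
  "gen_bayes_exists n a b c x s \<longleftrightarrow>
     prob_space (posterior n a b c x s) \<and>
     integrable (posterior n a b c x s) (\<lambda>(\<Theta>, \<Omega>, Q). \<Theta> ** Q) \<and>
     integrable (posterior n a b c x s) (\<lambda>(\<Theta>, \<Omega>, Q). Q) \<and>
     invertible (integral\<^sup>L (posterior n a b c x s) (\<lambda>(\<Theta>, \<Omega>, Q). Q))"

definition gen_bayes ::
    "nat \<Rightarrow> real \<Rightarrow> real \<Rightarrow> real \<Rightarrow> real^'p^'m \<Rightarrow> real^'p^'p \<Rightarrow> real^'p^'m" where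
  "gen_bayes n a b c x s =
     integral\<^sup>L (posterior n a b c x s) (\<lambda>(\<Theta>, \<Omega>, Q). \<Theta> ** Q) **
     matrix_inv (integral\<^sup>L (posterior n a b c x s) (\<lambda>(\<Theta>, \<Omega>, Q). Q))"

text \<open>The law of \<open>\<Lambda>\<close> given \<open>F\<close>; here \<open>p\<close> is an argument, as it is not determined by the types.\<close>

definition Lambda_kernel ::
    "nat \<Rightarrow> nat \<Rightarrow> real \<Rightarrow> real \<Rightarrow> real \<Rightarrow> real^'m^'m \<Rightarrow> real^'m^'m \<Rightarrow> real" where
  "Lambda_kernel p n a b c F \<Lambda> =
     (let m = real CARD('m) in
      if 0 \<prec> \<Lambda> \<and> \<Lambda> \<prec> mat 1 then
        det \<Lambda> powr ((a - c + m + real p - 1) / 2 - (m + 1) / 2) *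
        det (mat 1 - \<Lambda>) powr ((c + m + 1) / 2 - (m + 1) / 2) *
        det (mat 1 - F ** matrix_inv (mat 1 + F) ** \<Lambda>) powr ((b - a - m + real n) / 2)
      else 0)"

definition Lambda_law ::
    "nat \<Rightarrow> nat \<Rightarrow> real \<Rightarrow> real \<Rightarrow> real \<Rightarrow> real^'m^'m \<Rightarrow> (real^'m^'m) measure" where
  "Lambda_law p n a b c F = normalized sym_lborel (Lambda_kernel p n a b c F)"

end

theory Submission
  imports Defs
begin

text \<open>
  With \<open>Q = \<Sigma>\<^sup>-\<^sup>1\<close> and \<open>B = x s\<^sup>-\<^sup>1 x\<^sup>T\<close>, the three unknowns \<open>\<Theta>\<close>, \<open>Q\<close>, \<open>\<Omega>\<close> of the posterior can be integrated out in this
  order, and every step leaves a density of a known family.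

  Completing the square shows that, given \<open>\<Omega>\<close> and \<open>Q\<close>, the matrix \<open>\<Theta>\<close> is normal with mean
  \<open>(I - L) x\<close>, where \<open>L = (I + \<Omega>)\<^sup>-\<^sup>1\<close>, and that the remaining function of \<open>(\<Omega>, Q)\<close> is, in \<open>Q\<close>, a Wishart density
  with scale \<open>V\<^sup>-\<^sup>1\<close>, where \<open>V = s + x\<^sup>T L x\<close> (lemma \<open>posterior_kernel_factor\<close>). The mean of \<open>Q\<close> given \<open>\<Omega>\<close> is a fixed multiple of
  \<open>V\<^sup>-\<^sup>1\<close> and that of \<open>\<Theta> Q\<close> is the same multiple of \<open>(I - L) x V\<^sup>-\<^sup>1\<close>. The Woodbury identity
  turns both into affine functions of the single \<open>m \<times> m\<close> matrix \<open>G = (I + B + \<Omega>)\<^sup>-\<^sup>1\<close> (lemma \<open>posterior_scale_facts\<close>), and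
  \<open>det V = det s det (I + B + \<Omega>) / det (I + \<Omega>)\<close>, so \<open>\<Omega>\<close> has a density proportional to
  \<open>|I + \<Omega>|\<^sup>\<beta> |\<Omega>|\<^sup>c\<^sup>/\<^sup>2 |I + B + \<Omega>|\<^sup>-\<^sup>h\<close>. Both posterior expectations are therefore determined by the mean of \<open>G\<close>
  under this law.

  If \<open>B = R F R\<^sup>T\<close>, the substitution \<open>\<Omega> = A (\<Lambda>\<^sup>-\<^sup>1 - I) A\<^sup>T\<close> with \<open>A = R (I + F)\<^sup>1\<^sup>/\<^sup>2\<close> gives
  \<open>I + B + \<Omega> = A \<Lambda>\<^sup>-\<^sup>1 A\<^sup>T\<close> and carries the law of \<open>\<Omega>\<close> to that of \<open>\<Lambda>\<close> in the theorem
  (lemma \<open>omega_to_Lambda\<close>). The law of \<open>\<Lambda>\<close> does not change when row and column \<open>i\<close> change sign, so \<open>E[\<Lambda>]\<close>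
  is diagonal. From here on everything is diagonal in the basis \<open>R\<close>, and the estimator becomes
  \<open>x - H x\<close> with \<open>H = R diag (e\<^sub>i / (1 + f\<^sub>i - f\<^sub>i e\<^sub>i)) R\<^sup>T\<close>, where \<open>E[\<Lambda>] = diag (e\<^sub>i)\<close>
  (lemma \<open>gen_bayes_shrinkage\<close>). If \<open>b = a + m - n\<close>, the law of \<open>\<Lambda>\<close> is a matrix beta law. It is
  invariant under all orthogonal congruences, its mean is \<open>k\<^sub>0 I\<close>, and \<open>H\<close> is the closed form.

  The analytic substance is that all these integrals exist and that the substitutions are legitimate.
  Finiteness of the gamma integral over the cone of positive definite matrices is proved by integrating out one diagonal
  entry after the other (lemma \<open>minor_integral_finite\<close>) and then by convolution
  (lemma \<open>cone_mass_finite\<close>). The values of the gamma and beta integrals cancel in all the ratios. The first moments come from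
  scaling and from invariance under orthogonal congruences. The Jacobian \<open>|det A|\<^sup>n\<^sup>+\<^sup>1\<close> of a congruence \<open>Q \<mapsto> A Q A\<^sup>T\<close>
  is obtained from elementary matrices, and that of the inversion from the uniqueness of the
  invariant measure on the cone (lemma \<open>cone_haar_inversion\<close>).
\<close>

section \<open>Lebesgue measure on products\<close>

abbreviation lebesgue_product :: "'i set \<Rightarrow> ('i \<Rightarrow> real) measure" where
  "lebesgue_product E \<equiv> PiM E (\<lambda>_. lborel)"

lemma product_sigma_finite_lborel: "product_sigma_finite (\<lambda>_. lborel :: real measure)"
  by standard

lemma lebesgue_product_affine:
  fixes f :: "('i \<Rightarrow> real) \<Rightarrow> ennreal"
  assumes "finite E" and "f \<in> borel_measurable (lebesgue_product E)"
    and "\<And>e. e \<in> E \<Longrightarrow> t e \<noteq> 0"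
  shows "(\<integral>\<^sup>+v. f v \<partial>lebesgue_product E) =
    (\<Prod>e\<in>E. ennreal \<bar>t e\<bar>) * (\<integral>\<^sup>+v. f (\<lambda>e\<in>E. c e + t e * v e) \<partial>lebesgue_product E)"
  using assms
proof (induction E arbitrary: f rule: finite_induct)
  case empty
  interpret product_sigma_finite "\<lambda>_::'i. lborel :: real measure" by (rule product_sigma_finite_lborel)
  show ?case by (simp add: PiM_empty nn_integral_count_space_finite restrict_def)
next
  case (insert i E)
  interpret product_sigma_finite "\<lambda>_::'i. lborel :: real measure" by (rule product_sigma_finite_lborel)
  note [measurable] = insert.prems(1)
  have upd: "(\<lambda>(x, y). x(i := y)) \<in> measurable (lebesgue_product E \<Otimes>\<^sub>M lborel) (lebesgue_product (insert i E))"
    by measurable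
  have fm: "(\<lambda>(x, y). f (x(i := y))) \<in> borel_measurable (lebesgue_product E \<Otimes>\<^sub>M lborel)"
    using measurable_comp[OF upd insert.prems(1)] by (simp add: comp_def case_prod_beta)
  have h: "(\<lambda>x. \<integral>\<^sup>+y. f (x(i := y)) \<partial>lborel) \<in> borel_measurable (lebesgue_product E)"
    using fm by (intro lborel.borel_measurable_nn_integral) (simp add: case_prod_beta)
  have T: "(\<lambda>v. \<lambda>e\<in>insert i E. c e + t e * v e) \<in> measurable (lebesgue_product (insert i E)) (lebesgue_product (insert i E))"
    by (intro measurable_restrict) auto
  have aff: "f (\<lambda>e\<in>insert i E. c e + t e * (x(i := y)) e) =
      f ((\<lambda>e\<in>E. c e + t e * x e)(i := c i + t i * y))" for x y
    using insert.hyps by (intro arg_cong[where f=f]) (auto simp: fun_eq_iff)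
  have sec: "(\<lambda>y. f (x(i := y))) \<in> borel_measurable lborel" if "x \<in> space (lebesgue_product E)" for x
    using measurable_compose_Pair1[OF that fm] by simp
  have "(\<integral>\<^sup>+v. f v \<partial>lebesgue_product (insert i E)) = (\<integral>\<^sup>+x. (\<integral>\<^sup>+y. f (x(i := y)) \<partial>lborel) \<partial>lebesgue_product E)"
    using insert by (intro product_nn_integral_insert) auto
  also have "\<dots> = (\<Prod>e\<in>E. ennreal \<bar>t e\<bar>) *
      (\<integral>\<^sup>+x. (\<integral>\<^sup>+y. f ((\<lambda>e\<in>E. c e + t e * x e)(i := y)) \<partial>lborel) \<partial>lebesgue_product E)"
    by (rule insert.IH[OF h]) (use insert.prems in auto)
  also have "(\<integral>\<^sup>+x. (\<integral>\<^sup>+y. f ((\<lambda>e\<in>E. c e + t e * x e)(i := y)) \<partial>lborel) \<partial>lebesgue_product E) =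
      (\<integral>\<^sup>+x. ennreal \<bar>t i\<bar> * (\<integral>\<^sup>+y. f ((\<lambda>e\<in>E. c e + t e * x e)(i := c i + t i * y)) \<partial>lborel) \<partial>lebesgue_product E)"
  proof (rule nn_integral_cong)
    fix x assume "x \<in> space (lebesgue_product E)"
    then have "(\<lambda>e\<in>E. c e + t e * x e) \<in> space (lebesgue_product E)" by (simp add: space_PiM)
    from sec[OF this] show "(\<integral>\<^sup>+y. f ((\<lambda>e\<in>E. c e + t e * x e)(i := y)) \<partial>lborel) =
      ennreal \<bar>t i\<bar> * (\<integral>\<^sup>+y. f ((\<lambda>e\<in>E. c e + t e * x e)(i := c i + t i * y)) \<partial>lborel)"
      using insert.prems(2) by (intro nn_integral_real_affine) auto
  qed
  also have "\<dots> = ennreal \<bar>t i\<bar> * (\<integral>\<^sup>+x. (\<integral>\<^sup>+y. f (\<lambda>e\<in>insert i E. c e + t e * (x(i := y)) e) \<partial>lborel) \<partial>lebesgue_product E)"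
  proof -
    have "(\<lambda>(x,y). f (\<lambda>e\<in>insert i E. c e + t e * (x(i := y)) e)) \<in> borel_measurable (lebesgue_product E \<Otimes>\<^sub>M lborel)"
      using measurable_comp[OF upd measurable_comp[OF T insert.prems(1)]] by (simp add: comp_def case_prod_beta)
    then have "(\<lambda>x. \<integral>\<^sup>+y. f (\<lambda>e\<in>insert i E. c e + t e * (x(i := y)) e) \<partial>lborel) \<in> borel_measurable (lebesgue_product E)"
      by (intro lborel.borel_measurable_nn_integral) (simp add: case_prod_beta)
    then show ?thesis unfolding aff by (rule nn_integral_cmult)
  qed
  also have "(\<integral>\<^sup>+x. (\<integral>\<^sup>+y. f (\<lambda>e\<in>insert i E. c e + t e * (x(i := y)) e) \<partial>lborel) \<partial>lebesgue_product E) =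
      (\<integral>\<^sup>+v. f (\<lambda>e\<in>insert i E. c e + t e * v e) \<partial>lebesgue_product (insert i E))"
    using insert.hyps measurable_comp[OF T insert.prems(1)]
    by (intro product_nn_integral_insert[symmetric]) (auto simp: comp_def)
  finally show ?case by (simp only: prod.insert[OF insert.hyps] ac_simps)
qed

text \<open>
  With the coordinates outside \<open>J\<close> held fixed, the map translates those in \<open>J\<close> by constants, so Fubini reduces the
  claim to translation invariance.
\<close>

lemma lebesgue_product_shear:
  fixes f :: "('i \<Rightarrow> real) \<Rightarrow> ennreal"
  assumes E: "finite E" "J \<subseteq> E" and f: "f \<in> borel_measurable (lebesgue_product E)"
    and g: "\<And>e. e \<in> J \<Longrightarrow> g e \<in> borel_measurable (lebesgue_product E)"
    and dep: "\<And>e v w. e \<in> J \<Longrightarrow> (\<And>d. d \<in> E - J \<Longrightarrow> v d = w d) \<Longrightarrow> g e v = g e w"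
  shows "(\<integral>\<^sup>+v. f (\<lambda>e\<in>E. if e \<in> J then v e + g e v else v e) \<partial>lebesgue_product E) =
    (\<integral>\<^sup>+v. f v \<partial>lebesgue_product E)"
proof -
  interpret product_sigma_finite "\<lambda>_::'i. lborel :: real measure" by (rule product_sigma_finite_lborel)
  let ?I = "E - J"
  let ?T = "\<lambda>v. \<lambda>e\<in>E. if e \<in> J then v e + g e v else v e"
  have EJ: "?I \<union> J = E" "?I \<inter> J = {}" "finite ?I" "finite J" using E finite_subset by auto
  have T: "?T \<in> measurable (lebesgue_product E) (lebesgue_product E)"
  proof (intro measurable_restrict)
    fix i assume "i \<in> E"
    then show "(\<lambda>v. if i \<in> J then v i + g i v else v i) \<in> measurable (lebesgue_product E) lborel"
      using g[of i] by (cases "i \<in> J") auto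
  qed
  have fT: "(\<lambda>v. f (?T v)) \<in> borel_measurable (lebesgue_product (?I \<union> J))"
    using measurable_comp[OF T f] unfolding EJ(1) by (simp add: comp_def)
  have fm: "(\<lambda>y. f (merge ?I J (x, y))) \<in> borel_measurable (lebesgue_product J)"
    if "x \<in> space (lebesgue_product ?I)" for x
  proof -
    have "(\<lambda>z. f (merge ?I J z)) \<in> borel_measurable (lebesgue_product ?I \<Otimes>\<^sub>M lebesgue_product J)"
      using measurable_comp[OF measurable_merge, of f ?I J "\<lambda>_. lborel"] f unfolding EJ(1) by (simp add: comp_def)
    from measurable_compose_Pair1[OF that this] show ?thesis .
  qed
  have "(\<integral>\<^sup>+v. f (?T v) \<partial>lebesgue_product E) =
     (\<integral>\<^sup>+x. (\<integral>\<^sup>+y. f (?T (merge ?I J (x, y))) \<partial>lebesgue_product J) \<partial>lebesgue_product ?I)"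
    using product_nn_integral_fold[OF EJ(2-4) fT] unfolding EJ(1) .
  also have "\<dots> = (\<integral>\<^sup>+x. (\<integral>\<^sup>+y. f (merge ?I J (x, y)) \<partial>lebesgue_product J) \<partial>lebesgue_product ?I)"
  proof (rule nn_integral_cong)
    fix x assume x: "x \<in> space (lebesgue_product ?I)"
    let ?c = "\<lambda>e. g e x"
    have "?T (merge ?I J (x, y)) = merge ?I J (x, \<lambda>e\<in>J. ?c e + 1 * y e)" for y
    proof
      fix e
      have "e \<in> J \<Longrightarrow> g e (merge ?I J (x, y)) = g e x"
        by (rule dep) (auto simp: merge_def)
      then show "?T (merge ?I J (x, y)) e = merge ?I J (x, \<lambda>e\<in>J. ?c e + 1 * y e) e"
        using E by (auto simp: merge_def)
    qed
    then show "(\<integral>\<^sup>+y. f (?T (merge ?I J (x, y))) \<partial>lebesgue_product J) =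
        (\<integral>\<^sup>+y. f (merge ?I J (x, y)) \<partial>lebesgue_product J)"
      using lebesgue_product_affine[OF EJ(4) fm[OF x], of "\<lambda>_. 1" ?c] by simp
  qed
  also have "\<dots> = (\<integral>\<^sup>+v. f v \<partial>lebesgue_product E)"
    using product_nn_integral_fold[OF EJ(2-4), of f] f unfolding EJ(1) by simp
  finally show ?thesis .
qed

lemma lebesgue_product_permute:
  fixes f :: "('i \<Rightarrow> real) \<Rightarrow> ennreal"
  assumes E: "finite E" and p: "bij_betw p E E" and f: "f \<in> borel_measurable (lebesgue_product E)"
  shows "(\<integral>\<^sup>+v. f (\<lambda>e\<in>E. v (p e)) \<partial>lebesgue_product E) = (\<integral>\<^sup>+v. f v \<partial>lebesgue_product E)"
proof -
  interpret product_sigma_finite "\<lambda>_::'i. lborel :: real measure" by (rule product_sigma_finite_lborel)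
  interpret finite_product_sigma_finite "\<lambda>_::'i. lborel :: real measure" E by standard (rule E)
  let ?T = "\<lambda>v. \<lambda>e\<in>E. v (p e)"
  have pE: "e \<in> E \<Longrightarrow> p e \<in> E" for e using p by (auto simp: bij_betw_def)
  have T: "?T \<in> measurable (lebesgue_product E) (lebesgue_product E)"
    using pE by (intro measurable_restrict) auto
  have "distr (lebesgue_product E) (lebesgue_product E) ?T = lebesgue_product E"
  proof (rule PiM_eqI)
    fix A :: "'i \<Rightarrow> real set" assume A: "\<And>i. i \<in> E \<Longrightarrow> A i \<in> sets lborel"
    let ?q = "the_inv_into E p"
    have q: "e \<in> E \<Longrightarrow> ?q e \<in> E" "e \<in> E \<Longrightarrow> p (?q e) = e" "e \<in> E \<Longrightarrow> ?q (p e) = e" for e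
      using p by (auto simp: bij_betw_def the_inv_into_f_f f_the_inv_into_f the_inv_into_into)
    have "?T -` Pi\<^sub>E E A \<inter> space (lebesgue_product E) = (\<Pi>\<^sub>E e\<in>E. A (?q e))"
      using q pE by (auto simp: space_PiM PiE_iff)  (metis q)+
    moreover have "(\<Prod>e\<in>E. emeasure lborel (A (?q e))) = (\<Prod>e\<in>E. emeasure lborel (A e))"
      using p q by (intro prod.reindex_bij_witness[of _ p ?q]) (auto simp: pE)
    ultimately show "emeasure (distr (lebesgue_product E) (lebesgue_product E) ?T) (Pi\<^sub>E E A) = (\<Prod>i\<in>E. emeasure lborel (A i))"
      using A T E q by (subst emeasure_distr) (auto intro!: sets_PiM_I_finite simp: measure_times)
  qed (use E in simp_all)
  then show ?thesis using nn_integral_distr[OF T, of f] f by simp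
qed

section \<open>Lebesgue measure on symmetric matrices\<close>

lemma borel_measurable_matrix_component [measurable (raw)]:
  fixes f :: "'a \<Rightarrow> real^'n^'m"
  assumes [measurable]: "f \<in> borel_measurable M"
  shows "(\<lambda>x. f x $ i $ j) \<in> borel_measurable M"
proof -
  have "(\<lambda>x. f x \<bullet> axis i (axis j 1)) \<in> borel_measurable M" by measurable
  then show ?thesis by (simp add: inner_axis)
qed

lemma borel_measurable_matrixI:
  fixes f :: "'a \<Rightarrow> real^'n^'m"
  assumes "\<And>i j. (\<lambda>x. f x $ i $ j) \<in> borel_measurable M"
  shows "f \<in> borel_measurable M"
  using assms by (subst borel_measurable_euclidean_space) (auto simp: Basis_vec_def inner_axis)

lemma borel_measurable_matrix_mult [measurable (raw)]:
  fixes f :: "'a \<Rightarrow> real^'n^'m" and g :: "'a \<Rightarrow> real^'k^'n"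
  assumes [measurable]: "f \<in> borel_measurable M" "g \<in> borel_measurable M"
  shows "(\<lambda>x. f x ** g x) \<in> borel_measurable M"
  by (rule borel_measurable_matrixI) (simp add: matrix_matrix_mult_def)

lemma borel_measurable_transpose [measurable (raw)]:
  fixes f :: "'a \<Rightarrow> real^'n^'m"
  assumes [measurable]: "f \<in> borel_measurable M"
  shows "(\<lambda>x. transpose (f x)) \<in> borel_measurable M"
  by (rule borel_measurable_matrixI) (simp add: transpose_def)

lemma borel_measurable_trace [measurable (raw)]:
  fixes f :: "'a \<Rightarrow> real^'n^'n"
  assumes [measurable]: "f \<in> borel_measurable M"
  shows "(\<lambda>x. trace (f x)) \<in> borel_measurable M"
  by (simp add: trace_def)

lemma borel_measurable_det [measurable (raw)]:
  fixes f :: "'a \<Rightarrow> real^'n^'n"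
  assumes [measurable]: "f \<in> borel_measurable M"
  shows "(\<lambda>x. det (f x)) \<in> borel_measurable M"
  by (simp add: det_def)

definition unordered_pairs :: "'n set set" where
  "unordered_pairs = {{i, j} |i j :: 'n. True}"

definition symmetric_of :: "('n set \<Rightarrow> real) \<Rightarrow> real^'n^'n" where
  "symmetric_of v = (\<chi> i j. v {i, j})"

lemma symmetric_of_nth [simp]: "symmetric_of v $ i $ j = v {i, j}"
  by (simp add: symmetric_of_def)

lemma sym_lborel_eq: "sym_lborel = distr (lebesgue_product unordered_pairs) borel symmetric_of"
  by (simp add: sym_lborel_def unordered_pairs_def symmetric_of_def[abs_def])

lemma unordered_pairs_mem [simp]: "{i, j} \<in> unordered_pairs" "{i} \<in> unordered_pairs"
  by (auto simp: unordered_pairs_def)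

lemma measurable_symmetric_of [measurable]:
  "symmetric_of \<in> borel_measurable (lebesgue_product (unordered_pairs :: ('n::finite) set set))"
proof (rule borel_measurable_matrixI)
  fix i j :: 'n
  have "(\<lambda>v. v {i, j}) \<in> borel_measurable (lebesgue_product (unordered_pairs :: 'n set set))"
    by (rule measurable_component_singleton[where M="\<lambda>_. lborel", simplified]) simp
  then show "(\<lambda>v. symmetric_of v $ i $ j) \<in> borel_measurable (lebesgue_product (unordered_pairs :: 'n set set))"
    by simp
qed

lemma space_sym_lborel [simp]: "space sym_lborel = UNIV"
  and sets_sym_lborel [simp, measurable_cong]: "sets sym_lborel = sets borel"
  by (simp_all add: sym_lborel_eq)

lemma nn_integral_sym_lborel:
  fixes f :: "real^'n^'n \<Rightarrow> ennreal"
  assumes "f \<in> borel_measurable borel"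
  shows "(\<integral>\<^sup>+Q. f Q \<partial>sym_lborel) = (\<integral>\<^sup>+v. f (symmetric_of v) \<partial>lebesgue_product unordered_pairs)"
  unfolding sym_lborel_eq using assms
  by (intro nn_integral_distr measurable_symmetric_of) auto

lemma AE_sym_lborel_symmetric: "AE Q in sym_lborel. transpose Q = Q"
proof -
  have "{Q :: real^'n^'n. transpose Q = Q} \<in> sets borel"
  proof -
    have "{Q :: real^'n^'n. transpose Q = Q} = {Q. \<forall>i j. Q $ j $ i = Q $ i $ j}"
      by (auto simp: transpose_def vec_eq_iff)
    also have "\<dots> = {Q \<in> space borel. \<forall>i j. Q $ j $ i = Q $ i $ j}" by simp
    also have "\<dots> \<in> sets borel" by measurable
    finally show ?thesis .
  qed
  then show ?thesis unfolding sym_lborel_eq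
    by (subst AE_distr_iff) (auto simp: transpose_def vec_eq_iff insert_commute)
qed

lemma sym_lborel_translation:
  fixes f :: "real^'n^'n \<Rightarrow> ennreal"
  assumes [measurable]: "f \<in> borel_measurable borel" and M: "transpose M = M"
  shows "(\<integral>\<^sup>+Q. f (M + Q) \<partial>sym_lborel) = (\<integral>\<^sup>+Q. f Q \<partial>sym_lborel)"
proof -
  have sym: "M $ i $ j = M $ j $ i" for i j using arg_cong[OF M, of "\<lambda>A. A $ j $ i"] by (simp add: transpose_def)
  define c where "c e = (SOME r. \<exists>i j. e = {i, j} \<and> r = M $ i $ j)" for e
  have c: "c {i, j} = M $ i $ j" for i j
    unfolding c_def using sym by (intro some_equality) (auto simp: doubleton_eq_iff)
  have "(\<integral>\<^sup>+Q. f Q \<partial>sym_lborel) = (\<integral>\<^sup>+v. f (symmetric_of (\<lambda>e\<in>unordered_pairs. c e + 1 * v e)) \<partial>lebesgue_product unordered_pairs)"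
    by (subst nn_integral_sym_lborel, simp, subst lebesgue_product_affine[where t="\<lambda>_. 1" and c=c]) auto
  also have "\<dots> = (\<integral>\<^sup>+v. f (M + symmetric_of v) \<partial>lebesgue_product unordered_pairs)"
    by (intro nn_integral_cong arg_cong[where f=f]) (auto simp: vec_eq_iff c)
  also have "\<dots> = (\<integral>\<^sup>+Q. f (M + Q) \<partial>sym_lborel)"
    by (subst nn_integral_sym_lborel) auto
  finally show ?thesis by simp
qed

text \<open>
  Under \<open>Q \<mapsto> D Q D\<close> with \<open>D = diag w\<close>, the coordinate \<open>{i, j}\<close> is multiplied by \<open>w i * w j\<close>. A product over
  the set \<open>{i}\<close> yields only one factor \<open>w i\<close>, hence the second factor in \<open>s\<close>. Each index lies in
  \<open>n\<close> of the pairs and counts twice in \<open>{i}\<close>, so the Jacobian is the power \<open>n + 1\<close>.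
\<close>

lemma prod_unordered_pairs:
  fixes w :: "'n::finite \<Rightarrow> real"
  defines "s \<equiv> \<lambda>e. (\<Prod>k\<in>e. w k) * (if card e = 1 then \<Prod>k\<in>e. w k else 1)"
  shows "s {i, j} = w i * w j" and "(\<Prod>e\<in>unordered_pairs. s e) = (\<Prod>k\<in>UNIV. w k) ^ (CARD('n) + 1)"
proof -
  show "s {i, j} = w i * w j" by (cases "i = j") (auto simp: s_def)
  have fin: "finite (unordered_pairs :: 'n set set)" by simp
  have count: "card {e \<in> unordered_pairs. k \<in> e} = CARD('n)" for k :: 'n
  proof -
    have "{e \<in> unordered_pairs. k \<in> e} = (\<lambda>j. {k, j}) ` UNIV"
      by (auto simp: unordered_pairs_def)
    moreover have "inj (\<lambda>j. {k, j})" by (auto simp: inj_def doubleton_eq_iff)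
    ultimately show ?thesis by (simp add: card_image)
  qed
  have "(\<Prod>e\<in>unordered_pairs. \<Prod>k\<in>e. w k) = (\<Prod>e\<in>unordered_pairs. \<Prod>k\<in>UNIV. if k \<in> e then w k else 1)"
    by (rule prod.cong[OF refl]) (simp add: prod.If_cases)
  also have "\<dots> = (\<Prod>k\<in>UNIV. \<Prod>e\<in>unordered_pairs. if k \<in> e then w k else 1)"
    by (rule prod.swap)
  also have "\<dots> = (\<Prod>k\<in>UNIV. w k ^ CARD('n))"
    using count by (intro prod.cong refl) (simp add: prod.If_cases[OF fin] Collect_conj_eq[symmetric] Int_def)
  finally have 1: "(\<Prod>e\<in>unordered_pairs. \<Prod>k\<in>e. w k) = (\<Prod>k\<in>UNIV. w k) ^ CARD('n)"
    by (simp add: prod_power_distrib)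
  have "(\<Prod>e\<in>unordered_pairs. if card e = 1 then \<Prod>k\<in>e. w k else 1) = (\<Prod>e\<in>(\<lambda>k. {k}) ` UNIV. \<Prod>k\<in>e. w k)"
    by (rule prod.mono_neutral_cong_right[OF fin]) (auto simp: card_1_singleton_iff)
  also have "\<dots> = (\<Prod>k\<in>UNIV. w k)" by (subst prod.reindex) auto
  finally show "(\<Prod>e\<in>unordered_pairs. s e) = (\<Prod>k\<in>UNIV. w k) ^ (CARD('n) + 1)"
    unfolding s_def prod.distrib using 1 by simp
qed

lemma transpose_nth: "transpose A $ i $ j = A $ j $ i"
  by (simp add: transpose_def)

lemma diagonal_matrix_mult:
  fixes A :: "real^'n^'n" and Q :: "real^'p^'n"
  assumes "\<And>i j. i \<noteq> j \<Longrightarrow> A $ i $ j = 0"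
  shows "(A ** Q) $ i $ j = A $ i $ i * Q $ i $ j"
proof -
  have "(\<Sum>k\<in>UNIV. A $ i $ k * Q $ k $ j) = (\<Sum>k\<in>UNIV. (if k = i then A $ i $ i * Q $ i $ j else 0))"
    by (rule sum.cong) (use assms in auto)
  then show ?thesis by (simp add: matrix_matrix_mult_def)
qed

lemma diagonal_mult_matrix:
  fixes A :: "real^'n^'n" and Q :: "real^'n^'p"
  assumes "\<And>i j. i \<noteq> j \<Longrightarrow> A $ i $ j = 0"
  shows "(Q ** A) $ i $ j = Q $ i $ j * A $ j $ j"
proof -
  have "(\<Sum>k\<in>UNIV. Q $ i $ k * A $ k $ j) = (\<Sum>k\<in>UNIV. (if k = j then Q $ i $ j * A $ j $ j else 0))"
    by (rule sum.cong) (use assms in auto)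
  then show ?thesis by (simp add: matrix_matrix_mult_def)
qed

lemma swap_matrix_mult:
  fixes Q :: "real^'p^'n"
  shows "((\<chi> i j. mat 1 $ i $ Transposition.transpose m n j) ** Q) $ i $ j = Q $ (Transposition.transpose m n i) $ j"
proof -
  have "(\<Sum>k\<in>UNIV. mat 1 $ i $ Transposition.transpose m n k * Q $ k $ j) = (\<Sum>k\<in>UNIV. (if k = Transposition.transpose m n i then Q $ Transposition.transpose m n i $ j else 0))"
    by (rule sum.cong) (auto simp: mat_def)
  then show ?thesis by (simp add: matrix_matrix_mult_def)
qed

lemma abs_det_swap_matrix: "\<bar>det (\<chi> i j. mat 1 $ i $ Transposition.transpose m n j :: real^'n^'n)\<bar> = 1"
proof -
  let ?P = "\<chi> i j. mat 1 $ i $ Transposition.transpose m n j :: real^'n^'n"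
  have "?P ** ?P = mat 1"
    by (simp add: vec_eq_iff swap_matrix_mult) (auto simp: mat_def transpose_eq_iff)
  then have "det ?P * det ?P = 1" unfolding det_mul[symmetric] by simp
  then show ?thesis unfolding abs_square_eq_1[symmetric] power2_eq_square .
qed

lemma add_row_matrix_mult:
  fixes Q :: "real^'p^'n"
  assumes "m \<noteq> n"
  shows "((\<chi> i j. of_bool (i = m \<and> j = n \<or> i = j)) ** Q) $ i $ j = Q $ i $ j + (if i = m then Q $ n $ j else 0)"
proof -
  have "(\<Sum>k\<in>UNIV. of_bool (i = m \<and> k = n \<or> i = k) * Q $ k $ j) = (\<Sum>k\<in>UNIV. (if k = i then Q $ i $ j else 0) + (if k = n then (if i = m then Q $ n $ j else 0) else 0))"
    by (rule sum.cong) (use assms in auto)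
  then show ?thesis unfolding matrix_matrix_mult_def vec_lambda_beta by (simp only: sum.distrib) simp
qed

lemma det_add_row_matrix:
  assumes "m \<noteq> n"
  shows "det (\<chi> i j. of_bool (i = m \<and> j = n \<or> i = j) :: real^'n^'n) = 1"
proof -
  have "(\<chi> i j. of_bool (i = m \<and> j = n \<or> i = j) :: real^'n^'n) =
     (\<chi> k. if k = m then row m (mat 1) + 1 *s row n (mat 1) else row k (mat 1))"
    using assms by (auto simp: vec_eq_iff row_def mat_def)
  then show ?thesis using det_row_operation[OF assms, of "mat 1 :: real^'n^'n" 1] by simp
qed

lemma not_invertible_zero_row:
  fixes A :: "real^'n^'n"
  assumes "row i A = 0" shows "\<not> invertible A"
  using det_zero_row(2)[OF assms] by (simp add: invertible_det_nz)

text \<open>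
  The statement is multiplicative in \<open>A\<close>, so elementary matrices suffice. In the
  coordinates indexed by unordered pairs, a congruence by a diagonal matrix rescales the coordinates, one by a swap of two
  rows permutes them, and one by the addition of row \<open>n\<close> to row \<open>m\<close> is a composition of two shears.
\<close>

lemma sym_lborel_congruence:
  fixes A :: "real^'n^'n" and f :: "real^'n^'n \<Rightarrow> ennreal"
  assumes "invertible A" and "f \<in> borel_measurable borel"
  shows "(\<integral>\<^sup>+Q. f Q \<partial>sym_lborel) =
    ennreal (\<bar>det A\<bar> ^ (CARD('n) + 1)) * (\<integral>\<^sup>+Q. f (A ** Q ** transpose A) \<partial>sym_lborel)"
proof -
  let ?E = "unordered_pairs :: 'n set set"
  let ?P = "\<lambda>A :: real^'n^'n. invertible A \<longrightarrow> (\<forall>f :: real^'n^'n \<Rightarrow> ennreal. f \<in> borel_measurable borel \<longrightarrow>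
    (\<integral>\<^sup>+Q. f Q \<partial>sym_lborel) =
    ennreal (\<bar>det A\<bar> ^ (CARD('n) + 1)) * (\<integral>\<^sup>+Q. f (A ** Q ** transpose A) \<partial>sym_lborel))"
  have "?P A"
  proof (rule induct_matrix_elementary_alt[where P="?P"])
    fix A B :: "real^'n^'n" assume PA: "?P A" and PB: "?P B"
    show "?P (A ** B)"
    proof (intro impI allI)
      fix f :: "real^'n^'n \<Rightarrow> ennreal" assume inv: "invertible (A ** B)" and [measurable]: "f \<in> borel_measurable borel"
      have AB: "invertible A" "invertible B" using inv by (auto simp: invertible_det_nz det_mul)
      have "(\<integral>\<^sup>+Q. f Q \<partial>sym_lborel) = ennreal (\<bar>det A\<bar> ^ (CARD('n) + 1)) * (\<integral>\<^sup>+Q. f (A ** Q ** transpose A) \<partial>sym_lborel)"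
        by (rule PA[rule_format, OF AB(1)]) measurable
      also have "(\<integral>\<^sup>+Q. f (A ** Q ** transpose A) \<partial>sym_lborel) =
          ennreal (\<bar>det B\<bar> ^ (CARD('n) + 1)) * (\<integral>\<^sup>+Q. f (A ** (B ** Q ** transpose B) ** transpose A) \<partial>sym_lborel)"
        by (rule PB[rule_format, OF AB(2)]) measurable
      finally show "(\<integral>\<^sup>+Q. f Q \<partial>sym_lborel) = ennreal (\<bar>det (A ** B)\<bar> ^ (CARD('n) + 1)) *
          (\<integral>\<^sup>+Q. f (A ** B ** Q ** transpose (A ** B)) \<partial>sym_lborel)"
        by (simp add: matrix_transpose_mul matrix_mul_assoc det_mul abs_mult power_mult_distrib ennreal_mult' mult.assoc del: power_Suc)
    qed
  next
    fix A :: "real^'n^'n" and i assume "row i A = 0"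
    then show "?P A" using not_invertible_zero_row by blast
  next
    fix A :: "real^'n^'n" assume d: "\<And>i j. i \<noteq> j \<Longrightarrow> A $ i $ j = 0"
    let ?w = "\<lambda>k. A $ k $ k"
    define s where "s e = (\<Prod>k\<in>e. ?w k) * (if card e = 1 then \<Prod>k\<in>e. ?w k else 1)" for e
    have det: "det A = (\<Prod>k\<in>UNIV. ?w k)" using d by (rule det_diagonal)
    note s = prod_unordered_pairs[of ?w, folded s_def]
    show "?P A"
    proof (intro impI allI)
      fix f :: "real^'n^'n \<Rightarrow> ennreal" assume inv: "invertible A" and [measurable]: "f \<in> borel_measurable borel"
      have nz: "?w k \<noteq> 0" for k using inv det by (auto simp: invertible_det_nz)
      have sym: "A ** symmetric_of v ** transpose A = symmetric_of (\<lambda>e\<in>?E. 0 + s e * v e)" for v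
      proof -
        have "(A ** symmetric_of v ** transpose A) $ i $ j = ?w i * v {i, j} * ?w j" for i j
          by (subst diagonal_mult_matrix) (auto simp: diagonal_matrix_mult[OF d] d transpose_def)
        then show ?thesis by (simp add: vec_eq_iff s(1))
      qed
      have "(\<integral>\<^sup>+Q. f Q \<partial>sym_lborel) = (\<Prod>e\<in>?E. ennreal \<bar>s e\<bar>) *
          (\<integral>\<^sup>+v. f (symmetric_of (\<lambda>e\<in>?E. 0 + s e * v e)) \<partial>lebesgue_product ?E)"
        using nz by (subst nn_integral_sym_lborel, simp, subst lebesgue_product_affine[where t=s and c="\<lambda>_. 0"])
          (auto simp: s_def)
      also have "(\<Prod>e\<in>?E. ennreal \<bar>s e\<bar>) = ennreal (\<bar>det A\<bar> ^ (CARD('n) + 1))"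
        by (subst prod_ennreal) (simp_all only: abs_ge_zero abs_prod[symmetric] s(2) det power_abs)
      also have "(\<integral>\<^sup>+v. f (symmetric_of (\<lambda>e\<in>?E. 0 + s e * v e)) \<partial>lebesgue_product ?E) =
          (\<integral>\<^sup>+Q. f (A ** Q ** transpose A) \<partial>sym_lborel)"
        unfolding sym[symmetric] by (subst nn_integral_sym_lborel) auto
      finally show "(\<integral>\<^sup>+Q. f Q \<partial>sym_lborel) =
          ennreal (\<bar>det A\<bar> ^ (CARD('n) + 1)) * (\<integral>\<^sup>+Q. f (A ** Q ** transpose A) \<partial>sym_lborel)" .
    qed
  next
    fix m n :: 'n assume "m \<noteq> n"
    let ?A = "\<chi> i j. mat 1 $ i $ Transposition.transpose m n j :: real^'n^'n"
    let ?t = "Transposition.transpose m n"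
    have det: "\<bar>det ?A\<bar> = 1" by (rule abs_det_swap_matrix)
    have bij: "bij_betw ((`) ?t) ?E ?E"
    proof (rule bij_betw_byWitness[where f'="(`) ?t"])
      show "(`) ?t ` ?E \<subseteq> ?E" by (auto simp: unordered_pairs_def)
      then show "(`) ?t ` ?E \<subseteq> ?E" .
    qed (auto simp: image_image)
    show "?P ?A"
    proof (intro impI allI)
      fix f :: "real^'n^'n \<Rightarrow> ennreal" assume [measurable]: "f \<in> borel_measurable borel"
      have "?A ** Q ** transpose ?A = transpose (?A ** transpose (?A ** Q))" for Q
        by (simp add: matrix_transpose_mul matrix_mul_assoc)
      then have sym: "?A ** symmetric_of v ** transpose ?A = symmetric_of (\<lambda>e\<in>?E. v (?t ` e))" for v
        by (auto simp: vec_eq_iff swap_matrix_mult transpose_def)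
      have "(\<integral>\<^sup>+Q. f Q \<partial>sym_lborel) = (\<integral>\<^sup>+v. f (symmetric_of (\<lambda>e\<in>?E. v (?t ` e))) \<partial>lebesgue_product ?E)"
        by (subst nn_integral_sym_lborel, simp, subst lebesgue_product_permute[OF _ bij, symmetric]) auto
      also have "\<dots> = (\<integral>\<^sup>+Q. f (?A ** Q ** transpose ?A) \<partial>sym_lborel)"
        unfolding sym[symmetric] by (subst nn_integral_sym_lborel) auto
      finally show "(\<integral>\<^sup>+Q. f Q \<partial>sym_lborel) =
          ennreal (\<bar>det ?A\<bar> ^ (CARD('n) + 1)) * (\<integral>\<^sup>+Q. f (?A ** Q ** transpose ?A) \<partial>sym_lborel)"
        unfolding det by simp
    qed
  next
    fix m n :: 'n assume mn: "m \<noteq> n"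
    let ?A = "\<chi> i j. of_bool (i = m \<and> j = n \<or> i = j) :: real^'n^'n"
    have det: "det ?A = 1" using mn by (rule det_add_row_matrix)
    \<comment> \<open>The diagonal coordinate is sheared first, with the old values of row \<open>m\<close>; then the other coordinates of row \<open>m\<close> are.\<close>
    let ?J1 = "{{m}}" and ?J2 = "{{m, k} |k. k \<noteq> m}"
    define g1 where "g1 e v = 2 * v {m, n} + v {n}" for e :: "'n set" and v :: "'n set \<Rightarrow> real"
    define g2 where "g2 e v = v (insert n (e - {m}))" for e :: "'n set" and v :: "'n set \<Rightarrow> real"
    let ?T1 = "\<lambda>v. \<lambda>e\<in>?E. if e \<in> ?J1 then v e + g1 e v else v e"
    let ?T2 = "\<lambda>v. \<lambda>e\<in>?E. if e \<in> ?J2 then v e + g2 e v else v e"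
    have J: "?J1 \<subseteq> ?E" "?J2 \<subseteq> ?E" by (auto simp: unordered_pairs_def)
    have e1: "{i, j} \<in> ?J1 \<longleftrightarrow> i = m \<and> j = m" for i j by auto
    have e2: "{i, j} \<in> ?J2 \<longleftrightarrow> (i = m) \<noteq> (j = m)" for i j by (auto simp: doubleton_eq_iff)
    have mem: "{i, j} \<in> ?E" "{i} \<in> ?E" for i j by simp_all
    have g2m[measurable]: "g2 e \<in> borel_measurable (lebesgue_product ?E)" if "e \<in> ?J2" for e
    proof -
      from that obtain k where k: "e = {m, k}" "k \<noteq> m" by auto
      then have "insert n (e - {m}) = {n, k}" by auto
      with mem show ?thesis unfolding g2_def by (auto intro!: measurable_component_singleton)
    qed
    have g1m[measurable]: "g1 e \<in> borel_measurable (lebesgue_product ?E)" for e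
      unfolding g1_def using mem by (auto intro!: borel_measurable_add borel_measurable_times measurable_component_singleton)
    have T2: "?T2 \<in> measurable (lebesgue_product ?E) (lebesgue_product ?E)"
    proof (intro measurable_restrict)
      fix i assume "i \<in> ?E"
      then show "(\<lambda>v. if i \<in> ?J2 then v i + g2 i v else v i) \<in> measurable (lebesgue_product ?E) lborel"
      proof (cases "i \<in> ?J2")
        case True
        from g2m[OF this] \<open>i \<in> ?E\<close> show ?thesis unfolding if_P[OF True] measurable_lborel1
          by (intro borel_measurable_add measurable_component_singleton[where M="\<lambda>_. lborel", simplified])
      next
        case False
        show ?thesis unfolding if_not_P[OF False]
          using \<open>i \<in> ?E\<close> by (rule measurable_component_singleton)
      qed
    qed
    show "?P ?A"
    proof (intro impI allI)
      fix f :: "real^'n^'n \<Rightarrow> ennreal" assume [measurable]: "f \<in> borel_measurable borel"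
      have fs: "(\<lambda>v. f (symmetric_of v)) \<in> borel_measurable (lebesgue_product ?E)" by measurable
      have fs2: "(\<lambda>v. f (symmetric_of (?T2 v))) \<in> borel_measurable (lebesgue_product ?E)"
        using measurable_comp[OF T2 fs] by (simp add: comp_def)
      have "?A ** Q ** transpose ?A = transpose (?A ** transpose (?A ** Q))" for Q
        by (simp add: matrix_transpose_mul matrix_mul_assoc)
      then have entry: "(?A ** Q ** transpose ?A) $ i $ j =
          Q $ i $ j + (if j = m then Q $ i $ n else 0) + (if i = m then Q $ n $ j else 0) +
          (if i = m \<and> j = m then Q $ n $ n else 0)" for Q i j
        by (simp only: transpose_nth add_row_matrix_mult[OF mn]) auto
      have T1: "?T1 v {i, j} = v {i, j} + (if i = m \<and> j = m then 2 * v {m, n} + v {n} else 0)" for v i j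
        using e1[of i j] by (simp only: restrict_apply mem g1_def if_True) auto
      have T2': "?T2 w {i, j} = w {i, j} + (if (i = m) \<noteq> (j = m) then w (insert n ({i, j} - {m})) else 0)" for w i j
        by (simp only: restrict_apply mem if_True e2 g2_def) auto
      have sym: "?A ** symmetric_of v ** transpose ?A = symmetric_of (?T2 (?T1 v))" for v
      proof -
        have "(?A ** symmetric_of v ** transpose ?A) $ i $ j = ?T2 (?T1 v) {i, j}" for i j
        proof -
          consider "i = m" "j = m" | "i = m" "j \<noteq> m" | "i \<noteq> m" "j = m" | "i \<noteq> m" "j \<noteq> m" by blast
          then show ?thesis
          proof cases
            case 1
            then show ?thesis unfolding T2' T1 entry using T1[of v m m] by (simp add: insert_commute)
          next
            case 2
            then have "insert n ({i, j} - {m}) = {n, j}" by auto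
            with 2 show ?thesis unfolding T2' using T1[of v i j] T1[of v n j] mn entry[of "symmetric_of v" i j] by simp
          next
            case 3
            then have "insert n ({i, j} - {m}) = {i, n}" by auto
            with 3 show ?thesis unfolding T2' using T1[of v i j] T1[of v i n] mn entry[of "symmetric_of v" i j] by simp
          next
            case 4
            then show ?thesis unfolding T2' T1 entry by simp
          qed
        qed
        then show ?thesis by (simp only: vec_eq_iff symmetric_of_nth) simp
      qed
      have "(\<integral>\<^sup>+Q. f Q \<partial>sym_lborel) = (\<integral>\<^sup>+v. f (symmetric_of (?T2 v)) \<partial>lebesgue_product ?E)"
      proof (subst nn_integral_sym_lborel, simp, rule lebesgue_product_shear[OF _ J(2) fs, symmetric])
        fix e and v w :: "'n set \<Rightarrow> real" assume "e \<in> ?J2" and *: "\<And>d. d \<in> ?E - ?J2 \<Longrightarrow> v d = w d"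
        then obtain k where k: "e = {m, k}" "k \<noteq> m" by auto
        then have "insert n (e - {m}) = {n, k}" by auto
        moreover have "{n, k} \<in> ?E - ?J2" using mn k e2[of n k] mem(1)[of n k] by blast
        ultimately show "g2 e v = g2 e w" unfolding g2_def using * by presburger
      qed (use g2m in auto)
      also have "\<dots> = (\<integral>\<^sup>+v. f (symmetric_of (?T2 (?T1 v))) \<partial>lebesgue_product ?E)"
      proof (rule lebesgue_product_shear[OF _ J(1) fs2, symmetric])
        fix e and v w :: "'n set \<Rightarrow> real" assume *: "\<And>d. d \<in> ?E - ?J1 \<Longrightarrow> v d = w d"
        show "g1 e v = g1 e w" unfolding g1_def using mn mem e1 by (intro arg_cong2[where f="(+)"] arg_cong2[where f="(*)"] *) auto
      qed auto
      also have "\<dots> = (\<integral>\<^sup>+Q. f (?A ** Q ** transpose ?A) \<partial>sym_lborel)"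
        unfolding sym[symmetric] by (subst nn_integral_sym_lborel) auto
      finally show "(\<integral>\<^sup>+Q. f Q \<partial>sym_lborel) =
          ennreal (\<bar>det ?A\<bar> ^ (CARD('n) + 1)) * (\<integral>\<^sup>+Q. f (?A ** Q ** transpose ?A) \<partial>sym_lborel)"
        unfolding det by simp
    qed
  qed
  from this[rule_format, OF assms] show ?thesis .
qed

section \<open>Lebesgue measure on rectangular matrices\<close>

abbreviation matrix_of :: "('m \<times> 'p \<Rightarrow> real) \<Rightarrow> real^'p^'m" where
  "matrix_of v \<equiv> \<chi> i j. v (i, j)"

lemma Basis_matrix: "(Basis :: (real^'p^'m) set) = (\<lambda>(i, j). axis i (axis j 1)) ` UNIV"
  by (auto simp: Basis_vec_def)

lemma matrix_unit_Basis: "axis i (axis j 1) \<in> (Basis :: (real^'p^'m) set)"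
  by (auto simp: Basis_vec_def)

lemma inj_matrix_unit: "inj (\<lambda>(i, j). axis i (axis j (1::real)))"
  by (auto simp: inj_def axis_eq_axis)

lemma prod_Basis_matrix:
  fixes x :: "real^'p^'m"
  shows "(\<Prod>b\<in>Basis. x \<bullet> b) = (\<Prod>k\<in>UNIV. x $ fst k $ snd k)"
  unfolding Basis_matrix
  by (subst prod.reindex[OF inj_matrix_unit]) (simp add: case_prod_beta inner_axis)

lemma mem_box_matrix:
  fixes x :: "real^'p^'m"
  shows "x \<in> box l u \<longleftrightarrow> (\<forall>i j. l $ i $ j < x $ i $ j \<and> x $ i $ j < u $ i $ j)"
  unfolding mem_box Basis_matrix by (auto simp: inner_axis)

lemma measurable_matrix_of [measurable]:
  "matrix_of \<in> borel_measurable (lebesgue_product (UNIV :: ('m::finite \<times> 'p::finite) set))"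
proof (rule borel_measurable_matrixI)
  fix i :: 'm and j :: 'p
  have "(\<lambda>v. v (i, j)) \<in> borel_measurable (lebesgue_product (UNIV :: ('m \<times> 'p) set))"
    by (rule measurable_component_singleton[where M="\<lambda>_. lborel", simplified]) simp
  then show "(\<lambda>v. matrix_of v $ i $ j) \<in> borel_measurable (lebesgue_product (UNIV :: ('m \<times> 'p) set))"
    by simp
qed

text \<open>
  Rectangular matrices get the same description by coordinates as symmetric ones, so that the same
  decomposition into elementary matrices applies.
\<close>

lemma lborel_matrix_eq:
  "(lborel :: (real^'p^'m) measure) = distr (lebesgue_product UNIV) borel matrix_of"
proof (rule lborel_eqI)
  interpret finite_product_sigma_finite "\<lambda>_::'m \<times> 'p. lborel :: real measure" UNIV
    by (intro finite_product_sigma_finite.intro product_sigma_finite_lborel finite_product_sigma_finite_axioms.intro) simp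
  fix l u :: "real^'p^'m" assume le: "\<And>b. b \<in> Basis \<Longrightarrow> l \<bullet> b \<le> u \<bullet> b"
  have le: "l $ i $ j \<le> u $ i $ j" for i j
    using le[OF matrix_unit_Basis[of i j]] by (simp add: inner_axis)
  have "matrix_of -` box l u \<inter> space (lebesgue_product UNIV) =
      (\<Pi>\<^sub>E k\<in>UNIV. {l $ fst k $ snd k <..< u $ fst k $ snd k})"
    by (auto simp: mem_box_matrix space_PiM PiE_iff)
  then show "emeasure (distr (lebesgue_product UNIV) borel matrix_of) (box l u) = ennreal (\<Prod>b\<in>Basis. (u - l) \<bullet> b)"
    unfolding prod_Basis_matrix
    by (subst emeasure_distr) (auto simp: measure_times le prod_ennreal)
qed simp

lemma nn_integral_lborel_matrix:
  fixes f :: "real^'p^'m \<Rightarrow> ennreal"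
  assumes "f \<in> borel_measurable borel"
  shows "(\<integral>\<^sup>+Z. f Z \<partial>lborel) = (\<integral>\<^sup>+v. f (matrix_of v) \<partial>lebesgue_product UNIV)"
  unfolding lborel_matrix_eq using assms by (intro nn_integral_distr measurable_matrix_of) auto

lemma lborel_transpose:
  fixes f :: "real^'p^'m \<Rightarrow> ennreal"
  assumes "f \<in> borel_measurable borel"
  shows "(\<integral>\<^sup>+Z. f (transpose Z) \<partial>lborel) = (\<integral>\<^sup>+Z. f Z \<partial>lborel)"
proof -
  have "(lborel :: (real^'p^'m) measure) = distr lborel borel transpose"
  proof (rule lborel_eqI)
    fix l u :: "real^'p^'m" assume "\<And>b. b \<in> Basis \<Longrightarrow> l \<bullet> b \<le> u \<bullet> b"
    from this[OF matrix_unit_Basis] have le: "l $ i $ j \<le> u $ i $ j" for i j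
      by (simp add: inner_axis)
    have "transpose -` box l u = box (transpose l) (transpose u)"
      by (auto simp: mem_box_matrix transpose_def)
    moreover have "emeasure lborel (box (transpose l) (transpose u)) = ennreal (\<Prod>b\<in>Basis. (transpose u - transpose l) \<bullet> b)"
      using le by (intro emeasure_lborel_box) (auto simp: Basis_matrix inner_axis transpose_def)
    moreover have "(\<Prod>b\<in>Basis. (transpose u - transpose l) \<bullet> b) = (\<Prod>b\<in>Basis. (u - l) \<bullet> b)"
      unfolding prod_Basis_matrix
      by (rule prod.reindex_bij_witness[of _ prod.swap prod.swap]) (auto simp: transpose_def)
    ultimately show "emeasure (distr lborel borel transpose) (box l u) = ennreal (\<Prod>b\<in>Basis. (u - l) \<bullet> b)"
      by (subst emeasure_distr) auto
  qed simp
  then show ?thesis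
    using nn_integral_distr[of transpose "lborel :: (real^'m^'p) measure" borel f] assms by simp
qed

text \<open>
  Again by elementary matrices: row operations rescale, permute or shear the coordinates \<open>(i, j)\<close>, and each
  row operation acts on \<open>p\<close> columns at once.
\<close>

lemma lborel_left_mult:
  fixes A :: "real^'m^'m" and f :: "real^'p^'m \<Rightarrow> ennreal"
  assumes "invertible A" and "f \<in> borel_measurable borel"
  shows "(\<integral>\<^sup>+Z. f Z \<partial>lborel) = ennreal (\<bar>det A\<bar> ^ CARD('p)) * (\<integral>\<^sup>+Z. f (A ** Z) \<partial>lborel)"
proof -
  let ?E = "UNIV :: ('m \<times> 'p) set"
  let ?P = "\<lambda>A :: real^'m^'m. invertible A \<longrightarrow> (\<forall>f :: real^'p^'m \<Rightarrow> ennreal. f \<in> borel_measurable borel \<longrightarrow>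
    (\<integral>\<^sup>+Z. f Z \<partial>lborel) = ennreal (\<bar>det A\<bar> ^ CARD('p)) * (\<integral>\<^sup>+Z. f (A ** Z) \<partial>lborel))"
  have "?P A"
  proof (rule induct_matrix_elementary_alt[where P="?P"])
    fix A B :: "real^'m^'m" assume PA: "?P A" and PB: "?P B"
    show "?P (A ** B)"
    proof (intro impI allI)
      fix f :: "real^'p^'m \<Rightarrow> ennreal" assume inv: "invertible (A ** B)" and [measurable]: "f \<in> borel_measurable borel"
      have AB: "invertible A" "invertible B" using inv by (auto simp: invertible_det_nz det_mul)
      have "(\<integral>\<^sup>+Z. f Z \<partial>lborel) = ennreal (\<bar>det A\<bar> ^ CARD('p)) * (\<integral>\<^sup>+Z. f (A ** Z) \<partial>lborel)"
        by (rule PA[rule_format, OF AB(1)]) measurable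
      also have "(\<integral>\<^sup>+Z. f (A ** Z) \<partial>lborel) = ennreal (\<bar>det B\<bar> ^ CARD('p)) * (\<integral>\<^sup>+Z. f (A ** (B ** Z)) \<partial>lborel)"
        by (rule PB[rule_format, OF AB(2)]) measurable
      finally show "(\<integral>\<^sup>+Z. f Z \<partial>lborel) = ennreal (\<bar>det (A ** B)\<bar> ^ CARD('p)) * (\<integral>\<^sup>+Z. f (A ** B ** Z) \<partial>lborel)"
        by (simp add: matrix_mul_assoc det_mul abs_mult power_mult_distrib ennreal_mult' mult.assoc)
    qed
  next
    fix A :: "real^'m^'m" and i assume "row i A = 0"
    then show "?P A" using not_invertible_zero_row by blast
  next
    fix A :: "real^'m^'m" assume d: "\<And>i j. i \<noteq> j \<Longrightarrow> A $ i $ j = 0"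
    let ?w = "\<lambda>k. A $ k $ k"
    have det: "det A = (\<Prod>k\<in>UNIV. ?w k)" using d by (rule det_diagonal)
    show "?P A"
    proof (intro impI allI)
      fix f :: "real^'p^'m \<Rightarrow> ennreal" assume inv: "invertible A" and [measurable]: "f \<in> borel_measurable borel"
      have nz: "?w k \<noteq> 0" for k using inv det by (auto simp: invertible_det_nz)
      have eq: "A ** matrix_of v = matrix_of (\<lambda>e\<in>?E. 0 + ?w (fst e) * v e)" for v
        by (simp add: vec_eq_iff diagonal_matrix_mult[OF d])
      have "(\<integral>\<^sup>+Z. f Z \<partial>lborel) = (\<Prod>e\<in>?E. ennreal \<bar>?w (fst e)\<bar>) *
          (\<integral>\<^sup>+v. f (matrix_of (\<lambda>e\<in>?E. 0 + ?w (fst e) * v e)) \<partial>lebesgue_product ?E)"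
        using nz by (subst nn_integral_lborel_matrix, simp, subst lebesgue_product_affine[where t="\<lambda>e. ?w (fst e)" and c="\<lambda>_. 0"]) auto
      also have "(\<Prod>e\<in>?E. ennreal \<bar>?w (fst e)\<bar>) = ennreal (\<bar>det A\<bar> ^ CARD('p))"
      proof -
        have "(\<Prod>e\<in>?E. \<bar>?w (fst e)\<bar>) = (\<Prod>k\<in>UNIV. \<Prod>j\<in>(UNIV :: 'p set). \<bar>?w k\<bar>)"
          by (simp only: UNIV_Times_UNIV[symmetric] prod.cartesian_product) (rule prod.cong, auto)
        then show ?thesis
          by (simp add: prod_ennreal det abs_prod prod_power_distrib)
      qed
      also have "(\<integral>\<^sup>+v. f (matrix_of (\<lambda>e\<in>?E. 0 + ?w (fst e) * v e)) \<partial>lebesgue_product ?E) = (\<integral>\<^sup>+Z. f (A ** Z) \<partial>lborel)"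
        unfolding eq[symmetric] by (subst nn_integral_lborel_matrix) auto
      finally show "(\<integral>\<^sup>+Z. f Z \<partial>lborel) = ennreal (\<bar>det A\<bar> ^ CARD('p)) * (\<integral>\<^sup>+Z. f (A ** Z) \<partial>lborel)" .
    qed
  next
    fix m n :: 'm assume "m \<noteq> n"
    let ?A = "\<chi> i j. mat 1 $ i $ Transposition.transpose m n j :: real^'m^'m"
    let ?t = "Transposition.transpose m n"
    have det: "\<bar>det ?A\<bar> = 1" by (rule abs_det_swap_matrix)
    have bij: "bij_betw (\<lambda>e. (?t (fst e), snd e)) ?E ?E"
      by (rule bij_betw_byWitness[where f'="\<lambda>e. (?t (fst e), snd e)"]) auto
    show "?P ?A"
    proof (intro impI allI)
      fix f :: "real^'p^'m \<Rightarrow> ennreal" assume [measurable]: "f \<in> borel_measurable borel"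
      have eq: "?A ** matrix_of v = matrix_of (\<lambda>e\<in>?E. v (?t (fst e), snd e))" for v :: "'m \<times> 'p \<Rightarrow> real"
        by (simp add: vec_eq_iff swap_matrix_mult)
      have "(\<integral>\<^sup>+Z. f Z \<partial>lborel) = (\<integral>\<^sup>+v. f (matrix_of (\<lambda>e\<in>?E. v (?t (fst e), snd e))) \<partial>lebesgue_product ?E)"
        by (subst nn_integral_lborel_matrix, simp, subst lebesgue_product_permute[OF _ bij, symmetric]) auto
      also have "\<dots> = (\<integral>\<^sup>+Z. f (?A ** Z) \<partial>lborel)"
        unfolding eq[symmetric] by (subst nn_integral_lborel_matrix) auto
      finally show "(\<integral>\<^sup>+Z. f Z \<partial>lborel) = ennreal (\<bar>det ?A\<bar> ^ CARD('p)) * (\<integral>\<^sup>+Z. f (?A ** Z) \<partial>lborel)"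
        unfolding det by simp
    qed
  next
    fix m n :: 'm assume mn: "m \<noteq> n"
    let ?A = "\<chi> i j. of_bool (i = m \<and> j = n \<or> i = j) :: real^'m^'m"
    have det: "det ?A = 1" using mn by (rule det_add_row_matrix)
    let ?J = "{m} \<times> (UNIV :: 'p set)"
    define g where "g e v = v (n, snd e)" for e :: "'m \<times> 'p" and v :: "'m \<times> 'p \<Rightarrow> real"
    let ?T = "\<lambda>v. \<lambda>e\<in>?E. if e \<in> ?J then v e + g e v else v e"
    have gm [measurable]: "g e \<in> borel_measurable (lebesgue_product ?E)" for e
      unfolding g_def by (rule measurable_component_singleton[where M="\<lambda>_. lborel", simplified]) simp
    show "?P ?A"
    proof (intro impI allI)
      fix f :: "real^'p^'m \<Rightarrow> ennreal" assume [measurable]: "f \<in> borel_measurable borel"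
      have eq: "?A ** matrix_of v = matrix_of (?T v)" for v :: "'m \<times> 'p \<Rightarrow> real"
        by (simp only: vec_eq_iff vec_lambda_beta add_row_matrix_mult[OF mn] restrict_apply) (auto simp: g_def)
      have fm: "(\<lambda>v. f (matrix_of v)) \<in> borel_measurable (lebesgue_product ?E)" by measurable
      have "(\<integral>\<^sup>+Z. f Z \<partial>lborel) = (\<integral>\<^sup>+v. f (matrix_of (?T v)) \<partial>lebesgue_product ?E)"
        by (subst nn_integral_lborel_matrix, simp, rule lebesgue_product_shear[OF _ _ fm, symmetric])
          (use mn in \<open>auto simp: g_def intro: gm[unfolded g_def[abs_def]]\<close>)
      also have "\<dots> = (\<integral>\<^sup>+Z. f (?A ** Z) \<partial>lborel)"
        unfolding eq[symmetric] by (subst nn_integral_lborel_matrix) auto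
      finally show "(\<integral>\<^sup>+Z. f Z \<partial>lborel) = ennreal (\<bar>det ?A\<bar> ^ CARD('p)) * (\<integral>\<^sup>+Z. f (?A ** Z) \<partial>lborel)"
        unfolding det by simp
    qed
  qed
  from this[rule_format, OF assms] show ?thesis .
qed

lemma lborel_right_mult:
  fixes B :: "real^'p^'p" and f :: "real^'p^'m \<Rightarrow> ennreal"
  assumes "invertible B" and [measurable]: "f \<in> borel_measurable borel"
  shows "(\<integral>\<^sup>+Z. f Z \<partial>lborel) = ennreal (\<bar>det B\<bar> ^ CARD('m)) * (\<integral>\<^sup>+Z. f (Z ** B) \<partial>lborel)"
proof -
  have "invertible (transpose B)" using assms by (simp add: transpose_invertible)
  have "(\<integral>\<^sup>+Z. f Z \<partial>lborel) = (\<integral>\<^sup>+Z. f (transpose Z) \<partial>lborel)" by (simp add: lborel_transpose)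
  also have "\<dots> = ennreal (\<bar>det (transpose B)\<bar> ^ CARD('m)) * (\<integral>\<^sup>+Z. f (transpose (transpose B ** Z)) \<partial>lborel)"
    by (rule lborel_left_mult) (fact, measurable)
  also have "(\<integral>\<^sup>+Z. f (transpose (transpose B ** Z)) \<partial>lborel) = (\<integral>\<^sup>+Z. f (transpose Z ** B) \<partial>lborel)"
    by (simp add: matrix_transpose_mul)
  also have "\<dots> = (\<integral>\<^sup>+Z. f (Z ** B) \<partial>lborel)"
    using lborel_transpose[of "\<lambda>Z. f (Z ** B)"] by simp
  finally show ?thesis by simp
qed

section \<open>Matrix inverses\<close>

lemma matrix_inv_mult:
  fixes A :: "real^'n^'n"
  assumes "invertible A"
  shows "A ** matrix_inv A = mat 1" and "matrix_inv A ** A = mat 1"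
  using someI_ex[OF assms[unfolded invertible_def]] by (auto simp: matrix_inv_def)

lemma matrix_diff_ldistrib: "A ** (B - C) = A ** B - A ** (C :: real^'p^'n)"
  by (simp add: vec_eq_iff matrix_matrix_mult_def sum_subtractf algebra_simps)

lemma matrix_diff_rdistrib: "(B - C) ** A = B ** A - (C :: real^'p^'n) ** A"
  by (simp add: vec_eq_iff matrix_matrix_mult_def sum_subtractf algebra_simps)

lemma matrix_inv_eqI:
  fixes A :: "real^'n^'n"
  assumes "A ** B = mat 1"
  shows "matrix_inv A = B" and "invertible A"
proof -
  have BA: "B ** A = mat 1" using assms matrix_left_right_inverse by blast
  show inv: "invertible A" using assms BA by (auto simp: invertible_def)
  have "matrix_inv A = matrix_inv A ** (A ** B)" by (simp add: assms)
  also have "\<dots> = B" by (simp add: matrix_mul_assoc matrix_inv_mult[OF inv])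
  finally show "matrix_inv A = B" .
qed

lemma invertible_matrix_inv:
  fixes A :: "real^'n^'n"
  assumes "invertible A" shows "invertible (matrix_inv A)" and "matrix_inv (matrix_inv A) = A"
  using matrix_inv_eqI[OF matrix_inv_mult(2)[OF assms]] by auto

lemma matrix_inv_mat_1 [simp]: "matrix_inv (mat 1 :: real^'n^'n) = mat 1"
  by (rule matrix_inv_eqI) simp

lemma matrix_inv_mult_distrib:
  fixes A B :: "real^'n^'n"
  assumes "invertible A" "invertible B"
  shows "matrix_inv (A ** B) = matrix_inv B ** matrix_inv A"
proof (rule matrix_inv_eqI)
  have "A ** B ** (matrix_inv B ** matrix_inv A) = A ** (B ** matrix_inv B) ** matrix_inv A"
    by (simp only: matrix_mul_assoc)
  then show "A ** B ** (matrix_inv B ** matrix_inv A) = mat 1" by (simp add: matrix_inv_mult assms)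
qed

lemma matrix_inv_transpose:
  fixes A :: "real^'n^'n"
  assumes "invertible A"
  shows "matrix_inv (transpose A) = transpose (matrix_inv A)"
  by (rule matrix_inv_eqI) (simp add: matrix_transpose_mul[symmetric] matrix_inv_mult assms)

lemma det_matrix_inv:
  fixes A :: "real^'n^'n"
  assumes "invertible A"
  shows "det (matrix_inv A) = 1 / det A"
proof -
  have "det A * det (matrix_inv A) = 1" by (simp add: det_mul[symmetric] matrix_inv_mult assms)
  then show ?thesis using assms by (simp add: invertible_det_nz field_simps)
qed

lemma matrix_cancel_left:
  fixes A :: "real^'n^'n" and B :: "real^'m^'n"
  assumes "invertible A"
  shows "matrix_inv A ** (A ** B) = B" and "A ** (matrix_inv A ** B) = B"
  by (simp_all add: matrix_mul_assoc matrix_inv_mult assms)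

lemma matrix_cancel_right:
  fixes A :: "real^'n^'n" and B :: "real^'n^'m"
  assumes "invertible A"
  shows "B ** A ** matrix_inv A = B" and "B ** matrix_inv A ** A = B"
  by (simp_all add: matrix_mul_assoc[symmetric] matrix_inv_mult assms)

lemma matrix_inv_congruence:
  fixes A Q :: "real^'n^'n"
  assumes "invertible A" "invertible Q"
  shows "matrix_inv (A ** Q ** transpose A) = transpose (matrix_inv A) ** matrix_inv Q ** matrix_inv A"
  using assms by (simp add: matrix_inv_mult_distrib invertible_mult transpose_invertible matrix_inv_transpose matrix_mul_assoc)

lemma matrix_inv_entry:
  fixes A :: "real^'n^'n"
  assumes "det A \<noteq> 0"
  shows "matrix_inv A $ k $ j = det (\<chi> i l. if l = k then axis j 1 $ i else A $ i $ l) / det A"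
proof -
  have inv: "invertible A" using assms by (simp add: invertible_det_nz)
  have "A *v (matrix_inv A *v axis j 1) = axis j 1"
    by (simp add: matrix_vector_mul_assoc matrix_inv_mult[OF inv])
  then have "matrix_inv A *v axis j 1 = (\<chi> k. det (\<chi> i l. if l = k then axis j 1 $ i else A $ i $ l) / det A)"
    using cramer[OF assms] by blast
  moreover have "(matrix_inv A *v axis j 1) $ k = matrix_inv A $ k $ j"
    by (simp add: matrix_vector_mult_basis column_def)
  ultimately show ?thesis by simp
qed

text \<open>
  Cramer's rule makes the entries rational functions of those of \<open>f x\<close> on the invertible matrices. On all singular
  matrices \<open>matrix_inv\<close> takes the same value, the choice from the empty predicate.
\<close>

lemma borel_measurable_matrix_inv [measurable (raw)]:
  fixes f :: "'a \<Rightarrow> real^'n^'n"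
  assumes [measurable]: "f \<in> borel_measurable M"
  shows "(\<lambda>x. matrix_inv (f x)) \<in> borel_measurable M"
proof (rule borel_measurable_matrixI)
  fix k j :: 'n
  define z :: "real^'n^'n" where "z = (SOME B. False)"
  have "matrix_inv A = z" if "det A = 0" for A :: "real^'n^'n"
  proof -
    have "(\<lambda>B. A ** B = mat 1 \<and> B ** A = mat 1) = (\<lambda>_. False)"
      using that invertible_det_nz[of A] by (auto simp: invertible_def)
    then show ?thesis unfolding matrix_inv_def z_def by simp
  qed
  then have eq: "matrix_inv A $ k $ j =
      (if det A = 0 then z $ k $ j else det (\<chi> i l. if l = k then axis j 1 $ i else A $ i $ l) / det A)" for A :: "real^'n^'n"
    using matrix_inv_entry by auto
  have [measurable]: "(\<lambda>x. (\<chi> i l. if l = k then axis j 1 $ i else f x $ i $ l) :: real^'n^'n) \<in> borel_measurable M"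
    by (rule borel_measurable_matrixI) (auto simp: axis_def)
  show "(\<lambda>x. matrix_inv (f x) $ k $ j) \<in> borel_measurable M"
    unfolding eq by measurable
qed

section \<open>Positive definite matrices\<close>

lemma quadratic_form_congruence:
  fixes C :: "real^'n^'m" and A :: "real^'n^'n"
  shows "x \<bullet> ((C ** A ** transpose C) *v x) = (transpose C *v x) \<bullet> (A *v (transpose C *v x))"
  by (simp add: matrix_vector_mul_assoc[symmetric] dot_lmul_matrix)

lemma pos_def_symmetric: "pos_def A \<Longrightarrow> transpose A = A"
  by (simp add: pos_def_def)

lemma symmetric_inner:
  fixes A :: "real^'n^'n"
  assumes "transpose A = A"
  shows "x \<bullet> (A *v y) = (A *v x) \<bullet> y"
  by (metis assms dot_lmul_matrix transpose_matrix_vector)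

lemma pos_def_nonneg: "pos_def A \<Longrightarrow> 0 \<le> x \<bullet> (A *v x)"
  by (cases "x = 0") (auto simp: pos_def_def less_imp_le)

lemma pos_def_mat_1 [simp]: "pos_def (mat 1)"
  by (auto simp: pos_def_def)

lemma pos_def_add: "pos_def A \<Longrightarrow> pos_def B \<Longrightarrow> pos_def (A + B)"
  by (auto simp: pos_def_def matrix_vector_mult_add_rdistrib inner_add_right vec_eq_iff transpose_def intro!: add_pos_pos)

lemma pos_def_add_congruence:
  fixes A :: "real^'n^'n" and L :: "real^'m^'m" and C :: "real^'m^'n"
  assumes "pos_def A" "pos_def L"
  shows "pos_def (A + C ** L ** transpose C)"
proof -
  have "transpose (A + C ** L ** transpose C) = A + C ** L ** transpose C"
  proof -
    have "transpose (C ** L ** transpose C) = C ** L ** transpose C"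
      using pos_def_symmetric[OF assms(2)] by (simp add: matrix_transpose_mul matrix_mul_assoc)
    then show ?thesis using pos_def_symmetric[OF assms(1)] by (simp add: vec_eq_iff transpose_def)
  qed
  moreover have "x \<bullet> ((A + C ** L ** transpose C) *v x) > 0" if "x \<noteq> 0" for x
    unfolding matrix_vector_mult_add_rdistrib inner_add_right quadratic_form_congruence
    using assms(1) that pos_def_nonneg[OF assms(2)] by (auto simp: pos_def_def intro: add_pos_nonneg)
  ultimately show ?thesis by (simp add: pos_def_def)
qed

lemma pos_def_scaleR: "pos_def A \<Longrightarrow> r > 0 \<Longrightarrow> pos_def (r *\<^sub>R A)"
  by (auto simp: pos_def_def transpose_scalar scaleR_matrix_vector_assoc[symmetric])

lemma pos_def_invertible: "pos_def (A :: real^'n^'n) \<Longrightarrow> invertible A"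
  unfolding invertible_left_inverse matrix_left_invertible_ker
  by (metis inner_zero_right less_irrefl pos_def_def)

lemma pos_def_congruence:
  fixes A C :: "real^'n^'n"
  assumes "invertible C" "pos_def A"
  shows "pos_def (C ** A ** transpose C)"
proof -
  have "transpose C *v x \<noteq> 0" if "x \<noteq> 0" for x
    using that transpose_invertible[OF assms(1)] unfolding invertible_left_inverse matrix_left_invertible_ker by blast
  then show ?thesis
    using assms(2) unfolding pos_def_def quadratic_form_congruence
    by (simp add: matrix_transpose_mul matrix_mul_assoc)
qed

lemma pos_def_congruence_iff:
  fixes A C :: "real^'n^'n"
  assumes "invertible C"
  shows "pos_def (C ** A ** transpose C) \<longleftrightarrow> pos_def A"
proof
  assume "pos_def (C ** A ** transpose C)"
  then have "pos_def (matrix_inv C ** (C ** A ** transpose C) ** transpose (matrix_inv C))"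
    using invertible_matrix_inv(1)[OF assms] by (rule pos_def_congruence[rotated])
  also have "matrix_inv C ** (C ** A ** transpose C) ** transpose (matrix_inv C) =
      matrix_inv C ** (C ** (A ** transpose (matrix_inv C ** C)))"
    by (simp add: matrix_transpose_mul matrix_mul_assoc)
  finally show "pos_def A" by (simp add: matrix_cancel_left matrix_inv_mult assms)
qed (rule pos_def_congruence[OF assms])

lemma pos_def_matrix_inv:
  fixes A :: "real^'n^'n"
  assumes "pos_def A" shows "pos_def (matrix_inv A)"
proof -
  have inv: "invertible A" by (rule pos_def_invertible[OF assms])
  have "pos_def (matrix_inv A ** A ** transpose (matrix_inv A))"
    using invertible_matrix_inv(1)[OF inv] assms by (rule pos_def_congruence)
  then show ?thesis
    using matrix_inv_transpose[OF inv] pos_def_symmetric[OF assms] by (simp add: matrix_inv_mult[OF inv])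
qed

lemma pos_def_diagonal_pos: "pos_def A \<Longrightarrow> 0 < A $ i $ i"
proof -
  assume "pos_def A"
  then have "axis i 1 \<bullet> (A *v axis i 1) > 0" by (auto simp: pos_def_def)
  then show ?thesis by (simp add: matrix_vector_mult_basis column_def inner_axis')
qed

lemma pos_def_trace_pos:
  fixes A :: "real^'n^'n" assumes "pos_def A" shows "0 < trace A"
  unfolding trace_def using pos_def_diagonal_pos[OF assms] by (intro sum_pos) auto

lemma pos_def_entry_bound:
  fixes A :: "real^'n^'n" assumes A: "pos_def A" shows "\<bar>A $ i $ j\<bar> \<le> (A $ i $ i + A $ j $ j) / 2"
proof -
  have sym: "A $ j $ i = A $ i $ j" using pos_def_symmetric[OF A] by (metis transpose_nth)
  have "0 \<le> (axis i 1 + s *\<^sub>R axis j 1) \<bullet> (A *v (axis i 1 + s *\<^sub>R axis j 1))" for s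
    using A by (rule pos_def_nonneg)
  also have "(axis i 1 + s *\<^sub>R axis j 1) \<bullet> (A *v (axis i 1 + s *\<^sub>R axis j 1)) =
      A $ i $ i + s * A $ i $ j + s * A $ i $ j + s * s * A $ j $ j" for s
    by (simp add: matrix_vector_right_distrib matrix_vector_mult_scaleR inner_add_left inner_add_right
        matrix_vector_mult_basis column_def inner_axis' sym algebra_simps)
  finally have "0 \<le> A $ i $ i + s * A $ i $ j + s * A $ i $ j + s * s * A $ j $ j" for s .
  from this[of 1] this[of "- 1"] show ?thesis by (simp add: abs_le_iff)
qed

lemma pos_def_entry_le_trace:
  fixes A :: "real^'n^'n" assumes A: "pos_def A" shows "\<bar>A $ i $ j\<bar> \<le> trace A"
proof -
  have "A $ k $ k \<le> trace A" for k
    unfolding trace_def using pos_def_diagonal_pos[OF A] by (intro member_le_sum) (auto intro: less_imp_le)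
  from this[of i] this[of j] have "(A $ i $ i + A $ j $ j) / 2 \<le> trace A" by simp
  with pos_def_entry_bound[OF A, of i j] show ?thesis by (rule order_trans)
qed

text \<open>
  Symmetric Gaussian elimination. The index set \<open>S\<close> consists of the rows not yet reduced. The diagonal
  entry of the pivot row is positive because \<open>V\<close> is positive definite, and clearing its row and column does not touch the
  rows reduced before.
\<close>

lemma pos_def_congruent_mat_1:
  fixes V :: "real^'n^'n"
  assumes "pos_def V"
  obtains C :: "real^'n^'n" where "invertible C" and "C ** V ** transpose C = mat 1"
proof -
  have "\<exists>C :: real^'n^'n. invertible C \<and> C ** V ** transpose C = mat 1"
    if "pos_def V" "\<And>i j. i \<notin> S \<Longrightarrow> V $ i $ j = mat 1 $ i $ j" for S :: "'n set" and V :: "real^'n^'n"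
    using finite[of S] that
  proof (induction S arbitrary: V rule: finite_induct)
    case empty
    then have "V = mat 1" by (simp add: vec_eq_iff)
    then show ?case by (intro exI[of _ "mat 1"]) (simp add: invertible_det_nz)
  next
    case (insert k S)
    note V = insert.prems(1)
    have sym: "V $ j $ i = V $ i $ j" for i j using pos_def_symmetric[OF V] by (metis transpose_nth)
    define t where "t = V $ k $ k"
    have t: "t > 0" unfolding t_def by (rule pos_def_diagonal_pos[OF V])
    define r where "r = 1 / sqrt t"
    have r: "r \<noteq> 0" "r * r * t = 1" using t by (auto simp: r_def)
    \<comment> \<open>Elimination of column \<open>k\<close> with the pivot \<open>t\<close>; the factor \<open>r\<close> normalizes the pivot to \<open>1\<close>.\<close>
    define C where "C = (\<chi> i j. if j = k then (if i = k then r else - V $ i $ k / t) else if i = j then 1 else 0)"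
    have CM: "(C ** M) $ i $ j = (if i = k then r * M $ k $ j else M $ i $ j - V $ i $ k / t * M $ k $ j)"
      for M :: "real^'n^'n" and i j
    proof -
      have "(\<Sum>l\<in>UNIV. C $ i $ l * M $ l $ j) = (\<Sum>l\<in>UNIV. (if l = k then (if i = k then r else - V $ i $ k / t) * M $ k $ j else 0) +
          (if l = i then (if i = k then 0 else M $ i $ j) else 0))"
        by (rule sum.cong) (auto simp: C_def)
      then show ?thesis by (simp add: matrix_matrix_mult_def sum.distrib)
    qed
    have "invertible C"
      unfolding invertible_left_inverse matrix_left_invertible_ker
    proof (intro allI impI)
      fix x assume x: "C *v x = 0"
      have "C ** (\<chi> i j::'n. x $ i) = (\<chi> i j. (C *v x) $ i)"
        by (simp add: vec_eq_iff matrix_matrix_mult_def matrix_vector_mult_def)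
      then have eq: "(C ** (\<chi> i j::'n. x $ i)) $ i $ j = 0" for i j using x by simp
      have "x $ k = 0" using eq[of k] r CM by simp
      then have "x $ i = 0" for i using eq[of i] CM by (cases "i = k") auto
      then show "x = 0" by (simp add: vec_eq_iff)
    qed
    define V' where "V' = C ** V ** transpose C"
    have V': "pos_def V'" unfolding V'_def using \<open>invertible C\<close> V by (rule pos_def_congruence)
    have sV': "V' $ i $ j = V' $ j $ i" for i j using pos_def_symmetric[OF V'] by (metis transpose_nth)
    have "V' = transpose (C ** transpose (C ** V))"
      unfolding V'_def by (simp add: matrix_transpose_mul matrix_mul_assoc)
    then have entry: "V' $ i $ j = (if j = k then r * (C ** V) $ i $ k else (C ** V) $ i $ j - V $ j $ k / t * (C ** V) $ i $ k)" for i j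
      by (simp add: transpose_nth CM)
    have CVk: "(C ** V) $ i $ k = (if i = k then r * t else 0)" for i
      using t by (simp add: CM t_def)
    have "V' $ i $ j = mat 1 $ i $ j" if "i \<notin> S" for i j
    proof (cases "i = k")
      case True
      have "V' $ j $ k = (if j = k then 1 else 0)" unfolding entry CVk using r by (simp add: mult.assoc)
      then show ?thesis using True sV'[of k j] by (auto simp: mat_def)
    next
      case False
      then have row: "V $ i $ l = mat 1 $ i $ l" for l using that insert.prems(2) by auto
      then have "V $ i $ k = 0" using False by (simp add: mat_def)
      then have CVi: "(C ** V) $ i $ l = mat 1 $ i $ l" for l
        unfolding CM using False row by simp
      show ?thesis unfolding entry CVi using False by (simp add: mat_def)
    qed
    with insert.IH[OF V'] obtain D :: "real^'n^'n" where D: "invertible D" "D ** V' ** transpose D = mat 1" by blast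
    have "(D ** C) ** V ** transpose (D ** C) = mat 1"
      using D(2) unfolding V'_def by (simp add: matrix_transpose_mul matrix_mul_assoc)
    then show ?case using invertible_mult[OF D(1) \<open>invertible C\<close>] by blast
  qed
  from this[of V UNIV] assms that show ?thesis by auto
qed

lemma pos_def_factor:
  fixes V :: "real^'n^'n"
  assumes "pos_def V"
  obtains B :: "real^'n^'n" where "invertible B" and "V = B ** transpose B"
proof -
  obtain C :: "real^'n^'n" where C: "invertible C" "C ** V ** transpose C = mat 1" using pos_def_congruent_mat_1[OF assms] .
  have "matrix_inv C ** (C ** V ** transpose C) ** transpose (matrix_inv C) =
      matrix_inv C ** (C ** (V ** transpose (matrix_inv C ** C)))"
    by (simp add: matrix_transpose_mul matrix_mul_assoc)
  then have "V = matrix_inv C ** transpose (matrix_inv C)"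
    unfolding C(2) by (simp add: matrix_cancel_left matrix_inv_mult C)
  then show ?thesis using invertible_matrix_inv(1)[OF C(1)] that by blast
qed

lemma pos_def_det_pos:
  fixes V :: "real^'n^'n" assumes "pos_def V" shows "det V > 0"
proof -
  obtain B :: "real^'n^'n" where "invertible B" "V = B ** transpose B" using pos_def_factor[OF assms] .
  then show ?thesis by (simp add: det_mul invertible_det_nz power2_eq_square[symmetric])
qed

lemma trace_mult_congruence:
  fixes A :: "real^'n^'m" and Q :: "real^'n^'n" and V :: "real^'m^'m"
  shows "trace (A ** Q ** transpose A ** V) = trace (Q ** (transpose A ** V ** A))"
  by (metis matrix_mul_assoc trace_mul_sym)

text \<open>
  Positive definite is the same as symmetric, positive semidefinite and nonsingular. The first two conditions define
  closed sets, whereas the definition of \<open>pos_def\<close> quantifies over the uncountably many nonzero vectors with a strict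
  inequality.
\<close>

lemma pos_def_set_borel [measurable]: "{Q :: real^'n^'n. pos_def Q} \<in> sets borel"
proof -
  let ?psd = "{Q :: real^'n^'n. \<forall>x. 0 \<le> x \<bullet> (Q *v x)}"
  have "{Q :: real^'n^'n. pos_def Q} = {Q. transpose Q = Q} \<inter> ?psd \<inter> {Q. det Q \<noteq> 0}"
  proof (intro set_eqI iffI)
    fix Q :: "real^'n^'n" assume "Q \<in> {Q. pos_def Q}"
    then have "pos_def Q" by simp
    then show "Q \<in> {Q. transpose Q = Q} \<inter> ?psd \<inter> {Q. det Q \<noteq> 0}"
      using pos_def_det_pos[of Q] by (auto simp: pos_def_symmetric pos_def_nonneg)
  next
    fix Q :: "real^'n^'n" assume "Q \<in> {Q. transpose Q = Q} \<inter> ?psd \<inter> {Q. det Q \<noteq> 0}"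
    then have Q: "transpose Q = Q" "\<And>x. 0 \<le> x \<bullet> (Q *v x)" "invertible Q" by (auto simp: invertible_det_nz)
    have "Q *v x = 0" if x: "x \<bullet> (Q *v x) = 0" for x
    proof (rule ccontr)
      assume nz: "Q *v x \<noteq> 0"
      define y where "y = Q *v x"
      define s where "s = y \<bullet> (Q *v y)"
      have yy: "y \<bullet> y > 0" using nz by (simp add: y_def)
      have "0 \<le> (x - e *\<^sub>R y) \<bullet> (Q *v (x - e *\<^sub>R y))" for e by (rule Q(2))
      also have "(x - e *\<^sub>R y) \<bullet> (Q *v (x - e *\<^sub>R y)) = - 2 * e * (y \<bullet> y) + e * e * s" for e
        using x symmetric_inner[OF Q(1), of x y]
        by (simp add: matrix_vector_mult_diff_distrib matrix_vector_mult_scaleR inner_diff_left inner_diff_right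
            y_def[symmetric] s_def algebra_simps inner_commute)
      finally have *: "0 \<le> - 2 * e * (y \<bullet> y) + e * e * s" for e .
      have s: "0 \<le> s" unfolding s_def by (rule Q(2))
      \<comment> \<open>A step in direction \<open>- Q x\<close> so short that the linear term of the form dominates.\<close>
      define e where "e = (y \<bullet> y) / (1 + s)"
      have e: "e > 0" "e * s \<le> y \<bullet> y" using yy s by (auto simp: e_def field_simps)
      have "e * (e * s) \<le> e * (y \<bullet> y)" using e by (intro mult_left_mono) auto
      moreover have "e * (y \<bullet> y) > 0" using e yy by simp
      ultimately show False using *[of e] by (simp add: mult.assoc)
    qed
    then have "x = 0" if "x \<bullet> (Q *v x) = 0" for x
      using that Q(3) unfolding invertible_left_inverse matrix_left_invertible_ker by blast
    then show "Q \<in> {Q. pos_def Q}" using Q(1,2) by (auto simp: pos_def_def less_le)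
  qed
  moreover have "{Q :: real^'n^'n. transpose Q = Q} \<in> sets borel"
  proof -
    have "{Q :: real^'n^'n. transpose Q = Q} = {Q \<in> space borel. \<forall>i j. Q $ j $ i = Q $ i $ j}"
      by (auto simp: vec_eq_iff transpose_nth)
    also have "\<dots> \<in> sets borel" by measurable
    finally show ?thesis .
  qed
  moreover have "?psd \<in> sets borel"
  proof -
    have "closed ?psd"
      unfolding matrix_vector_mult_def inner_vec_def
      by (intro closed_Collect_all closed_Collect_le continuous_intros)
    then show ?thesis by (rule borel_closed)
  qed
  moreover have "{Q :: real^'n^'n. det Q \<noteq> 0} \<in> sets borel"
  proof -
    have "{Q :: real^'n^'n. det Q \<noteq> 0} = {Q \<in> space borel. det Q \<noteq> 0}" by simp
    also have "\<dots> \<in> sets borel" by measurable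
    finally show ?thesis .
  qed
  ultimately show ?thesis by auto
qed

lemma measurable_pos_def [measurable (raw)]:
  fixes f :: "'a \<Rightarrow> real^'n^'n"
  assumes [measurable]: "f \<in> borel_measurable M"
  shows "Measurable.pred M (\<lambda>x. pos_def (f x))"
proof -
  have "(\<lambda>x. f x \<in> {Q. pos_def Q}) \<in> measurable M (count_space UNIV)" by measurable
  then show ?thesis by simp
qed

lemma loewner_less_zero [simp]: "0 \<prec> A \<longleftrightarrow> pos_def A"
  by (simp add: loewner_less_def)

section \<open>Principal minors and the finiteness of the gamma integral\<close>

text \<open>
  The principal submatrix with index set \<open>S\<close>, completed by the identity to a matrix of the full size. Its
  determinant is the principal minor.
\<close>

definition principal_block :: "'n set \<Rightarrow> real^'n^'n \<Rightarrow> real^'n^'n" where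
  "principal_block S Q = (\<chi> i j. if i \<in> S \<and> j \<in> S then Q $ i $ j else mat 1 $ i $ j)"

lemma principal_block_UNIV [simp]: "principal_block UNIV Q = Q"
  by (simp add: principal_block_def vec_eq_iff)

lemma principal_block_empty [simp]: "principal_block {} Q = mat 1"
  by (simp add: principal_block_def vec_eq_iff)

text \<open>
  The quadratic form is that of \<open>Q\<close> in the coordinates in \<open>S\<close> plus the sum of the squares of the others.
\<close>

lemma pos_def_principal_block:
  fixes Q :: "real^'n^'n"
  assumes Q: "pos_def Q" shows "pos_def (principal_block S Q)"
proof -
  have "transpose (principal_block S Q) = principal_block S Q"
    using pos_def_symmetric[OF Q] by (auto simp: vec_eq_iff transpose_nth principal_block_def mat_def)
  moreover have "x \<bullet> (principal_block S Q *v x) > 0" if "x \<noteq> 0" for x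
  proof -
    define y where "y = (\<chi> i. if i \<in> S then x $ i else 0)"
    have blk: "(principal_block S Q *v x) $ i = (if i \<in> S then (Q *v y) $ i else x $ i)" for i
    proof (cases "i \<in> S")
      case True
      have "(\<Sum>j\<in>UNIV. principal_block S Q $ i $ j * x $ j) = (\<Sum>j\<in>UNIV. Q $ i $ j * y $ j)"
        using True by (intro sum.cong) (auto simp: principal_block_def y_def mat_def)
      with True show ?thesis by (simp add: matrix_vector_mult_def)
    next
      case False
      have "(\<Sum>j\<in>UNIV. principal_block S Q $ i $ j * x $ j) = (\<Sum>j\<in>UNIV. if j = i then x $ i else 0)"
        using False by (intro sum.cong) (auto simp: principal_block_def mat_def)
      with False show ?thesis by (simp add: matrix_vector_mult_def)
    qed
    have "x \<bullet> (principal_block S Q *v x) = (\<Sum>i\<in>UNIV. y $ i * (Q *v y) $ i + (x - y) $ i * (x - y) $ i)"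
      unfolding inner_vec_def blk by (intro sum.cong) (auto simp: y_def)
    also have "\<dots> = y \<bullet> (Q *v y) + (x - y) \<bullet> (x - y)"
      by (simp add: inner_vec_def sum.distrib)
    also have "\<dots> > 0"
      using Q that pos_def_nonneg[OF Q, of y] unfolding pos_def_def
      by (cases "y = 0") (auto intro: add_pos_nonneg)
    finally show ?thesis .
  qed
  ultimately show ?thesis by (simp add: pos_def_def)
qed

text \<open>
  If row \<open>k\<close> is the unit vector \<open>axis k 1\<close>, only permutations fixing \<open>k\<close> contribute to the determinant, and they never
  meet the other entries of column \<open>k\<close>.
\<close>

lemma det_unit_row_cong:
  fixes A B :: "real^'n^'n"
  assumes "A $ k = axis k 1" "B $ k = axis k 1"
    and "\<And>i j. i \<noteq> k \<Longrightarrow> j \<noteq> k \<Longrightarrow> A $ i $ j = B $ i $ j"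
  shows "det A = det B"
  unfolding det_def
proof (rule sum.cong[OF refl])
  fix p :: "'n \<Rightarrow> 'n" assume "p \<in> {p. p permutes UNIV}"
  then have inj: "inj p" by (auto simp: permutes_inj)
  have "(\<Prod>i\<in>UNIV. A $ i $ p i) = (\<Prod>i\<in>UNIV. B $ i $ p i)"
  proof (cases "p k = k")
    case True
    then have "p i \<noteq> k" if "i \<noteq> k" for i using that inj by (metis injD)
    then have "A $ i $ p i = B $ i $ p i" for i
      using assms by (cases "i = k") auto
    then show ?thesis by simp
  next
    case False
    then have "A $ k $ p k = 0" "B $ k $ p k = 0" using assms by (auto simp: axis_def)
    then have "(\<Prod>i\<in>UNIV. A $ i $ p i) = 0" "(\<Prod>i\<in>UNIV. B $ i $ p i) = 0"
      by (auto intro!: prod_zero)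
    then show ?thesis by (simp only:)
  qed
  then show "of_int (sign p) * (\<Prod>i\<in>UNIV. A $ i $ p i) = of_int (sign p) * (\<Prod>i\<in>UNIV. B $ i $ p i)" by simp
qed

text \<open>
  The diagonal entry \<open>t\<close> occurs in one place, so the minor is an affine function of \<open>t\<close>; the coefficient is the minor
  without that row and column. This is what allows the integration over \<open>t\<close>.
\<close>

lemma det_principal_block_insert:
  fixes v :: "'n::finite set \<Rightarrow> real"
  assumes "k \<notin> S"
  shows "det (principal_block (insert k S) (symmetric_of (v({k} := t)))) =
    det (principal_block (insert k S) (symmetric_of (v({k} := 0)))) +
    t * det (principal_block S (symmetric_of v))"
proof -
  let ?P = "\<lambda>t. principal_block (insert k S) (symmetric_of (v({k} := t)))"
  let ?U = "\<chi> i. if i = k then axis k 1 else ?P 0 $ i"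
  have off: "?P t $ i $ j = ?P 0 $ i $ j" if "i \<noteq> k \<or> j \<noteq> k" for i j
    using that by (auto simp: principal_block_def)
  have diag: "?P t $ k $ k = t" for t by (simp add: principal_block_def)
  have "?P t = (\<chi> i. if i = k then ?P 0 $ i + t *s axis k 1 else ?P 0 $ i)"
  proof -
    have "?P t $ i $ j = (\<chi> i. if i = k then ?P 0 $ i + t *s axis k 1 else ?P 0 $ i) $ i $ j" for i j
      using off[of i j] diag[of t] diag[of 0] by (cases "i = k"; cases "j = k") (auto simp: axis_def)
    then show ?thesis by (simp only: vec_eq_iff) simp
  qed
  then have "det (?P t) = det (\<chi> i. if i = k then ?P 0 $ i else ?P 0 $ i) + det (\<chi> i. if i = k then t *s axis k 1 else ?P 0 $ i)"
    by (simp only: det_row_add)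
  also have "(\<chi> i. if i = k then ?P 0 $ i else ?P 0 $ i) = ?P 0" by (simp add: vec_eq_iff)
  also have "det (\<chi> i. if i = k then t *s axis k 1 else ?P 0 $ i) = t * det ?U"
    by (simp only: det_row_mul)
  also have "det ?U = det (principal_block S (symmetric_of v))"
  proof (rule det_unit_row_cong)
    show "principal_block S (symmetric_of v) $ k = axis k 1"
      using assms by (auto simp: vec_eq_iff principal_block_def axis_def mat_def)
    show "?U $ i $ j = principal_block S (symmetric_of v) $ i $ j" if "i \<noteq> k" "j \<noteq> k" for i j
      using that by (auto simp: principal_block_def)
  qed simp
  finally show ?thesis .
qed

lemma nn_integral_exp_abs_finite:
  assumes "c > (0::real)"
  shows "(\<integral>\<^sup>+t. ennreal (exp (- c * \<bar>t\<bar>)) \<partial>lborel) < \<infinity>"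
proof -
  have 1: "(\<integral>\<^sup>+t. ennreal (exp (- c * t)) * indicator {0..} t \<partial>lborel) = ennreal (0 - (- exp (- c * 0) / c))"
  proof (rule nn_integral_FTC_atLeast)
    show "((\<lambda>t. - exp (- c * t) / c) \<longlongrightarrow> 0) at_top" using assms by real_asymp
  qed (use assms in \<open>auto intro!: derivative_eq_intros\<close>)
  then have "(\<integral>\<^sup>+t. ennreal (exp (- c * t)) * indicator {0..} t \<partial>lborel) < \<infinity>" by simp
  moreover have "(\<integral>\<^sup>+t. ennreal (exp (- c * t)) * indicator {0..} t \<partial>lborel) =
      (\<integral>\<^sup>+t. ennreal (exp (- c * (0 + - 1 * t))) * indicator {0..} (0 + - 1 * t) \<partial>lborel)"
    by (subst nn_integral_real_affine[where c="- 1" and t=0]) auto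
  moreover have le: "(\<integral>\<^sup>+t. ennreal (exp (- c * \<bar>t\<bar>)) \<partial>lborel) \<le>
      (\<integral>\<^sup>+t. ennreal (exp (- c * t)) * indicator {0..} t +
        ennreal (exp (- c * (0 + - 1 * t))) * indicator {0..} (0 + - 1 * t) \<partial>lborel)"
    by (intro nn_integral_mono) (auto simp: indicator_def)
  ultimately show ?thesis
    by (intro le_less_trans[OF le], subst nn_integral_add) auto
qed

lemma nn_integral_powr_unit_finite:
  assumes "g > (- 1::real)"
  shows "(\<integral>\<^sup>+s. ennreal (s powr g) * indicator {0<..1} s \<partial>lborel) < \<infinity>"
proof -
  have "((\<lambda>x. x powr g) has_integral (1 powr (g + 1) / (g + 1))) {0..1::real}"
    using assms by (intro has_integral_powr_from_0) auto
  then have "(\<integral>\<^sup>+s. ennreal (s powr g) * indicator {0..1} s \<partial>lborel) = ennreal (1 powr (g + 1) / (g + 1))"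
    by (rule nn_integral_has_integral_lebesgue'[rotated]) simp
  moreover have le: "(\<integral>\<^sup>+s. ennreal (s powr g) * indicator {0<..1} s \<partial>lborel) \<le> (\<integral>\<^sup>+s. ennreal (s powr g) * indicator {0..1} s \<partial>lborel)"
    by (intro nn_integral_mono) (auto simp: indicator_def)
  ultimately show ?thesis by (intro le_less_trans[OF le]) simp
qed

text \<open>
  The point is the uniformity in \<open>\<alpha>\<close> and the power of \<open>\<delta>\<close>. After the shift \<open>t = s - \<alpha> / \<delta>\<close> the integrand is at most
  \<open>\<delta>\<^sup>g\<close> times \<open>s\<^sup>g\<close> for \<open>s \<le> 1\<close> and times the exponential for \<open>s > 1\<close>, since \<open>g \<le> 0\<close>.
\<close>

lemma nn_integral_powr_linear_bound:
  assumes c: "c > (0::real)" and g: "- 1 < g" "g \<le> 0"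
  obtains K where "K < \<infinity>" and
    "\<And>\<alpha> \<delta>. \<delta> > 0 \<Longrightarrow> (\<integral>\<^sup>+t. ennreal ((if \<alpha> + t * \<delta> > 0 then (\<alpha> + t * \<delta>) powr g else 0) * exp (- c * \<bar>t\<bar>)) \<partial>lborel) \<le> K * ennreal (\<delta> powr g)"
proof -
  define K where "K = (\<integral>\<^sup>+s. ennreal (s powr g) * indicator {0<..1} s \<partial>lborel) + (\<integral>\<^sup>+t. ennreal (exp (- c * \<bar>t\<bar>)) \<partial>lborel)"
  have "K < \<infinity>" using nn_integral_powr_unit_finite[OF g(1)] nn_integral_exp_abs_finite[OF c] by (simp add: K_def)
  moreover have "(\<integral>\<^sup>+t. ennreal ((if \<alpha> + t * \<delta> > 0 then (\<alpha> + t * \<delta>) powr g else 0) * exp (- c * \<bar>t\<bar>)) \<partial>lborel) \<le> K * ennreal (\<delta> powr g)"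
    if d: "\<delta> > 0" for \<alpha> \<delta>
  proof -
    let ?f = "\<lambda>t. ennreal ((if \<alpha> + t * \<delta> > 0 then (\<alpha> + t * \<delta>) powr g else 0) * exp (- c * \<bar>t\<bar>))"
    have "(\<integral>\<^sup>+t. ?f t \<partial>lborel) = (\<integral>\<^sup>+s. ?f (- \<alpha> / \<delta> + 1 * s) \<partial>lborel)"
      by (subst nn_integral_real_affine[where c=1 and t="- \<alpha> / \<delta>"]) auto
    also have "\<dots> \<le> (\<integral>\<^sup>+s. ennreal (\<delta> powr g) * (ennreal (s powr g) * indicator {0<..1} s + ennreal (exp (- c * \<bar>- \<alpha> / \<delta> + 1 * s\<bar>))) \<partial>lborel)"
    proof (rule nn_integral_mono)
      fix s :: real
      have e: "\<alpha> + (- \<alpha> / \<delta> + 1 * s) * \<delta> = s * \<delta>" using d by (simp add: field_simps)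
      define E where "E = exp (- c * \<bar>- \<alpha> / \<delta> + 1 * s\<bar>)"
      have E: "0 \<le> E" "E \<le> 1" using c by (auto simp: E_def)
      show "?f (- \<alpha> / \<delta> + 1 * s) \<le> ennreal (\<delta> powr g) * (ennreal (s powr g) * indicator {0<..1} s + ennreal (exp (- c * \<bar>- \<alpha> / \<delta> + 1 * s\<bar>)))"
        unfolding e E_def[symmetric]
      proof (cases "s > 0")
        case s: True
        have pw: "(s * \<delta>) powr g = s powr g * \<delta> powr g" using s d by (simp add: powr_mult)
        show "ennreal ((if 0 < s * \<delta> then (s * \<delta>) powr g else 0) * E)
          \<le> ennreal (\<delta> powr g) * (ennreal (s powr g) * indicator {0<..1} s + ennreal E)"
        proof (cases "s \<le> 1")
          case True
          have "(s * \<delta>) powr g * E \<le> \<delta> powr g * (s powr g + E)"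
          proof -
            have "(s powr g * \<delta> powr g) * E \<le> s powr g * \<delta> powr g" using E by (intro mult_left_le) auto
            moreover have "0 \<le> \<delta> powr g * E" using E by simp
            ultimately show ?thesis unfolding pw by (simp add: algebra_simps)
          qed
          with s d True E show ?thesis by (simp add: ennreal_mult'[symmetric] ennreal_plus[symmetric] del: ennreal_plus)
        next
          case False
          then have "s powr g \<le> 1" using g s powr_mono[of g 0 s] by simp
          then have "(s * \<delta>) powr g * E \<le> \<delta> powr g * E"
            unfolding pw using E by (intro mult_right_mono) (auto simp: mult_left_le_one_le)
          with s d False E show ?thesis by (simp add: ennreal_mult'[symmetric])
        qed
      next
        case False
        then have "\<not> 0 < s * \<delta>" using d by (simp add: zero_less_mult_iff)
        then show "ennreal ((if 0 < s * \<delta> then (s * \<delta>) powr g else 0) * E)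
          \<le> ennreal (\<delta> powr g) * (ennreal (s powr g) * indicator {0<..1} s + ennreal E)" by simp
      qed
    qed
    also have "\<dots> = ennreal (\<delta> powr g) * ((\<integral>\<^sup>+s. ennreal (s powr g) * indicator {0<..1} s \<partial>lborel) +
        (\<integral>\<^sup>+s. ennreal (exp (- c * \<bar>- \<alpha> / \<delta> + 1 * s\<bar>)) \<partial>lborel))"
      by (subst nn_integral_cmult, simp, subst nn_integral_add) auto
    also have "(\<integral>\<^sup>+s. ennreal (exp (- c * \<bar>- \<alpha> / \<delta> + 1 * s\<bar>)) \<partial>lborel) = (\<integral>\<^sup>+t. ennreal (exp (- c * \<bar>t\<bar>)) \<partial>lborel)"
      by (subst (2) nn_integral_real_affine[where c=1 and t="- \<alpha> / \<delta>"]) auto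
    finally show ?thesis by (simp add: K_def mult.commute)
  qed
  ultimately show ?thesis using that by blast
qed

text \<open>
  Induction on \<open>S\<close>, adding one index \<open>k\<close> at a time. All coordinates except the diagonal one \<open>{k}\<close> are held fixed. In that
  coordinate the minor of \<open>insert k S\<close> is affine with slope the minor \<open>\<delta>\<close> of \<open>S\<close>, so the integral over it costs a constant and
  turns the power of the new minor into \<open>\<delta>\<^sup>g\<close>, the integrand of the previous step. The conditions on all the minors
  keep the slopes positive.
\<close>

lemma minor_integral_finite:
  fixes S :: "'n::finite set"
  assumes c: "c > (0::real)" and g: "- 1 < g" "g \<le> 0"
  shows "(\<integral>\<^sup>+v. ennreal ((if \<forall>T\<subseteq>S. 0 < det (principal_block T (symmetric_of v))
      then det (principal_block S (symmetric_of v)) powr g else 0) *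
      (\<Prod>e\<in>unordered_pairs. exp (- c * \<bar>v e\<bar>))) \<partial>lebesgue_product unordered_pairs) < \<infinity>"
  using finite[of S]
proof (induction S rule: finite_induct)
  interpret product_sigma_finite "\<lambda>_::'n set. lborel :: real measure" by (rule product_sigma_finite_lborel)
  case empty
  have "(\<integral>\<^sup>+v. (\<Prod>e\<in>(unordered_pairs :: 'n set set). ennreal (exp (- c * \<bar>v e\<bar>))) \<partial>lebesgue_product unordered_pairs) =
      (\<Prod>e\<in>(unordered_pairs :: 'n set set). \<integral>\<^sup>+t. ennreal (exp (- c * \<bar>t\<bar>)) \<partial>lborel)"
    by (rule product_nn_integral_prod) auto
  also have "\<dots> < \<infinity>" using nn_integral_exp_abs_finite[OF c] by (simp add: power_less_top_ennreal)
  finally show ?case by (simp add: prod_ennreal)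
next
  case (insert k S)
  interpret product_sigma_finite "\<lambda>_::'n set. lborel :: real measure" by (rule product_sigma_finite_lborel)
  let ?U = "unordered_pairs :: 'n set set"
  let ?E = "?U - {{k}}"
  have E: "insert {k} ?E = ?U" "finite ?E" "{k} \<notin> ?E" by (auto simp: insert_absorb)
  obtain K where K: "K < \<infinity>" "\<And>\<alpha> \<delta>. \<delta> > 0 \<Longrightarrow>
      (\<integral>\<^sup>+t. ennreal ((if \<alpha> + t * \<delta> > 0 then (\<alpha> + t * \<delta>) powr g else 0) * exp (- c * \<bar>t\<bar>)) \<partial>lborel) \<le> K * ennreal (\<delta> powr g)"
    using nn_integral_powr_linear_bound[OF c g] by blast
  define L where "L = (\<integral>\<^sup>+t. ennreal (exp (- c * \<bar>t\<bar>)) \<partial>lborel)"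
  have L: "L < \<infinity>" "L > 0"
  proof -
    show "L < \<infinity>" unfolding L_def by (rule nn_integral_exp_abs_finite[OF c])
    have "ennreal (exp (- c)) = (\<integral>\<^sup>+t. ennreal (exp (- c)) * indicator {0..1::real} t \<partial>lborel)"
      by (simp add: nn_integral_cmult_indicator)
    also have "\<dots> \<le> L"
      unfolding L_def using c by (intro nn_integral_mono) (auto simp: indicator_def)
    finally show "L > 0" by (rule less_le_trans[rotated]) simp
  qed
  define D where "D T v = det (principal_block T (symmetric_of v))" for T :: "'n set" and v
  have comp: "(\<lambda>v. v e) \<in> borel_measurable (lebesgue_product ?U)" if "e \<in> ?U" for e
    using that by (rule measurable_component_singleton[where M="\<lambda>_. lborel", simplified])
  have [measurable]: "D T \<in> borel_measurable (lebesgue_product ?U)" for T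
  proof -
    have "(\<lambda>v. principal_block T (symmetric_of v)) \<in> borel_measurable (lebesgue_product ?U)"
    proof (rule borel_measurable_matrixI)
      fix i j :: 'n
      show "(\<lambda>v. principal_block T (symmetric_of v) $ i $ j) \<in> borel_measurable (lebesgue_product ?U)"
        using comp[of "{i, j}"] unfolding principal_block_def by (cases "i \<in> T \<and> j \<in> T") simp_all
    qed
    then show ?thesis unfolding D_def by measurable
  qed
  define w where "w S v = (if \<forall>T\<subseteq>S. 0 < D T v then D S v powr g else 0) * (\<Prod>e\<in>?U. exp (- c * \<bar>v e\<bar>))" for S v
  have wm: "(\<lambda>v. ennreal (w S v)) \<in> borel_measurable (lebesgue_product ?U)" for S :: "'n set"
  proof -
    have "Measurable.pred (lebesgue_product ?U) (\<lambda>v. \<forall>T\<in>{T. T \<subseteq> S}. 0 < D T v)"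
      by (rule measurable_pred_countable) auto
    then have [measurable]: "Measurable.pred (lebesgue_product ?U) (\<lambda>v. \<forall>T\<subseteq>S. 0 < D T v)" by simp
    have [measurable]: "(\<lambda>v. \<Prod>e\<in>?U. exp (- c * \<bar>v e\<bar>)) \<in> borel_measurable (lebesgue_product ?U)"
    proof (rule borel_measurable_prod)
      fix e assume "e \<in> ?U"
      note comp[OF this, measurable]
      show "(\<lambda>v. exp (- c * \<bar>v e\<bar>)) \<in> borel_measurable (lebesgue_product ?U)" by measurable
    qed
    show ?thesis unfolding w_def by measurable
  qed
  have fold: "(\<integral>\<^sup>+v. ennreal (w S v) \<partial>lebesgue_product ?U) =
      (\<integral>\<^sup>+x. (\<integral>\<^sup>+t. ennreal (w S (x({k} := t))) \<partial>lborel) \<partial>lebesgue_product ?E)" for S :: "'n set"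
    using product_nn_integral_insert[OF E(2,3), of "\<lambda>v. ennreal (w S v)"] wm[of S] unfolding E(1) by simp
  define R where "R x = (\<Prod>e\<in>?E. exp (- c * \<bar>x e\<bar>))" for x
  have prodU: "(\<Prod>e\<in>?U. exp (- c * \<bar>(x({k} := t)) e\<bar>)) = exp (- c * \<bar>t\<bar>) * R x" for x t
  proof -
    have "(\<Prod>e\<in>?U. exp (- c * \<bar>(x({k} := t)) e\<bar>)) =
        exp (- c * \<bar>t\<bar>) * (\<Prod>e\<in>?E. exp (- c * \<bar>(x({k} := t)) e\<bar>))"
      using prod.remove[of ?U "{k}" "\<lambda>e. exp (- c * \<bar>(x({k} := t)) e\<bar>)"] by simp
    also have "(\<Prod>e\<in>?E. exp (- c * \<bar>(x({k} := t)) e\<bar>)) = R x"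
      unfolding R_def by (intro prod.cong) auto
    finally show ?thesis .
  qed
  have R: "R x \<ge> 0" for x by (simp add: R_def prod_nonneg)
  have Dk: "D T (x({k} := t)) = D T x" if "T \<subseteq> S" for T x t
  proof -
    have "k \<notin> T" using that insert.hyps by auto
    then have "principal_block T (symmetric_of (x({k} := t))) = principal_block T (symmetric_of x)"
      by (auto simp: vec_eq_iff principal_block_def)
    then show ?thesis by (simp add: D_def)
  qed
  have step: "L * (\<integral>\<^sup>+t. ennreal (w (insert k S) (x({k} := t))) \<partial>lborel) \<le> K * (\<integral>\<^sup>+t. ennreal (w S (x({k} := t))) \<partial>lborel)" for x
  proof (cases "\<forall>T\<subseteq>S. 0 < D T x")
    case True
    define \<delta> where "\<delta> = D S x"
    define \<alpha> where "\<alpha> = D (insert k S) (x({k} := 0))"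
    have d: "\<delta> > 0" using True by (simp add: \<delta>_def)
    have lin: "D (insert k S) (x({k} := t)) = \<alpha> + t * \<delta>" for t
      unfolding D_def \<alpha>_def \<delta>_def by (rule det_principal_block_insert) fact
    have "(\<integral>\<^sup>+t. ennreal (w (insert k S) (x({k} := t))) \<partial>lborel) \<le>
        (\<integral>\<^sup>+t. ennreal (R x) * ennreal ((if \<alpha> + t * \<delta> > 0 then (\<alpha> + t * \<delta>) powr g else 0) * exp (- c * \<bar>t\<bar>)) \<partial>lborel)"
    proof (rule nn_integral_mono)
      fix t :: real
      have "w (insert k S) (x({k} := t)) \<le>
        R x * ((if \<alpha> + t * \<delta> > 0 then (\<alpha> + t * \<delta>) powr g else 0) * exp (- c * \<bar>t\<bar>))"
      proof (cases "\<forall>T\<subseteq>insert k S. 0 < D T (x({k} := t))")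
        case True
        then have "0 < \<alpha> + t * \<delta>" using lin[of t] by (metis order_refl)
        then show ?thesis unfolding w_def prodU lin if_P[OF True] by simp
      next
        case False
        then show ?thesis unfolding w_def if_not_P[OF False] using R[of x] by simp
      qed
      then show "ennreal (w (insert k S) (x({k} := t))) \<le>
        ennreal (R x) * ennreal ((if \<alpha> + t * \<delta> > 0 then (\<alpha> + t * \<delta>) powr g else 0) * exp (- c * \<bar>t\<bar>))"
        by (subst ennreal_mult'[OF R, symmetric]) (rule ennreal_leI)
    qed
    also have "\<dots> = ennreal (R x) * (\<integral>\<^sup>+t. ennreal ((if \<alpha> + t * \<delta> > 0 then (\<alpha> + t * \<delta>) powr g else 0) * exp (- c * \<bar>t\<bar>)) \<partial>lborel)"
      by (rule nn_integral_cmult) measurable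
    also have "\<dots> \<le> ennreal (R x) * (K * ennreal (\<delta> powr g))"
      by (intro mult_left_mono K(2) d) simp
    finally have 1: "(\<integral>\<^sup>+t. ennreal (w (insert k S) (x({k} := t))) \<partial>lborel) \<le> ennreal (R x) * (K * ennreal (\<delta> powr g))" .
    have "(\<integral>\<^sup>+t. ennreal (w S (x({k} := t))) \<partial>lborel) = (\<integral>\<^sup>+t. ennreal (\<delta> powr g * R x) * ennreal (exp (- c * \<bar>t\<bar>)) \<partial>lborel)"
    proof (rule nn_integral_cong)
      fix t :: real
      have all: "\<forall>T\<subseteq>S. 0 < D T (x({k} := t))" using True Dk by simp
      have "w S (x({k} := t)) = \<delta> powr g * R x * exp (- c * \<bar>t\<bar>)"
        unfolding w_def prodU if_P[OF all] \<delta>_def by (simp add: Dk)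
      then show "ennreal (w S (x({k} := t))) = ennreal (\<delta> powr g * R x) * ennreal (exp (- c * \<bar>t\<bar>))"
        using R[of x] by (simp add: ennreal_mult')
    qed
    also have "\<dots> = ennreal (\<delta> powr g * R x) * L" unfolding L_def by (rule nn_integral_cmult) measurable
    finally have 2: "(\<integral>\<^sup>+t. ennreal (w S (x({k} := t))) \<partial>lborel) = ennreal (\<delta> powr g * R x) * L" .
    have "L * (\<integral>\<^sup>+t. ennreal (w (insert k S) (x({k} := t))) \<partial>lborel) \<le> L * (ennreal (R x) * (K * ennreal (\<delta> powr g)))"
      by (rule mult_left_mono[OF 1]) simp
    also have "\<dots> = K * (ennreal (\<delta> powr g * R x) * L)"
      using R[of x] by (simp add: ennreal_mult' mult.assoc mult.left_commute mult.commute)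
    finally show ?thesis unfolding 2 .
  next
    case False
    have "w (insert k S) (x({k} := t)) = 0" for t
    proof -
      have "\<not> (\<forall>T\<subseteq>insert k S. 0 < D T (x({k} := t)))"
        using False Dk by (metis subset_insertI2)
      then show ?thesis unfolding w_def by (subst if_not_P) simp_all
    qed
    then show ?thesis by simp
  qed
  have "L * (\<integral>\<^sup>+v. ennreal (w (insert k S) v) \<partial>lebesgue_product ?U) \<le> K * (\<integral>\<^sup>+v. ennreal (w S v) \<partial>lebesgue_product ?U)"
  proof -
    have m: "(\<lambda>x. \<integral>\<^sup>+t. ennreal (w S (x({k} := t))) \<partial>lborel) \<in> borel_measurable (lebesgue_product ?E)" for S :: "'n set"
    proof -
      have "(\<lambda>(x, t). x({k} := t)) \<in> measurable (lebesgue_product ?E \<Otimes>\<^sub>M lborel) (lebesgue_product (insert {k} ?E))"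
        by measurable
      from measurable_comp[OF this[unfolded E(1)] wm[of S]]
      have "(\<lambda>(x, t). ennreal (w S (x({k} := t)))) \<in> borel_measurable (lebesgue_product ?E \<Otimes>\<^sub>M lborel)"
        by (simp add: comp_def case_prod_beta)
      then show ?thesis by (intro lborel.borel_measurable_nn_integral) (simp add: case_prod_beta)
    qed
    show ?thesis unfolding fold
      by (subst (1 2) nn_integral_cmult[symmetric]) (auto intro!: m nn_integral_mono step)
  qed
  also have "\<dots> < \<infinity>" using K(1) insert.IH unfolding w_def D_def by (simp add: ennreal_mult_less_top)
  finally have "(\<integral>\<^sup>+v. ennreal (w (insert k S) v) \<partial>lebesgue_product ?U) < \<infinity>"
    using L(2) by (auto simp: ennreal_mult_less_top)
  then show ?case unfolding w_def D_def .
qed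

section \<open>Sigma-finiteness and sets of positive measure\<close>

lemma unordered_pairs_nonempty [simp]: "unordered_pairs \<noteq> {}"
  by (auto simp: unordered_pairs_def)

lemma sigma_finite_sym_lborel: "sigma_finite_measure (sym_lborel :: (real^'n^'n) measure)"
proof
  interpret finite_product_sigma_finite "\<lambda>_::'n set. lborel :: real measure" "unordered_pairs :: 'n set set"
    by (intro finite_product_sigma_finite.intro product_sigma_finite_lborel finite_product_sigma_finite_axioms.intro) simp
  let ?A = "\<lambda>k::nat. {Q :: real^'n^'n. \<forall>i j. \<bar>Q $ i $ j\<bar> \<le> real k}"
  have A: "?A k \<in> sets borel" for k
  proof -
    have "?A k = {Q \<in> space borel. \<forall>i j. \<bar>Q $ i $ j\<bar> \<le> real k}" by simp
    also have "\<dots> \<in> sets borel" by measurable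
    finally show ?thesis .
  qed
  have "emeasure sym_lborel (?A k) \<noteq> \<infinity>" for k
  proof -
    have "symmetric_of -` ?A k \<inter> space (lebesgue_product unordered_pairs) = (\<Pi>\<^sub>E e\<in>unordered_pairs. {- real k..real k})"
    proof -
      have "(\<forall>e\<in>unordered_pairs. P e) \<longleftrightarrow> (\<forall>i j. P {i, j})" for P :: "'n set \<Rightarrow> bool"
        unfolding unordered_pairs_def by blast
      then show ?thesis
        by (auto simp only: set_eq_iff vimage_eq Int_iff mem_Collect_eq symmetric_of_nth space_PiM PiE_iff
            atLeastAtMost_iff abs_le_iff space_lborel space_borel UNIV_I minus_le_iff)
    qed
    then have "emeasure sym_lborel (?A k) = (\<Prod>e\<in>(unordered_pairs :: 'n set set). emeasure lborel {- real k..real k})"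
      unfolding sym_lborel_eq by (subst emeasure_distr) (auto simp: A measure_times)
    also have "\<dots> < \<infinity>" by (simp add: power_less_top_ennreal)
    finally show ?thesis by simp
  qed
  moreover have "(\<Union>k. ?A k) = UNIV"
  proof (intro set_eqI iffI UNIV_I)
    fix Q :: "real^'n^'n"
    obtain k :: nat where k: "norm Q \<le> real k" using real_arch_simple by blast
    have "\<bar>Q $ i $ j\<bar> \<le> norm Q" for i j
      using Finite_Cartesian_Product.norm_nth_le[of "Q $ i" j] Finite_Cartesian_Product.norm_nth_le[of Q i]
      by simp
    with k show "Q \<in> (\<Union>k. ?A k)" by (auto intro!: exI[of _ k] intro: order_trans)
  qed
  ultimately show "\<exists>A :: (real^'n^'n) set set. countable A \<and> A \<subseteq> sets sym_lborel \<and> \<Union> A = space sym_lborel \<and> (\<forall>a\<in>A. emeasure sym_lborel a \<noteq> \<infinity>)"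
    using A by (intro exI[of _ "range ?A"]) auto
qed

interpretation sym_lborel: sigma_finite_measure sym_lborel
  by (rule sigma_finite_sym_lborel)

lemma emeasure_sym_lborel_UNIV: "emeasure sym_lborel (UNIV :: (real^'n^'n) set) = \<infinity>"
proof -
  interpret finite_product_sigma_finite "\<lambda>_::'n set. lborel :: real measure" "unordered_pairs :: 'n set set"
    by (intro finite_product_sigma_finite.intro product_sigma_finite_lborel finite_product_sigma_finite_axioms.intro) simp
  have "symmetric_of -` UNIV \<inter> space (lebesgue_product unordered_pairs) = (\<Pi>\<^sub>E e\<in>(unordered_pairs :: 'n set set). UNIV)"
    by (auto simp: space_PiM)
  then have "emeasure sym_lborel (UNIV :: (real^'n^'n) set) = (\<Prod>e\<in>(unordered_pairs :: 'n set set). emeasure lborel UNIV)"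
    unfolding sym_lborel_eq by (subst emeasure_distr) (auto simp: measure_times)
  then show ?thesis by (simp add: top_power_ennreal card_gt_0_iff)
qed

lemma matrix_scaleR_mult: "(r *\<^sub>R A) ** B = r *\<^sub>R (A ** (B :: real^'p^'n))"
  and matrix_mult_scaleR: "A ** (r *\<^sub>R B) = r *\<^sub>R (A ** (B :: real^'p^'n))"
  by (simp_all add: vec_eq_iff matrix_matrix_mult_def sum_distrib_left algebra_simps)

lemma transpose_add: "transpose (A + B) = transpose A + transpose (B :: real^'n^'m)"
  by (simp add: vec_eq_iff transpose_def)

lemma transpose_diff: "transpose (A - B) = transpose A - transpose (B :: real^'n^'m)"
  by (simp add: vec_eq_iff transpose_def)

text \<open>
  This exhausts the symmetric matrices by order intervals \<open>{Q. - k I < Q < k I}\<close>.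
\<close>

lemma symmetric_bounded_loewner:
  fixes Q :: "real^'n^'n"
  assumes "transpose Q = Q"
  obtains k :: nat where "k > 0" and "pos_def (real k *\<^sub>R mat 1 + Q)" and "pos_def (real k *\<^sub>R mat 1 - Q)"
proof -
  obtain K where K: "K > 0" "\<And>x. norm (Q *v x) \<le> norm x * K"
    using bounded_linear.pos_bounded[OF matrix_vector_mul_bounded_linear[of Q]] by blast
  obtain k :: nat where k: "real k > K" using reals_Archimedean2 by blast
  have pd: "pos_def (real k *\<^sub>R mat 1 + s *\<^sub>R Q)" if "\<bar>s\<bar> = 1" for s
    unfolding pos_def_def
  proof (intro conjI allI impI)
    show "transpose (real k *\<^sub>R mat 1 + s *\<^sub>R Q) = real k *\<^sub>R mat 1 + s *\<^sub>R Q"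
      by (simp add: transpose_add transpose_scalar assms)
    fix x :: "real^'n" assume "x \<noteq> 0"
    then have "K * (norm x * norm x) < real k * (norm x * norm x)" using k by simp
    moreover have "\<bar>s * (x \<bullet> (Q *v x))\<bar> \<le> norm x * (norm x * K)"
      using Cauchy_Schwarz_ineq2[of x "Q *v x"] K(2)[of x] that
      by (simp add: abs_mult) (meson mult_left_mono norm_ge_zero order_trans)
    ultimately have "0 < real k * (norm x * norm x) + s * (x \<bullet> (Q *v x))"
      by (auto simp: abs_le_iff ac_simps)
    then show "0 < x \<bullet> ((real k *\<^sub>R mat 1 + s *\<^sub>R Q) *v x)"
      by (simp add: matrix_vector_mult_add_rdistrib inner_add_right scaleR_matrix_vector_assoc[symmetric]
          power2_norm_eq_inner[symmetric] power2_eq_square)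
  qed
  have "k > 0" using k K(1) by (cases k) auto
  with pd[of 1] pd[of "- 1"] that show ?thesis by simp
qed

text \<open>
  An affine map carries \<open>{Q. 0 < Q < I}\<close> onto \<open>{Q. - k I < Q < k I}\<close>. If the former were a null set, so would be the
  countable union of the latter, which contains almost every matrix.
\<close>

lemma emeasure_unit_interval_pos:
  "emeasure sym_lborel {Q :: real^'n^'n. pos_def Q \<and> pos_def (mat 1 - Q)} > 0"
proof (rule ccontr)
  let ?N = "{Q :: real^'n^'n. pos_def Q \<and> pos_def (mat 1 - Q)}"
  have N [measurable]: "?N \<in> sets borel"
  proof -
    have "?N = {Q \<in> space borel. pos_def Q \<and> pos_def (mat 1 - Q)}" by simp
    also have "\<dots> \<in> sets borel" by measurable
    finally show ?thesis .
  qed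
  assume "\<not> emeasure sym_lborel ?N > 0"
  then have null: "emeasure sym_lborel ?N = 0" by (simp add: zero_less_iff_neq_zero)
  let ?M = "\<lambda>k::nat. {Q :: real^'n^'n. pos_def (real (Suc k) *\<^sub>R mat 1 + Q) \<and> pos_def (real (Suc k) *\<^sub>R mat 1 - Q)}"
  have "?M k \<in> null_sets sym_lborel" for k
  proof -
    have M [measurable]: "?M k \<in> sets borel"
    proof -
      have "?M k = {Q \<in> space borel. pos_def (real (Suc k) *\<^sub>R mat 1 + Q) \<and> pos_def (real (Suc k) *\<^sub>R mat 1 - Q)}" by simp
      also have "\<dots> \<in> sets borel" by measurable
      finally show ?thesis .
    qed
    define r where "r = real (Suc k)"
    have r: "r > 0" by (simp add: r_def)
    let ?A = "sqrt (2 * r) *\<^sub>R mat 1 :: real^'n^'n"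
    have inv: "invertible ?A"
      by (rule pos_def_invertible, rule pos_def_scaleR) (use r in auto)
    have AQ: "?A ** Q ** transpose ?A = (2 * r) *\<^sub>R Q" for Q
      using r by (simp add: transpose_scalar matrix_scaleR_mult matrix_mult_scaleR)
    have iff: "(- r) *\<^sub>R mat 1 + (2 * r) *\<^sub>R Q \<in> ?M k \<longleftrightarrow> Q \<in> ?N" for Q :: "real^'n^'n"
    proof -
      have 1: "r *\<^sub>R mat 1 + ((- r) *\<^sub>R mat 1 + (2 * r) *\<^sub>R Q) = ?A ** Q ** transpose ?A"
        unfolding AQ by simp
      have 2: "r *\<^sub>R mat 1 - ((- r) *\<^sub>R mat 1 + (2 * r) *\<^sub>R Q) = ?A ** (mat 1 - Q) ** transpose ?A"
        unfolding AQ by (simp add: vec_eq_iff algebra_simps)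
      show ?thesis unfolding mem_Collect_eq r_def[symmetric] 1 2 pos_def_congruence_iff[OF inv] ..
    qed
    have "emeasure sym_lborel (?M k) = (\<integral>\<^sup>+Q. indicator (?M k) Q \<partial>sym_lborel)" by simp
    also have "\<dots> = (\<integral>\<^sup>+Q. indicator (?M k) ((- r) *\<^sub>R mat 1 + Q) \<partial>sym_lborel)"
      by (rule sym_lborel_translation[symmetric]) (auto simp: vec_eq_iff transpose_nth mat_def)
    also have "\<dots> = ennreal (\<bar>det ?A\<bar> ^ (CARD('n) + 1)) * (\<integral>\<^sup>+Q. indicator (?M k) ((- r) *\<^sub>R mat 1 + ?A ** Q ** transpose ?A) \<partial>sym_lborel)"
      by (rule sym_lborel_congruence[OF inv]) measurable
    also have "(\<integral>\<^sup>+Q. indicator (?M k) ((- r) *\<^sub>R mat 1 + ?A ** Q ** transpose ?A) \<partial>sym_lborel) = (\<integral>\<^sup>+Q. indicator ?N Q \<partial>sym_lborel)"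
      unfolding AQ by (intro nn_integral_cong) (simp only: indicator_def iff)
    also have "\<dots> = 0" using null by simp
    finally show ?thesis using M by (simp add: null_sets_def)
  qed
  then have "(\<Union>k. ?M k) \<in> null_sets sym_lborel" by (rule null_sets_UN)
  then have "AE Q in sym_lborel. Q \<notin> (\<Union>k. ?M k)" by (rule AE_not_in)
  then have "AE Q in sym_lborel. Q \<notin> (UNIV :: (real^'n^'n) set)"
    using AE_sym_lborel_symmetric
  proof eventually_elim
    case (elim Q)
    obtain k where "k > 0" "pos_def (real k *\<^sub>R mat 1 + Q)" "pos_def (real k *\<^sub>R mat 1 - Q)"
      using symmetric_bounded_loewner[OF elim(2)] .
    then have "Q \<in> ?M (k - 1)" by simp
    with elim(1) show ?case by blast
  qed
  then have "(UNIV :: (real^'n^'n) set) \<in> null_sets sym_lborel"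
    by (subst AE_iff_null_sets) auto
  then show False using emeasure_sym_lborel_UNIV[where 'n='n] null_setsD1 by fastforce
qed

lemma nn_integral_sym_lborel_pos:
  fixes f :: "real^'n^'n \<Rightarrow> ennreal"
  assumes [measurable]: "f \<in> borel_measurable borel"
    and pos: "\<And>Q. pos_def Q \<Longrightarrow> pos_def (mat 1 - Q) \<Longrightarrow> f Q > 0"
  shows "(\<integral>\<^sup>+Q. f Q \<partial>sym_lborel) > 0"
proof (rule ccontr)
  let ?N = "{Q :: real^'n^'n. pos_def Q \<and> pos_def (mat 1 - Q)}"
  assume "\<not> ?thesis"
  then have "(\<integral>\<^sup>+Q. f Q \<partial>sym_lborel) = 0" by (simp add: zero_less_iff_neq_zero)
  then have "AE Q in sym_lborel. f Q = 0" by (subst (asm) nn_integral_0_iff_AE) auto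
  then have "AE Q in sym_lborel. Q \<notin> ?N" by eventually_elim (use pos in fastforce)
  moreover have "?N \<in> sets sym_lborel"
  proof -
    have "?N = {Q \<in> space borel. pos_def Q \<and> pos_def (mat 1 - Q)}" by simp
    also have "\<dots> \<in> sets borel" by measurable
    finally show ?thesis by simp
  qed
  ultimately have "emeasure sym_lborel ?N = 0"
    using AE_iff_null_sets null_setsD1 by blast
  then show False using emeasure_unit_interval_pos[where 'n='n] by simp
qed

section \<open>Gamma and beta integrals over the cone of positive definite matrices\<close>

text \<open>
  The unnormalized Wishart density; for \<open>V = I\<close> it is the integrand of the multivariate gamma function at
  \<open>\<gamma> + (n + 1) / 2\<close>.
\<close>

definition cone_weight :: "real \<Rightarrow> real^'n^'n \<Rightarrow> real^'n^'n \<Rightarrow> real" where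
  "cone_weight \<gamma> V Q = (if pos_def Q then det Q powr \<gamma> * exp (- trace (Q ** V)) else 0)"

lemma cone_weight_nonneg [simp]: "0 \<le> cone_weight \<gamma> V Q"
  by (simp add: cone_weight_def)

lemma borel_measurable_cone_weight [measurable (raw)]:
  fixes f g :: "'a \<Rightarrow> real^'n^'n"
  assumes [measurable]: "f \<in> borel_measurable M" "g \<in> borel_measurable M"
  shows "(\<lambda>x. cone_weight \<gamma> (f x) (g x)) \<in> borel_measurable M"
  unfolding cone_weight_def by measurable

lemma cone_weight_transform:
  fixes V C :: "real^'n^'n"
  assumes C: "invertible C" "C ** V ** transpose C = mat 1"
  shows "cone_weight \<gamma> V (transpose C ** Q ** C) = det V powr (- \<gamma>) * cone_weight \<gamma> (mat 1) Q"
    and "\<bar>det C\<bar> ^ (CARD('n) + 1) = det V powr (- ((real CARD('n) + 1) / 2))"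
    and "matrix_inv V = transpose C ** C"
proof -
  let ?D = "transpose C"
  have D: "invertible ?D" using C(1) by (rule transpose_invertible)
  define d where "d = \<bar>det C\<bar>"
  have d: "d > 0" using C(1) by (simp add: d_def invertible_det_nz)
  have "det C * det V * det C = 1"
    using arg_cong[OF C(2), of det] by (simp add: det_mul)
  then have "det V * d powr 2 = 1" using d by (simp add: d_def power2_eq_square ac_simps)
  then have dV: "det V = d powr (- 2)" using d by (simp add: powr_minus field_simps)
  show "cone_weight \<gamma> V (?D ** Q ** C) = det V powr (- \<gamma>) * cone_weight \<gamma> (mat 1) Q"
  proof (cases "pos_def Q")
    case True
    have "det (?D ** Q ** C) = d powr 2 * det Q" using d by (simp add: det_mul d_def power2_eq_square)
    then have "det (?D ** Q ** C) powr \<gamma> = det V powr (- \<gamma>) * det Q powr \<gamma>"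
      using d pos_def_det_pos[OF True] by (simp add: dV powr_mult powr_powr del: powr_numeral)
    moreover have "trace (?D ** Q ** C ** V) = trace Q"
      using trace_mult_congruence[of ?D Q V] C(2) by simp
    ultimately show ?thesis using pos_def_congruence[OF D True] True by (simp add: cone_weight_def)
  next
    case False
    then show ?thesis using pos_def_congruence_iff[OF D, of Q] by (simp add: cone_weight_def)
  qed
  have "d ^ (CARD('n) + 1) = d powr real (CARD('n) + 1)"
    by (rule powr_realpow[OF d, symmetric])
  also have "real (CARD('n) + 1) = - 2 * (- ((real CARD('n) + 1) / 2))" by (simp add: field_simps)
  finally show "\<bar>det C\<bar> ^ (CARD('n) + 1) = det V powr (- ((real CARD('n) + 1) / 2))"
    unfolding dV powr_powr d_def .
  show "matrix_inv V = transpose C ** C"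
  proof (rule matrix_inv_eqI)
    have "matrix_inv C = V ** transpose C"
      using C(2) by (intro matrix_inv_eqI) (simp add: matrix_mul_assoc)
    then have "V ** transpose C ** C = mat 1" using matrix_inv_mult(2)[OF C(1)] by simp
    then show "V ** (transpose C ** C) = mat 1" by (simp add: matrix_mul_assoc)
  qed
qed

text \<open>
  The substitution \<open>Q \<mapsto> C\<^sup>T Q C\<close> reduces a general scale matrix to the identity. Any \<open>C\<close> with
  \<open>C V C\<^sup>T = I\<close> will do, which avoids a distinguished square root of \<open>V\<close>.
\<close>

lemma cone_weight_congruence:
  fixes V C :: "real^'n^'n" and \<phi> :: "real^'n^'n \<Rightarrow> ennreal"
  assumes C: "invertible C" "C ** V ** transpose C = mat 1" and [measurable]: "\<phi> \<in> borel_measurable borel"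
  shows "(\<integral>\<^sup>+Q. ennreal (cone_weight \<gamma> V Q) * \<phi> Q \<partial>sym_lborel) =
    ennreal (det V powr (- \<gamma> - (real CARD('n) + 1) / 2)) *
    (\<integral>\<^sup>+Q. ennreal (cone_weight \<gamma> (mat 1) Q) * \<phi> (transpose C ** Q ** C) \<partial>sym_lborel)"
proof -
  let ?D = "transpose C"
  note tr = cone_weight_transform[OF C]
  have "(\<integral>\<^sup>+Q. ennreal (cone_weight \<gamma> V Q) * \<phi> Q \<partial>sym_lborel) = ennreal (\<bar>det ?D\<bar> ^ (CARD('n) + 1)) *
      (\<integral>\<^sup>+Q. ennreal (cone_weight \<gamma> V (?D ** Q ** transpose ?D)) * \<phi> (?D ** Q ** transpose ?D) \<partial>sym_lborel)"
    by (rule sym_lborel_congruence[OF transpose_invertible[OF C(1)]]) measurable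
  also have "(\<integral>\<^sup>+Q. ennreal (cone_weight \<gamma> V (?D ** Q ** transpose ?D)) * \<phi> (?D ** Q ** transpose ?D) \<partial>sym_lborel) =
      ennreal (det V powr (- \<gamma>)) * (\<integral>\<^sup>+Q. ennreal (cone_weight \<gamma> (mat 1) Q) * \<phi> (?D ** Q ** C) \<partial>sym_lborel)"
    unfolding transpose_transpose tr(1) by (subst nn_integral_cmult[symmetric]) (auto simp: ennreal_mult' mult.assoc)
  also have "ennreal (\<bar>det ?D\<bar> ^ (CARD('n) + 1)) * (ennreal (det V powr (- \<gamma>)) *
      (\<integral>\<^sup>+Q. ennreal (cone_weight \<gamma> (mat 1) Q) * \<phi> (?D ** Q ** C) \<partial>sym_lborel)) =
      ennreal (det V powr (- ((real CARD('n) + 1) / 2)) * det V powr (- \<gamma>)) *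
      (\<integral>\<^sup>+Q. ennreal (cone_weight \<gamma> (mat 1) Q) * \<phi> (?D ** Q ** C) \<partial>sym_lborel)"
    unfolding det_transpose tr(2) by (subst ennreal_mult') (simp_all add: mult.assoc)
  also have "det V powr (- ((real CARD('n) + 1) / 2)) * det V powr (- \<gamma>) = det V powr (- \<gamma> - (real CARD('n) + 1) / 2)"
    unfolding powr_add[symmetric] by (rule arg_cong[where f="\<lambda>x. det V powr x"]) linarith
  finally show ?thesis .
qed

text \<open>
  The entries of a positive definite matrix are bounded by its trace, so the exponential factor is dominated by a
  product of exponentials in the separate coordinates, as in \<open>minor_integral_finite\<close>.
\<close>

lemma cone_weight_finite_small:
  assumes g: "- 1 < \<gamma>" "\<gamma> \<le> 0"
  shows "(\<integral>\<^sup>+Q. ennreal (cone_weight \<gamma> (mat 1 :: real^'n^'n) Q) \<partial>sym_lborel) < \<infinity>"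
proof -
  let ?U = "unordered_pairs :: 'n set set"
  have ne: "card ?U > 0" by (simp add: card_gt_0_iff)
  \<comment> \<open>The coordinates share the exponent \<open>tr Q\<close> evenly.\<close>
  define c where "c = 1 / real (card ?U)"
  have c: "c > 0" using ne by (simp add: c_def)
  have "(\<integral>\<^sup>+Q. ennreal (cone_weight \<gamma> (mat 1 :: real^'n^'n) Q) \<partial>sym_lborel) =
      (\<integral>\<^sup>+v. ennreal (cone_weight \<gamma> (mat 1) (symmetric_of v :: real^'n^'n)) \<partial>lebesgue_product ?U)"
    by (rule nn_integral_sym_lborel) measurable
  also have "\<dots> \<le> (\<integral>\<^sup>+v. ennreal ((if \<forall>T\<subseteq>UNIV. 0 < det (principal_block T (symmetric_of v :: real^'n^'n))
      then det (principal_block UNIV (symmetric_of v :: real^'n^'n)) powr \<gamma> else 0) *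
      (\<Prod>e\<in>?U. exp (- c * \<bar>v e\<bar>))) \<partial>lebesgue_product ?U)"
  proof (rule nn_integral_mono, rule ennreal_leI)
    fix v :: "'n set \<Rightarrow> real"
    let ?Q = "symmetric_of v :: real^'n^'n"
    show "cone_weight \<gamma> (mat 1) ?Q \<le> (if \<forall>T\<subseteq>UNIV. 0 < det (principal_block T ?Q)
      then det (principal_block UNIV ?Q) powr \<gamma> else 0) * (\<Prod>e\<in>?U. exp (- c * \<bar>v e\<bar>))"
    proof (cases "pos_def ?Q")
      case True
      have "\<bar>v e\<bar> \<le> trace ?Q" if "e \<in> ?U" for e
        using that pos_def_entry_le_trace[OF True] by (auto simp: unordered_pairs_def)
      then have "(\<Sum>e\<in>?U. \<bar>v e\<bar>) \<le> real (card ?U) * trace ?Q"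
        using sum_bounded_above[of ?U "\<lambda>e. \<bar>v e\<bar>" "trace ?Q"] by simp
      then have "c * (\<Sum>e\<in>?U. \<bar>v e\<bar>) \<le> trace ?Q" using ne by (simp add: c_def field_simps)
      then have "exp (- trace ?Q) \<le> exp (\<Sum>e\<in>?U. - c * \<bar>v e\<bar>)"
        by (simp add: sum_distrib_left[symmetric] sum_negf)
      also have "\<dots> = (\<Prod>e\<in>?U. exp (- c * \<bar>v e\<bar>))" by (rule exp_sum) simp
      finally show ?thesis
        using True pos_def_det_pos[OF pos_def_principal_block[OF True]]
        by (simp add: cone_weight_def mult_left_mono)
    next
      case False
      then show ?thesis by (simp add: cone_weight_def prod_nonneg)
    qed
  qed
  also have "\<dots> < \<infinity>" by (rule minor_integral_finite[OF c g])
  finally show ?thesis .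
qed

lemma cone_weight_pos: "(\<integral>\<^sup>+Q. ennreal (cone_weight \<gamma> (V :: real^'n^'n) Q) \<partial>sym_lborel) > 0"
  by (rule nn_integral_sym_lborel_pos) (auto simp: cone_weight_def dest: pos_def_det_pos)

definition cone_mass :: "'n::finite itself \<Rightarrow> real \<Rightarrow> ennreal" where
  "cone_mass _ \<gamma> = (\<integral>\<^sup>+Q. ennreal (cone_weight \<gamma> (mat 1 :: real^'n^'n) Q) \<partial>sym_lborel)"

text \<open>
  The integrand of the matrix beta function with the two exponents written out.
\<close>

definition beta_weight :: "real \<Rightarrow> real \<Rightarrow> real^'n^'n \<Rightarrow> real" where
  "beta_weight \<gamma> \<delta> \<Lambda> =
     (if pos_def \<Lambda> \<and> pos_def (mat 1 - \<Lambda>) then det \<Lambda> powr \<gamma> * det (mat 1 - \<Lambda>) powr \<delta> else 0)"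

lemma beta_weight_nonneg [simp]: "0 \<le> beta_weight \<gamma> \<delta> \<Lambda>"
  by (simp add: beta_weight_def)

lemma borel_measurable_beta_weight [measurable (raw)]:
  fixes f :: "'a \<Rightarrow> real^'n^'n"
  assumes [measurable]: "f \<in> borel_measurable M"
  shows "(\<lambda>x. beta_weight \<gamma> \<delta> (f x)) \<in> borel_measurable M"
  unfolding beta_weight_def by measurable

text \<open>
  If \<open>U\<close> and \<open>V\<close> are independent gamma matrices, then \<open>T = U + V\<close> is a gamma matrix and \<open>U = A \<Lambda> A\<^sup>T\<close> with \<open>A A\<^sup>T = T\<close>,
  where \<open>\<Lambda>\<close> is beta distributed and independent of \<open>T\<close>. The substitution
  \<open>U = A T ** \<Lambda> ** transpose (A T)\<close> is made for each fixed \<open>T\<close> separately, so \<open>A\<close> can be an arbitrary choice of factors.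
\<close>

lemma cone_beta_convolution:
  fixes \<phi> :: "real^'n^'n \<Rightarrow> ennreal" and A :: "real^'n^'n \<Rightarrow> real^'n^'n"
  assumes [measurable]: "\<phi> \<in> borel_measurable borel"
    and A: "\<And>T. pos_def T \<Longrightarrow> invertible (A T)" "\<And>T. pos_def T \<Longrightarrow> A T ** transpose (A T) = T"
  shows "(\<integral>\<^sup>+U. ennreal (cone_weight \<gamma> (mat 1) U) * \<phi> U \<partial>sym_lborel) * cone_mass TYPE('n) \<delta> =
    (\<integral>\<^sup>+T. ennreal (cone_weight (\<gamma> + \<delta> + (real CARD('n) + 1) / 2) (mat 1) T) *
      (\<integral>\<^sup>+\<Lambda>. ennreal (beta_weight \<gamma> \<delta> \<Lambda>) * \<phi> (A T ** \<Lambda> ** transpose (A T)) \<partial>sym_lborel) \<partial>sym_lborel)"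
proof -
  let ?w = "\<lambda>\<gamma>. cone_weight \<gamma> (mat 1 :: real^'n^'n)"
  interpret pair_sigma_finite "sym_lborel :: (real^'n^'n) measure" "sym_lborel :: (real^'n^'n) measure" ..
  have "(\<integral>\<^sup>+U. ennreal (?w \<gamma> U) * \<phi> U \<partial>sym_lborel) * cone_mass TYPE('n) \<delta> =
      (\<integral>\<^sup>+U. (ennreal (?w \<gamma> U) * \<phi> U) * cone_mass TYPE('n) \<delta> \<partial>sym_lborel)"
    by (rule nn_integral_multc[symmetric]) measurable
  also have "\<dots> = (\<integral>\<^sup>+U. (\<integral>\<^sup>+T. (ennreal (?w \<gamma> U) * \<phi> U) * ennreal (?w \<delta> (- U + T)) \<partial>sym_lborel) \<partial>sym_lborel)"
  proof (rule nn_integral_cong)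
    fix U :: "real^'n^'n"
    have "(ennreal (?w \<gamma> U) * \<phi> U) * cone_mass TYPE('n) \<delta> = (\<integral>\<^sup>+V. (ennreal (?w \<gamma> U) * \<phi> U) * ennreal (?w \<delta> V) \<partial>sym_lborel)"
      unfolding cone_mass_def by (rule nn_integral_cmult[symmetric]) measurable
    also have "\<dots> = (\<integral>\<^sup>+T. (ennreal (?w \<gamma> U) * \<phi> U) * ennreal (?w \<delta> (- U + T)) \<partial>sym_lborel)"
    proof (cases "pos_def U")
      case True
      have "transpose (- U) = - U" using pos_def_symmetric[OF True] by (simp add: vec_eq_iff transpose_nth)
      then show ?thesis
        by (intro sym_lborel_translation[symmetric, where M="- U" and f="\<lambda>V. (ennreal (?w \<gamma> U) * \<phi> U) * ennreal (?w \<delta> V)"]) measurable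
    next
      case False
      then show ?thesis by (simp add: cone_weight_def)
    qed
    finally show "(ennreal (?w \<gamma> U) * \<phi> U) * cone_mass TYPE('n) \<delta> =
      (\<integral>\<^sup>+T. (ennreal (?w \<gamma> U) * \<phi> U) * ennreal (?w \<delta> (- U + T)) \<partial>sym_lborel)" .
  qed
  also have "\<dots> = (\<integral>\<^sup>+T. (\<integral>\<^sup>+U. (ennreal (?w \<gamma> U) * \<phi> U) * ennreal (?w \<delta> (- U + T)) \<partial>sym_lborel) \<partial>sym_lborel)"
    by (rule Fubini'[symmetric]) measurable
  also have "\<dots> = (\<integral>\<^sup>+T. ennreal (?w (\<gamma> + \<delta> + (real CARD('n) + 1) / 2) T) *
      (\<integral>\<^sup>+\<Lambda>. ennreal (beta_weight \<gamma> \<delta> \<Lambda>) * \<phi> (A T ** \<Lambda> ** transpose (A T)) \<partial>sym_lborel) \<partial>sym_lborel)"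
  proof (rule nn_integral_cong)
    fix T :: "real^'n^'n"
    let ?F = "\<lambda>U. (ennreal (?w \<gamma> U) * \<phi> U) * ennreal (?w \<delta> (- U + T))"
    show "(\<integral>\<^sup>+U. ?F U \<partial>sym_lborel) = ennreal (?w (\<gamma> + \<delta> + (real CARD('n) + 1) / 2) T) *
      (\<integral>\<^sup>+\<Lambda>. ennreal (beta_weight \<gamma> \<delta> \<Lambda>) * \<phi> (A T ** \<Lambda> ** transpose (A T)) \<partial>sym_lborel)"
    proof (cases "pos_def T")
      case T: True
      let ?A = "A T"
      note inv = A(1)[OF T] and AA = A(2)[OF T]
      define d where "d = \<bar>det ?A\<bar>"
      have d: "d > 0" using inv by (simp add: d_def invertible_det_nz)
      have dT: "det T = d powr 2"
        using arg_cong[OF AA, of det] d by (simp add: det_mul d_def power2_eq_square)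
      have sub: "- (?A ** \<Lambda> ** transpose ?A) + T = ?A ** (mat 1 - \<Lambda>) ** transpose ?A" for \<Lambda>
        by (simp add: matrix_diff_ldistrib matrix_diff_rdistrib AA)
      have detA: "det (?A ** \<Lambda> ** transpose ?A) powr g = d powr (2 * g) * det \<Lambda> powr g" if "pos_def \<Lambda>" for \<Lambda> g
      proof -
        have "det (?A ** \<Lambda> ** transpose ?A) = d powr 2 * det \<Lambda>"
          using d by (simp add: det_mul d_def power2_eq_square)
        then show ?thesis using d pos_def_det_pos[OF that] by (simp add: powr_mult powr_powr del: powr_numeral)
      qed
      have prod: "?w \<gamma> (?A ** \<Lambda> ** transpose ?A) * ?w \<delta> (?A ** (mat 1 - \<Lambda>) ** transpose ?A) =
          (d powr (2 * \<gamma>) * d powr (2 * \<delta>) * exp (- trace T)) * beta_weight \<gamma> \<delta> \<Lambda>" for \<Lambda>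
      proof -
        have "exp (- trace (?A ** \<Lambda> ** transpose ?A)) * exp (- trace (?A ** (mat 1 - \<Lambda>) ** transpose ?A)) = exp (- trace T)"
          unfolding sub[symmetric] exp_add[symmetric]
          by (simp add: trace_def sum_subtractf sum.distrib sum_negf)
        then show ?thesis
          unfolding cone_weight_def beta_weight_def pos_def_congruence_iff[OF inv]
          by (simp add: detA algebra_simps)
      qed
      have "(\<integral>\<^sup>+U. ?F U \<partial>sym_lborel) = ennreal (\<bar>det ?A\<bar> ^ (CARD('n) + 1)) * (\<integral>\<^sup>+\<Lambda>. ?F (?A ** \<Lambda> ** transpose ?A) \<partial>sym_lborel)"
        by (rule sym_lborel_congruence[OF inv]) measurable
      also have "(\<integral>\<^sup>+\<Lambda>. ?F (?A ** \<Lambda> ** transpose ?A) \<partial>sym_lborel) =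
          (\<integral>\<^sup>+\<Lambda>. ennreal (d powr (2 * \<gamma>) * d powr (2 * \<delta>) * exp (- trace T)) *
            (ennreal (beta_weight \<gamma> \<delta> \<Lambda>) * \<phi> (?A ** \<Lambda> ** transpose ?A)) \<partial>sym_lborel)"
      proof (rule nn_integral_cong)
        fix \<Lambda> :: "real^'n^'n"
        have "?F (?A ** \<Lambda> ** transpose ?A) = ennreal (?w \<gamma> (?A ** \<Lambda> ** transpose ?A) * ?w \<delta> (?A ** (mat 1 - \<Lambda>) ** transpose ?A)) *
           \<phi> (?A ** \<Lambda> ** transpose ?A)"
          unfolding sub by (simp add: ennreal_mult' mult.assoc mult.left_commute mult.commute)
        then show "?F (?A ** \<Lambda> ** transpose ?A) = ennreal (d powr (2 * \<gamma>) * d powr (2 * \<delta>) * exp (- trace T)) *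
            (ennreal (beta_weight \<gamma> \<delta> \<Lambda>) * \<phi> (?A ** \<Lambda> ** transpose ?A))"
          unfolding prod by (subst (asm) ennreal_mult') (auto simp: mult.assoc)
      qed
      also have "\<dots> = ennreal (d powr (2 * \<gamma>) * d powr (2 * \<delta>) * exp (- trace T)) *
            (\<integral>\<^sup>+\<Lambda>. ennreal (beta_weight \<gamma> \<delta> \<Lambda>) * \<phi> (?A ** \<Lambda> ** transpose ?A) \<partial>sym_lborel)"
        by (rule nn_integral_cmult) measurable
      also have "ennreal (\<bar>det ?A\<bar> ^ (CARD('n) + 1)) * (ennreal (d powr (2 * \<gamma>) * d powr (2 * \<delta>) * exp (- trace T)) *
            (\<integral>\<^sup>+\<Lambda>. ennreal (beta_weight \<gamma> \<delta> \<Lambda>) * \<phi> (?A ** \<Lambda> ** transpose ?A) \<partial>sym_lborel)) =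
          ennreal (d ^ (CARD('n) + 1) * (d powr (2 * \<gamma>) * d powr (2 * \<delta>) * exp (- trace T))) *
            (\<integral>\<^sup>+\<Lambda>. ennreal (beta_weight \<gamma> \<delta> \<Lambda>) * \<phi> (?A ** \<Lambda> ** transpose ?A) \<partial>sym_lborel)"
        using d by (subst ennreal_mult') (auto simp: d_def mult.assoc)
      also have "d ^ (CARD('n) + 1) * (d powr (2 * \<gamma>) * d powr (2 * \<delta>) * exp (- trace T)) =
          ?w (\<gamma> + \<delta> + (real CARD('n) + 1) / 2) T"
      proof -
        have "d ^ (CARD('n) + 1) * (d powr (2 * \<gamma>) * d powr (2 * \<delta>)) = d powr (real (CARD('n) + 1) + (2 * \<gamma> + 2 * \<delta>))"
          by (simp only: powr_realpow[OF d, symmetric] powr_add)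
        also have "real (CARD('n) + 1) + (2 * \<gamma> + 2 * \<delta>) = 2 * (\<gamma> + \<delta> + (real CARD('n) + 1) / 2)" by simp
        finally show ?thesis unfolding cone_weight_def dT powr_powr using T by (simp add: mult.assoc)
      qed
      finally show ?thesis .
    next
      case False
      have "?F U = 0" for U
      proof -
        have "\<not> (pos_def U \<and> pos_def (- U + T))"
          using False pos_def_add[of U "- U + T"] by auto
        then show ?thesis by (auto simp: cone_weight_def)
      qed
      then show ?thesis using False by (simp only: cone_weight_def[of _ _ T]) simp
    qed
  qed
  finally show ?thesis .
qed

definition beta_mass :: "'n::finite itself \<Rightarrow> real \<Rightarrow> real \<Rightarrow> ennreal" where
  "beta_mass _ \<gamma> \<delta> = (\<integral>\<^sup>+\<Lambda>. ennreal (beta_weight \<gamma> \<delta> (\<Lambda> :: real^'n^'n)) \<partial>sym_lborel)"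

lemma pos_def_factor_function:
  obtains A :: "real^'n^'n \<Rightarrow> real^'n^'n"
  where "\<And>T. pos_def T \<Longrightarrow> invertible (A T)" and "\<And>T. pos_def T \<Longrightarrow> A T ** transpose (A T) = T"
proof -
  have "\<exists>B :: real^'n^'n. pos_def T \<longrightarrow> invertible B \<and> B ** transpose B = T" for T
  proof (cases "pos_def T")
    case True
    obtain B :: "real^'n^'n" where "invertible B" "T = B ** transpose B" using pos_def_factor[OF True] .
    then show ?thesis by blast
  qed simp
  then obtain A :: "real^'n^'n \<Rightarrow> real^'n^'n" where "\<And>T. pos_def T \<longrightarrow> invertible (A T) \<and> A T ** transpose (A T) = T"
    by metis
  with that show ?thesis by blast
qed

text \<open>
  The matrix form of \<open>\<Gamma>(\<alpha>) \<Gamma>(\<beta>) = \<Gamma>(\<alpha> + \<beta>) B(\<alpha>, \<beta>)\<close>.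
\<close>

lemma cone_mass_mult:
  "cone_mass TYPE('n::finite) \<gamma> * cone_mass TYPE('n) \<delta> =
    cone_mass TYPE('n) (\<gamma> + \<delta> + (real CARD('n) + 1) / 2) * beta_mass TYPE('n) \<gamma> \<delta>"
proof -
  obtain A :: "real^'n^'n \<Rightarrow> real^'n^'n"
    where A: "\<And>T. pos_def T \<Longrightarrow> invertible (A T)" "\<And>T. pos_def T \<Longrightarrow> A T ** transpose (A T) = T"
    using pos_def_factor_function by blast
  have "cone_mass TYPE('n) \<gamma> * cone_mass TYPE('n) \<delta> =
      (\<integral>\<^sup>+T. ennreal (cone_weight (\<gamma> + \<delta> + (real CARD('n) + 1) / 2) (mat 1 :: real^'n^'n) T) * beta_mass TYPE('n) \<gamma> \<delta> \<partial>sym_lborel)"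
    using cone_beta_convolution[of "\<lambda>_. 1" A \<gamma> \<delta>] A by (simp add: cone_mass_def[of _ \<gamma>] beta_mass_def)
  also have "\<dots> = cone_mass TYPE('n) (\<gamma> + \<delta> + (real CARD('n) + 1) / 2) * beta_mass TYPE('n) \<gamma> \<delta>"
    unfolding cone_mass_def by (rule nn_integral_multc) measurable
  finally show ?thesis .
qed

lemma cone_mass_pos: "cone_mass TYPE('n::finite) \<gamma> > 0"
  unfolding cone_mass_def by (rule cone_weight_pos)

lemma beta_mass_pos: "beta_mass TYPE('n::finite) \<gamma> \<delta> > 0"
  unfolding beta_mass_def
  by (rule nn_integral_sym_lborel_pos) (auto simp: beta_weight_def dest!: pos_def_det_pos)

text \<open>
  Exponents in \<open>(- 1, 0]\<close> are covered by the estimate through principal minors. Since the product of two finite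
  gamma integrals is a third one times a positive beta integral, finiteness spreads to the multiples of \<open>(n + 1) / 2\<close>, and
  \<open>x\<^sup>\<gamma> \<le> 1 + x\<^sup>g\<close> for \<open>0 \<le> \<gamma> \<le> g\<close> interpolates between them.
\<close>

lemma cone_mass_finite:
  assumes "\<gamma> > - 1"
  shows "cone_mass TYPE('n::finite) \<gamma> < \<infinity>"
proof (cases "\<gamma> \<le> 0")
  case True
  then show ?thesis unfolding cone_mass_def by (rule cone_weight_finite_small[OF assms])
next
  case False
  let ?\<kappa> = "(real CARD('n) + 1) / 2"
  have fin: "cone_mass TYPE('n) (real j * ?\<kappa>) < \<infinity>" for j
  proof (induction j)
    case 0
    show ?case unfolding cone_mass_def by (rule cone_weight_finite_small) auto
  next
    case (Suc j)
    have "cone_mass TYPE('n) 0 < \<infinity>" unfolding cone_mass_def by (rule cone_weight_finite_small) auto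
    then have "cone_mass TYPE('n) 0 * cone_mass TYPE('n) (real j * ?\<kappa>) < \<infinity>"
      using Suc.IH by (simp add: ennreal_mult_less_top)
    then have "cone_mass TYPE('n) (0 + real j * ?\<kappa> + ?\<kappa>) * beta_mass TYPE('n) 0 (real j * ?\<kappa>) < \<infinity>"
      unfolding cone_mass_mult .
    then have "cone_mass TYPE('n) (0 + real j * ?\<kappa> + ?\<kappa>) < \<infinity>"
      using beta_mass_pos[where 'n='n, of 0 "real j * ?\<kappa>"] by (auto simp: ennreal_mult_less_top)
    moreover have eq: "0 + real j * ?\<kappa> + ?\<kappa> = real (Suc j) * ?\<kappa>" by (simp add: field_simps)
    ultimately show ?case unfolding eq by blast
  qed
  obtain j :: nat where j: "\<gamma> \<le> real j" using real_arch_simple by blast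
  have "real j * 1 \<le> real j * ?\<kappa>" by (intro mult_left_mono) auto
  then have j\<kappa>: "\<gamma> \<le> real j * ?\<kappa>" using j by simp
  have "cone_mass TYPE('n) \<gamma> \<le> (\<integral>\<^sup>+Q. ennreal (cone_weight (real 0 * ?\<kappa>) (mat 1 :: real^'n^'n) Q) +
      ennreal (cone_weight (real j * ?\<kappa>) (mat 1 :: real^'n^'n) Q) \<partial>sym_lborel)"
    unfolding cone_mass_def
  proof (rule nn_integral_mono)
    fix Q :: "real^'n^'n"
    have "cone_weight \<gamma> (mat 1) Q \<le> cone_weight (real 0 * ?\<kappa>) (mat 1) Q + cone_weight (real j * ?\<kappa>) (mat 1) Q"
    proof (cases "pos_def Q")
      case True
      note d = pos_def_det_pos[OF True]
      have "det Q powr \<gamma> \<le> 1 + det Q powr (real j * ?\<kappa>)"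
      proof (cases "det Q \<le> 1")
        case True
        then have "det Q powr \<gamma> \<le> 1" using False d powr_mono2[of \<gamma> "det Q" 1] by simp
        then show ?thesis by (simp add: add_increasing2)
      next
        case False
        then have "det Q powr \<gamma> \<le> det Q powr (real j * ?\<kappa>)" using j\<kappa> by (intro powr_mono) auto
        then show ?thesis by simp
      qed
      from mult_right_mono[OF this, of "exp (- trace Q)"] True d show ?thesis
        by (simp add: cone_weight_def algebra_simps)
    qed (simp add: cone_weight_def)
    then show "ennreal (cone_weight \<gamma> (mat 1) Q) \<le> ennreal (cone_weight (real 0 * ?\<kappa>) (mat 1) Q) + ennreal (cone_weight (real j * ?\<kappa>) (mat 1) Q)"
      by (simp add: ennreal_plus[symmetric] del: ennreal_plus)
  qed
  also have "\<dots> = cone_mass TYPE('n) (real 0 * ?\<kappa>) + cone_mass TYPE('n) (real j * ?\<kappa>)"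
    unfolding cone_mass_def by (rule nn_integral_add) measurable
  also have "\<dots> < \<infinity>" using fin[of 0] fin[of j] by simp
  finally show ?thesis .
qed

lemma beta_mass_finite:
  assumes "\<gamma> > - 1" "\<delta> > - 1"
  shows "beta_mass TYPE('n::finite) \<gamma> \<delta> < \<infinity>"
proof -
  have "cone_mass TYPE('n) \<gamma> * cone_mass TYPE('n) \<delta> < \<infinity>"
    using cone_mass_finite[where 'n='n] assms by (simp add: ennreal_mult_less_top)
  then show ?thesis unfolding cone_mass_mult
    using cone_mass_pos[where 'n='n, of "\<gamma> + \<delta> + (real CARD('n) + 1) / 2"] by (auto simp: ennreal_mult_less_top)
qed

text \<open>
  The analogue of \<open>\<Gamma>(\<alpha> + 1) = \<alpha> \<Gamma>(\<alpha>)\<close>. With the factor \<open>exp (- t tr Q)\<close> instead of \<open>exp (- tr Q)\<close> the integral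
  is a power of \<open>t\<close> times its value at \<open>t = 1\<close>, and \<open>exp (- tr Q)\<close> is the integral of \<open>tr Q exp (- t tr Q)\<close> over
  \<open>t \<ge> 1\<close>. Exchanging the two integrations compares the two moments.
\<close>

lemma cone_trace_moment:
  assumes g: "\<gamma> > - 1"
  shows "(\<integral>\<^sup>+Q. ennreal (cone_weight \<gamma> (mat 1 :: real^'n^'n) Q) * ennreal (trace Q) \<partial>sym_lborel) =
    ennreal (real CARD('n) * (\<gamma> + (real CARD('n) + 1) / 2)) * cone_mass TYPE('n) \<gamma>"
proof -
  let ?m = "real CARD('n)" and ?\<kappa> = "(real CARD('n) + 1) / 2"
  define a where "a = ?m * (\<gamma> + ?\<kappa>)"
  have a: "a > 0"
  proof -
    have "?m \<ge> 1" using zero_less_card_finite[where 'a='n] by linarith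
    then have "\<gamma> + ?\<kappa> > 0" using g by (simp only: field_simps)
    then show ?thesis unfolding a_def by simp
  qed
  interpret pair_sigma_finite "lborel :: real measure" "sym_lborel :: (real^'n^'n) measure" ..
  define H where "H = (\<integral>\<^sup>+Q. ennreal (cone_weight \<gamma> (mat 1 :: real^'n^'n) Q) * ennreal (trace Q) \<partial>sym_lborel)"
  have scale: "(\<integral>\<^sup>+Q. ennreal (cone_weight \<gamma> (t *\<^sub>R mat 1 :: real^'n^'n) Q) * ennreal (trace Q) \<partial>sym_lborel) =
      ennreal (t powr (- a - 1)) * H" if t: "t > 0" for t
  proof -
    let ?C = "(1 / sqrt t) *\<^sub>R mat 1 :: real^'n^'n"
    have inv: "invertible ?C" by (rule pos_def_invertible, rule pos_def_scaleR) (use t in auto)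
    have one: "?C ** (t *\<^sub>R mat 1) ** transpose ?C = mat 1"
      using t by (simp add: transpose_scalar matrix_scaleR_mult matrix_mult_scaleR)
    have detV: "det (t *\<^sub>R mat 1 :: real^'n^'n) = t powr ?m"
      using det_matrix_scaleR[where 'n='n, of t] t by (simp add: matrix_scaleR powr_realpow) (simp add: mat_def vec_eq_iff scaleR_vec_def if_distrib cong: if_cong)
    have tr: "trace (transpose ?C ** Q ** ?C) = (1 / t) * trace Q" for Q
      using t by (simp add: transpose_scalar matrix_scaleR_mult matrix_mult_scaleR trace_def sum_divide_distrib)
    have "(\<integral>\<^sup>+Q. ennreal (cone_weight \<gamma> (t *\<^sub>R mat 1 :: real^'n^'n) Q) * ennreal (trace Q) \<partial>sym_lborel) =
      ennreal (det (t *\<^sub>R mat 1 :: real^'n^'n) powr (- \<gamma> - ?\<kappa>)) *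
      (\<integral>\<^sup>+Q. ennreal (cone_weight \<gamma> (mat 1 :: real^'n^'n) Q) * ennreal (trace (transpose ?C ** Q ** ?C)) \<partial>sym_lborel)"
      by (rule cone_weight_congruence[OF inv one]) measurable
    also have "(\<integral>\<^sup>+Q. ennreal (cone_weight \<gamma> (mat 1 :: real^'n^'n) Q) * ennreal (trace (transpose ?C ** Q ** ?C)) \<partial>sym_lborel) =
      ennreal (1 / t) * H"
    proof -
      have "ennreal (1 / t * trace Q) = ennreal (1 / t) * ennreal (trace Q)" for Q :: "real^'n^'n"
        using t by (intro ennreal_mult') simp
      then show ?thesis
        unfolding tr H_def by (subst nn_integral_cmult[symmetric]) (simp_all add: mult.left_commute)
    qed
    also have "ennreal (det (t *\<^sub>R mat 1 :: real^'n^'n) powr (- \<gamma> - ?\<kappa>)) * (ennreal (1 / t) * H) =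
        ennreal (t powr (?m * (- \<gamma> - ?\<kappa>)) * (1 / t)) * H"
      unfolding detV powr_powr by (subst ennreal_mult') (auto simp: mult.assoc)
    also have "t powr (?m * (- \<gamma> - ?\<kappa>)) * (1 / t) = t powr (- a - 1)"
    proof -
      have "- a - 1 = ?m * (- \<gamma> - ?\<kappa>) + (- 1)" by (simp add: a_def algebra_simps)
      then show ?thesis using t by (simp only: powr_add) (simp add: powr_minus_divide)
    qed
    finally show ?thesis .
  qed
  have "cone_mass TYPE('n) \<gamma> = (\<integral>\<^sup>+Q. (\<integral>\<^sup>+t. ennreal (cone_weight \<gamma> (t *\<^sub>R mat 1 :: real^'n^'n) Q) * ennreal (trace Q) * indicator {1..} t \<partial>lborel) \<partial>sym_lborel)"
    unfolding cone_mass_def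
  proof (rule nn_integral_cong)
    fix Q :: "real^'n^'n"
    show "ennreal (cone_weight \<gamma> (mat 1) Q) = (\<integral>\<^sup>+t. ennreal (cone_weight \<gamma> (t *\<^sub>R mat 1 :: real^'n^'n) Q) * ennreal (trace Q) * indicator {1..} t \<partial>lborel)"
    proof (cases "pos_def Q")
      case True
      define s where "s = trace Q"
      have s: "s > 0" unfolding s_def by (rule pos_def_trace_pos[OF True])
      have tr: "trace (Q ** (t *\<^sub>R mat 1)) = t * s" for t
        by (simp add: matrix_mult_scaleR trace_def s_def sum_distrib_left)
      have "(\<integral>\<^sup>+t. ennreal (cone_weight \<gamma> (t *\<^sub>R mat 1 :: real^'n^'n) Q) * ennreal (trace Q) * indicator {1..} t \<partial>lborel) =
          (\<integral>\<^sup>+t. ennreal (det Q powr \<gamma> * (exp (- t * s) * s)) * indicator {1..} t \<partial>lborel)"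
        using True s by (intro nn_integral_cong) (simp add: cone_weight_def tr s_def[symmetric] ennreal_mult'[symmetric] mult.assoc)
      also have "\<dots> = ennreal (0 - (- (det Q powr \<gamma> * exp (- 1 * s))))"
      proof (rule nn_integral_FTC_atLeast)
        show "((\<lambda>t. - (det Q powr \<gamma> * exp (- t * s))) \<longlongrightarrow> 0) at_top"
        proof -
          have "((\<lambda>t. exp (- t * s)) \<longlongrightarrow> 0) at_top" using s by real_asymp
          from tendsto_minus[OF tendsto_mult_left[OF this, of "det Q powr \<gamma>"]] show ?thesis by simp
        qed
      qed (use s in \<open>auto intro!: derivative_eq_intros\<close>)
      finally show ?thesis using True by (simp add: cone_weight_def s_def)
    qed (simp add: cone_weight_def)
  qed
  also have "\<dots> = (\<integral>\<^sup>+t. (\<integral>\<^sup>+Q. ennreal (cone_weight \<gamma> (t *\<^sub>R mat 1 :: real^'n^'n) Q) * ennreal (trace Q) * indicator {1..} t \<partial>sym_lborel) \<partial>lborel)"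
    by (rule Fubini') measurable
  also have "\<dots> = (\<integral>\<^sup>+t. H * (ennreal (t powr (- a - 1)) * indicator {1..} t) \<partial>lborel)"
  proof (rule nn_integral_cong)
    fix t :: real
    show "(\<integral>\<^sup>+Q. ennreal (cone_weight \<gamma> (t *\<^sub>R mat 1 :: real^'n^'n) Q) * ennreal (trace Q) * indicator {1..} t \<partial>sym_lborel) =
        H * (ennreal (t powr (- a - 1)) * indicator {1..} t)"
      using scale[of t] by (cases "t \<ge> 1") (auto simp: indicator_def mult.commute)
  qed
  also have "\<dots> = H * (\<integral>\<^sup>+t. ennreal (t powr (- a - 1)) * indicator {1..} t \<partial>lborel)"
    by (rule nn_integral_cmult) measurable
  also have "(\<integral>\<^sup>+t. ennreal (t powr (- a - 1)) * indicator {1..} t \<partial>lborel) = ennreal (0 - (- (1 powr (- a)) / a))"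
  proof (rule nn_integral_FTC_atLeast)
    show "((\<lambda>t. - (t powr (- a)) / a) \<longlongrightarrow> 0) at_top" using a by real_asymp
    show "((\<lambda>t. - (t powr (- a)) / a) has_real_derivative t powr (- a - 1)) (at t)" if "1 \<le> t" for t
      using that a by (auto intro!: derivative_eq_intros)
  qed auto
  also have "\<dots> = ennreal (1 / a)" by simp
  finally have "ennreal a * cone_mass TYPE('n) \<gamma> = ennreal a * (H * ennreal (1 / a))" by simp
  also have "\<dots> = H * ennreal (a * (1 / a))" using a by (subst ennreal_mult') (auto simp: ac_simps)
  also have "\<dots> = H" using a by simp
  finally show ?thesis by (simp add: H_def a_def)
qed

section \<open>First moments by invariance\<close>

lemma sym_lborel_congruence_distr:
  fixes A :: "real^'n^'n"
  assumes A: "invertible A"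
  shows "distr sym_lborel borel (\<lambda>Q. A ** Q ** transpose A) =
    density sym_lborel (\<lambda>_. ennreal (1 / \<bar>det A\<bar> ^ (CARD('n) + 1)))"
proof (rule measure_eqI)
  fix X assume "X \<in> sets (distr sym_lborel borel (\<lambda>Q. A ** Q ** transpose A))"
  then have [measurable]: "X \<in> sets borel" by simp
  have d: "\<bar>det A\<bar> ^ (CARD('n) + 1) > 0" using A by (simp add: invertible_det_nz)
  have "emeasure sym_lborel X = (\<integral>\<^sup>+Q. indicator X Q \<partial>sym_lborel)" by simp
  also have "\<dots> = ennreal (\<bar>det A\<bar> ^ (CARD('n) + 1)) * (\<integral>\<^sup>+Q. indicator X (A ** Q ** transpose A) \<partial>sym_lborel)"
    by (rule sym_lborel_congruence[OF A]) measurable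
  also have "(\<integral>\<^sup>+Q. indicator X (A ** Q ** transpose A) \<partial>sym_lborel) = (\<integral>\<^sup>+Q. indicator X Q \<partial>distr sym_lborel borel (\<lambda>Q. A ** Q ** transpose A))"
    by (subst nn_integral_distr) auto
  also have "\<dots> = emeasure (distr sym_lborel borel (\<lambda>Q. A ** Q ** transpose A)) X" by simp
  finally have "ennreal (1 / \<bar>det A\<bar> ^ (CARD('n) + 1)) * emeasure sym_lborel X =
      ennreal (1 / \<bar>det A\<bar> ^ (CARD('n) + 1)) * (ennreal (\<bar>det A\<bar> ^ (CARD('n) + 1)) * emeasure (distr sym_lborel borel (\<lambda>Q. A ** Q ** transpose A)) X)"
    by simp
  also have "\<dots> = emeasure (distr sym_lborel borel (\<lambda>Q. A ** Q ** transpose A)) X"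
    using d A[unfolded invertible_det_nz]
    by (simp only: mult.assoc[symmetric] ennreal_mult'[symmetric] zero_le_divide_1_iff less_imp_le) simp
  finally show "emeasure (distr sym_lborel borel (\<lambda>Q. A ** Q ** transpose A)) X =
      emeasure (density sym_lborel (\<lambda>_. ennreal (1 / \<bar>det A\<bar> ^ (CARD('n) + 1)))) X"
    by (subst emeasure_density) (auto simp: nn_integral_cmult)
qed simp

lemma integral_sym_lborel_congruence:
  fixes A :: "real^'n^'n" and f :: "real^'n^'n \<Rightarrow> 'b::euclidean_space"
  assumes A: "invertible A" and [measurable]: "f \<in> borel_measurable borel"
  shows "(\<integral>Q. f (A ** Q ** transpose A) \<partial>sym_lborel) = (1 / \<bar>det A\<bar> ^ (CARD('n) + 1)) *\<^sub>R (\<integral>Q. f Q \<partial>sym_lborel)"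
proof -
  have "(\<integral>Q. f (A ** Q ** transpose A) \<partial>sym_lborel) = (\<integral>Q. f Q \<partial>distr sym_lborel borel (\<lambda>Q. A ** Q ** transpose A))"
    by (subst integral_distr) auto
  also have "\<dots> = (\<integral>Q. (1 / \<bar>det A\<bar> ^ (CARD('n) + 1)) *\<^sub>R f Q \<partial>sym_lborel)"
    unfolding sym_lborel_congruence_distr[OF A] by (subst integral_density) auto
  finally show ?thesis by simp
qed

lemma bounded_linear_congruence:
  fixes A :: "real^'n^'m" and B :: "real^'p^'k"
  shows "bounded_linear (\<lambda>Q. A ** Q ** B)"
  by (rule linear_conv_bounded_linear[THEN iffD1], rule linearI)
    (simp_all add: matrix_add_ldistrib matrix_mult_scaleR matrix_scaleR_mult vec_eq_iff matrix_matrix_mult_def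
      algebra_simps sum.distrib sum_distrib_left)

text \<open>
  Substituting \<open>A Q A\<^sup>T\<close> for \<open>Q\<close> does not change the integral, and congruence is linear in \<open>Q\<close>.
\<close>

lemma congruence_invariant_mean:
  fixes A :: "real^'n^'n" and w :: "real^'n^'n \<Rightarrow> real"
  assumes A: "\<bar>det A\<bar> = 1" and [measurable]: "w \<in> borel_measurable borel"
    and int: "integrable sym_lborel (\<lambda>Q. w Q *\<^sub>R Q)"
    and inv: "\<And>Q. w (A ** Q ** transpose A) = w Q"
  shows "A ** (\<integral>Q. w Q *\<^sub>R Q \<partial>sym_lborel) ** transpose A = (\<integral>Q. w Q *\<^sub>R Q \<partial>sym_lborel)"
proof -
  have iA: "invertible A" using A by (auto simp: invertible_det_nz)
  have "A ** (\<integral>Q. w Q *\<^sub>R Q \<partial>sym_lborel) ** transpose A = (\<integral>Q. A ** (w Q *\<^sub>R Q) ** transpose A \<partial>sym_lborel)"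
    by (rule integral_bounded_linear[OF bounded_linear_congruence int, symmetric])
  also have "\<dots> = (\<integral>Q. w (A ** Q ** transpose A) *\<^sub>R (A ** Q ** transpose A) \<partial>sym_lborel)"
    by (simp add: inv matrix_mult_scaleR matrix_scaleR_mult)
  also have "\<dots> = (\<integral>Q. w Q *\<^sub>R Q \<partial>sym_lborel)"
    using integral_sym_lborel_congruence[OF iA, of "\<lambda>Q. w Q *\<^sub>R Q"] A by simp
  finally show ?thesis .
qed

text \<open>
  The reflection in the hyperplane orthogonal to the axis \<open>k\<close>.
\<close>

abbreviation sign_flip :: "'n \<Rightarrow> real^'n^'n" where
  "sign_flip k \<equiv> diag_mat (\<lambda>i. if i = k then - 1 else 1)"

lemma diag_mat_nth: "diag_mat f $ i $ j = (if i = j then f i else 0)"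
  by (simp add: diag_mat_def)

lemma transpose_diag_mat [simp]: "transpose (diag_mat f) = diag_mat f"
  by (auto simp: vec_eq_iff transpose_nth diag_mat_nth)

lemma det_diag_mat: "det (diag_mat f :: real^'n^'n) = (\<Prod>i\<in>UNIV. f i)"
  by (subst det_diagonal) (auto simp: diag_mat_nth)

lemma diag_mat_left: "(diag_mat f ** (Q :: real^'p^'n)) $ i $ j = f i * Q $ i $ j"
  by (subst diagonal_matrix_mult) (auto simp: diag_mat_nth)

lemma diag_mat_right: "((Q :: real^'n^'p) ** diag_mat f) $ i $ j = Q $ i $ j * f j"
  by (subst diagonal_mult_matrix) (auto simp: diag_mat_nth)

lemma sign_flip_square: "sign_flip k ** sign_flip k = (mat 1 :: real^'n^'n)"
  by (simp add: vec_eq_iff diag_mat_left) (auto simp: diag_mat_nth mat_def)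

lemma sign_flip_congruence:
  "(sign_flip k ** Q ** transpose (sign_flip k)) $ i $ j =
    (if i = k then - 1 else 1) * (if j = k then - 1 else 1) * (Q :: real^'n^'n) $ i $ j"
  by (simp add: diag_mat_right diag_mat_left)

lemma abs_det_involution:
  fixes A :: "real^'n^'n" assumes "A ** A = mat 1" shows "\<bar>det A\<bar> = 1"
proof -
  have "det A * det A = 1" unfolding det_mul[symmetric] assms by simp
  then show ?thesis unfolding abs_square_eq_1[symmetric] power2_eq_square .
qed

text \<open>
  The reflection of axis \<open>i\<close> changes the sign of the entry \<open>(i, j)\<close>.
\<close>

lemma sign_invariant_mean_diagonal:
  fixes w :: "real^'n^'n \<Rightarrow> real"
  assumes "w \<in> borel_measurable borel" "integrable sym_lborel (\<lambda>Q. w Q *\<^sub>R Q)"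
    and "\<And>k Q. w (sign_flip k ** Q ** transpose (sign_flip k)) = w Q" and "i \<noteq> j"
  shows "(\<integral>Q. w Q *\<^sub>R Q \<partial>sym_lborel) $ i $ j = 0"
proof -
  have "sign_flip i ** (\<integral>Q. w Q *\<^sub>R Q \<partial>sym_lborel) ** transpose (sign_flip i) = (\<integral>Q. w Q *\<^sub>R Q \<partial>sym_lborel)"
    using assms(1-3) by (intro congruence_invariant_mean abs_det_involution sign_flip_square)
  then have "(\<integral>Q. w Q *\<^sub>R Q \<partial>sym_lborel) $ i $ j = - (\<integral>Q. w Q *\<^sub>R Q \<partial>sym_lborel) $ i $ j"
    using sign_flip_congruence[of i "\<integral>Q. w Q *\<^sub>R Q \<partial>sym_lborel" i j] assms(4) by simp
  then show ?thesis by simp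
qed

text \<open>
  Reflections kill the entries off the diagonal, and transpositions of the coordinates make those on it equal.
\<close>

lemma orthogonal_invariant_mean_scalar:
  fixes w :: "real^'n^'n \<Rightarrow> real"
  assumes w: "w \<in> borel_measurable borel" "integrable sym_lborel (\<lambda>Q. w Q *\<^sub>R Q)"
    and inv: "\<And>A Q. A ** transpose A = mat 1 \<Longrightarrow> w (A ** Q ** transpose A) = w Q"
  obtains e where "(\<integral>Q. w Q *\<^sub>R Q \<partial>sym_lborel) = e *\<^sub>R mat 1"
    and "real CARD('n) * e = (\<integral>Q. w Q * trace Q \<partial>sym_lborel)"
proof -
  let ?M = "\<integral>Q. w Q *\<^sub>R Q \<partial>sym_lborel"
  have off: "?M $ i $ j = 0" if "i \<noteq> j" for i j
    by (rule sign_invariant_mean_diagonal[OF w _ that]) (rule inv, simp add: sign_flip_square)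
  have diag: "?M $ i $ i = ?M $ j $ j" for i j
  proof -
    let ?P = "\<chi> k l. mat 1 $ k $ Transposition.transpose i j l :: real^'n^'n"
    have tr: "transpose ?P = ?P" by (auto simp: vec_eq_iff transpose_nth mat_def transpose_eq_iff)
    have PP: "?P ** ?P = mat 1"
      by (simp add: vec_eq_iff swap_matrix_mult) (auto simp: mat_def transpose_eq_iff)
    have inv': "w (?P ** Q ** transpose ?P) = w Q" for Q by (rule inv) (simp only: tr PP)
    have eq: "?P ** ?M ** transpose ?P = ?M"
      by (rule congruence_invariant_mean[OF abs_det_swap_matrix w inv'])
    have "?P ** ?M ** transpose ?P = transpose (?P ** transpose (?P ** ?M))"
      by (simp add: matrix_transpose_mul matrix_mul_assoc)
    then have "(?P ** ?M ** transpose ?P) $ i $ i = ?M $ j $ j"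
      by (simp only: transpose_nth swap_matrix_mult) (simp add: transpose_nth)
    then show ?thesis unfolding eq .
  qed
  define e where "e = ?M $ undefined $ undefined"
  have "?M $ i $ j = (e *\<^sub>R mat 1) $ i $ j" for i j
    using off[of i j] diag[of i undefined] by (auto simp: e_def mat_def)
  then have M: "?M = e *\<^sub>R mat 1" by (simp only: vec_eq_iff) simp
  have "bounded_linear (trace :: real^'n^'n \<Rightarrow> real)"
    by (rule linear_conv_bounded_linear[THEN iffD1], rule linearI) (simp_all add: trace_def sum.distrib sum_distrib_left)
  from integral_bounded_linear[OF this w(2)] have "(\<integral>Q. trace (w Q *\<^sub>R Q) \<partial>sym_lborel) = trace ?M" .
  moreover have "trace (r *\<^sub>R (Q :: real^'n^'n)) = r * trace Q" for r Q by (simp add: trace_def sum_distrib_left)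
  ultimately have "real CARD('n) * e = (\<integral>Q. w Q * trace Q \<partial>sym_lborel)"
    unfolding M by (simp add: trace_I mult.commute)
  with M that show ?thesis by blast
qed

lemma norm_matrix_le_sum: "norm (Q :: real^'n^'m) \<le> (\<Sum>i\<in>UNIV. \<Sum>j\<in>UNIV. \<bar>Q $ i $ j\<bar>)"
proof -
  have "norm Q \<le> (\<Sum>i\<in>UNIV. norm (Q $ i))" unfolding norm_vec_def by (rule L2_set_le_sum) simp
  also have "\<dots> \<le> (\<Sum>i\<in>UNIV. \<Sum>j\<in>UNIV. \<bar>Q $ i $ j\<bar>)" by (intro sum_mono norm_le_l1_cart)
  finally show ?thesis .
qed

lemma pos_def_norm_le_trace:
  fixes Q :: "real^'n^'n" assumes "pos_def Q" shows "norm Q \<le> (real CARD('n))\<^sup>2 * trace Q"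
proof -
  have "(\<Sum>i\<in>UNIV. \<Sum>j\<in>UNIV. \<bar>Q $ i $ j\<bar>) \<le> (\<Sum>i\<in>(UNIV::'n set). \<Sum>j\<in>(UNIV::'n set). trace Q)"
    using pos_def_entry_le_trace[OF assms] by (intro sum_mono)
  with norm_matrix_le_sum[of Q] show ?thesis by (simp add: power2_eq_square mult.assoc)
qed

lemma trace_orthogonal_congruence:
  fixes A :: "real^'n^'n"
  assumes "A ** transpose A = mat 1" shows "trace (A ** Q ** transpose A) = trace Q"
proof -
  have "transpose A ** A = mat 1" using assms matrix_left_right_inverse by blast
  then show ?thesis by (metis matrix_mul_assoc matrix_mul_rid trace_mul_sym)
qed

lemma det_orthogonal_congruence:
  fixes A :: "real^'n^'n"
  assumes "A ** transpose A = mat 1" shows "det (A ** Q ** transpose A) = det Q"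
proof -
  have "det A * det A = 1" using arg_cong[OF assms, of det] by (simp add: det_mul)
  then show ?thesis by (simp add: det_mul algebra_simps)
qed

lemma cone_weight_orthogonal:
  fixes A :: "real^'n^'n"
  assumes "A ** transpose A = mat 1"
  shows "cone_weight \<gamma> (mat 1) (A ** Q ** transpose A) = cone_weight \<gamma> (mat 1) Q"
  using pos_def_congruence_iff[OF matrix_inv_eqI(2)[OF assms], of Q]
  by (simp add: cone_weight_def trace_orthogonal_congruence[OF assms] det_orthogonal_congruence[OF assms])

lemma beta_weight_orthogonal:
  fixes A :: "real^'n^'n"
  assumes A: "A ** transpose A = mat 1"
  shows "beta_weight \<gamma> \<delta> (A ** Q ** transpose A) = beta_weight \<gamma> \<delta> Q"
proof -
  have "mat 1 - A ** Q ** transpose A = A ** (mat 1 - Q) ** transpose A"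
    by (simp add: matrix_diff_ldistrib matrix_diff_rdistrib A)
  then show ?thesis
    using pos_def_congruence_iff[OF matrix_inv_eqI(2)[OF A]]
    by (simp add: beta_weight_def det_orthogonal_congruence[OF A])
qed

text \<open>
  The factor of the identity matrix in the first moment of the unnormalized density \<open>cone_weight \<gamma> I\<close>.
\<close>

definition cone_mean :: "'n::finite itself \<Rightarrow> real \<Rightarrow> real" where
  "cone_mean _ \<gamma> = (\<gamma> + (real CARD('n) + 1) / 2) * enn2real (cone_mass TYPE('n) \<gamma>)"

lemma cone_mean_pos:
  assumes "\<gamma> > - 1" shows "cone_mean TYPE('n::finite) \<gamma> > 0"
proof -
  have "real CARD('n) \<ge> 1" using zero_less_card_finite[where 'a='n] by linarith
  then have "\<gamma> + (real CARD('n) + 1) / 2 > 0" using assms by (simp only: field_simps)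
  moreover have "enn2real (cone_mass TYPE('n) \<gamma>) > 0"
    using cone_mass_finite[where 'n='n, OF assms] cone_mass_pos[where 'n='n, of \<gamma>]
    by (simp add: enn2real_positive_iff)
  ultimately show ?thesis by (simp add: cone_mean_def)
qed

lemma nn_integral_cone_trace:
  assumes g: "\<gamma> > - 1"
  shows "(\<integral>\<^sup>+Q. ennreal (cone_weight \<gamma> (mat 1 :: real^'n^'n) Q * trace Q) \<partial>sym_lborel) = ennreal (real CARD('n) * cone_mean TYPE('n) \<gamma>)"
proof -
  have "\<gamma> + (real CARD('n) + 1) / 2 \<ge> 0" using cone_mean_pos[where 'n='n, OF g] unfolding cone_mean_def
    by (smt (verit) enn2real_nonneg mult_nonneg_nonneg zero_less_mult_iff)
  moreover have "ennreal (enn2real (cone_mass TYPE('n) \<gamma>)) = cone_mass TYPE('n) \<gamma>"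
    using cone_mass_finite[where 'n='n, OF g] by simp
  ultimately show ?thesis
    using cone_trace_moment[where 'n='n, OF g]
    by (simp add: ennreal_mult' cone_mean_def mult.assoc)
qed

lemma cone_weight_mean_mat_1:
  fixes \<gamma> :: real
  assumes g: "\<gamma> > - 1"
  shows "integrable sym_lborel (\<lambda>Q :: real^'n^'n. cone_weight \<gamma> (mat 1) Q *\<^sub>R Q)"
    and "(\<integral>Q. cone_weight \<gamma> (mat 1) Q *\<^sub>R Q \<partial>sym_lborel) = cone_mean TYPE('n) \<gamma> *\<^sub>R (mat 1 :: real^'n^'n)"
proof -
  let ?w = "cone_weight \<gamma> (mat 1 :: real^'n^'n)"
  have tr0: "0 \<le> ?w Q * trace Q" for Q
    using pos_def_trace_pos[of Q] by (auto simp: cone_weight_def)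
  have [measurable]: "integrable sym_lborel (\<lambda>Q. ?w Q * trace Q)"
    by (rule integrableI_nonneg) (auto simp: tr0 nn_integral_cone_trace[OF g])
  then have "integrable sym_lborel (\<lambda>Q. (real CARD('n))\<^sup>2 * (?w Q * trace Q))" by simp
  then show int: "integrable sym_lborel (\<lambda>Q. ?w Q *\<^sub>R Q)"
  proof (rule Bochner_Integration.integrable_bound)
    show "AE Q in sym_lborel. norm (?w Q *\<^sub>R Q) \<le> norm ((real CARD('n))\<^sup>2 * (?w Q * trace Q))"
    proof (rule AE_I2)
      fix Q :: "real^'n^'n"
      show "norm (?w Q *\<^sub>R Q) \<le> norm ((real CARD('n))\<^sup>2 * (?w Q * trace Q))"
      proof (cases "pos_def Q")
        case True
        from mult_left_mono[OF pos_def_norm_le_trace[OF True] cone_weight_nonneg[of \<gamma> "mat 1" Q]] tr0[of Q]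
        show ?thesis by (simp add: ac_simps)
      qed (simp add: cone_weight_def)
    qed
  qed measurable
  obtain e where e: "(\<integral>Q. ?w Q *\<^sub>R Q \<partial>sym_lborel) = e *\<^sub>R mat 1" "real CARD('n) * e = (\<integral>Q. ?w Q * trace Q \<partial>sym_lborel)"
    by (rule orthogonal_invariant_mean_scalar[OF _ int]) (auto simp: cone_weight_orthogonal)
  have "(\<integral>Q. ?w Q * trace Q \<partial>sym_lborel) = real CARD('n) * cone_mean TYPE('n) \<gamma>"
    using cone_mean_pos[where 'n='n, OF g]
    by (intro integral_eq_nn_integral[THEN trans]) (auto simp: tr0 nn_integral_cone_trace[OF g])
  then have "e = cone_mean TYPE('n) \<gamma>" using e(2) by simp
  with e(1) show "(\<integral>Q. ?w Q *\<^sub>R Q \<partial>sym_lborel) = cone_mean TYPE('n) \<gamma> *\<^sub>R (mat 1 :: real^'n^'n)" by simp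
qed

lemma integrable_sym_lborel_congruence:
  fixes A :: "real^'n^'n" and f :: "real^'n^'n \<Rightarrow> 'b::euclidean_space"
  assumes A: "invertible A" and [measurable]: "f \<in> borel_measurable borel"
  shows "integrable sym_lborel (\<lambda>Q. f (A ** Q ** transpose A)) \<longleftrightarrow> integrable sym_lborel f"
proof -
  have d: "1 / \<bar>det A\<bar> ^ (CARD('n) + 1) \<noteq> 0" using A by (simp add: invertible_det_nz)
  have "integrable sym_lborel (\<lambda>Q. f (A ** Q ** transpose A)) \<longleftrightarrow> integrable (distr sym_lborel borel (\<lambda>Q. A ** Q ** transpose A)) f"
    by (subst integrable_distr_eq) auto
  also have "\<dots> \<longleftrightarrow> integrable sym_lborel (\<lambda>Q. (1 / \<bar>det A\<bar> ^ (CARD('n) + 1)) *\<^sub>R f Q)"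
    unfolding sym_lborel_congruence_distr[OF A] by (subst integrable_density) auto
  also have "\<dots> \<longleftrightarrow> integrable sym_lborel f"
  proof
    assume "integrable sym_lborel (\<lambda>Q. (1 / \<bar>det A\<bar> ^ (CARD('n) + 1)) *\<^sub>R f Q)"
    then have "integrable sym_lborel (\<lambda>Q. (\<bar>det A\<bar> ^ (CARD('n) + 1)) *\<^sub>R (1 / \<bar>det A\<bar> ^ (CARD('n) + 1)) *\<^sub>R f Q)"
      by (rule integrable_scaleR_right)
    then show "integrable sym_lborel f" using d by simp
  qed simp
  finally show ?thesis .
qed

lemma cone_weight_mean:
  fixes V :: "real^'n^'n"
  assumes g: "\<gamma> > - 1" and V: "pos_def V"
  shows "integrable sym_lborel (\<lambda>Q. cone_weight \<gamma> V Q *\<^sub>R Q)"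
    and "(\<integral>Q. cone_weight \<gamma> V Q *\<^sub>R Q \<partial>sym_lborel) =
      (det V powr (- \<gamma> - (real CARD('n) + 1) / 2) * cone_mean TYPE('n) \<gamma>) *\<^sub>R matrix_inv V"
proof -
  obtain C :: "real^'n^'n" where C: "invertible C" "C ** V ** transpose C = mat 1"
    using pos_def_congruent_mat_1[OF V] .
  note tr = cone_weight_transform[OF C]
  let ?D = "transpose C"
  let ?f = "\<lambda>Q. cone_weight \<gamma> V Q *\<^sub>R Q"
  have D: "invertible ?D" using C(1) by (rule transpose_invertible)
  have f: "?f \<in> borel_measurable borel" by measurable
  have eq: "?f (?D ** Q ** transpose ?D) = det V powr (- \<gamma>) *\<^sub>R (?D ** (cone_weight \<gamma> (mat 1) Q *\<^sub>R Q) ** C)" for Q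
    by (simp add: tr(1) matrix_mult_scaleR matrix_scaleR_mult)
  note mean = cone_weight_mean_mat_1[where 'n='n, OF g]
  have "integrable sym_lborel (\<lambda>Q. ?f (?D ** Q ** transpose ?D))"
    unfolding eq by (intro integrable_scaleR_right integrable_bounded_linear[OF bounded_linear_congruence mean(1)])
  then show "integrable sym_lborel ?f" by (simp only: integrable_sym_lborel_congruence[OF D f])
  have d: "\<bar>det ?D\<bar> ^ (CARD('n) + 1) \<noteq> 0" using C(1) by (simp add: invertible_det_nz)
  have "(\<integral>Q. ?f Q \<partial>sym_lborel) = (\<bar>det ?D\<bar> ^ (CARD('n) + 1)) *\<^sub>R (\<integral>Q. ?f (?D ** Q ** transpose ?D) \<partial>sym_lborel)"
    unfolding integral_sym_lborel_congruence[OF D f] using d by simp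
  also have "(\<integral>Q. ?f (?D ** Q ** transpose ?D) \<partial>sym_lborel) =
      det V powr (- \<gamma>) *\<^sub>R (\<integral>Q. ?D ** (cone_weight \<gamma> (mat 1) Q *\<^sub>R Q) ** C \<partial>sym_lborel)"
    unfolding eq by (rule integral_scaleR_right)
  also have "(\<integral>Q. ?D ** (cone_weight \<gamma> (mat 1) Q *\<^sub>R Q) ** C \<partial>sym_lborel) =
      ?D ** (cone_mean TYPE('n) \<gamma> *\<^sub>R (mat 1 :: real^'n^'n)) ** C"
    unfolding mean(2)[symmetric] by (rule integral_bounded_linear[OF bounded_linear_congruence mean(1)])
  also have "\<dots> = cone_mean TYPE('n) \<gamma> *\<^sub>R matrix_inv V"
    by (simp add: matrix_mult_scaleR matrix_scaleR_mult tr(3))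
  also have "\<bar>det ?D\<bar> ^ (CARD('n) + 1) = det V powr (- ((real CARD('n) + 1) / 2))"
    unfolding det_transpose tr(2) ..
  also have "det V powr (- ((real CARD('n) + 1) / 2)) *\<^sub>R det V powr (- \<gamma>) *\<^sub>R cone_mean TYPE('n) \<gamma> *\<^sub>R matrix_inv V =
      (det V powr (- ((real CARD('n) + 1) / 2) + - \<gamma>) * cone_mean TYPE('n) \<gamma>) *\<^sub>R matrix_inv V"
    by (simp only: powr_add scaleR_scaleR mult.assoc)
  also have "- ((real CARD('n) + 1) / 2) + - \<gamma> = - \<gamma> - (real CARD('n) + 1) / 2" by linarith
  finally show "(\<integral>Q. ?f Q \<partial>sym_lborel) =
      (det V powr (- \<gamma> - (real CARD('n) + 1) / 2) * cone_mean TYPE('n) \<gamma>) *\<^sub>R matrix_inv V" .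
qed

lemma bounded_linear_trace: "bounded_linear (trace :: real^'n^'n \<Rightarrow> real)"
  by (rule linear_conv_bounded_linear[THEN iffD1], rule linearI) (simp_all add: trace_def sum.distrib sum_distrib_left)

lemma trace_scaleR: "trace (r *\<^sub>R (Q :: real^'n^'n)) = r * trace Q"
  by (simp add: trace_def sum_distrib_left)

text \<open>
  By invariance the mean is \<open>e I\<close>. The number \<open>e\<close> comes from computing the first moment of \<open>tr U\<close> in two ways, directly and
  through \<open>U = A \<Lambda> A\<^sup>T\<close>: the factors \<open>\<gamma> + (n + 1) / 2\<close> and \<open>\<gamma> + \<delta> + (n + 1)\<close> are those of the gamma matrices \<open>U\<close> and
  \<open>U + V\<close>.
\<close>

lemma beta_weight_mean:
  assumes g: "\<gamma> > - 1" and d: "\<delta> > - 1"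
  shows "integrable sym_lborel (\<lambda>\<Lambda> :: real^'n^'n. beta_weight \<gamma> \<delta> \<Lambda> *\<^sub>R \<Lambda>)"
    and "(\<integral>\<Lambda>. beta_weight \<gamma> \<delta> \<Lambda> *\<^sub>R \<Lambda> \<partial>sym_lborel) =
      ((\<gamma> + (real CARD('n) + 1) / 2) / (\<gamma> + \<delta> + (real CARD('n) + 1)) * enn2real (beta_mass TYPE('n) \<gamma> \<delta>)) *\<^sub>R (mat 1 :: real^'n^'n)"
proof -
  let ?w = "beta_weight \<gamma> \<delta> :: real^'n^'n \<Rightarrow> real"
  let ?m = "real CARD('n)" and ?\<kappa> = "(real CARD('n) + 1) / 2"
  have m: "?m \<ge> 1" using zero_less_card_finite[where 'a='n] by linarith
  have "integrable sym_lborel ?w"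
    using beta_mass_finite[where 'n='n, OF g d] by (intro integrableI_nonneg) (auto simp: beta_mass_def)
  then have "integrable sym_lborel (\<lambda>\<Lambda>. (?m\<^sup>2 * ?m) * ?w \<Lambda>)" by simp
  then show int: "integrable sym_lborel (\<lambda>\<Lambda>. ?w \<Lambda> *\<^sub>R \<Lambda>)"
  proof (rule Bochner_Integration.integrable_bound)
    show "AE \<Lambda> in sym_lborel. norm (?w \<Lambda> *\<^sub>R \<Lambda>) \<le> norm ((?m\<^sup>2 * ?m) * ?w \<Lambda>)"
    proof (rule AE_I2)
      fix \<Lambda> :: "real^'n^'n"
      show "norm (?w \<Lambda> *\<^sub>R \<Lambda>) \<le> norm ((?m\<^sup>2 * ?m) * ?w \<Lambda>)"
      proof (cases "pos_def \<Lambda> \<and> pos_def (mat 1 - \<Lambda>)")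
        case True
        have "trace \<Lambda> \<le> ?m" using pos_def_trace_pos[of "mat 1 - \<Lambda>"] True by (simp add: trace_sub trace_I)
        then have "?m\<^sup>2 * trace \<Lambda> \<le> ?m\<^sup>2 * ?m" by (intro mult_left_mono) auto
        then have "norm \<Lambda> \<le> ?m\<^sup>2 * ?m"
          using pos_def_norm_le_trace[of \<Lambda>] True order_trans by blast
        from mult_left_mono[OF this beta_weight_nonneg[of \<gamma> \<delta> \<Lambda>]]
        show ?thesis by (simp add: ac_simps)
      qed (auto simp: beta_weight_def)
    qed
  qed measurable
  obtain e where e: "(\<integral>\<Lambda>. ?w \<Lambda> *\<^sub>R \<Lambda> \<partial>sym_lborel) = e *\<^sub>R mat 1" "?m * e = (\<integral>\<Lambda>. ?w \<Lambda> * trace \<Lambda> \<partial>sym_lborel)"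
    by (rule orthogonal_invariant_mean_scalar[OF _ int]) (auto simp: beta_weight_orthogonal)
  have "0 \<le> ?w \<Lambda> * trace \<Lambda>" for \<Lambda>
    using pos_def_trace_pos[of \<Lambda>] by (auto simp: beta_weight_def)
  then have "0 \<le> ?m * e" unfolding e(2) by (intro Bochner_Integration.integral_nonneg) auto
  then have e0: "e \<ge> 0" using m by (simp add: zero_le_mult_iff)
  obtain A :: "real^'n^'n \<Rightarrow> real^'n^'n"
    where A: "\<And>T. pos_def T \<Longrightarrow> invertible (A T)" "\<And>T. pos_def T \<Longrightarrow> A T ** transpose (A T) = T"
    using pos_def_factor_function by blast
  \<comment> \<open>The exponent of the gamma density of the sum \<open>U + V\<close>.\<close>
  let ?g = "\<gamma> + \<delta> + ?\<kappa>"
  have "?\<kappa> \<ge> 1" using m by simp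
  then have g': "?g > - 1" using g d by linarith
  define mass where "mass \<gamma> = enn2real (cone_mass TYPE('n) \<gamma>)" for \<gamma>
  have mass: "cone_mass TYPE('n) \<gamma> = ennreal (mass \<gamma>)" "mass \<gamma> > 0" if "\<gamma> > - 1" for \<gamma>
    using cone_mass_finite[where 'n='n, OF that] cone_mass_pos[where 'n='n, of \<gamma>]
    by (simp_all add: mass_def enn2real_positive_iff)
  define bm where "bm = enn2real (beta_mass TYPE('n) \<gamma> \<delta>)"
  have bm: "beta_mass TYPE('n) \<gamma> \<delta> = ennreal bm" "bm \<ge> 0"
    using beta_mass_finite[where 'n='n, OF g d] by (simp_all add: bm_def)
  have inner: "(\<integral>\<^sup>+\<Lambda>. ennreal (?w \<Lambda>) * ennreal (trace (A T ** \<Lambda> ** transpose (A T))) \<partial>sym_lborel) = ennreal (e * trace T)"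
    if T: "pos_def T" for T
  proof -
    let ?L = "\<lambda>\<Lambda>. trace (A T ** \<Lambda> ** transpose (A T))"
    have L: "bounded_linear ?L"
      using bounded_linear_compose[OF bounded_linear_trace bounded_linear_congruence[of "A T" "transpose (A T)"]] by simp
    have wL: "?w \<Lambda> * ?L \<Lambda> = ?L (?w \<Lambda> *\<^sub>R \<Lambda>)" for \<Lambda>
      by (simp add: matrix_mult_scaleR matrix_scaleR_mult trace_scaleR)
    have nn: "0 \<le> ?w \<Lambda> * ?L \<Lambda>" for \<Lambda>
      using pos_def_trace_pos[OF pos_def_congruence[OF A(1)[OF T]]] by (auto simp: beta_weight_def less_imp_le)
    have "(\<integral>\<^sup>+\<Lambda>. ennreal (?w \<Lambda>) * ennreal (?L \<Lambda>) \<partial>sym_lborel) = (\<integral>\<^sup>+\<Lambda>. ennreal (?w \<Lambda> * ?L \<Lambda>) \<partial>sym_lborel)"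
      by (simp add: ennreal_mult')
    also have "\<dots> = ennreal (\<integral>\<Lambda>. ?w \<Lambda> * ?L \<Lambda> \<partial>sym_lborel)"
      using nn integrable_bounded_linear[OF L int] by (intro nn_integral_eq_integral) (auto simp: wL)
    also have "(\<integral>\<Lambda>. ?w \<Lambda> * ?L \<Lambda> \<partial>sym_lborel) = ?L (e *\<^sub>R mat 1)"
      unfolding wL e(1)[symmetric] by (rule integral_bounded_linear[OF L int])
    also have "\<dots> = e * trace T"
      using A(2)[OF T] by (simp add: matrix_mult_scaleR matrix_scaleR_mult trace_scaleR)
    finally show ?thesis .
  qed
  have "ennreal (?m * (\<gamma> + ?\<kappa>)) * cone_mass TYPE('n) \<gamma> * cone_mass TYPE('n) \<delta> =
      (\<integral>\<^sup>+T. ennreal (cone_weight ?g (mat 1) T) *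
      (\<integral>\<^sup>+\<Lambda>. ennreal (?w \<Lambda>) * ennreal (trace (A T ** \<Lambda> ** transpose (A T))) \<partial>sym_lborel) \<partial>sym_lborel)"
    unfolding cone_trace_moment[where 'n='n, OF g, symmetric]
    by (rule cone_beta_convolution) (auto simp: A)
  also have "\<dots> = (\<integral>\<^sup>+T. ennreal e * (ennreal (cone_weight ?g (mat 1 :: real^'n^'n) T) * ennreal (trace T)) \<partial>sym_lborel)"
  proof (rule nn_integral_cong)
    fix T :: "real^'n^'n"
    show "ennreal (cone_weight ?g (mat 1) T) *
      (\<integral>\<^sup>+\<Lambda>. ennreal (?w \<Lambda>) * ennreal (trace (A T ** \<Lambda> ** transpose (A T))) \<partial>sym_lborel) =
      ennreal e * (ennreal (cone_weight ?g (mat 1 :: real^'n^'n) T) * ennreal (trace T))"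
    proof (cases "pos_def T")
      case True
      show ?thesis unfolding inner[OF True] using e0 by (simp add: ennreal_mult' mult.left_commute)
    qed (simp add: cone_weight_def)
  qed
  also have "\<dots> = ennreal e * (ennreal (?m * (?g + ?\<kappa>)) * cone_mass TYPE('n) ?g)"
    unfolding cone_trace_moment[where 'n='n, OF g', symmetric] by (rule nn_integral_cmult) measurable
  finally have raw: "ennreal (?m * (\<gamma> + ?\<kappa>)) * cone_mass TYPE('n) \<gamma> * cone_mass TYPE('n) \<delta> =
      ennreal e * (ennreal (?m * (?g + ?\<kappa>)) * cone_mass TYPE('n) ?g)" .
  have nn: "?m * (\<gamma> + ?\<kappa>) \<ge> 0" "?m * (?g + ?\<kappa>) \<ge> 0"
    using g g' \<open>?\<kappa> \<ge> 1\<close> by (intro mult_nonneg_nonneg; linarith)+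
  have "ennreal (?m * (\<gamma> + ?\<kappa>) * mass \<gamma> * mass \<delta>) = ennreal (e * (?m * (?g + ?\<kappa>) * mass ?g))"
    using raw mass(2)[OF g] mass(2)[OF d] mass(2)[OF g'] e0 nn
    unfolding mass(1)[OF g] mass(1)[OF d] mass(1)[OF g']
    by (simp only: ennreal_mult mult_nonneg_nonneg less_imp_le)
  then have eq1: "?m * (\<gamma> + ?\<kappa>) * mass \<gamma> * mass \<delta> = e * (?m * (?g + ?\<kappa>) * mass ?g)"
    using mass(2)[OF g] mass(2)[OF d] mass(2)[OF g'] e0 nn
    by (subst (asm) ennreal_inj) (simp_all only: mult_nonneg_nonneg less_imp_le)
  have "ennreal (mass \<gamma> * mass \<delta>) = ennreal (mass ?g * bm)"
    using cone_mass_mult[where 'n='n, of \<gamma> \<delta>] mass(2)[OF g] mass(2)[OF g']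
    unfolding mass(1)[OF g] mass(1)[OF d] mass(1)[OF g'] bm(1) by (simp add: ennreal_mult')
  then have eq2: "mass \<gamma> * mass \<delta> = mass ?g * bm"
    using mass(2)[OF g] mass(2)[OF d] mass(2)[OF g'] bm(2) by (subst (asm) ennreal_inj) auto
  have "(?m * mass ?g) * ((\<gamma> + ?\<kappa>) * bm) = (?m * mass ?g) * (e * (?g + ?\<kappa>))"
    using eq1 unfolding mult.assoc eq2 by (simp add: algebra_simps)
  then have eq3: "(\<gamma> + ?\<kappa>) * bm = e * (?g + ?\<kappa>)" using m mass(2)[OF g'] by simp
  have den: "?g + ?\<kappa> = \<gamma> + \<delta> + (?m + 1)" by (simp add: field_simps)
  have "\<gamma> + \<delta> + (?m + 1) > 0" using g d m by linarith
  then have "e = (\<gamma> + ?\<kappa>) / (\<gamma> + \<delta> + (?m + 1)) * bm" using eq3 unfolding den by (simp add: field_simps)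
  with e(1) show "(\<integral>\<Lambda>. ?w \<Lambda> *\<^sub>R \<Lambda> \<partial>sym_lborel) =
      ((\<gamma> + ?\<kappa>) / (\<gamma> + \<delta> + (?m + 1)) * enn2real (beta_mass TYPE('n) \<gamma> \<delta>)) *\<^sub>R (mat 1 :: real^'n^'n)"
    unfolding bm_def by simp
qed

section \<open>Gaussian integrals over matrices\<close>

lemma trace_mult_transpose: "trace ((Z :: real^'p^'m) ** transpose Z) = (norm Z)\<^sup>2"
  by (simp add: trace_def matrix_matrix_mult_def transpose_def power2_norm_eq_inner inner_vec_def)

definition gaussian_kernel :: "real^'m^'m \<Rightarrow> real^'p^'p \<Rightarrow> real^'p^'m \<Rightarrow> real" where
  "gaussian_kernel A Q Z = exp (- trace (A ** Z ** Q ** transpose Z) / 2)"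

lemma borel_measurable_gaussian_kernel [measurable (raw)]:
  fixes f :: "'a \<Rightarrow> real^'m^'m" and g :: "'a \<Rightarrow> real^'p^'p" and h :: "'a \<Rightarrow> real^'p^'m"
  assumes [measurable]: "f \<in> borel_measurable M" "g \<in> borel_measurable M" "h \<in> borel_measurable M"
  shows "(\<lambda>x. gaussian_kernel (f x) (g x) (h x)) \<in> borel_measurable M"
  unfolding gaussian_kernel_def by measurable

text \<open>
  This is \<open>(2 \<pi>)\<^sup>m\<^sup>p\<^sup>/\<^sup>2\<close>. Only its positivity and finiteness enter, because it cancels in all ratios.
\<close>

definition gaussian_mass :: "'p::finite itself \<Rightarrow> 'm::finite itself \<Rightarrow> ennreal" where
  "gaussian_mass _ _ = (\<integral>\<^sup>+Z. ennreal (exp (- (norm (Z :: real^'p^'m))\<^sup>2 / 2)) \<partial>lborel)"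

lemma not_AE_lborel_False: "\<not> (AE x in (lborel :: 'a::euclidean_space measure). False)"
proof
  assume "AE x in (lborel :: 'a measure). False"
  then have "(UNIV :: 'a set) \<in> null_sets lborel" by (subst AE_iff_null_sets) auto
  then show False using emeasure_lborel_UNIV[where 'a='a] null_setsD1 by fastforce
qed

lemma gaussian_mass_pos: "gaussian_mass TYPE('p::finite) TYPE('m::finite) > 0"
proof (rule ccontr)
  assume "\<not> ?thesis"
  then have "AE Z in (lborel :: (real^'p^'m) measure). ennreal (exp (- (norm Z)\<^sup>2 / 2)) = 0"
    unfolding gaussian_mass_def by (subst nn_integral_0_iff_AE[symmetric]) (auto simp: zero_less_iff_neq_zero)
  then show False using not_AE_lborel_False[where 'a="real^'p^'m"] by (simp add: ennreal_eq_0_iff)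
qed

lemma gaussian_mass_finite: "gaussian_mass TYPE('p::finite) TYPE('m::finite) < \<infinity>"
proof -
  interpret product_sigma_finite "\<lambda>_::'m \<times> 'p. lborel :: real measure" by (rule product_sigma_finite_lborel)
  let ?G = "\<integral>\<^sup>+t. ennreal (exp (- t\<^sup>2 / 2)) \<partial>lborel"
  have "?G \<le> (\<integral>\<^sup>+t. ennreal (exp (1 / 2)) * ennreal (exp (- 1 * \<bar>t\<bar>)) \<partial>lborel)"
  proof (rule nn_integral_mono)
    fix t :: real
    have "0 \<le> (\<bar>t\<bar> - 1)\<^sup>2" by simp
    then have "- t\<^sup>2 / 2 \<le> 1 / 2 + - 1 * \<bar>t\<bar>" by (simp add: power2_eq_square algebra_simps)
    then have "exp (- t\<^sup>2 / 2) \<le> exp (1 / 2) * exp (- 1 * \<bar>t\<bar>)" unfolding exp_add[symmetric] by simp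
    then show "ennreal (exp (- t\<^sup>2 / 2)) \<le> ennreal (exp (1 / 2)) * ennreal (exp (- 1 * \<bar>t\<bar>))"
      by (subst ennreal_mult'[symmetric]) (auto intro: ennreal_leI)
  qed
  also have "\<dots> < \<infinity>"
    using nn_integral_exp_abs_finite[of 1] by (subst nn_integral_cmult) (auto simp: ennreal_mult_less_top)
  finally have G: "?G < \<infinity>" .
  have sq: "(norm (matrix_of v :: real^'p^'m))\<^sup>2 = (\<Sum>k\<in>UNIV. (v k)\<^sup>2)" for v
  proof -
    have "(norm (matrix_of v :: real^'p^'m))\<^sup>2 = (\<Sum>i\<in>UNIV. \<Sum>j\<in>UNIV. (v (i, j))\<^sup>2)"
      unfolding power2_norm_eq_inner inner_vec_def by (simp add: power2_eq_square)
    also have "\<dots> = (\<Sum>k\<in>UNIV \<times> UNIV. (v k)\<^sup>2)"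
      by (simp only: sum.cartesian_product) (rule sum.cong, auto)
    finally show ?thesis by simp
  qed
  have "gaussian_mass TYPE('p) TYPE('m) = (\<integral>\<^sup>+v. ennreal (exp (- (norm (matrix_of v :: real^'p^'m))\<^sup>2 / 2)) \<partial>lebesgue_product UNIV)"
    unfolding gaussian_mass_def by (rule nn_integral_lborel_matrix) measurable
  also have "\<dots> = (\<integral>\<^sup>+v. (\<Prod>k\<in>UNIV. ennreal (exp (- (v k)\<^sup>2 / 2))) \<partial>lebesgue_product (UNIV :: ('m \<times> 'p) set))"
  proof (rule nn_integral_cong)
    fix v :: "'m \<times> 'p \<Rightarrow> real"
    have "exp (- (norm (matrix_of v :: real^'p^'m))\<^sup>2 / 2) = (\<Prod>k\<in>UNIV. exp (- (v k)\<^sup>2 / 2))"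
      unfolding sq by (subst exp_sum[symmetric]) (simp_all add: sum_divide_distrib sum_negf)
    then show "ennreal (exp (- (norm (matrix_of v :: real^'p^'m))\<^sup>2 / 2)) = (\<Prod>k\<in>UNIV. ennreal (exp (- (v k)\<^sup>2 / 2)))"
      by (simp add: prod_ennreal)
  qed
  also have "\<dots> = (\<Prod>k\<in>(UNIV :: ('m \<times> 'p) set). ?G)" by (rule product_nn_integral_prod) auto
  also have "\<dots> < \<infinity>" using G by (simp add: power_less_top_ennreal)
  finally show ?thesis .
qed

lemma gaussian_integral:
  fixes A :: "real^'m^'m" and Q :: "real^'p^'p"
  assumes A: "pos_def A" and Q: "pos_def Q"
  shows "(\<integral>\<^sup>+Z. ennreal (gaussian_kernel A Q Z) \<partial>lborel) =
    ennreal (det A powr (- real CARD('p) / 2) * det Q powr (- real CARD('m) / 2)) * gaussian_mass TYPE('p) TYPE('m)"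
proof -
  obtain C :: "real^'m^'m" where C: "invertible C" "C ** A ** transpose C = mat 1" using pos_def_congruent_mat_1[OF A] .
  obtain D :: "real^'p^'p" where D: "invertible D" "D ** Q ** transpose D = mat 1" using pos_def_congruent_mat_1[OF Q] .
  have power: "\<bar>det E\<bar> ^ k = det B powr (- real k / 2)"
    if "invertible E" "E ** B ** transpose E = mat 1" for E B :: "real^'k^'k" and k
  proof -
    define d where "d = \<bar>det E\<bar>"
    have d: "d > 0" using that(1) by (simp add: d_def invertible_det_nz)
    have "det E * det B * det E = 1" using arg_cong[OF that(2), of det] by (simp add: det_mul)
    then have "det B * d powr 2 = 1" using d by (simp add: d_def power2_eq_square ac_simps)
    then have dB: "det B = d powr (- 2)" using d by (simp add: powr_minus field_simps)
    show ?thesis unfolding dB powr_powr d_def[symmetric] using d by (simp add: powr_realpow)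
  qed
  have kern: "gaussian_kernel A Q (transpose C ** (Z ** D)) = exp (- (norm Z)\<^sup>2 / 2)" for Z :: "real^'p^'m"
  proof -
    have "trace (A ** (transpose C ** (Z ** D)) ** Q ** transpose (transpose C ** (Z ** D))) =
        trace ((A ** transpose C ** Z ** (D ** Q ** transpose D) ** transpose Z) ** C)"
      by (simp add: matrix_transpose_mul matrix_mul_assoc)
    also have "\<dots> = trace (C ** (A ** transpose C ** Z ** transpose Z))"
      unfolding D(2) matrix_mul_rid by (rule trace_mul_sym)
    also have "\<dots> = trace ((C ** A ** transpose C) ** (Z ** transpose Z))" by (simp add: matrix_mul_assoc)
    also have "\<dots> = (norm Z)\<^sup>2" unfolding C(2) by (simp add: trace_mult_transpose)
    finally show ?thesis by (simp add: gaussian_kernel_def)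
  qed
  have "(\<integral>\<^sup>+Z. ennreal (gaussian_kernel A Q Z) \<partial>lborel) =
      ennreal (\<bar>det (transpose C)\<bar> ^ CARD('p)) * (\<integral>\<^sup>+Z. ennreal (gaussian_kernel A Q (transpose C ** Z)) \<partial>lborel)"
    by (rule lborel_left_mult[OF transpose_invertible[OF C(1)]]) measurable
  also have "(\<integral>\<^sup>+Z. ennreal (gaussian_kernel A Q (transpose C ** Z)) \<partial>lborel) =
      ennreal (\<bar>det D\<bar> ^ CARD('m)) * (\<integral>\<^sup>+Z. ennreal (gaussian_kernel A Q (transpose C ** (Z ** D))) \<partial>lborel)"
    by (rule lborel_right_mult[OF D(1)]) measurable
  finally show ?thesis
    unfolding kern det_transpose power[OF C] power[OF D] gaussian_mass_def
    by (simp add: ennreal_mult' mult.assoc)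
qed

section \<open>The inversion of positive definite matrices\<close>

lemma compact_orthogonal_matrices: "compact {R :: real^'n^'n. transpose R ** R = mat 1}"
  unfolding compact_eq_bounded_closed
proof
  show "bounded {R :: real^'n^'n. transpose R ** R = mat 1}"
    unfolding bounded_iff
  proof (intro exI ballI)
    fix R :: "real^'n^'n" assume "R \<in> {R. transpose R ** R = mat 1}"
    then have "R ** transpose R = mat 1" using matrix_left_right_inverse by auto
    then have "(norm R)\<^sup>2 = real CARD('n)" unfolding trace_mult_transpose[symmetric] by (simp add: trace_I)
    then show "norm R \<le> sqrt (real CARD('n))" by (simp add: real_le_rsqrt)
  qed
  show "closed {R :: real^'n^'n. transpose R ** R = mat 1}"
    unfolding matrix_matrix_mult_def transpose_def
    by (intro closed_Collect_eq continuous_intros)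
qed

text \<open>
  The derivative of \<open>tr (S R)\<close> along the rotations in the plane of the axes \<open>i\<close> and \<open>j\<close>, taken at the identity, is
  \<open>S\<^sub>i\<^sub>j - S\<^sub>j\<^sub>i\<close>. Instead of differentiating, the proof inserts the rotation with the best angle.
\<close>

lemma symmetric_of_maximal_trace:
  fixes S :: "real^'n^'n"
  assumes max: "\<And>R :: real^'n^'n. transpose R ** R = mat 1 \<Longrightarrow> trace (S ** R) \<le> trace S"
  shows "transpose S = S"
proof -
  have "S $ i $ j = S $ j $ i" if ij: "i \<noteq> j" for i j
  proof -
    define a where "a = S $ i $ i + S $ j $ j"
    define b where "b = S $ i $ j - S $ j $ i"
    have rot: "a * c + b * s \<le> a" if cs: "c * c + s * s = 1" for c s :: real
    proof -
      define R :: "real^'n^'n" where "R = (\<chi> k l. if k = i \<and> l = i \<or> k = j \<and> l = j then c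
        else if k = j \<and> l = i then s else if k = i \<and> l = j then - s else if k = l then 1 else 0)"
      have RM: "(R ** M) $ k $ l = (if k = i then c * M $ i $ l - s * M $ j $ l
          else if k = j then s * M $ i $ l + c * M $ j $ l else M $ k $ l)" for M :: "real^'n^'n" and k l
      proof -
        have "(\<Sum>q\<in>UNIV. R $ k $ q * M $ q $ l) =
          (\<Sum>q\<in>UNIV. (if q = i then R $ k $ i * M $ i $ l else 0) + (if q = j then R $ k $ j * M $ j $ l else 0) +
            (if q = k then (if k = i \<or> k = j then 0 else M $ k $ l) else 0))"
          using ij by (intro sum.cong) (auto simp: R_def)
        then have "(R ** M) $ k $ l = R $ k $ i * M $ i $ l + R $ k $ j * M $ j $ l + (if k = i \<or> k = j then 0 else M $ k $ l)"
          by (simp add: matrix_matrix_mult_def sum.distrib)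
        then show ?thesis using ij by (simp add: R_def)
      qed
      have "R ** transpose R = mat 1"
      proof -
        have "(R ** transpose R) $ k $ l = mat 1 $ k $ l" for k l
          unfolding RM transpose_nth using ij cs
          by (cases "k = i"; cases "k = j"; cases "l = i"; cases "l = j") (simp_all add: R_def mat_def mult.commute)
        then show ?thesis by (simp only: vec_eq_iff) simp
      qed
      then have "transpose R ** R = mat 1" using matrix_left_right_inverse by blast
      from max[OF this] have "trace (R ** S) \<le> trace S" unfolding trace_mul_sym[of R S] .
      moreover have "trace (R ** S) - trace S = (c * a + s * b) - a"
      proof -
        have "trace (R ** S) - trace S = (\<Sum>k\<in>UNIV. (R ** S) $ k $ k - S $ k $ k)" by (simp add: trace_def sum_subtractf)
        also have "\<dots> = (\<Sum>k\<in>UNIV. (if k = i then c * S $ i $ i - s * S $ j $ i - S $ i $ i else 0) +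
            (if k = j then s * S $ i $ j + c * S $ j $ j - S $ j $ j else 0))"
          using ij by (intro sum.cong) (auto simp: RM)
        also have "\<dots> = (c * a + s * b) - a" by (simp add: sum.distrib a_def b_def algebra_simps)
        finally show ?thesis .
      qed
      ultimately show ?thesis by (simp add: ac_simps)
    qed
    have "b = 0"
    proof (rule ccontr)
      assume "b \<noteq> 0"
      \<comment> \<open>The angle with \<open>cos = a / r\<close> and \<open>sin = b / r\<close> maximizes \<open>a * cos + b * sin\<close>.\<close>
      define r where "r = sqrt (a * a + b * b)"
      have pos: "a * a + b * b > 0" using \<open>b \<noteq> 0\<close> by (simp add: sum_squares_gt_zero_iff)
      have r: "r > 0" "r * r = a * a + b * b" using pos by (auto simp: r_def)
      have "(a / r) * (a / r) + (b / r) * (b / r) = 1"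
        using r(1) by (simp add: add_divide_distrib[symmetric] r(2)[symmetric])
      from rot[OF this] have "(a * a + b * b) / r \<le> a" by (simp add: add_divide_distrib)
      then have "r \<le> a" unfolding r(2)[symmetric] using r(1) by simp
      then have "r * r \<le> a * a" using r(1) by (intro mult_mono) auto
      then have "b * b \<le> 0" using r(2) by simp
      moreover have "b * b > 0" using \<open>b \<noteq> 0\<close> by (simp add: zero_less_mult_iff) linarith
      ultimately show False by simp
    qed
    then show ?thesis by (simp add: b_def)
  qed
  then show ?thesis by (simp add: vec_eq_iff transpose_nth) metis
qed

text \<open>
  A polar decomposition. If \<open>Q = G G\<^sup>T\<close>, then \<open>(G R) (G R)\<^sup>T = Q\<close> for all orthogonal \<open>R\<close>, and the factor \<open>G R\<close> is symmetric
  when \<open>R\<close> maximizes \<open>tr (G R)\<close> over the compact orthogonal group.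
\<close>

lemma pos_def_symmetric_root:
  fixes Q :: "real^'n^'n"
  assumes "pos_def Q"
  obtains S :: "real^'n^'n" where "invertible S" "transpose S = S" "S ** S = Q"
proof -
  obtain G :: "real^'n^'n" where G: "invertible G" "Q = G ** transpose G" using pos_def_factor[OF assms] .
  let ?O = "{R :: real^'n^'n. transpose R ** R = mat 1}"
  have "continuous_on ?O (\<lambda>R. trace (G ** R))"
    unfolding trace_def matrix_matrix_mult_def by (intro continuous_intros)
  moreover have "mat 1 \<in> ?O" by simp
  ultimately obtain R where R: "R \<in> ?O" "\<And>R'. R' \<in> ?O \<Longrightarrow> trace (G ** R') \<le> trace (G ** R)"
    using continuous_attains_sup[OF compact_orthogonal_matrices, of "\<lambda>R. trace (G ** R)"] by blast
  have R1: "transpose R ** R = mat 1" using R(1) by simp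
  then have R2: "R ** transpose R = mat 1" using matrix_left_right_inverse by blast
  let ?S = "G ** R"
  have sym: "transpose ?S = ?S"
  proof (rule symmetric_of_maximal_trace)
    fix R' :: "real^'n^'n" assume R': "transpose R' ** R' = mat 1"
    have "transpose (R ** R') ** (R ** R') = transpose R' ** (transpose R ** R) ** R'"
      by (simp add: matrix_transpose_mul matrix_mul_assoc)
    then have "R ** R' \<in> ?O" by (simp add: R1 R')
    from R(2)[OF this] show "trace (?S ** R') \<le> trace ?S" by (simp add: matrix_mul_assoc)
  qed
  have "?S ** ?S = ?S ** transpose ?S" by (simp only: sym)
  also have "\<dots> = G ** (R ** transpose R) ** transpose G" by (simp add: matrix_transpose_mul matrix_mul_assoc)
  finally have "?S ** ?S = Q" by (simp add: R2 G(2))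
  moreover have "invertible ?S" using G(1) matrix_inv_eqI(2)[OF R2] by (rule invertible_mult)
  ultimately show ?thesis using sym that by blast
qed

text \<open>
  The density of the measure on the cone that is invariant under all congruences.
\<close>

definition cone_haar :: "real^'n^'n \<Rightarrow> real" where
  "cone_haar Q = (if pos_def Q then det Q powr (- ((real CARD('n) + 1) / 2)) else 0)"

lemma borel_measurable_cone_haar [measurable (raw)]:
  fixes f :: "'a \<Rightarrow> real^'n^'n"
  assumes [measurable]: "f \<in> borel_measurable M"
  shows "(\<lambda>x. cone_haar (f x)) \<in> borel_measurable M"
  unfolding cone_haar_def by measurable

lemma cone_haar_invariant:
  fixes A :: "real^'n^'n" and f :: "real^'n^'n \<Rightarrow> ennreal"
  assumes A: "invertible A" and [measurable]: "f \<in> borel_measurable borel"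
  shows "(\<integral>\<^sup>+Q. ennreal (cone_haar Q) * f (A ** Q ** transpose A) \<partial>sym_lborel) = (\<integral>\<^sup>+Q. ennreal (cone_haar Q) * f Q \<partial>sym_lborel)"
proof -
  define d where "d = \<bar>det A\<bar>"
  have d: "d > 0" using A by (simp add: d_def invertible_det_nz)
  have w: "d ^ (CARD('n) + 1) * cone_haar (A ** Q ** transpose A) = cone_haar Q" for Q
  proof (cases "pos_def Q")
    case True
    have "det (A ** Q ** transpose A) = d powr 2 * det Q" using d by (simp add: det_mul d_def power2_eq_square)
    then have "cone_haar (A ** Q ** transpose A) = d powr (2 * (- ((real CARD('n) + 1) / 2))) * cone_haar Q"
      using True pos_def_congruence[OF A True] d pos_def_det_pos[OF True]
      by (simp add: cone_haar_def powr_mult powr_powr del: powr_numeral)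
    moreover have "d ^ (CARD('n) + 1) = d powr real (CARD('n) + 1)" by (rule powr_realpow[OF d, symmetric])
    moreover have "real (CARD('n) + 1) + 2 * (- ((real CARD('n) + 1) / 2)) = 0" by (simp add: field_simps)
    ultimately show ?thesis using d by (simp only: mult.assoc[symmetric] powr_add[symmetric]) simp
  next
    case False
    then show ?thesis by (simp add: cone_haar_def pos_def_congruence_iff[OF A])
  qed
  have "(\<integral>\<^sup>+Q. ennreal (cone_haar Q) * f Q \<partial>sym_lborel) = ennreal (\<bar>det A\<bar> ^ (CARD('n) + 1)) *
      (\<integral>\<^sup>+Q. ennreal (cone_haar (A ** Q ** transpose A)) * f (A ** Q ** transpose A) \<partial>sym_lborel)"
    by (rule sym_lborel_congruence[OF A]) measurable
  also have "\<dots> = (\<integral>\<^sup>+Q. ennreal (d ^ (CARD('n) + 1) * cone_haar (A ** Q ** transpose A)) * f (A ** Q ** transpose A) \<partial>sym_lborel)"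
    unfolding d_def using d by (subst nn_integral_cmult[symmetric]) (auto simp: ennreal_mult' mult.assoc simp del: power_Suc)
  finally show ?thesis unfolding w by simp
qed

text \<open>
  The double integral of \<open>f (A Q A\<^sup>T) h (A A\<^sup>T)\<close> against the invariant measures of the cone and of the general linear
  group is evaluated in two ways. Integrating over \<open>Q\<close> first gives the left side. Replacing \<open>A\<close> by \<open>A Q\<^sup>-\<^sup>1\<^sup>/\<^sup>2\<close> first turns the
  arguments into \<open>A A\<^sup>T\<close> and \<open>A Q\<^sup>-\<^sup>1 A\<^sup>T\<close> and gives the right side. This is the usual argument for the uniqueness of an
  invariant measure, and the place where a symmetric root is essential.
\<close>

lemma haar_cone_duality:
  fixes f h :: "real^'n^'n \<Rightarrow> ennreal"
  defines "u \<equiv> \<lambda>A :: real^'n^'n. ennreal (\<bar>det A\<bar> powr (- real CARD('n)))"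
  assumes [measurable]: "f \<in> borel_measurable borel" "h \<in> borel_measurable borel"
  shows "(\<integral>\<^sup>+Q. ennreal (cone_haar Q) * f Q \<partial>sym_lborel) * (\<integral>\<^sup>+A. u A * h (A ** transpose A) \<partial>lborel) =
    (\<integral>\<^sup>+Q. ennreal (cone_haar Q) * h (matrix_inv Q) \<partial>sym_lborel) * (\<integral>\<^sup>+A. u A * f (A ** transpose A) \<partial>lborel)"
proof -
  interpret pair_sigma_finite "lborel :: (real^'n^'n) measure" "sym_lborel :: (real^'n^'n) measure" ..
  let ?w = "\<lambda>Q. ennreal (cone_haar (Q :: real^'n^'n))"
  have [measurable]: "u \<in> borel_measurable borel" unfolding u_def by measurable
  have u0: "u A = 0" if "\<not> invertible A" for A using that by (simp add: u_def invertible_det_nz)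
  have "(\<integral>\<^sup>+Q. ?w Q * f Q \<partial>sym_lborel) * (\<integral>\<^sup>+A. u A * h (A ** transpose A) \<partial>lborel) =
      (\<integral>\<^sup>+A. (\<integral>\<^sup>+Q. ?w Q * f Q \<partial>sym_lborel) * (u A * h (A ** transpose A)) \<partial>lborel)"
    by (rule nn_integral_cmult[symmetric]) measurable
  also have "\<dots> = (\<integral>\<^sup>+A. (\<integral>\<^sup>+Q. (?w Q * f (A ** Q ** transpose A)) * (u A * h (A ** transpose A)) \<partial>sym_lborel) \<partial>lborel)"
  proof (rule nn_integral_cong)
    fix A :: "real^'n^'n"
    have "(\<integral>\<^sup>+Q. ?w Q * f Q \<partial>sym_lborel) * (u A * h (A ** transpose A)) =
      (\<integral>\<^sup>+Q. ?w Q * f (A ** Q ** transpose A) \<partial>sym_lborel) * (u A * h (A ** transpose A))"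
      by (cases "invertible A") (simp_all add: cone_haar_invariant u0)
    also have "\<dots> = (\<integral>\<^sup>+Q. (?w Q * f (A ** Q ** transpose A)) * (u A * h (A ** transpose A)) \<partial>sym_lborel)"
      by (rule nn_integral_multc[symmetric]) measurable
    finally show "(\<integral>\<^sup>+Q. ?w Q * f Q \<partial>sym_lborel) * (u A * h (A ** transpose A)) =
      (\<integral>\<^sup>+Q. (?w Q * f (A ** Q ** transpose A)) * (u A * h (A ** transpose A)) \<partial>sym_lborel)" .
  qed
  also have "\<dots> = (\<integral>\<^sup>+Q. (\<integral>\<^sup>+A. (?w Q * f (A ** Q ** transpose A)) * (u A * h (A ** transpose A)) \<partial>lborel) \<partial>sym_lborel)"
    by (rule Fubini'[symmetric]) measurable
  also have "\<dots> = (\<integral>\<^sup>+Q. (\<integral>\<^sup>+A. (?w Q * h (A ** matrix_inv Q ** transpose A)) * (u A * f (A ** transpose A)) \<partial>lborel) \<partial>sym_lborel)"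
  proof (rule nn_integral_cong)
    fix Q :: "real^'n^'n"
    show "(\<integral>\<^sup>+A. (?w Q * f (A ** Q ** transpose A)) * (u A * h (A ** transpose A)) \<partial>lborel) =
      (\<integral>\<^sup>+A. (?w Q * h (A ** matrix_inv Q ** transpose A)) * (u A * f (A ** transpose A)) \<partial>lborel)"
    proof (cases "pos_def Q")
      case True
      obtain S :: "real^'n^'n" where S: "invertible S" "transpose S = S" "S ** S = Q"
        using pos_def_symmetric_root[OF True] .
      let ?B = "matrix_inv S"
      have B: "invertible ?B" "transpose ?B = ?B"
        using invertible_matrix_inv(1)[OF S(1)] matrix_inv_transpose[OF S(1)] S(2) by auto
      have BB: "?B ** ?B = matrix_inv Q" unfolding S(3)[symmetric] by (simp add: matrix_inv_mult_distrib S(1))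
      have BQB: "?B ** Q ** ?B = mat 1"
        unfolding S(3)[symmetric] by (simp add: matrix_mul_assoc matrix_inv_mult[OF S(1)])
      have fB: "(A ** ?B) ** Q ** transpose (A ** ?B) = A ** transpose A" for A :: "real^'n^'n"
      proof -
        have "(A ** ?B) ** Q ** transpose (A ** ?B) = A ** (?B ** Q ** ?B) ** transpose A"
          by (simp add: matrix_transpose_mul B(2) matrix_mul_assoc)
        then show ?thesis by (simp add: BQB)
      qed
      have hB: "(A ** ?B) ** transpose (A ** ?B) = A ** matrix_inv Q ** transpose A" for A :: "real^'n^'n"
        by (simp add: matrix_transpose_mul B(2) matrix_mul_assoc BB[symmetric])
      define d where "d = \<bar>det ?B\<bar>"
      have d: "d > 0" using B(1) by (simp add: d_def invertible_det_nz)
      have uB: "ennreal (d ^ CARD('n)) * u (A ** ?B) = u A" for A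
      proof -
        have "d ^ CARD('n) * \<bar>det (A ** ?B)\<bar> powr (- real CARD('n)) = \<bar>det A\<bar> powr (- real CARD('n)) * (d powr real CARD('n) * d powr (- real CARD('n)))"
          using d by (simp add: det_mul abs_mult powr_mult d_def powr_realpow)
        also have "d powr real CARD('n) * d powr (- real CARD('n)) = 1" using d by (simp add: powr_add[symmetric])
        finally show ?thesis using d unfolding u_def by (subst ennreal_mult'[symmetric]) auto
      qed
      have "(\<integral>\<^sup>+A. (?w Q * f (A ** Q ** transpose A)) * (u A * h (A ** transpose A)) \<partial>lborel) =
          ennreal (\<bar>det ?B\<bar> ^ CARD('n)) * (\<integral>\<^sup>+A. (?w Q * f ((A ** ?B) ** Q ** transpose (A ** ?B))) * (u (A ** ?B) * h ((A ** ?B) ** transpose (A ** ?B))) \<partial>lborel)"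
        by (rule lborel_right_mult[OF B(1)]) measurable
      also have "\<dots> = (\<integral>\<^sup>+A. ennreal (d ^ CARD('n)) * ((?w Q * f (A ** transpose A)) * (u (A ** ?B) * h (A ** matrix_inv Q ** transpose A))) \<partial>lborel)"
        unfolding fB hB d_def by (rule nn_integral_cmult[symmetric]) measurable
      also have "\<dots> = (\<integral>\<^sup>+A. (?w Q * h (A ** matrix_inv Q ** transpose A)) * (u A * f (A ** transpose A)) \<partial>lborel)"
      proof (rule nn_integral_cong)
        fix A :: "real^'n^'n"
        show "ennreal (d ^ CARD('n)) * ((?w Q * f (A ** transpose A)) * (u (A ** ?B) * h (A ** matrix_inv Q ** transpose A))) =
            (?w Q * h (A ** matrix_inv Q ** transpose A)) * (u A * f (A ** transpose A))"
          unfolding uB[of A, symmetric] by (simp only: ac_simps)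
      qed
      finally show ?thesis .
    next
      case False
      then show ?thesis by (simp add: cone_haar_def)
    qed
  qed
  also have "\<dots> = (\<integral>\<^sup>+A. (\<integral>\<^sup>+Q. (?w Q * h (A ** matrix_inv Q ** transpose A)) * (u A * f (A ** transpose A)) \<partial>sym_lborel) \<partial>lborel)"
    by (rule Fubini') measurable
  also have "\<dots> = (\<integral>\<^sup>+A. (\<integral>\<^sup>+Q. ?w Q * h (matrix_inv Q) \<partial>sym_lborel) * (u A * f (A ** transpose A)) \<partial>lborel)"
  proof (rule nn_integral_cong)
    fix A :: "real^'n^'n"
    have "(\<integral>\<^sup>+Q. (?w Q * h (A ** matrix_inv Q ** transpose A)) * (u A * f (A ** transpose A)) \<partial>sym_lborel) =
        (\<integral>\<^sup>+Q. ?w Q * h (A ** matrix_inv Q ** transpose A) \<partial>sym_lborel) * (u A * f (A ** transpose A))"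
      by (rule nn_integral_multc) measurable
    also have "\<dots> = (\<integral>\<^sup>+Q. ?w Q * h (matrix_inv Q) \<partial>sym_lborel) * (u A * f (A ** transpose A))"
    proof (cases "invertible A")
      case True
      let ?D = "transpose (matrix_inv A)"
      have D: "invertible ?D" using True by (intro transpose_invertible invertible_matrix_inv)
      have "(\<integral>\<^sup>+Q. ?w Q * h (A ** matrix_inv Q ** transpose A) \<partial>sym_lborel) =
          (\<integral>\<^sup>+Q. ?w Q * h (matrix_inv (?D ** Q ** transpose ?D)) \<partial>sym_lborel)"
      proof (rule nn_integral_cong)
        fix Q :: "real^'n^'n"
        show "?w Q * h (A ** matrix_inv Q ** transpose A) = ?w Q * h (matrix_inv (?D ** Q ** transpose ?D))"
        proof (cases "pos_def Q")
          case Q: True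
          have "matrix_inv ?D = transpose A"
            using matrix_inv_transpose[OF invertible_matrix_inv(1)[OF True]] invertible_matrix_inv(2)[OF True] by simp
          then show ?thesis
            using matrix_inv_congruence[OF D pos_def_invertible[OF Q]] by simp
        qed (simp add: cone_haar_def)
      qed
      also have "\<dots> = (\<integral>\<^sup>+Q. ?w Q * h (matrix_inv Q) \<partial>sym_lborel)"
        using cone_haar_invariant[OF D, of "\<lambda>Q. h (matrix_inv Q)"] by simp
      finally show ?thesis by simp
    qed (simp add: u0)
    finally show "(\<integral>\<^sup>+Q. (?w Q * h (A ** matrix_inv Q ** transpose A)) * (u A * f (A ** transpose A)) \<partial>sym_lborel) =
        (\<integral>\<^sup>+Q. ?w Q * h (matrix_inv Q) \<partial>sym_lborel) * (u A * f (A ** transpose A))" .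
  qed
  also have "\<dots> = (\<integral>\<^sup>+Q. ?w Q * h (matrix_inv Q) \<partial>sym_lborel) * (\<integral>\<^sup>+A. u A * f (A ** transpose A) \<partial>lborel)"
    by (rule nn_integral_cmult) measurable
  finally show ?thesis .
qed

lemma AE_lborel_det_nonzero_frequently: "\<not> (AE A in (lborel :: (real^'n^'n) measure). det A = 0)"
proof
  assume ae: "AE A in (lborel :: (real^'n^'n) measure). det A = 0"
  let ?U = "{A :: real^'n^'n. det A \<noteq> 0}"
  have "open ?U" unfolding det_def by (intro open_Collect_neq continuous_intros)
  moreover have "mat 1 \<in> ?U" by simp
  ultimately have "\<not> negligible ?U" using open_not_negligible by blast
  moreover have "?U \<in> sets lborel" using borel_open[OF \<open>open ?U\<close>] by simp
  then have "?U \<in> null_sets lborel" using ae by (subst AE_iff_null_sets) auto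
  then have "negligible ?U" by (simp add: negligible_iff_null_sets null_sets_completionI)
  ultimately show False by blast
qed

text \<open>
  In \<open>haar_cone_duality\<close> with \<open>f = h\<close> the factor common to both sides cancels: \<open>h\<close> and its composition with the
  inversion have the same integral. Using this for one fixed \<open>h\<close>, the duality for \<open>(f, h)\<close> and for \<open>(h, f)\<close> gives the claim
  for every \<open>f\<close>.
\<close>

lemma cone_haar_inversion:
  fixes f :: "real^'n^'n \<Rightarrow> ennreal"
  assumes [measurable]: "f \<in> borel_measurable borel"
  shows "(\<integral>\<^sup>+Q. ennreal (cone_haar Q) * f (matrix_inv Q) \<partial>sym_lborel) = (\<integral>\<^sup>+Q. ennreal (cone_haar Q) * f Q \<partial>sym_lborel)"
proof -
  let ?n = "real CARD('n)"
  define u where "u A = ennreal (\<bar>det A\<bar> powr (- ?n))" for A :: "real^'n^'n"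
  \<comment> \<open>Chosen such that \<open>u A * h (A A\<^sup>T)\<close> is a Gaussian function of \<open>A\<close>, whose integral \<open>E\<close> is positive and finite.\<close>
  define h where "h Q = ennreal (det Q powr (?n / 2) * exp (- trace Q))" for Q :: "real^'n^'n"
  have hm [measurable]: "h \<in> borel_measurable borel" unfolding h_def by measurable
  have [measurable]: "u \<in> borel_measurable borel" unfolding u_def by measurable
  note dual = haar_cone_duality[where 'n='n, folded u_def]
  define E where "E = (\<integral>\<^sup>+A. u A * h (A ** transpose A) \<partial>lborel)"
  have uh: "u A * h (A ** transpose A) = (if det A = 0 then 0 else ennreal (exp (- (norm A)\<^sup>2)))" for A
  proof (cases "det A = 0")
    case False
    define d where "d = \<bar>det A\<bar>"
    have d: "d > 0" using False by (simp add: d_def)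
    have "det (A ** transpose A) = d powr 2" using d by (simp add: det_mul d_def power2_eq_square)
    then have "d powr (- ?n) * (det (A ** transpose A) powr (?n / 2) * exp (- trace (A ** transpose A))) = exp (- (norm A)\<^sup>2)"
      using d by (simp add: powr_powr trace_mult_transpose powr_add[symmetric] mult.assoc[symmetric] del: powr_numeral)
    with False show ?thesis unfolding u_def h_def d_def[symmetric] by (subst ennreal_mult'[symmetric]) auto
  qed (simp add: u_def)
  have "E \<noteq> 0"
  proof
    assume "E = 0"
    then have "AE A in lborel. u A * h (A ** transpose A) = 0" unfolding E_def by (subst (asm) nn_integral_0_iff_AE) auto
    then have "AE A in (lborel :: (real^'n^'n) measure). det A = 0"
      unfolding uh by eventually_elim (simp split: if_splits)
    then show False using AE_lborel_det_nonzero_frequently by blast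
  qed
  have "E < \<infinity>"
  proof -
    have "E \<le> (\<integral>\<^sup>+A. ennreal (exp (- (norm (A :: real^'n^'n))\<^sup>2 / 2)) \<partial>lborel)"
      unfolding E_def uh by (intro nn_integral_mono) (auto intro!: ennreal_leI)
    also have "\<dots> < \<infinity>" using gaussian_mass_finite[where 'p='n and 'm='n] unfolding gaussian_mass_def .
    finally show ?thesis .
  qed
  have cancel: "x = y" if "x * E = y * E" for x y
    using that \<open>E \<noteq> 0\<close> \<open>E < \<infinity>\<close> by (auto simp: mult.commute[of _ E] ennreal_mult_cancel_left)
  have eq: "(\<integral>\<^sup>+Q. ennreal (cone_haar Q) * h Q \<partial>sym_lborel) = (\<integral>\<^sup>+Q. ennreal (cone_haar Q) * h (matrix_inv Q) \<partial>sym_lborel)"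
    using dual[OF hm hm, folded E_def] by (rule cancel)
  have "(\<integral>\<^sup>+Q. ennreal (cone_haar Q) * f (matrix_inv Q) \<partial>sym_lborel) * E =
      (\<integral>\<^sup>+Q. ennreal (cone_haar Q) * h Q \<partial>sym_lborel) * (\<integral>\<^sup>+A. u A * f (A ** transpose A) \<partial>lborel)"
    using dual[OF hm assms, folded E_def] by (rule sym)
  also have "\<dots> = (\<integral>\<^sup>+Q. ennreal (cone_haar Q) * f Q \<partial>sym_lborel) * E"
    using dual[OF assms hm, folded E_def] unfolding eq by (rule sym)
  finally show ?thesis by (rule cancel)
qed

text \<open>
  The Jacobian of the inversion, read off from the invariance of \<open>|Q|\<^sup>-\<^sup>(\<^sup>n\<^sup>+\<^sup>1\<^sup>)\<^sup>/\<^sup>2 dQ\<close>.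
\<close>

lemma sym_lborel_inversion:
  fixes g :: "real^'n^'n \<Rightarrow> ennreal"
  assumes [measurable]: "g \<in> borel_measurable borel"
  shows "(\<integral>\<^sup>+Q. (if pos_def Q then g Q else 0) \<partial>sym_lborel) =
    (\<integral>\<^sup>+Q. (if pos_def Q then ennreal (det Q powr (- (real CARD('n) + 1))) * g (matrix_inv Q) else 0) \<partial>sym_lborel)"
proof -
  let ?\<kappa> = "(real CARD('n) + 1) / 2"
  let ?f = "\<lambda>Q. ennreal (det Q powr ?\<kappa>) * g Q"
  have "ennreal (cone_haar Q) * ?f Q = (if pos_def Q then g Q else 0)" for Q :: "real^'n^'n"
  proof (cases "pos_def Q")
    case True
    have "ennreal (det Q powr (- ?\<kappa>)) * ennreal (det Q powr ?\<kappa>) = 1"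
      using pos_def_det_pos[OF True] by (subst ennreal_mult'[symmetric]) (simp_all add: powr_add[symmetric])
    with True show ?thesis by (simp add: cone_haar_def mult.assoc[symmetric])
  qed (simp add: cone_haar_def)
  moreover have "ennreal (cone_haar Q) * ?f (matrix_inv Q) =
      (if pos_def Q then ennreal (det Q powr (- (real CARD('n) + 1))) * g (matrix_inv Q) else 0)" for Q :: "real^'n^'n"
  proof (cases "pos_def Q")
    case True
    note d = pos_def_det_pos[OF True]
    have e: "- (real CARD('n) + 1) = - ?\<kappa> + - ?\<kappa>" by (simp add: field_simps)
    have "det Q powr (- ?\<kappa>) * det (matrix_inv Q) powr ?\<kappa> = det Q powr (- (real CARD('n) + 1))"
      unfolding e powr_add using d det_matrix_inv[OF pos_def_invertible[OF True]] by (simp add: powr_divide powr_minus_divide)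
    then have "ennreal (det Q powr (- ?\<kappa>)) * ennreal (det (matrix_inv Q) powr ?\<kappa>) = ennreal (det Q powr (- (real CARD('n) + 1)))"
      by (subst ennreal_mult'[symmetric]) simp_all
    with True show ?thesis by (simp add: cone_haar_def mult.assoc[symmetric])
  qed (simp add: cone_haar_def)
  ultimately show ?thesis using cone_haar_inversion[of ?f] by simp
qed

section \<open>Completing the square and the Woodbury identity\<close>

lemma matrix_add_rdistrib: "(B + C) ** A = B ** A + (C :: real^'p^'n) ** A"
  by (simp add: vec_eq_iff matrix_matrix_mult_def sum.distrib algebra_simps)

lemma trace_transpose: "trace (transpose A) = trace (A :: real^'n^'n)"
  by (simp add: trace_def transpose_def)

lemma trace_cross_symmetric:
  fixes M :: "real^'k^'k" and Q :: "real^'p^'p" and Y Z :: "real^'p^'k"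
  assumes "transpose M = M" "transpose Q = Q"
  shows "trace (M ** Y ** Q ** transpose Z) = trace (M ** Z ** Q ** transpose Y)"
proof -
  have "trace (M ** Y ** Q ** transpose Z) = trace (transpose (M ** Y ** Q ** transpose Z))"
    by (rule trace_transpose[symmetric])
  also have "transpose (M ** Y ** Q ** transpose Z) = (Z ** Q ** transpose Y) ** M"
    by (simp add: matrix_transpose_mul matrix_mul_assoc assms)
  also have "trace \<dots> = trace (M ** (Z ** Q ** transpose Y))" by (rule trace_mul_sym)
  finally show ?thesis by (simp add: matrix_mul_assoc)
qed

lemma trace_square_diff:
  fixes M :: "real^'k^'k" and Q :: "real^'p^'p" and Y Z :: "real^'p^'k"
  assumes "transpose M = M" "transpose Q = Q"
  shows "trace (M ** (Y - Z) ** Q ** transpose (Y - Z)) =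
    trace (M ** Y ** Q ** transpose Y) - 2 * trace (M ** Z ** Q ** transpose Y) + trace (M ** Z ** Q ** transpose Z)"
  using trace_cross_symmetric[OF assms, of Y Z]
  by (simp add: matrix_diff_ldistrib matrix_diff_rdistrib transpose_diff trace_sub)

text \<open>
  The exponents of the likelihood of \<open>Y\<close> and of a centred normal prior for \<open>\<Theta>\<close> add up to a square in \<open>\<Theta>\<close> around the
  generalized least squares solution \<open>W\<close> and a quadratic form in \<open>Y\<close>.
\<close>

lemma complete_square:
  fixes X :: "real^'k^'j" and L :: "real^'j^'j" and N :: "real^'k^'k" and Q :: "real^'p^'p"
    and Y :: "real^'p^'j" and \<Theta> :: "real^'p^'k"
  defines "V \<equiv> N + transpose X ** L ** X"
  defines "W \<equiv> matrix_inv V ** transpose X ** L ** Y"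
  assumes sym: "transpose L = L" "transpose N = N" "transpose Q = Q" and inv: "invertible V"
  shows "trace (L ** (Y - X ** \<Theta>) ** Q ** transpose (Y - X ** \<Theta>)) + trace (N ** \<Theta> ** Q ** transpose \<Theta>) =
    trace (V ** (\<Theta> - W) ** Q ** transpose (\<Theta> - W)) +
    trace ((L - L ** X ** matrix_inv V ** transpose X ** L) ** Y ** Q ** transpose Y)"
proof -
  have V: "transpose V = V"
    by (simp add: V_def transpose_add matrix_transpose_mul matrix_mul_assoc sym)
  have Vi: "transpose (matrix_inv V) = matrix_inv V" using matrix_inv_transpose[OF inv] V by simp
  have VW: "V ** W = transpose X ** L ** Y"
    unfolding W_def matrix_mul_assoc matrix_inv_mult(1)[OF inv] by simp
  have cross: "trace (L ** (X ** \<Theta>) ** Q ** transpose Y) = trace (V ** W ** Q ** transpose \<Theta>)"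
  proof -
    have "trace (L ** (X ** \<Theta>) ** Q ** transpose Y) = trace (L ** Y ** Q ** transpose (X ** \<Theta>))"
      by (rule trace_cross_symmetric[OF sym(1,3)])
    also have "\<dots> = trace ((L ** Y ** Q ** transpose \<Theta>) ** transpose X)" by (simp add: matrix_transpose_mul matrix_mul_assoc)
    also have "\<dots> = trace (transpose X ** (L ** Y ** Q ** transpose \<Theta>))" by (rule trace_mul_sym)
    finally show ?thesis unfolding VW by (simp add: matrix_mul_assoc)
  qed
  have quad: "trace (L ** (X ** \<Theta>) ** Q ** transpose (X ** \<Theta>)) + trace (N ** \<Theta> ** Q ** transpose \<Theta>) = trace (V ** \<Theta> ** Q ** transpose \<Theta>)"
  proof -
    have "trace (L ** (X ** \<Theta>) ** Q ** transpose (X ** \<Theta>)) = trace ((L ** X ** \<Theta> ** Q ** transpose \<Theta>) ** transpose X)"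
      by (simp add: matrix_transpose_mul matrix_mul_assoc)
    also have "\<dots> = trace (transpose X ** (L ** X ** \<Theta> ** Q ** transpose \<Theta>))" by (rule trace_mul_sym)
    finally show ?thesis by (simp add: V_def matrix_mul_assoc matrix_add_rdistrib trace_add)
  qed
  have rest: "trace (V ** W ** Q ** transpose W) = trace (L ** X ** matrix_inv V ** transpose X ** L ** Y ** Q ** transpose Y)"
  proof -
    have "transpose W = transpose Y ** L ** X ** matrix_inv V"
      by (simp add: W_def matrix_transpose_mul matrix_mul_assoc sym Vi)
    then have "trace (V ** W ** Q ** transpose W) = trace ((transpose X ** L ** Y ** Q ** transpose Y) ** (L ** X ** matrix_inv V))"
      unfolding VW by (simp add: matrix_mul_assoc)
    also have "\<dots> = trace ((L ** X ** matrix_inv V) ** (transpose X ** L ** Y ** Q ** transpose Y))" by (rule trace_mul_sym)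
    finally show ?thesis by (simp add: matrix_mul_assoc)
  qed
  have WT: "trace (V ** \<Theta> ** Q ** transpose W) = trace (V ** W ** Q ** transpose \<Theta>)"
    by (rule trace_cross_symmetric[OF V sym(3)])
  show ?thesis
    unfolding trace_square_diff[OF sym(1,3)] trace_square_diff[OF V sym(3)] cross
    using quad rest WT by (simp add: matrix_diff_rdistrib trace_sub)
qed

lemma woodbury:
  fixes X :: "real^'p^'m" and L :: "real^'m^'m" and s :: "real^'p^'p"
  assumes L: "pos_def L" and s: "pos_def s"
  defines "V \<equiv> s + transpose X ** L ** X"
    and "G \<equiv> matrix_inv (matrix_inv L + X ** matrix_inv s ** transpose X)"
  shows "pos_def V" and "pos_def G"
    and "L ** X ** matrix_inv V = G ** X ** matrix_inv s"
    and "matrix_inv V = matrix_inv s - matrix_inv s ** transpose X ** G ** X ** matrix_inv s"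
    and "L - L ** X ** matrix_inv V ** transpose X ** L = G"
proof -
  show V: "pos_def V" using pos_def_add_congruence[OF s L, of "transpose X"] by (simp add: V_def)
  let ?H = "matrix_inv L + X ** matrix_inv s ** transpose X"
  have H: "pos_def ?H" using pos_def_add_congruence[OF pos_def_matrix_inv[OF L] pos_def_matrix_inv[OF s]] .
  then show "pos_def G" unfolding G_def by (rule pos_def_matrix_inv)
  note iL = pos_def_invertible[OF L] and ivs = pos_def_invertible[OF s] and iV = pos_def_invertible[OF V] and iH = pos_def_invertible[OF H]
  have GH: "G ** ?H = mat 1" unfolding G_def by (rule matrix_inv_mult(2)[OF iH])
  have push: "?H ** (L ** X) = X ** matrix_inv s ** V"
  proof -
    have "?H ** (L ** X) = X + X ** matrix_inv s ** (transpose X ** L ** X)"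
      by (simp add: matrix_add_rdistrib matrix_inv_mult[OF iL] matrix_mul_assoc)
    also have "\<dots> = X ** matrix_inv s ** V"
      by (simp add: V_def matrix_add_ldistrib matrix_cancel_right[OF ivs])
    finally show ?thesis .
  qed
  have "G ** (?H ** (L ** X)) ** matrix_inv V = G ** X ** matrix_inv s"
    unfolding push by (simp add: matrix_mul_assoc matrix_cancel_right[OF iV])
  then show LXV: "L ** X ** matrix_inv V = G ** X ** matrix_inv s"
    by (simp add: matrix_mul_assoc GH)
  have "matrix_inv s ** V ** matrix_inv V = matrix_inv V + matrix_inv s ** transpose X ** (L ** X ** matrix_inv V)"
    by (simp add: V_def matrix_add_ldistrib matrix_add_rdistrib matrix_inv_mult[OF ivs] matrix_mul_assoc)
  then show "matrix_inv V = matrix_inv s - matrix_inv s ** transpose X ** G ** X ** matrix_inv s"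
    unfolding matrix_cancel_right[OF iV] LXV eq_diff_eq matrix_mul_assoc by (rule sym)
  have "L = G ** (?H ** L)" by (simp add: matrix_mul_assoc GH)
  also have "\<dots> = G + G ** X ** matrix_inv s ** transpose X ** L"
    by (simp add: matrix_add_rdistrib matrix_add_ldistrib matrix_inv_mult[OF iL] matrix_mul_assoc)
  finally show "L - L ** X ** matrix_inv V ** transpose X ** L = G"
    unfolding LXV by (subst diff_eq_eq)
qed

lemma lborel_translation:
  fixes f :: "real^'p^'m \<Rightarrow> ennreal"
  assumes "f \<in> borel_measurable borel"
  shows "(\<integral>\<^sup>+Z. f (Z - W) \<partial>lborel) = (\<integral>\<^sup>+Z. f Z \<partial>lborel)"
proof -
  have "(\<integral>\<^sup>+Z. f (Z - W) \<partial>lborel) = (\<integral>\<^sup>+Z. f Z \<partial>distr lborel borel ((+) (- W)))"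
    using assms by (subst nn_integral_distr) auto
  then show ?thesis by (simp add: lborel_distr_plus)
qed

text \<open>
  The double integral of \<open>exp (- (q\<^sup>T s q + (z - X q)\<^sup>T L (z - X q)) / 2)\<close> over the columns \<open>q\<close> and \<open>z\<close> is the product of
  two Gaussian integrals in either order: with matrices \<open>L\<close> and \<open>s\<close> if \<open>z\<close> is integrated first, and after completing the
  square with matrices \<open>V\<close> and \<open>G\<close>. Columns are matrices of type \<open>real^1^'n\<close> here, so that the matrix Gaussian integral
  applies.
\<close>

lemma det_woodbury:
  fixes X :: "real^'p^'m" and L :: "real^'m^'m" and s :: "real^'p^'p"
  assumes L: "pos_def L" and s: "pos_def s"
  shows "det (s + transpose X ** L ** X) = det s * det L * det (matrix_inv L + X ** matrix_inv s ** transpose X)"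
proof -
  let ?V = "s + transpose X ** L ** X" and ?H = "matrix_inv L + X ** matrix_inv s ** transpose X"
  let ?G = "matrix_inv ?H"
  let ?one = "mat 1 :: real^1^1"
  note wb = woodbury[OF L s, of X]
  have iV: "invertible ?V" using wb(1) by (rule pos_def_invertible)
  have H: "pos_def ?H" using pos_def_add_congruence[OF pos_def_matrix_inv[OF L] pos_def_matrix_inv[OF s]] .
  have one: "pos_def ?one" by simp
  let ?gm = "gaussian_mass TYPE(1) TYPE('m)" and ?gp = "gaussian_mass TYPE(1) TYPE('p)"
  let ?J = "\<lambda>(q :: real^1^'p) (z :: real^1^'m). ennreal (gaussian_kernel s ?one q * gaussian_kernel L ?one (z - X ** q))"
  have "(\<integral>\<^sup>+q. (\<integral>\<^sup>+z. ?J q z \<partial>lborel) \<partial>lborel) =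
      (\<integral>\<^sup>+q. ennreal (gaussian_kernel s ?one q) * (ennreal (det L powr (- 1 / 2)) * ?gm) \<partial>lborel)"
  proof (rule nn_integral_cong)
    fix q :: "real^1^'p"
    have "(\<integral>\<^sup>+z. ?J q z \<partial>lborel) = ennreal (gaussian_kernel s ?one q) * (\<integral>\<^sup>+z. ennreal (gaussian_kernel L ?one (z - X ** q)) \<partial>lborel)"
      by (subst nn_integral_cmult[symmetric]) (auto simp: ennreal_mult' gaussian_kernel_def[of s])
    also have "(\<integral>\<^sup>+z. ennreal (gaussian_kernel L ?one (z - X ** q)) \<partial>lborel) = (\<integral>\<^sup>+z. ennreal (gaussian_kernel L ?one z) \<partial>lborel)"
      by (rule lborel_translation) measurable
    also have "\<dots> = ennreal (det L powr (- 1 / 2)) * ?gm" using gaussian_integral[OF L one] by simp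
    finally show "(\<integral>\<^sup>+z. ?J q z \<partial>lborel) = ennreal (gaussian_kernel s ?one q) * (ennreal (det L powr (- 1 / 2)) * ?gm)" .
  qed
  also have "\<dots> = (ennreal (det s powr (- 1 / 2)) * ?gp) * (ennreal (det L powr (- 1 / 2)) * ?gm)"
    using gaussian_integral[OF s one] by (subst nn_integral_multc) auto
  finally have I1: "(\<integral>\<^sup>+q. (\<integral>\<^sup>+z. ?J q z \<partial>lborel) \<partial>lborel) = (ennreal (det s powr (- 1 / 2)) * ?gp) * (ennreal (det L powr (- 1 / 2)) * ?gm)" .
  have J: "?J q z = ennreal (gaussian_kernel ?G ?one z) * ennreal (gaussian_kernel ?V ?one (q - matrix_inv ?V ** transpose X ** L ** z))" for q z
  proof -
    have "trace (L ** (z - X ** q) ** ?one ** transpose (z - X ** q)) + trace (s ** q ** ?one ** transpose q) =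
      trace (?V ** (q - matrix_inv ?V ** transpose X ** L ** z) ** ?one ** transpose (q - matrix_inv ?V ** transpose X ** L ** z)) +
      trace ((L - L ** X ** matrix_inv ?V ** transpose X ** L) ** z ** ?one ** transpose z)"
      by (rule complete_square[where N=s]) (simp_all add: pos_def_symmetric[OF L] pos_def_symmetric[OF s] iV)
    then have "gaussian_kernel s ?one q * gaussian_kernel L ?one (z - X ** q) =
       gaussian_kernel ?G ?one z * gaussian_kernel ?V ?one (q - matrix_inv ?V ** transpose X ** L ** z)"
      unfolding gaussian_kernel_def exp_add[symmetric] wb(5) by (simp add: add_divide_distrib[symmetric])
    then show ?thesis by (simp add: ennreal_mult' gaussian_kernel_def[of ?G])
  qed
  have "(\<integral>\<^sup>+q. (\<integral>\<^sup>+z. ?J q z \<partial>lborel) \<partial>lborel) = (\<integral>\<^sup>+z. (\<integral>\<^sup>+q. ?J q z \<partial>lborel) \<partial>lborel)"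
    by (rule lborel_pair.Fubini') measurable
  also have "\<dots> = (\<integral>\<^sup>+z. ennreal (gaussian_kernel ?G ?one z) * (ennreal (det ?V powr (- 1 / 2)) * ?gp) \<partial>lborel)"
  proof (rule nn_integral_cong)
    fix z :: "real^1^'m"
    have "(\<integral>\<^sup>+q. ?J q z \<partial>lborel) = ennreal (gaussian_kernel ?G ?one z) *
        (\<integral>\<^sup>+q. ennreal (gaussian_kernel ?V ?one (q - matrix_inv ?V ** transpose X ** L ** z)) \<partial>lborel)"
      unfolding J by (rule nn_integral_cmult) measurable
    also have "(\<integral>\<^sup>+q. ennreal (gaussian_kernel ?V ?one (q - matrix_inv ?V ** transpose X ** L ** z)) \<partial>lborel) = (\<integral>\<^sup>+q. ennreal (gaussian_kernel ?V ?one q) \<partial>lborel)"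
      by (rule lborel_translation) measurable
    also have "\<dots> = ennreal (det ?V powr (- 1 / 2)) * ?gp" using gaussian_integral[OF wb(1) one] by simp
    finally show "(\<integral>\<^sup>+q. ?J q z \<partial>lborel) = ennreal (gaussian_kernel ?G ?one z) * (ennreal (det ?V powr (- 1 / 2)) * ?gp)" .
  qed
  also have "\<dots> = (ennreal (det ?G powr (- 1 / 2)) * ?gm) * (ennreal (det ?V powr (- 1 / 2)) * ?gp)"
    using gaussian_integral[OF wb(2) one] by (subst nn_integral_multc) auto
  finally have I2: "(ennreal (det s powr (- 1 / 2)) * ?gp) * (ennreal (det L powr (- 1 / 2)) * ?gm) =
      (ennreal (det ?G powr (- 1 / 2)) * ?gm) * (ennreal (det ?V powr (- 1 / 2)) * ?gp)"
    unfolding I1 .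
  have g: "?gm * ?gp \<noteq> 0" "?gm * ?gp \<noteq> top"
    using gaussian_mass_pos[where 'p=1 and 'm='m] gaussian_mass_finite[where 'p=1 and 'm='m]
      gaussian_mass_pos[where 'p=1 and 'm='p] gaussian_mass_finite[where 'p=1 and 'm='p]
    by (auto simp: ennreal_mult_eq_top_iff)
  have "(?gm * ?gp) * ennreal (det s powr (- 1 / 2) * det L powr (- 1 / 2)) =
      (?gm * ?gp) * ennreal (det ?G powr (- 1 / 2) * det ?V powr (- 1 / 2))"
    using I2 by (simp add: ennreal_mult' ac_simps)
  then have "ennreal (det s powr (- 1 / 2) * det L powr (- 1 / 2)) = ennreal (det ?G powr (- 1 / 2) * det ?V powr (- 1 / 2))"
    using g by (simp add: ennreal_mult_cancel_left)
  then have eq: "det s powr (- 1 / 2) * det L powr (- 1 / 2) = det ?G powr (- 1 / 2) * det ?V powr (- 1 / 2)"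
    by (subst (asm) ennreal_inj) auto
  note pos = pos_def_det_pos[OF s] pos_def_det_pos[OF L] pos_def_det_pos[OF wb(1)] pos_def_det_pos[OF wb(2)] pos_def_det_pos[OF H]
  have "(det s * det L) powr (- 1 / 2) = (det ?G * det ?V) powr (- 1 / 2)"
    using eq pos by (simp add: powr_mult)
  then have "((det s * det L) powr (- 1 / 2)) powr (- 2) = ((det ?G * det ?V) powr (- 1 / 2)) powr (- 2)" by simp
  then have "det s * det L = det ?G * det ?V" unfolding powr_powr using pos by simp
  moreover have "det ?G = 1 / det ?H" by (rule det_matrix_inv[OF pos_def_invertible[OF H]])
  ultimately show ?thesis using pos(5) by (simp add: field_simps)
qed

section \<open>Normalized densities\<close>

text \<open>
  The integrals are related by a common factor \<open>r\<close>, so expectations are ratios of unnormalized integrals.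
\<close>

lemma normalized_density:
  fixes g :: "'a \<Rightarrow> real"
  assumes g [measurable]: "g \<in> borel_measurable \<mu>" and nn: "\<And>x. g x \<ge> 0"
    and z: "0 < (\<integral>\<^sup>+x. ennreal (g x) \<partial>\<mu>)" "(\<integral>\<^sup>+x. ennreal (g x) \<partial>\<mu>) < \<infinity>"
  obtains r where "r > 0" and "(\<integral>\<^sup>+x. ennreal (g x) \<partial>\<mu>) = ennreal r"
    and "prob_space (normalized \<mu> g)"
    and "\<And>f :: 'a \<Rightarrow> 'b::euclidean_space. f \<in> borel_measurable \<mu> \<Longrightarrow>
      integrable (normalized \<mu> g) f \<longleftrightarrow> integrable \<mu> (\<lambda>x. g x *\<^sub>R f x)"
    and "\<And>f :: 'a \<Rightarrow> 'b. f \<in> borel_measurable \<mu> \<Longrightarrow>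
      (\<integral>x. f x \<partial>normalized \<mu> g) = (1 / r) *\<^sub>R (\<integral>x. g x *\<^sub>R f x \<partial>\<mu>)"
proof -
  define r where "r = enn2real (\<integral>\<^sup>+x. ennreal (g x) \<partial>\<mu>)"
  have r: "r > 0" "(\<integral>\<^sup>+x. ennreal (g x) \<partial>\<mu>) = ennreal r"
    using z by (simp_all add: r_def enn2real_positive_iff)
  have eq: "normalized \<mu> g = density \<mu> (\<lambda>x. ennreal (g x / r))"
    unfolding normalized_def r(2) using r(1) nn by (simp add: divide_ennreal)
  have "emeasure (normalized \<mu> g) (space (normalized \<mu> g)) = (\<integral>\<^sup>+x. ennreal (1 / r) * ennreal (g x) \<partial>\<mu>)"
    unfolding eq using r(1) nn
    by (simp add: emeasure_density ennreal_mult'[symmetric] cong: nn_integral_cong_simp)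
  also have "\<dots> = ennreal (1 / r) * ennreal r" unfolding r(2)[symmetric] by (rule nn_integral_cmult) measurable
  also have "\<dots> = 1" using r(1) by (subst ennreal_mult'[symmetric]) auto
  finally have prob: "prob_space (normalized \<mu> g)" by (rule prob_spaceI)
  have scale: "(g x / r) *\<^sub>R f x = (1 / r) *\<^sub>R (g x *\<^sub>R f x)" for f :: "'a \<Rightarrow> 'b" and x by simp
  have int: "integrable (normalized \<mu> g) f \<longleftrightarrow> integrable \<mu> (\<lambda>x. g x *\<^sub>R f x)" if [measurable]: "f \<in> borel_measurable \<mu>" for f :: "'a \<Rightarrow> 'b"
  proof -
    have "integrable (normalized \<mu> g) f \<longleftrightarrow> integrable \<mu> (\<lambda>x. (1 / r) *\<^sub>R (g x *\<^sub>R f x))"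
      unfolding eq using r(1) nn by (subst integrable_density) (auto simp: divide_nonneg_pos simp del: scaleR_scaleR simp flip: scale)
    also have "\<dots> \<longleftrightarrow> integrable \<mu> (\<lambda>x. g x *\<^sub>R f x)"
    proof
      assume "integrable \<mu> (\<lambda>x. (1 / r) *\<^sub>R (g x *\<^sub>R f x))"
      then have "integrable \<mu> (\<lambda>x. r *\<^sub>R ((1 / r) *\<^sub>R (g x *\<^sub>R f x)))" by (rule integrable_scaleR_right)
      then show "integrable \<mu> (\<lambda>x. g x *\<^sub>R f x)" using r(1) by simp
    qed (rule integrable_scaleR_right)
    finally show ?thesis .
  qed
  have "(\<integral>x. f x \<partial>normalized \<mu> g) = (1 / r) *\<^sub>R (\<integral>x. g x *\<^sub>R f x \<partial>\<mu>)" if [measurable]: "f \<in> borel_measurable \<mu>" for f :: "'a \<Rightarrow> 'b"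
  proof -
    have "(\<integral>x. f x \<partial>normalized \<mu> g) = (\<integral>x. (g x / r) *\<^sub>R f x \<partial>\<mu>)"
      unfolding eq using r(1) nn by (subst integral_density) (auto simp: divide_nonneg_pos)
    then show ?thesis by (simp only: scale integral_scaleR_right)
  qed
  with r prob int that show ?thesis by blast
qed

section \<open>The law of the shrinkage matrix\<close>

text \<open>
  With \<open>Y = S\<^sup>2\<close> and \<open>S\<close> symmetric, \<open>Y - I\<close> is congruent to \<open>I - Y\<^sup>-\<^sup>1\<close>.
\<close>

lemma pos_def_diff_mat_1_iff:
  fixes Y :: "real^'n^'n"
  assumes "pos_def Y"
  shows "pos_def (Y - mat 1) \<longleftrightarrow> pos_def (mat 1 - matrix_inv Y)"
proof -
  obtain S :: "real^'n^'n" where S: "invertible S" "transpose S = S" "S ** S = Y"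
    using pos_def_symmetric_root[OF assms] .
  have "S ** matrix_inv Y ** S = mat 1"
    unfolding S(3)[symmetric] matrix_inv_mult_distrib[OF S(1) S(1)]
    by (simp add: matrix_mul_assoc matrix_inv_mult[OF S(1)])
  then have "Y - mat 1 = S ** (mat 1 - matrix_inv Y) ** transpose S"
    by (simp add: matrix_diff_ldistrib matrix_diff_rdistrib S(2,3))
  then show ?thesis using pos_def_congruence_iff[OF S(1)] by simp
qed

text \<open>
  The determinant is a decreasing function of the Gaussian integral, which decreases when the form grows.
\<close>

lemma det_le_of_quadratic_form_le:
  fixes P Q :: "real^'n^'n"
  assumes P: "pos_def P" and Q: "pos_def Q" and le: "\<And>x. x \<bullet> (P *v x) \<le> x \<bullet> (Q *v x)"
  shows "det P \<le> det Q"
proof -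
  let ?one = "mat 1 :: real^1^1" and ?g = "gaussian_mass TYPE(1) TYPE('n)"
  have tr: "trace (M ** Z ** ?one ** transpose Z) = column 1 Z \<bullet> (M *v column 1 Z)" for M :: "real^'n^'n" and Z :: "real^1^'n"
  proof -
    have "trace ((M ** Z) ** transpose Z) = trace (transpose Z ** (M ** Z))" by (rule trace_mul_sym)
    also have "\<dots> = column 1 Z \<bullet> (M *v column 1 Z)"
      by (simp add: trace_def matrix_matrix_mult_def transpose_def inner_vec_def matrix_vector_mult_def column_def UNIV_1)
    finally show ?thesis by simp
  qed
  have one: "pos_def ?one" by simp
  have "(\<integral>\<^sup>+Z. ennreal (gaussian_kernel Q ?one Z) \<partial>lborel) \<le> (\<integral>\<^sup>+Z. ennreal (gaussian_kernel P ?one Z) \<partial>lborel)"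
    unfolding gaussian_kernel_def tr using le by (intro nn_integral_mono ennreal_leI) simp
  then have "ennreal (det Q powr (- 1 / 2)) * ?g \<le> ennreal (det P powr (- 1 / 2)) * ?g"
    using gaussian_integral[OF P one] gaussian_integral[OF Q one] by simp
  then have "det Q powr (- 1 / 2) \<le> det P powr (- 1 / 2)"
    using gaussian_mass_pos[where 'p=1 and 'm='n] gaussian_mass_finite[where 'p=1 and 'm='n]
    by (cases ?g) (auto simp: ennreal_mult'[symmetric] ennreal_le_iff)
  then show ?thesis
    using powr_less_mono2_neg[of "- 1 / 2" "det Q" "det P"] pos_def_det_pos[OF P] pos_def_det_pos[OF Q] by force
qed

lemma pos_def_diag_mat: "(\<And>i. f i > 0) \<Longrightarrow> pos_def (diag_mat f :: real^'n^'n)"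
proof -
  assume f: "\<And>i. f i > 0"
  have "x \<bullet> (diag_mat f *v x) > 0" if "x \<noteq> 0" for x :: "real^'n"
  proof -
    have entry: "(diag_mat f *v x) $ i = f i * x $ i" for i
    proof -
      have "(\<Sum>j\<in>UNIV. (if i = j then f i else 0) * x $ j) = (\<Sum>j\<in>UNIV. if j = i then f i * x $ i else 0)"
        by (intro sum.cong) auto
      then show ?thesis by (simp add: matrix_vector_mult_def diag_mat_nth)
    qed
    from that have "\<exists>k. x $ k \<noteq> 0" by (simp add: vec_eq_iff)
    then obtain k where "x $ k \<noteq> 0" ..
    have "x \<bullet> (diag_mat f *v x) = (\<Sum>i\<in>UNIV. f i * (x $ i * x $ i))"
      using entry by (simp add: inner_vec_def algebra_simps)
    also have "(\<Sum>i\<in>UNIV. f i * (x $ i * x $ i)) > 0"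
      using f \<open>x $ k \<noteq> 0\<close> by (intro sum_pos2[of _ k]) (auto simp: less_imp_le zero_less_mult_iff)
    finally show ?thesis .
  qed
  then show ?thesis by (simp add: pos_def_def)
qed

lemma diag_mat_mult: "diag_mat f ** diag_mat g = (diag_mat (\<lambda>i. f i * g i) :: real^'n^'n)"
  by (simp add: vec_eq_iff diag_mat_left) (simp add: diag_mat_nth)

lemma mat_1_diag: "mat 1 = (diag_mat (\<lambda>_. 1) :: real^'n^'n)"
  by (simp add: vec_eq_iff mat_def diag_mat_nth)

lemma diag_mat_add: "diag_mat f + diag_mat g = (diag_mat (\<lambda>i. f i + g i) :: real^'n^'n)"
  by (simp add: vec_eq_iff diag_mat_nth)

lemma diag_mat_diff: "diag_mat f - diag_mat g = (diag_mat (\<lambda>i. f i - g i) :: real^'n^'n)"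
  by (simp add: vec_eq_iff diag_mat_nth)

lemma diag_mat_scaleR: "r *\<^sub>R diag_mat f = (diag_mat (\<lambda>i. r * f i) :: real^'n^'n)"
  by (simp add: vec_eq_iff diag_mat_nth)

lemma matrix_inv_diag_mat:
  assumes "\<And>i. f i \<noteq> 0"
  shows "matrix_inv (diag_mat f) = (diag_mat (\<lambda>i. 1 / f i) :: real^'n^'n)" and "invertible (diag_mat f :: real^'n^'n)"
proof -
  have "diag_mat f ** diag_mat (\<lambda>i. 1 / f i) = (mat 1 :: real^'n^'n)"
    using assms by (simp add: diag_mat_mult mat_1_diag)
  from matrix_inv_eqI[OF this] show "matrix_inv (diag_mat f) = (diag_mat (\<lambda>i. 1 / f i) :: real^'n^'n)" "invertible (diag_mat f :: real^'n^'n)" .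
qed

text \<open>
  The diagonal matrix \<open>F (I + F)\<^sup>-\<^sup>1\<close>.
\<close>

abbreviation shrink_ratio :: "('n \<Rightarrow> real) \<Rightarrow> real^'n^'n" where
  "shrink_ratio f \<equiv> diag_mat (\<lambda>i. f i / (1 + f i))"

lemma shrink_ratio_eq:
  assumes "\<And>i. f i > 0"
  shows "diag_mat f ** matrix_inv (mat 1 + diag_mat f) = (shrink_ratio f :: real^'n^'n)"
proof -
  have "1 + f i \<noteq> 0" for i using assms[of i] by linarith
  then show ?thesis unfolding mat_1_diag diag_mat_add by (subst matrix_inv_diag_mat) (auto simp: diag_mat_mult)
qed

text \<open>
  The factor of the density of \<open>\<Lambda>\<close> whose exponent may have either sign stays in a compact subset of the positive
  reals. So the density is comparable to a beta density, and its mass and moments are finite for every \<open>b\<close>. The product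
  \<open>F (I + F)\<^sup>-\<^sup>1 \<Lambda>\<close> is not symmetric; splitting the diagonal factor into two square roots makes it so.
\<close>

lemma det_shrink_bounds:
  fixes \<Lambda> :: "real^'n^'n"
  assumes f: "\<And>i. f i > 0" and L: "pos_def \<Lambda>" "pos_def (mat 1 - \<Lambda>)"
  shows "det (mat 1 - shrink_ratio f :: real^'n^'n) \<le> det (mat 1 - shrink_ratio f ** \<Lambda>)"
    and "det (mat 1 - shrink_ratio f ** \<Lambda>) \<le> 1"
    and "det (mat 1 - shrink_ratio f :: real^'n^'n) > 0"
proof -
  let ?h = "diag_mat (\<lambda>i. sqrt (f i / (1 + f i))) :: real^'n^'n" and ?H = "shrink_ratio f :: real^'n^'n"
  have pos: "f i / (1 + f i) > 0" "1 - f i / (1 + f i) > 0" for i using f[of i] by (auto simp: field_simps)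
  have "sqrt (f i / (1 + f i)) * sqrt (f i / (1 + f i)) = f i / (1 + f i)" for i
    using pos(1)[of i] by (simp only: real_sqrt_mult_self abs_of_pos)
  then have hh: "?h ** ?h = ?H" by (simp only: diag_mat_mult)
  have "sqrt (f i / (1 + f i)) \<noteq> 0" for i
    using pos(1)[of i] by (simp only: real_sqrt_eq_zero_cancel_iff less_imp_neq[symmetric] not_False_eq_True)
  then have ih: "invertible ?h" by (rule matrix_inv_diag_mat(2))
  have "?h ** (mat 1 - ?h ** \<Lambda> ** ?h) = (mat 1 - ?H ** \<Lambda>) ** ?h"
    by (simp add: matrix_diff_ldistrib matrix_diff_rdistrib matrix_mul_assoc hh)
  from arg_cong[OF this, of det] have "det ?h * det (mat 1 - ?h ** \<Lambda> ** ?h) = det (mat 1 - ?H ** \<Lambda>) * det ?h"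
    by (simp only: det_mul)
  then have det: "det (mat 1 - ?H ** \<Lambda>) = det (mat 1 - ?h ** \<Lambda> ** ?h)" using ih by (simp add: invertible_det_nz)
  have pd1: "pos_def (mat 1 - ?H)" unfolding mat_1_diag diag_mat_diff by (rule pos_def_diag_mat) (rule pos)
  show "det (mat 1 - ?H) > 0" by (rule pos_def_det_pos[OF pd1])
  have pdL: "pos_def (?h ** \<Lambda> ** ?h)" using pos_def_congruence[OF ih L(1)] by simp
  have pd1L: "pos_def (?h ** (mat 1 - \<Lambda>) ** ?h)" using pos_def_congruence[OF ih L(2)] by simp
  have split: "mat 1 - ?h ** \<Lambda> ** ?h = (mat 1 - ?H) + ?h ** (mat 1 - \<Lambda>) ** ?h"
    by (simp add: matrix_diff_ldistrib matrix_diff_rdistrib hh)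
  have pd: "pos_def (mat 1 - ?h ** \<Lambda> ** ?h)" unfolding split by (rule pos_def_add[OF pd1 pd1L])
  show "det (mat 1 - ?H) \<le> det (mat 1 - ?H ** \<Lambda>)" unfolding det
    by (rule det_le_of_quadratic_form_le[OF pd1 pd], unfold split)
      (simp add: matrix_vector_mult_add_rdistrib inner_add_right pos_def_nonneg[OF pd1L])
  have "det (mat 1 - ?h ** \<Lambda> ** ?h) \<le> det (mat 1 :: real^'n^'n)"
    by (rule det_le_of_quadratic_form_le[OF pd pos_def_mat_1])
      (simp add: matrix_vector_mult_diff_rdistrib inner_diff_right pos_def_nonneg[OF pdL])
  then show "det (mat 1 - ?H ** \<Lambda>) \<le> 1" unfolding det by simp
qed

lemma beta_weight_eq_0:
  "\<not> (pos_def \<Lambda> \<and> pos_def (mat 1 - \<Lambda>)) \<Longrightarrow> beta_weight \<gamma> \<delta> \<Lambda> = 0"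
  unfolding beta_weight_def by (rule if_not_P)

text \<open>
  In this form the exponents are those of a beta density, and the conditions \<open>- 2 < c < a + p\<close> say that both exceed
  \<open>- 1\<close>.
\<close>

lemma Lambda_kernel_eq:
  fixes \<Lambda> :: "real^'m^'m"
  assumes "\<And>i. f i > 0"
  shows "Lambda_kernel p n a b c (diag_mat f) \<Lambda> =
    beta_weight ((a - c + real p - 2) / 2) (c / 2) \<Lambda> * det (mat 1 - shrink_ratio f ** \<Lambda>) powr ((b - a - real CARD('m) + real n) / 2)"
proof -
  have e: "(a - c + real CARD('m) + real p - 1) / 2 - (real CARD('m) + 1) / 2 = (a - c + real p - 2) / 2"
    "(c + real CARD('m) + 1) / 2 - (real CARD('m) + 1) / 2 = c / 2" by (simp_all add: field_simps)
  show ?thesis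
    unfolding Lambda_kernel_def Let_def shrink_ratio_eq[where f=f, OF assms] beta_weight_def loewner_less_def e by simp
qed

lemma Lambda_kernel_nonneg [simp]: "0 \<le> Lambda_kernel p n a b c F \<Lambda>"
  by (simp add: Lambda_kernel_def Let_def)

lemma borel_measurable_Lambda_kernel [measurable]:
  "Lambda_kernel p n a b c (F :: real^'m^'m) \<in> borel_measurable borel"
  unfolding Lambda_kernel_def Let_def loewner_less_def by measurable

lemma Lambda_kernel_mass:
  fixes f :: "'m::finite \<Rightarrow> real" and a b c :: real and n p :: nat
  assumes f: "\<And>i. f i > 0" and c: "- 2 < c" "c < a + real p"
  defines "k \<equiv> Lambda_kernel p n a b c (diag_mat f :: real^'m^'m)"
  shows "(\<integral>\<^sup>+\<Lambda>. ennreal (k \<Lambda>) \<partial>sym_lborel) > 0" and "(\<integral>\<^sup>+\<Lambda>. ennreal (k \<Lambda>) \<partial>sym_lborel) < \<infinity>"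
    and "integrable sym_lborel (\<lambda>\<Lambda>. k \<Lambda> *\<^sub>R \<Lambda>)"
    and "pos_def \<Lambda> \<Longrightarrow> pos_def (mat 1 - \<Lambda>) \<Longrightarrow> k \<Lambda> > 0"
    and "\<not> (pos_def \<Lambda> \<and> pos_def (mat 1 - \<Lambda>)) \<Longrightarrow> k \<Lambda> = 0"
proof -
  let ?\<beta> = "(b - a - real CARD('m) + real n) / 2"
  let ?bw = "beta_weight ((a - c + real p - 2) / 2) (c / 2) :: real^'m^'m \<Rightarrow> real"
  define \<delta> where "\<delta> = det (mat 1 - shrink_ratio f :: real^'m^'m)"
  have k: "k \<Lambda> = ?bw \<Lambda> * det (mat 1 - shrink_ratio f ** \<Lambda>) powr ?\<beta>" for \<Lambda>
    unfolding k_def by (rule Lambda_kernel_eq[where f=f, OF f])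
  have [measurable]: "k \<in> borel_measurable borel" unfolding k_def by measurable
  have k0: "k \<Lambda> \<ge> 0" for \<Lambda> unfolding k_def by simp
  show pos: "k \<Lambda> > 0" if "pos_def \<Lambda>" "pos_def (mat 1 - \<Lambda>)" for \<Lambda>
  proof -
    have "det (mat 1 - shrink_ratio f ** \<Lambda>) > 0"
      using det_shrink_bounds(1,3)[where f=f, OF f that] by linarith
    then show ?thesis using that pos_def_det_pos[OF that(1)] pos_def_det_pos[OF that(2)] by (simp add: k beta_weight_def)
  qed
  show zero: "k \<Lambda> = 0" if "\<not> (pos_def \<Lambda> \<and> pos_def (mat 1 - \<Lambda>))" for \<Lambda>
    unfolding k beta_weight_def if_not_P[OF that] by simp
  show "(\<integral>\<^sup>+\<Lambda>. ennreal (k \<Lambda>) \<partial>sym_lborel) > 0"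
    by (rule nn_integral_sym_lborel_pos) (auto simp: pos)
  define K where "K = max 1 (\<delta> powr ?\<beta>)"
  have kK: "k \<Lambda> \<le> K * ?bw \<Lambda>" for \<Lambda>
  proof (cases "pos_def \<Lambda> \<and> pos_def (mat 1 - \<Lambda>)")
    case True
    then have L: "pos_def \<Lambda>" "pos_def (mat 1 - \<Lambda>)" by auto
    note bd = det_shrink_bounds[where f=f, OF f L, folded \<delta>_def]
    have "det (mat 1 - shrink_ratio f ** \<Lambda>) powr ?\<beta> \<le> K"
    proof (cases "?\<beta> \<ge> 0")
      case True
      then have "det (mat 1 - shrink_ratio f ** \<Lambda>) powr ?\<beta> \<le> 1"
        using powr_mono2[OF True _ bd(2)] bd by simp
      then show ?thesis by (simp add: K_def)
    next
      case False
      then have "det (mat 1 - shrink_ratio f ** \<Lambda>) powr ?\<beta> \<le> \<delta> powr ?\<beta>"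
        using bd by (intro powr_mono2') auto
      then show ?thesis by (simp add: K_def)
    qed
    from mult_left_mono[OF this beta_weight_nonneg] show ?thesis unfolding k by (simp only: mult.commute)
  next
    case False
    show ?thesis unfolding zero[OF False] beta_weight_eq_0[OF False] by simp
  qed
  have "(\<integral>\<^sup>+\<Lambda>. ennreal (k \<Lambda>) \<partial>sym_lborel) \<le> (\<integral>\<^sup>+\<Lambda>. ennreal K * ennreal (?bw \<Lambda>) \<partial>sym_lborel)"
    using kK by (intro nn_integral_mono) (simp add: ennreal_mult''[symmetric] ennreal_leI)
  also have "\<dots> = ennreal K * beta_mass TYPE('m) ((a - c + real p - 2) / 2) (c / 2)"
    unfolding beta_mass_def by (rule nn_integral_cmult) measurable
  also have "\<dots> < \<infinity>"
    using c beta_mass_finite[where 'n='m, of "(a - c + real p - 2) / 2" "c / 2"] by (simp add: ennreal_mult_less_top)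
  finally show "(\<integral>\<^sup>+\<Lambda>. ennreal (k \<Lambda>) \<partial>sym_lborel) < \<infinity>" .
  have "integrable sym_lborel (\<lambda>\<Lambda>. K * norm (?bw \<Lambda> *\<^sub>R \<Lambda>))"
    using c by (intro integrable_mult_right integrable_norm beta_weight_mean) auto
  then show "integrable sym_lborel (\<lambda>\<Lambda>. k \<Lambda> *\<^sub>R \<Lambda>)"
  proof (rule Bochner_Integration.integrable_bound)
    show "AE \<Lambda> in sym_lborel. norm (k \<Lambda> *\<^sub>R \<Lambda>) \<le> norm (K * norm (?bw \<Lambda> *\<^sub>R \<Lambda>))"
    proof (rule AE_I2)
      fix \<Lambda> :: "real^'m^'m"
      have "K \<ge> 0" by (simp add: K_def)
      then show "norm (k \<Lambda> *\<^sub>R \<Lambda>) \<le> norm (K * norm (?bw \<Lambda> *\<^sub>R \<Lambda>))"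
        using mult_right_mono[OF kK[of \<Lambda>], of "norm \<Lambda>"] k0[of \<Lambda>] by (simp add: abs_mult mult.assoc)
    qed
  qed measurable
qed

text \<open>
  A reflection commutes with \<open>F\<close>, hence preserves the density and makes the mean diagonal. The bound \<open>e i < 1\<close> follows
  from \<open>\<Lambda>\<^sub>i\<^sub>i < 1\<close> and keeps all denominators of the estimator positive.
\<close>

lemma Lambda_mean:
  fixes f :: "'m::finite \<Rightarrow> real" and a b c :: real and n p :: nat
  assumes f: "\<And>i. f i > 0" and c: "- 2 < c" "c < a + real p"
  defines "\<L> \<equiv> Lambda_law p n a b c (diag_mat f :: real^'m^'m)"
  obtains e where "prob_space \<L>" and "integrable \<L> (\<lambda>\<Lambda>. \<Lambda>)" and "(\<integral>\<Lambda>. \<Lambda> \<partial>\<L>) = diag_mat e"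
    and "\<And>i. e i < 1"
    and "b = a + real CARD('m) - real n \<Longrightarrow> e = (\<lambda>_. (a - c + real p + real CARD('m) - 1) / (a + 2 * real CARD('m) + real p))"
proof -
  define k where "k = Lambda_kernel p n a b c (diag_mat f :: real^'m^'m)"
  note mass = Lambda_kernel_mass[where f=f and n=n and b=b, OF f c, folded k_def]
  have [measurable]: "k \<in> borel_measurable borel" unfolding k_def by measurable
  have k0: "k \<Lambda> \<ge> 0" for \<Lambda> unfolding k_def by simp
  obtain r where r: "r > 0" "(\<integral>\<^sup>+\<Lambda>. ennreal (k \<Lambda>) \<partial>sym_lborel) = ennreal r"
    "prob_space (normalized sym_lborel k)"
    "\<And>g :: real^'m^'m \<Rightarrow> real^'m^'m. g \<in> borel_measurable sym_lborel \<Longrightarrow>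
      integrable (normalized sym_lborel k) g \<longleftrightarrow> integrable sym_lborel (\<lambda>x. k x *\<^sub>R g x)"
    "\<And>g :: real^'m^'m \<Rightarrow> real^'m^'m. g \<in> borel_measurable sym_lborel \<Longrightarrow>
      (\<integral>x. g x \<partial>normalized sym_lborel k) = (1 / r) *\<^sub>R (\<integral>x. k x *\<^sub>R g x \<partial>sym_lborel)"
    by (rule normalized_density[of k sym_lborel]) (use k0 mass(1,2) in auto)
  have \<L>: "\<L> = normalized sym_lborel k" by (simp add: \<L>_def Lambda_law_def k_def)
  have int: "integrable \<L> (\<lambda>\<Lambda>. \<Lambda>)" unfolding \<L> using r(4)[of "\<lambda>\<Lambda>. \<Lambda>"] mass(3) by simp
  have E: "(\<integral>\<Lambda>. \<Lambda> \<partial>\<L>) = (1 / r) *\<^sub>R (\<integral>\<Lambda>. k \<Lambda> *\<^sub>R \<Lambda> \<partial>sym_lborel)" unfolding \<L> by (rule r(5)) simp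
  let ?M = "\<integral>\<Lambda>. k \<Lambda> *\<^sub>R \<Lambda> \<partial>sym_lborel"
  have flip: "k (sign_flip i ** \<Lambda> ** transpose (sign_flip i)) = k \<Lambda>" for i \<Lambda>
  proof -
    let ?S = "sign_flip i :: real^'m^'m"
    have SS: "?S ** transpose ?S = mat 1" by (simp add: sign_flip_square)
    have comm: "shrink_ratio f ** ?S = ?S ** shrink_ratio f" by (simp add: diag_mat_mult mult.commute)
    have "mat 1 - shrink_ratio f ** (?S ** \<Lambda> ** transpose ?S) = ?S ** (mat 1 - shrink_ratio f ** \<Lambda>) ** transpose ?S"
      using SS by (simp add: matrix_diff_ldistrib matrix_diff_rdistrib matrix_mul_assoc comm)
    then have "det (mat 1 - shrink_ratio f ** (?S ** \<Lambda> ** transpose ?S)) = det (mat 1 - shrink_ratio f ** \<Lambda>)"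
      using det_orthogonal_congruence[OF SS] by simp
    then show ?thesis unfolding k_def Lambda_kernel_eq[where f=f, OF f] beta_weight_orthogonal[OF SS] by simp
  qed
  have off: "?M $ i $ j = 0" if "i \<noteq> j" for i j
    by (rule sign_invariant_mean_diagonal[OF _ mass(3) flip that]) simp
  have entry: "bounded_linear (\<lambda>\<Lambda> :: real^'m^'m. \<Lambda> $ i $ i)" for i
    by (rule linear_conv_bounded_linear[THEN iffD1], rule linearI) auto
  have intk: "integrable sym_lborel k" using mass(2) k0 by (intro integrableI_nonneg) auto
  have rk: "(\<integral>\<Lambda>. k \<Lambda> \<partial>sym_lborel) = r"
    using r(1,2) k0 by (subst integral_eq_nn_integral) auto
  have intii: "integrable sym_lborel (\<lambda>\<Lambda>. k \<Lambda> * \<Lambda> $ i $ i)" and Mii: "?M $ i $ i = (\<integral>\<Lambda>. k \<Lambda> * \<Lambda> $ i $ i \<partial>sym_lborel)" for i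
    using integrable_bounded_linear[OF entry mass(3)] integral_bounded_linear[OF entry mass(3), of i] by simp_all
  have diag1: "\<Lambda> $ i $ i < 1" if "pos_def \<Lambda>" "pos_def (mat 1 - \<Lambda>)" for \<Lambda> :: "real^'m^'m" and i
    using pos_def_diagonal_pos[OF that(2), of i] by (auto simp: mat_def)
  have posint: "0 < (\<integral>\<Lambda>. g \<Lambda> \<partial>sym_lborel)"
    if "integrable sym_lborel g" "\<And>\<Lambda>. 0 \<le> g \<Lambda>" "\<And>\<Lambda>. pos_def \<Lambda> \<Longrightarrow> pos_def (mat 1 - \<Lambda>) \<Longrightarrow> g \<Lambda> > 0" for g :: "real^'m^'m \<Rightarrow> real"
  proof -
    have "g \<in> borel_measurable borel" using borel_measurable_integrable[OF that(1)] by simp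
    then have "(\<integral>\<^sup>+\<Lambda>. ennreal (g \<Lambda>) \<partial>sym_lborel) > 0" using that(3) by (intro nn_integral_sym_lborel_pos) auto
    then show ?thesis using nn_integral_eq_integral[OF that(1)] that(2) by simp
  qed
  have Mr: "?M $ i $ i < r" for i
  proof -
    have "0 < (\<integral>\<Lambda>. k \<Lambda> - k \<Lambda> * \<Lambda> $ i $ i \<partial>sym_lborel)"
    proof (rule posint[OF Bochner_Integration.integrable_diff[OF intk intii]])
      fix \<Lambda> :: "real^'m^'m"
      have eq: "k \<Lambda> - k \<Lambda> * \<Lambda> $ i $ i = k \<Lambda> * (1 - \<Lambda> $ i $ i)" by (simp add: algebra_simps)
      show "0 \<le> k \<Lambda> - k \<Lambda> * \<Lambda> $ i $ i" unfolding eq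
        using diag1[of \<Lambda> i] mass(5)[of \<Lambda>] k0[of \<Lambda>] by (cases "pos_def \<Lambda> \<and> pos_def (mat 1 - \<Lambda>)") auto
      show "pos_def \<Lambda> \<Longrightarrow> pos_def (mat 1 - \<Lambda>) \<Longrightarrow> 0 < k \<Lambda> - k \<Lambda> * \<Lambda> $ i $ i" unfolding eq
        using diag1[of \<Lambda> i] mass(4)[of \<Lambda>] by simp
    qed
    then show ?thesis unfolding Mii rk[symmetric] using intk intii by simp
  qed
  define e where "e i = (1 / r) * ?M $ i $ i" for i
  have Ediag: "(\<integral>\<Lambda>. \<Lambda> \<partial>\<L>) = diag_mat e"
    unfolding E e_def using off by (auto simp: vec_eq_iff diag_mat_nth)
  have e1: "e i < 1" for i using Mr[of i] r(1) by (auto simp: e_def field_simps)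
  have closed: "e = (\<lambda>_. (a - c + real p + real CARD('m) - 1) / (a + 2 * real CARD('m) + real p))" if b: "b = a + real CARD('m) - real n"
  proof
    fix i
    let ?g = "(a - c + real p - 2) / 2" and ?d = "c / 2"
    have kb: "k \<Lambda> = beta_weight ?g ?d \<Lambda>" for \<Lambda>
    proof (cases "pos_def \<Lambda> \<and> pos_def (mat 1 - \<Lambda>)")
      case True
      then have "det (mat 1 - shrink_ratio f ** \<Lambda>) > 0"
        using det_shrink_bounds(1,3)[where f=f and \<Lambda>=\<Lambda>, OF f] by linarith
      then show ?thesis unfolding k_def Lambda_kernel_eq[where f=f, OF f] b by simp
    next
      case False
      show ?thesis unfolding mass(5)[OF False] beta_weight_eq_0[OF False] ..
    qed
    have gd: "?g > - 1" "?d > - 1" using c by auto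
    have "r = enn2real (beta_mass TYPE('m) ?g ?d)"
      using r(1,2) unfolding beta_mass_def kb by simp
    then have "?M = ((?g + (real CARD('m) + 1) / 2) / (?g + ?d + (real CARD('m) + 1)) * r) *\<^sub>R mat 1"
      unfolding kb using beta_weight_mean(2)[where 'n='m, OF gd] by simp
    then have "e i = (?g + (real CARD('m) + 1) / 2) / (?g + ?d + (real CARD('m) + 1))"
      using r(1) by (simp add: e_def mat_def)
    also have "\<dots> = (a - c + real p + real CARD('m) - 1) / (a + 2 * real CARD('m) + real p)"
    proof -
      have e: "?g + (real CARD('m) + 1) / 2 = (a - c + real p + real CARD('m) - 1) / 2"
        "?g + ?d + (real CARD('m) + 1) = (a + 2 * real CARD('m) + real p) / 2" by (simp_all add: field_simps)
      have halves: "(u / 2) / (v / 2) = u / v" for u v :: real by simp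
      show ?thesis unfolding e by (rule halves)
    qed
    finally show "e i = (a - c + real p + real CARD('m) - 1) / (a + 2 * real CARD('m) + real p)" .
  qed
  show ?thesis
  proof (rule that[of e])
    show "prob_space \<L>" unfolding \<L> by (rule r(3))
  qed (fact int Ediag e1 closed)+
qed

section \<open>From the prior scale matrix to the shrinkage matrix\<close>

text \<open>
  The marginal posterior density of \<open>\<Omega>\<close>, up to a constant.
\<close>

definition omega_weight :: "real \<Rightarrow> real \<Rightarrow> real \<Rightarrow> real^'m^'m \<Rightarrow> real^'m^'m \<Rightarrow> real" where
  "omega_weight \<beta> c h B \<Omega> =
     (if pos_def \<Omega> then det (mat 1 + \<Omega>) powr \<beta> * det \<Omega> powr (c / 2) * det (mat 1 + B + \<Omega>) powr (- h) else 0)"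

lemma omega_weight_nonneg [simp]: "0 \<le> omega_weight \<beta> c h B \<Omega>"
  by (simp add: omega_weight_def)

lemma borel_measurable_omega_weight [measurable (raw)]:
  fixes g :: "'a \<Rightarrow> real^'m^'m"
  assumes [measurable]: "g \<in> borel_measurable M"
  shows "(\<lambda>x. omega_weight \<beta> c h B (g x)) \<in> borel_measurable M"
  unfolding omega_weight_def by measurable

text \<open>
  The diagonal matrix \<open>(I + F)\<^sup>-\<^sup>1\<^sup>/\<^sup>2\<close>.
\<close>

abbreviation root_shrink :: "('m \<Rightarrow> real) \<Rightarrow> real^'m^'m" where
  "root_shrink f \<equiv> diag_mat (\<lambda>i. 1 / sqrt (1 + f i))"

text \<open>
  The substitutions \<open>\<Omega> \<mapsto> A \<Omega> A\<^sup>T\<close> with \<open>A A\<^sup>T = I + B\<close>, then \<open>Y = I + \<Omega>\<close>, then \<open>\<Lambda> = Y\<^sup>-\<^sup>1\<close>. Under them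
  \<open>I + B + \<Omega>\<close> becomes \<open>A Y A\<^sup>T\<close> and \<open>I + \<Omega>\<close> becomes \<open>A (Y - F (I + F)\<^sup>-\<^sup>1) A\<^sup>T\<close>, whose determinant provides the third
  factor of the density of \<open>\<Lambda>\<close>.
\<close>

lemma omega_to_Lambda:
  fixes f :: "'m::finite \<Rightarrow> real" and R :: "real^'m^'m" and a b c :: real and n p :: nat
  assumes f: "\<And>i. f i > 0" and R: "R ** transpose R = mat 1"
  defines "B \<equiv> R ** diag_mat f ** transpose R"
    and "\<beta> \<equiv> (b - a - real CARD('m) + real n) / 2"
    and "h \<equiv> (real CARD('m) + real n + b + real p) / 2"
    and "E \<equiv> R ** root_shrink f"
  obtains C where "C > 0" and
    "\<And>\<phi> :: real^'m^'m \<Rightarrow> ennreal. \<phi> \<in> borel_measurable borel \<Longrightarrow>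
      (\<integral>\<^sup>+\<Omega>. ennreal (omega_weight \<beta> c h B \<Omega>) * \<phi> (matrix_inv (mat 1 + B + \<Omega>)) \<partial>sym_lborel) =
      ennreal C * (\<integral>\<^sup>+\<Lambda>. ennreal (Lambda_kernel p n a b c (diag_mat f) \<Lambda>) * \<phi> (E ** \<Lambda> ** transpose E) \<partial>sym_lborel)"
proof -
  let ?m = "real CARD('m)"
  let ?D = "diag_mat (\<lambda>i. sqrt (1 + f i)) :: real^'m^'m" and ?H = "shrink_ratio f :: real^'m^'m"
  let ?k = "Lambda_kernel p n a b c (diag_mat f :: real^'m^'m)"
  have f1: "1 + f i > 0" for i using f[of i] by linarith
  have sq: "sqrt (1 + f i) * sqrt (1 + f i) = 1 + f i" for i
    using f1[of i] by (simp only: real_sqrt_mult_self abs_of_pos)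
  have R': "transpose R ** R = mat 1" using R matrix_left_right_inverse by blast
  define A where "A = R ** ?D"
  have AA: "A ** transpose A = mat 1 + B"
  proof -
    have "?D ** ?D = mat 1 + diag_mat f" unfolding diag_mat_mult sq mat_1_diag diag_mat_add ..
    moreover have "A ** transpose A = R ** (?D ** ?D) ** transpose R"
      by (simp add: A_def matrix_transpose_mul matrix_mul_assoc)
    ultimately show ?thesis by (simp add: matrix_add_ldistrib matrix_add_rdistrib R B_def)
  qed
  have AHA: "A ** ?H ** transpose A = B"
  proof -
    have "?D ** ?H ** ?D = diag_mat f"
    proof -
      have "sqrt (1 + f i) * (f i / (1 + f i)) * sqrt (1 + f i) = f i" for i
      proof -
        have "sqrt (1 + f i) * (f i / (1 + f i)) * sqrt (1 + f i) = (sqrt (1 + f i) * sqrt (1 + f i)) * (f i / (1 + f i))"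
          by (simp only: ac_simps)
        then show ?thesis unfolding sq using f1[of i] by simp
      qed
      then show ?thesis by (simp only: diag_mat_mult)
    qed
    moreover have "A ** ?H ** transpose A = R ** (?D ** ?H ** ?D) ** transpose R"
      by (simp add: A_def matrix_transpose_mul matrix_mul_assoc)
    ultimately show ?thesis by (simp add: B_def)
  qed
  have "transpose A ** E = mat 1"
  proof -
    have "sqrt (1 + f i) * (1 / sqrt (1 + f i)) = 1" for i using f1[of i] by simp
    then have "?D ** root_shrink f = mat 1" by (simp only: diag_mat_mult mat_1_diag)
    moreover have "transpose A ** E = ?D ** (transpose R ** R) ** root_shrink f"
      by (simp add: A_def E_def matrix_transpose_mul matrix_mul_assoc)
    ultimately show ?thesis by (simp add: R')
  qed
  note invT = matrix_inv_eqI[OF this]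
  have iA: "invertible A" using transpose_invertible[OF invT(2)] by simp
  have E: "E = transpose (matrix_inv A)" using invT(1) matrix_inv_transpose[OF iA] by simp
  have ET: "transpose E = matrix_inv A" by (simp add: E)
  define d where "d = \<bar>det A\<bar>"
  have d: "d > 0" using iA by (simp add: d_def invertible_det_nz)
  have detA: "det (A ** M ** transpose A) = d powr 2 * det M" for M :: "real^'m^'m"
    using d by (simp add: det_mul d_def power2_eq_square)
  define C where "C = d ^ (CARD('m) + 1) * (d powr (2 * \<beta>) * d powr c * d powr (- 2 * h))"
  have C: "C > 0" using d by (simp add: C_def)
  have "(\<integral>\<^sup>+\<Omega>. ennreal (omega_weight \<beta> c h B \<Omega>) * \<phi> (matrix_inv (mat 1 + B + \<Omega>)) \<partial>sym_lborel) =
      ennreal C * (\<integral>\<^sup>+\<Lambda>. ennreal (?k \<Lambda>) * \<phi> (E ** \<Lambda> ** transpose E) \<partial>sym_lborel)"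
    if [measurable]: "\<phi> \<in> borel_measurable borel" for \<phi> :: "real^'m^'m \<Rightarrow> ennreal"
  proof -
    \<comment> \<open>The integrand after the congruence, as a function of \<open>Y = I + \<Omega>\<close>.\<close>
    define g where "g Y = ennreal (if pos_def (Y - mat 1) then det (Y - ?H) powr \<beta> * det (Y - mat 1) powr (c / 2) * det Y powr (- h) else 0) *
        \<phi> (E ** matrix_inv Y ** transpose E)" for Y :: "real^'m^'m"
    have [measurable]: "g \<in> borel_measurable borel" unfolding g_def by measurable
    have pdY: "pos_def Y" if "pos_def (Y - mat 1)" for Y :: "real^'m^'m"
      using pos_def_add[OF that pos_def_mat_1] by simp
    have pdH: "pos_def (mat 1 - ?H)"
      unfolding mat_1_diag diag_mat_diff using f1 f by (intro pos_def_diag_mat) (simp add: field_simps)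
    have pdYH: "pos_def (Y - ?H)" if "pos_def (Y - mat 1)" for Y :: "real^'m^'m"
      using pos_def_add[OF that pdH] by simp
    have "(\<integral>\<^sup>+\<Omega>. ennreal (omega_weight \<beta> c h B \<Omega>) * \<phi> (matrix_inv (mat 1 + B + \<Omega>)) \<partial>sym_lborel) =
        ennreal (\<bar>det A\<bar> ^ (CARD('m) + 1)) * (\<integral>\<^sup>+\<Omega>. ennreal (omega_weight \<beta> c h B (A ** \<Omega> ** transpose A)) *
          \<phi> (matrix_inv (mat 1 + B + A ** \<Omega> ** transpose A)) \<partial>sym_lborel)"
      by (rule sym_lborel_congruence[OF iA]) measurable
    also have "(\<integral>\<^sup>+\<Omega>. ennreal (omega_weight \<beta> c h B (A ** \<Omega> ** transpose A)) * \<phi> (matrix_inv (mat 1 + B + A ** \<Omega> ** transpose A)) \<partial>sym_lborel) =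
        (\<integral>\<^sup>+\<Omega>. ennreal (d powr (2 * \<beta>) * d powr c * d powr (- 2 * h)) * g (mat 1 + \<Omega>) \<partial>sym_lborel)"
    proof (rule nn_integral_cong)
      fix \<Omega> :: "real^'m^'m"
      let ?Y = "mat 1 + \<Omega>"
      have 1: "mat 1 + B + A ** \<Omega> ** transpose A = A ** ?Y ** transpose A"
        by (simp add: matrix_add_ldistrib matrix_add_rdistrib AA)
      have 2: "mat 1 + A ** \<Omega> ** transpose A = A ** (?Y - ?H) ** transpose A"
        by (simp add: matrix_add_ldistrib matrix_add_rdistrib matrix_diff_ldistrib matrix_diff_rdistrib AA AHA)
      show "ennreal (omega_weight \<beta> c h B (A ** \<Omega> ** transpose A)) * \<phi> (matrix_inv (mat 1 + B + A ** \<Omega> ** transpose A)) =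
        ennreal (d powr (2 * \<beta>) * d powr c * d powr (- 2 * h)) * g ?Y"
      proof (cases "pos_def \<Omega>")
        case True
        then have pd: "pos_def (?Y - mat 1)" by simp
        note pos = pos_def_det_pos[OF pdYH[OF pd]] pos_def_det_pos[OF pdY[OF pd]] pos_def_det_pos[OF True]
        have "omega_weight \<beta> c h B (A ** \<Omega> ** transpose A) =
          (d powr (2 * \<beta>) * d powr c * d powr (- 2 * h)) * (det (?Y - ?H) powr \<beta> * det \<Omega> powr (c / 2) * det ?Y powr (- h))"
          unfolding omega_weight_def if_P[OF pos_def_congruence[OF iA True]] 1 2 detA
          using pos d by (simp add: powr_mult powr_powr del: powr_numeral)
        moreover have "matrix_inv (A ** ?Y ** transpose A) = E ** matrix_inv ?Y ** transpose E"
          unfolding ET unfolding E by (rule matrix_inv_congruence[OF iA pos_def_invertible[OF pdY[OF pd]]])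
        ultimately show ?thesis unfolding g_def 1 using True by (simp add: ennreal_mult' mult.assoc)
      next
        case False
        then show ?thesis by (simp add: g_def omega_weight_def pos_def_congruence_iff[OF iA])
      qed
    qed
    also have "\<dots> = ennreal (d powr (2 * \<beta>) * d powr c * d powr (- 2 * h)) * (\<integral>\<^sup>+\<Omega>. g (mat 1 + \<Omega>) \<partial>sym_lborel)"
      by (rule nn_integral_cmult) measurable
    also have "(\<integral>\<^sup>+\<Omega>. g (mat 1 + \<Omega>) \<partial>sym_lborel) = (\<integral>\<^sup>+Y. g Y \<partial>sym_lborel)"
      by (rule sym_lborel_translation) simp_all
    also have "\<dots> = (\<integral>\<^sup>+Y. (if pos_def Y then g Y else 0) \<partial>sym_lborel)"
      using pdY by (intro nn_integral_cong) (auto simp: g_def)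
    also have "\<dots> = (\<integral>\<^sup>+\<Lambda>. (if pos_def \<Lambda> then ennreal (det \<Lambda> powr (- (?m + 1))) * g (matrix_inv \<Lambda>) else 0) \<partial>sym_lborel)"
      by (rule sym_lborel_inversion) measurable
    also have "\<dots> = (\<integral>\<^sup>+\<Lambda>. ennreal (?k \<Lambda>) * \<phi> (E ** \<Lambda> ** transpose E) \<partial>sym_lborel)"
    proof (rule nn_integral_cong)
      fix \<Lambda> :: "real^'m^'m"
      show "(if pos_def \<Lambda> then ennreal (det \<Lambda> powr (- (?m + 1))) * g (matrix_inv \<Lambda>) else 0) = ennreal (?k \<Lambda>) * \<phi> (E ** \<Lambda> ** transpose E)"
      proof (cases "pos_def \<Lambda>")
        case L: True
        let ?Y = "matrix_inv \<Lambda>"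
        have iL: "invertible \<Lambda>" by (rule pos_def_invertible[OF L])
        have iff: "pos_def (?Y - mat 1) \<longleftrightarrow> pos_def (mat 1 - \<Lambda>)"
          using pos_def_diff_mat_1_iff[OF pos_def_matrix_inv[OF L]] by (simp add: invertible_matrix_inv(2)[OF iL])
        show ?thesis
        proof (cases "pos_def (mat 1 - \<Lambda>)")
          case L1: True
          then have Y1: "pos_def (?Y - mat 1)" unfolding iff .
          have dl: "det \<Lambda> > 0" by (rule pos_def_det_pos[OF L])
          have dY: "det ?Y = 1 / det \<Lambda>" by (rule det_matrix_inv[OF iL])
          have "(?Y - mat 1) = (mat 1 - \<Lambda>) ** ?Y" by (simp add: matrix_diff_rdistrib matrix_inv_mult[OF iL])
          then have d1: "det (?Y - mat 1) = det (mat 1 - \<Lambda>) / det \<Lambda>" by (simp add: det_mul dY)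
          have "(?Y - ?H) = (mat 1 - ?H ** \<Lambda>) ** ?Y"
            by (simp add: matrix_diff_rdistrib matrix_cancel_right[OF iL])
          then have dH: "det (?Y - ?H) = det (mat 1 - ?H ** \<Lambda>) / det \<Lambda>" by (simp add: det_mul dY)
          have pos: "det (mat 1 - \<Lambda>) > 0" "det (mat 1 - ?H ** \<Lambda>) > 0"
            using pos_def_det_pos[OF L1] pos_def_det_pos[OF pdYH[OF Y1]] dl unfolding dH by (simp_all add: zero_less_divide_iff)
          have "det \<Lambda> powr (- (?m + 1)) * (det (?Y - ?H) powr \<beta> * det (?Y - mat 1) powr (c / 2) * det ?Y powr (- h)) =
            (det \<Lambda> powr (- (?m + 1)) * det \<Lambda> powr (- \<beta>) * det \<Lambda> powr (- (c / 2)) * det \<Lambda> powr h) *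
            (det (mat 1 - ?H ** \<Lambda>) powr \<beta> * det (mat 1 - \<Lambda>) powr (c / 2))"
            unfolding dH d1 dY using pos dl by (simp add: powr_divide powr_minus_divide)
          also have "det \<Lambda> powr (- (?m + 1)) * det \<Lambda> powr (- \<beta>) * det \<Lambda> powr (- (c / 2)) * det \<Lambda> powr h =
              det \<Lambda> powr ((a - c + real p - 2) / 2)"
          proof -
            have "- (?m + 1) + - \<beta> + - (c / 2) + h = (a - c + real p - 2) / 2"
              by (simp add: \<beta>_def h_def field_simps)
            then show ?thesis by (simp only: powr_add[symmetric])
          qed
          also have "\<dots> * (det (mat 1 - ?H ** \<Lambda>) powr \<beta> * det (mat 1 - \<Lambda>) powr (c / 2)) = ?k \<Lambda>"
            unfolding Lambda_kernel_eq[where f=f, OF f] beta_weight_def \<beta>_def[symmetric] using L L1 by simp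
          finally have "ennreal (det \<Lambda> powr (- (?m + 1))) * ennreal (det (?Y - ?H) powr \<beta> * det (?Y - mat 1) powr (c / 2) * det ?Y powr (- h)) = ennreal (?k \<Lambda>)"
            by (subst ennreal_mult'[symmetric]) simp_all
          then show ?thesis using L Y1 by (simp add: g_def invertible_matrix_inv(2)[OF iL] mult.assoc[symmetric])
        next
          case False
          then have "?k \<Lambda> = 0" unfolding Lambda_kernel_eq[where f=f, OF f] by (simp add: beta_weight_def)
          then show ?thesis using False iff by (simp add: g_def)
        qed
      next
        case False
        then have "?k \<Lambda> = 0" unfolding Lambda_kernel_eq[where f=f, OF f] by (simp add: beta_weight_def)
        then show ?thesis using False by simp
      qed
    qed
    finally show ?thesis using d by (simp add: C_def d_def ennreal_mult' mult.assoc del: power_Suc)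
  qed
  with C that show ?thesis by blast
qed

text \<open>
  The change of variables identifies the law of \<open>(I + B + \<Omega>)\<^sup>-\<^sup>1\<close> with that of \<open>E \<Lambda> E\<^sup>T\<close>; the conjugating
  matrix \<open>E\<close> contributes \<open>(1 + f i)\<^sup>-\<^sup>1\<^sup>/\<^sup>2\<close> twice to the diagonal mean.
\<close>

lemma omega_mean:
  fixes f :: "'m::finite \<Rightarrow> real" and R :: "real^'m^'m" and a b c :: real and n p :: nat
  assumes f: "\<And>i. f i > 0" and R: "R ** transpose R = mat 1" and c: "- 2 < c" "c < a + real p"
  defines "B \<equiv> R ** diag_mat f ** transpose R"
    and "\<beta> \<equiv> (b - a - real CARD('m) + real n) / 2"
    and "h \<equiv> (real CARD('m) + real n + b + real p) / 2"
  assumes e: "(\<integral>\<Lambda>. \<Lambda> \<partial>Lambda_law p n a b c (diag_mat f :: real^'m^'m)) = diag_mat e"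
  obtains r where "r > 0" and "(\<integral>\<^sup>+\<Omega>. ennreal (omega_weight \<beta> c h B \<Omega>) \<partial>sym_lborel) = ennreal r"
    and "integrable sym_lborel (\<lambda>\<Omega>. omega_weight \<beta> c h B \<Omega> *\<^sub>R matrix_inv (mat 1 + B + \<Omega>))"
    and "(\<integral>\<Omega>. omega_weight \<beta> c h B \<Omega> *\<^sub>R matrix_inv (mat 1 + B + \<Omega>) \<partial>sym_lborel) =
      r *\<^sub>R (R ** diag_mat (\<lambda>i. e i / (1 + f i)) ** transpose R)"
proof -
  define E where "E = R ** root_shrink f"
  define k where "k = Lambda_kernel p n a b c (diag_mat f :: real^'m^'m)"
  let ?w = "omega_weight \<beta> c h B" and ?G = "\<lambda>\<Omega>. matrix_inv (mat 1 + B + \<Omega>)" and ?T = "\<lambda>\<Lambda>. E ** \<Lambda> ** transpose E"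
  obtain C where C: "C > 0" and sub: "\<And>\<phi> :: real^'m^'m \<Rightarrow> ennreal. \<phi> \<in> borel_measurable borel \<Longrightarrow>
      (\<integral>\<^sup>+\<Omega>. ennreal (?w \<Omega>) * \<phi> (?G \<Omega>) \<partial>sym_lborel) = ennreal C * (\<integral>\<^sup>+\<Lambda>. ennreal (k \<Lambda>) * \<phi> (?T \<Lambda>) \<partial>sym_lborel)"
    using omega_to_Lambda[where f=f and R=R and a=a and b=b and c=c and n=n and p=p, OF f R, folded B_def \<beta>_def h_def E_def k_def] by blast
  note mass = Lambda_kernel_mass[where f=f and n=n and b=b, OF f c, folded k_def]
  have [measurable]: "k \<in> borel_measurable borel" unfolding k_def by measurable
  have k0: "k \<Lambda> \<ge> 0" for \<Lambda> unfolding k_def by simp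
  obtain z where z: "z > 0" "(\<integral>\<^sup>+\<Lambda>. ennreal (k \<Lambda>) \<partial>sym_lborel) = ennreal z"
    "\<And>g :: real^'m^'m \<Rightarrow> real^'m^'m. g \<in> borel_measurable sym_lborel \<Longrightarrow>
      (\<integral>x. g x \<partial>normalized sym_lborel k) = (1 / z) *\<^sub>R (\<integral>x. k x *\<^sub>R g x \<partial>sym_lborel)"
    by (rule normalized_density[of k sym_lborel]) (use k0 mass(1,2) in auto)
  have M: "(\<integral>\<Lambda>. k \<Lambda> *\<^sub>R \<Lambda> \<partial>sym_lborel) = z *\<^sub>R diag_mat e"
  proof -
    have "diag_mat e = (1 / z) *\<^sub>R (\<integral>\<Lambda>. k \<Lambda> *\<^sub>R \<Lambda> \<partial>sym_lborel)"
      using e z(3)[of "\<lambda>\<Lambda>. \<Lambda>"] by (simp add: Lambda_law_def k_def)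
    then show ?thesis using z(1) by simp
  qed
  \<comment> \<open>The equality of nonnegative integrals is an equality of measures, which covers matrix-valued integrands as well.\<close>
  have law: "distr (density sym_lborel (\<lambda>\<Omega>. ennreal (?w \<Omega>))) borel ?G = distr (density sym_lborel (\<lambda>\<Lambda>. ennreal (C * k \<Lambda>))) borel ?T"
  proof (rule measure_eqI)
    fix S assume "S \<in> sets (distr (density sym_lborel (\<lambda>\<Omega>. ennreal (?w \<Omega>))) borel ?G)"
    then have [measurable]: "S \<in> sets borel" by simp
    have "emeasure (distr (density sym_lborel (\<lambda>\<Omega>. ennreal (?w \<Omega>))) borel ?G) S =
        (\<integral>\<^sup>+\<Omega>. indicator S \<Omega> \<partial>distr (density sym_lborel (\<lambda>\<Omega>. ennreal (?w \<Omega>))) borel ?G)" by simp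
    also have "\<dots> = (\<integral>\<^sup>+\<Omega>. ennreal (?w \<Omega>) * indicator S (?G \<Omega>) \<partial>sym_lborel)"
      by (subst nn_integral_distr, simp, simp, subst nn_integral_density) auto
    also have "\<dots> = ennreal C * (\<integral>\<^sup>+\<Lambda>. ennreal (k \<Lambda>) * indicator S (?T \<Lambda>) \<partial>sym_lborel)"
      by (rule sub) measurable
    also have "\<dots> = (\<integral>\<^sup>+\<Lambda>. ennreal (C * k \<Lambda>) * indicator S (?T \<Lambda>) \<partial>sym_lborel)"
      using C by (subst nn_integral_cmult[symmetric]) (auto simp: ennreal_mult' mult.assoc)
    also have "\<dots> = (\<integral>\<^sup>+\<Lambda>. indicator S \<Lambda> \<partial>distr (density sym_lborel (\<lambda>\<Lambda>. ennreal (C * k \<Lambda>))) borel ?T)"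
      by (subst nn_integral_distr, simp, simp, subst nn_integral_density) auto
    finally show "emeasure (distr (density sym_lborel (\<lambda>\<Omega>. ennreal (?w \<Omega>))) borel ?G) S =
        emeasure (distr (density sym_lborel (\<lambda>\<Lambda>. ennreal (C * k \<Lambda>))) borel ?T) S" by simp
  qed simp
  have Ck: "(C * k \<Lambda>) *\<^sub>R ?T \<Lambda> = C *\<^sub>R ?T (k \<Lambda> *\<^sub>R \<Lambda>)" for \<Lambda> by (simp add: matrix_mult_scaleR matrix_scaleR_mult)
  have "integrable sym_lborel (\<lambda>\<Omega>. ?w \<Omega> *\<^sub>R ?G \<Omega>) \<longleftrightarrow> integrable (distr (density sym_lborel (\<lambda>\<Omega>. ennreal (?w \<Omega>))) borel ?G) (\<lambda>x. x)"
    by (subst integrable_distr_eq, simp, simp, subst integrable_density) auto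
  also have "\<dots> \<longleftrightarrow> integrable sym_lborel (\<lambda>\<Lambda>. (C * k \<Lambda>) *\<^sub>R ?T \<Lambda>)"
    unfolding law using C k0 by (subst integrable_distr_eq, simp, simp, subst integrable_density) auto
  finally have int: "integrable sym_lborel (\<lambda>\<Omega>. ?w \<Omega> *\<^sub>R ?G \<Omega>)"
    unfolding Ck
    using integrable_scaleR_right[OF integrable_bounded_linear[OF bounded_linear_congruence[of E "transpose E"] mass(3)], of C]
    by (simp only:)
  have "(\<integral>\<Omega>. ?w \<Omega> *\<^sub>R ?G \<Omega> \<partial>sym_lborel) = (\<integral>x. x \<partial>distr (density sym_lborel (\<lambda>\<Omega>. ennreal (?w \<Omega>))) borel ?G)"
    by (subst integral_distr, simp, simp, subst integral_density) auto
  also have "\<dots> = (\<integral>\<Lambda>. (C * k \<Lambda>) *\<^sub>R ?T \<Lambda> \<partial>sym_lborel)"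
    unfolding law using C k0 by (subst integral_distr, simp, simp, subst integral_density) auto
  also have "\<dots> = C *\<^sub>R ?T (z *\<^sub>R diag_mat e)"
    unfolding Ck M[symmetric] using integral_bounded_linear[OF bounded_linear_congruence mass(3), of E "transpose E"] by simp
  also have "\<dots> = (C * z) *\<^sub>R ?T (diag_mat e)" by (simp add: matrix_mult_scaleR matrix_scaleR_mult)
  also have "?T (diag_mat e) = R ** diag_mat (\<lambda>i. e i / (1 + f i)) ** transpose R"
  proof -
    have "1 / sqrt (1 + f i) * e i * (1 / sqrt (1 + f i)) = e i / (1 + f i)" for i
    proof -
      have "1 + f i > 0" using f[of i] by linarith
      then have "sqrt (1 + f i) * sqrt (1 + f i) = 1 + f i" by (simp only: real_sqrt_mult_self abs_of_pos)
      then show ?thesis by (simp add: divide_simps)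
    qed
    then have "root_shrink f ** diag_mat e ** root_shrink f = (diag_mat (\<lambda>i. e i / (1 + f i)) :: real^'m^'m)"
      by (simp only: diag_mat_mult)
    moreover have "?T (diag_mat e) = R ** (root_shrink f ** diag_mat e ** root_shrink f) ** transpose R"
      by (simp add: E_def matrix_transpose_mul matrix_mul_assoc)
    ultimately show ?thesis by simp
  qed
  finally have mean: "(\<integral>\<Omega>. ?w \<Omega> *\<^sub>R ?G \<Omega> \<partial>sym_lborel) = (C * z) *\<^sub>R (R ** diag_mat (\<lambda>i. e i / (1 + f i)) ** transpose R)" .
  have "(\<integral>\<^sup>+\<Omega>. ennreal (?w \<Omega>) \<partial>sym_lborel) = ennreal (C * z)"
    using sub[of "\<lambda>_. 1"] C z(1) by (simp add: z(2) ennreal_mult')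
  with int mean C z(1) that[of "C * z"] show ?thesis by simp
qed

section \<open>Moments of a matrix normal variable\<close>

lemma norm_matrix_mult_le: "norm ((X :: real^'k^'m) ** (Y :: real^'p^'k)) \<le> norm X * norm Y"
proof -
  have sq: "(norm (Z :: real^'b^'a))\<^sup>2 = (\<Sum>i\<in>UNIV. (norm (Z $ i))\<^sup>2)" for Z
    by (simp add: power2_norm_eq_inner inner_vec_def)
  have "(norm (X ** Y))\<^sup>2 = (\<Sum>i\<in>UNIV. \<Sum>j\<in>UNIV. ((X ** Y) $ i $ j)\<^sup>2)"
    unfolding power2_norm_eq_inner inner_vec_def by (simp add: power2_eq_square)
  also have "\<dots> \<le> (\<Sum>i\<in>UNIV. \<Sum>j\<in>UNIV. (norm (X $ i))\<^sup>2 * (norm (transpose Y $ j))\<^sup>2)"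
  proof (intro sum_mono)
    fix i :: 'm and j :: 'p
    have "(X ** Y) $ i $ j = X $ i \<bullet> transpose Y $ j"
      by (simp add: matrix_matrix_mult_def inner_vec_def transpose_def)
    then show "((X ** Y) $ i $ j)\<^sup>2 \<le> (norm (X $ i))\<^sup>2 * (norm (transpose Y $ j))\<^sup>2"
      using Cauchy_Schwarz_ineq[of "X $ i" "transpose Y $ j"] by (simp add: power2_norm_eq_inner)
  qed
  also have "\<dots> = (norm X)\<^sup>2 * (norm (transpose Y))\<^sup>2"
    unfolding sq by (simp add: sum_product)
  also have "norm (transpose Y) = norm Y"
    unfolding norm_eq_sqrt_inner inner_vec_def transpose_def by (simp add: sum.swap[of _ "UNIV :: 'p set"])
  finally have "(norm (X ** Y))\<^sup>2 \<le> (norm X * norm Y)\<^sup>2" by (simp only: power_mult_distrib)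
  then show ?thesis by (rule power2_le_imp_le) simp
qed

lemma norm_transpose_matrix: "norm (transpose (Y :: real^'p^'k)) = norm Y"
  unfolding norm_eq_sqrt_inner inner_vec_def transpose_def by (simp add: sum.swap[of _ "UNIV :: 'p set"])

lemma trace_quadratic_factor:
  fixes Z :: "real^'p^'m" and E :: "real^'m^'m" and K :: "real^'p^'p"
  shows "trace ((E ** transpose E) ** Z ** (K ** transpose K) ** transpose Z) = (norm (transpose E ** Z ** K))\<^sup>2"
proof -
  have "trace ((E ** transpose E) ** Z ** (K ** transpose K) ** transpose Z) =
      trace (E ** (transpose E ** Z ** K ** transpose K ** transpose Z))" by (simp add: matrix_mul_assoc)
  also have "\<dots> = trace ((transpose E ** Z ** K ** transpose K ** transpose Z) ** E)" by (rule trace_mul_sym)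
  also have "\<dots> = trace ((transpose E ** Z ** K) ** transpose (transpose E ** Z ** K))"
    by (simp add: matrix_transpose_mul matrix_mul_assoc)
  finally show ?thesis unfolding trace_mult_transpose .
qed

lemma trace_quadratic_nonneg:
  fixes N :: "real^'m^'m" and Q :: "real^'p^'p" and Z :: "real^'p^'m"
  assumes "pos_def N" "pos_def Q"
  shows "0 \<le> trace (N ** Z ** Q ** transpose Z)"
proof -
  obtain E :: "real^'m^'m" where "invertible E" and E: "N = E ** transpose E" using pos_def_factor[OF assms(1)] .
  obtain K :: "real^'p^'p" where "invertible K" and K: "Q = K ** transpose K" using pos_def_factor[OF assms(2)] .
  show ?thesis unfolding E K trace_quadratic_factor by simp
qed

text \<open>
  Bounds the norm by the quadratic form in the exponent, so that the exponential absorbs it.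
\<close>

lemma norm_mult_le_quadratic:
  fixes N :: "real^'m^'m" and Q :: "real^'p^'p" and Z :: "real^'p^'m"
  assumes N: "pos_def N" and Q: "pos_def Q"
  shows "norm (Z ** Q) \<le> 1 + trace Q * trace ((mat 1 + N) ** Z ** Q ** transpose Z)"
proof -
  obtain K :: "real^'p^'p" where "invertible K" and K: "Q = K ** transpose K" using pos_def_factor[OF Q] .
  have trQ: "trace Q = (norm K)\<^sup>2" unfolding K trace_mult_transpose ..
  have one: "trace (mat 1 ** Z ** Q ** transpose Z) = (norm (Z ** K))\<^sup>2"
    using trace_quadratic_factor[of "mat 1" Z K] unfolding K by simp
  have "norm (Z ** Q) \<le> norm (Z ** K) * norm K"
    using norm_matrix_mult_le[of "Z ** K" "transpose K"] unfolding K by (simp add: matrix_mul_assoc norm_transpose_matrix)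
  moreover have "2 * (norm (Z ** K) * norm K) \<le> 1 + (norm (Z ** K) * norm K)\<^sup>2"
    using sum_power2_ge_zero[of "norm (Z ** K) * norm K - 1" 0] by (simp add: power2_eq_square algebra_simps)
  moreover have "0 \<le> norm (Z ** K) * norm K" by simp
  ultimately have "norm (Z ** Q) \<le> 1 + (norm (Z ** K) * norm K)\<^sup>2" by linarith
  also have "(norm (Z ** K) * norm K)\<^sup>2 = trace Q * trace (mat 1 ** Z ** Q ** transpose Z)"
    unfolding trQ one by (simp add: power_mult_distrib)
  also have "\<dots> \<le> trace Q * trace ((mat 1 + N) ** Z ** Q ** transpose Z)"
    using trace_quadratic_nonneg[OF N Q, of Z] pos_def_trace_pos[OF Q]
    by (intro mult_left_mono) (simp_all add: matrix_add_rdistrib trace_add)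
  finally show ?thesis by simp
qed

text \<open>
  The matrix normal density with precision matrices \<open>A\<close> and \<open>Q\<close>, up to the factor \<open>gaussian_mass\<close>.
\<close>

definition gaussian_density :: "real^'m^'m \<Rightarrow> real^'p^'p \<Rightarrow> real^'p^'m \<Rightarrow> real" where
  "gaussian_density A Q Z = det A powr (real CARD('p) / 2) * det Q powr (real CARD('m) / 2) * gaussian_kernel A Q Z"

lemma gaussian_density_nonneg [simp]: "0 \<le> gaussian_density A Q Z"
  by (simp add: gaussian_density_def gaussian_kernel_def)

lemma borel_measurable_gaussian_density [measurable (raw)]:
  fixes f :: "'a \<Rightarrow> real^'m^'m" and g :: "'a \<Rightarrow> real^'p^'p" and h :: "'a \<Rightarrow> real^'p^'m"
  assumes [measurable]: "f \<in> borel_measurable M" "g \<in> borel_measurable M" "h \<in> borel_measurable M"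
  shows "(\<lambda>x. gaussian_density (f x) (g x) (h x)) \<in> borel_measurable M"
  unfolding gaussian_density_def by measurable

lemma gaussian_density_integral:
  fixes A :: "real^'m^'m" and Q :: "real^'p^'p"
  assumes A: "pos_def A" and Q: "pos_def Q"
  shows "(\<integral>\<^sup>+Z. ennreal (gaussian_density A Q Z) \<partial>lborel) = gaussian_mass TYPE('p) TYPE('m)"
proof -
  let ?c = "det A powr (real CARD('p) / 2) * det Q powr (real CARD('m) / 2)"
  have "(\<integral>\<^sup>+Z. ennreal (gaussian_density A Q Z) \<partial>lborel) = ennreal ?c * (\<integral>\<^sup>+Z. ennreal (gaussian_kernel A Q Z) \<partial>lborel)"
    unfolding gaussian_density_def by (subst nn_integral_cmult[symmetric]) (auto simp: ennreal_mult')
  also have "\<dots> = ennreal (?c * (det A powr (- real CARD('p) / 2) * det Q powr (- real CARD('m) / 2))) * gaussian_mass TYPE('p) TYPE('m)"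
    unfolding gaussian_integral[OF A Q] by (subst ennreal_mult'[of ?c]) (auto simp: mult.assoc)
  also have "?c * (det A powr (- real CARD('p) / 2) * det Q powr (- real CARD('m) / 2)) = 1"
    using pos_def_det_pos[OF A] pos_def_det_pos[OF Q] by (simp add: powr_minus field_simps)
  finally show ?thesis by simp
qed

text \<open>
  The norm is absorbed by half of the exponent, and what remains is bounded by a constant times the density with \<open>A / 2\<close>
  in place of \<open>A\<close>, which has the same mass. What matters is that the bound depends on \<open>Q\<close> only through its trace, because \<open>Q\<close> is integrated next.
\<close>

lemma gaussian_density_moment_bound:
  obtains K where "K < \<infinity>" and
    "\<And>(N :: real^'m^'m) (Q :: real^'p^'p). pos_def N \<Longrightarrow> pos_def Q \<Longrightarrow>
      (\<integral>\<^sup>+Z. ennreal (gaussian_density (mat 1 + N) Q Z * norm (Z ** Q)) \<partial>lborel) \<le> K * ennreal (1 + trace Q)"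
proof -
  \<comment> \<open>The factor by which the determinant part of the density changes when \<open>A\<close> is halved.\<close>
  define c where "c = 2 powr (real CARD('m) * real CARD('p) / 2)"
  define K where "K = ennreal (4 * c) * gaussian_mass TYPE('p) TYPE('m)"
  have "K < \<infinity>" using gaussian_mass_finite[where 'p='p and 'm='m] by (simp add: K_def ennreal_mult_less_top)
  moreover have "(\<integral>\<^sup>+Z. ennreal (gaussian_density (mat 1 + N) Q Z * norm (Z ** Q)) \<partial>lborel) \<le> K * ennreal (1 + trace Q)"
    if N: "pos_def N" and Q: "pos_def Q" for N :: "real^'m^'m" and Q :: "real^'p^'p"
  proof -
    let ?A = "mat 1 + N"
    let ?A2 = "(1 / 2) *\<^sub>R ?A"
    have A: "pos_def ?A" by (rule pos_def_add[OF pos_def_mat_1 N])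
    have A2: "pos_def ?A2" by (rule pos_def_scaleR[OF A]) simp
    have tQ: "trace Q > 0" by (rule pos_def_trace_pos[OF Q])
    have detA2: "det ?A2 powr (real CARD('p) / 2) * c = det ?A powr (real CARD('p) / 2)"
    proof -
      have "det ?A2 = (1 / 2) ^ CARD('m) * det ?A"
      proof -
        have "?A2 = ((1 / 2) *\<^sub>R mat 1) ** ?A" by (simp add: matrix_scaleR_mult)
        moreover have "((1 / 2) *\<^sub>R mat 1 :: real^'m^'m) = diag_mat (\<lambda>_. 1 / 2)"
          unfolding mat_1_diag diag_mat_scaleR by simp
        ultimately show ?thesis by (simp add: det_mul det_diag_mat)
      qed
      also have "(1 / 2 :: real) ^ CARD('m) = 2 powr (- real CARD('m))"
        by (simp only: powr_minus powr_realpow[OF zero_less_numeral] power_one_over inverse_eq_divide)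
      finally have "det ?A2 powr (real CARD('p) / 2) = 2 powr (- (real CARD('m) * real CARD('p) / 2)) * det ?A powr (real CARD('p) / 2)"
        using pos_def_det_pos[OF A] by (simp add: powr_mult powr_powr)
      moreover have "2 powr (- (real CARD('m) * real CARD('p) / 2)) * c = 1"
        unfolding c_def by (simp add: powr_add[symmetric])
      ultimately show ?thesis by (simp add: mult.assoc mult.left_commute)
    qed
    have bound: "gaussian_density ?A Q Z * norm (Z ** Q) \<le> (4 * c * (1 + trace Q)) * gaussian_density ?A2 Q Z" for Z
    proof -
      define u where "u = trace (?A ** Z ** Q ** transpose Z)"
      have u: "u \<ge> 0" unfolding u_def by (rule trace_quadratic_nonneg[OF A Q])
      have "1 + u / 4 \<le> exp (u / 4)" by (rule exp_ge_add_one_self)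
      then have eu: "1 + u \<le> 4 * exp (u / 4)" using u by linarith
      have "norm (Z ** Q) \<le> 1 + trace Q * u" unfolding u_def by (rule norm_mult_le_quadratic[OF N Q])
      also have "\<dots> \<le> (1 + trace Q) * (1 + u)" using tQ u by (simp add: algebra_simps)
      also have "\<dots> \<le> (1 + trace Q) * (4 * exp (u / 4))" using tQ by (intro mult_left_mono eu) simp
      finally have "exp (- u / 2) * norm (Z ** Q) \<le> exp (- u / 2) * ((1 + trace Q) * (4 * exp (u / 4)))"
        by (intro mult_left_mono) simp_all
      also have "\<dots> = 4 * (1 + trace Q) * (exp (- u / 2) * exp (u / 4))" by (simp only: ac_simps)
      also have "exp (- u / 2) * exp (u / 4) = exp (- (u / 4))" unfolding exp_add[symmetric] by simp
      finally have *: "exp (- u / 2) * norm (Z ** Q) \<le> 4 * (1 + trace Q) * exp (- (u / 4))" .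
      have "trace (?A2 ** Z ** Q ** transpose Z) = u / 2" by (simp add: u_def matrix_scaleR_mult trace_scaleR)
      then have k2: "gaussian_kernel ?A2 Q Z = exp (- (u / 4))" by (simp add: gaussian_kernel_def)
      have k1: "gaussian_kernel ?A Q Z = exp (- u / 2)" by (simp add: gaussian_kernel_def u_def)
      have "gaussian_density ?A Q Z * norm (Z ** Q) =
          (det ?A powr (real CARD('p) / 2) * det Q powr (real CARD('m) / 2)) * (exp (- u / 2) * norm (Z ** Q))"
        unfolding gaussian_density_def k1 by (simp only: ac_simps)
      also have "\<dots> \<le> (det ?A powr (real CARD('p) / 2) * det Q powr (real CARD('m) / 2)) * (4 * (1 + trace Q) * exp (- (u / 4)))"
        by (rule mult_left_mono[OF *]) simp
      also have "\<dots> = (4 * c * (1 + trace Q)) * gaussian_density ?A2 Q Z"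
        unfolding gaussian_density_def k2 detA2[symmetric] by (simp only: ac_simps)
      finally show ?thesis .
    qed
    have "(\<integral>\<^sup>+Z. ennreal (gaussian_density ?A Q Z * norm (Z ** Q)) \<partial>lborel) \<le>
        (\<integral>\<^sup>+Z. ennreal (4 * c * (1 + trace Q)) * ennreal (gaussian_density ?A2 Q Z) \<partial>lborel)"
    proof (rule nn_integral_mono)
      fix Z :: "real^'p^'m"
      show "ennreal (gaussian_density ?A Q Z * norm (Z ** Q)) \<le> ennreal (4 * c * (1 + trace Q)) * ennreal (gaussian_density ?A2 Q Z)"
        unfolding ennreal_mult''[OF gaussian_density_nonneg, symmetric] by (rule ennreal_leI[OF bound])
    qed
    also have "\<dots> = ennreal (4 * c * (1 + trace Q)) * gaussian_mass TYPE('p) TYPE('m)"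
      unfolding gaussian_density_integral[OF A2 Q, symmetric] by (rule nn_integral_cmult) measurable
    also have "\<dots> = K * ennreal (1 + trace Q)"
      using tQ by (subst ennreal_mult'') (auto simp: K_def ac_simps)
    finally show ?thesis .
  qed
  ultimately show ?thesis using that by blast
qed

lemma lborel_distr_uminus_matrix: "distr lborel borel uminus = (lborel :: (real^'p^'m) measure)"
proof -
  have "density (distr lborel borel (\<lambda>x. 0 + (- 1) *\<^sub>R x)) (\<lambda>_. ennreal (\<bar>- 1\<bar> ^ DIM(real^'p^'m))) = (lborel :: (real^'p^'m) measure)"
    by (rule lborel_affine[symmetric]) simp
  then show ?thesis by (simp add: density_1 one_ennreal_def[symmetric])
qed

lemma gaussian_density_mean:
  fixes N :: "real^'m^'m" and Q :: "real^'p^'p" and \<mu> :: "real^'p^'m"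
  assumes N: "pos_def N" and Q: "pos_def Q"
  defines "A \<equiv> mat 1 + N"
  shows "(\<integral>\<Theta>. gaussian_density A Q (\<Theta> - \<mu>) *\<^sub>R (\<Theta> ** Q) \<partial>lborel) =
      enn2real (gaussian_mass TYPE('p) TYPE('m)) *\<^sub>R (\<mu> ** Q)"
    and "integrable lborel (\<lambda>\<Theta>. gaussian_density A Q (\<Theta> - \<mu>))"
    and "(\<integral>\<Theta>. gaussian_density A Q (\<Theta> - \<mu>) \<partial>lborel) = enn2real (gaussian_mass TYPE('p) TYPE('m))"
proof -
  let ?g = "\<lambda>Z. gaussian_density A Q Z" and ?gm = "gaussian_mass TYPE('p) TYPE('m)"
  have A: "pos_def A" unfolding A_def by (rule pos_def_add[OF pos_def_mat_1 N])
  have nn: "(\<integral>\<^sup>+\<Theta>. ennreal (?g (\<Theta> - \<mu>)) \<partial>lborel) = ?gm"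
    using lborel_translation[of "\<lambda>Z. ennreal (?g Z)" \<mu>] gaussian_density_integral[OF A Q] by simp
  show int: "integrable lborel (\<lambda>\<Theta>. ?g (\<Theta> - \<mu>))"
    using gaussian_mass_finite[where 'p='p and 'm='m] by (intro integrableI_nonneg) (auto simp: nn)
  show val: "(\<integral>\<Theta>. ?g (\<Theta> - \<mu>) \<partial>lborel) = enn2real ?gm"
    by (subst integral_eq_nn_integral) (auto simp: nn)
  obtain K where K1: "K < \<infinity>" and K2: "\<And>(N :: real^'m^'m) (Q :: real^'p^'p). pos_def N \<Longrightarrow> pos_def Q \<Longrightarrow>
      (\<integral>\<^sup>+Z. ennreal (gaussian_density (mat 1 + N) Q Z * norm (Z ** Q)) \<partial>lborel) \<le> K * ennreal (1 + trace Q)"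
    using gaussian_density_moment_bound by blast
  note K = K1 K2[OF N Q, folded A_def]
  have intZ: "integrable lborel (\<lambda>Z. ?g Z *\<^sub>R (Z ** Q))"
  proof (rule integrableI_bounded)
    have "(\<integral>\<^sup>+Z. ennreal (norm (?g Z *\<^sub>R (Z ** Q))) \<partial>lborel) \<le> K * ennreal (1 + trace Q)" using K(2) by simp
    also have "\<dots> < \<infinity>" using K(1) by (simp add: ennreal_mult_less_top)
    finally show "(\<integral>\<^sup>+Z. ennreal (norm (?g Z *\<^sub>R (Z ** Q))) \<partial>lborel) < \<infinity>" .
  qed measurable
  \<comment> \<open>The centred density is even, so its first moment vanishes.\<close>
  have odd: "?g (- Z) *\<^sub>R (- Z ** Q) = - (?g Z *\<^sub>R (Z ** Q))" for Z
  proof -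
    have neg: "- Z ** Q = - (Z ** Q)" "transpose (- Z) = - transpose Z" "A ** (- Z) = - (A ** Z)"
      "- (A ** Z) ** Q = - (A ** Z ** Q)" "(- (A ** Z ** Q)) ** (- transpose Z) = A ** Z ** Q ** transpose Z"
      by (simp_all add: vec_eq_iff matrix_matrix_mult_def transpose_def sum_negf)
    then show ?thesis by (simp add: gaussian_density_def gaussian_kernel_def)
  qed
  have "(\<integral>Z. ?g Z *\<^sub>R (Z ** Q) \<partial>lborel) = (\<integral>Z. ?g (- Z) *\<^sub>R (- Z ** Q) \<partial>lborel)"
  proof -
    have "(\<integral>Z. ?g Z *\<^sub>R (Z ** Q) \<partial>lborel) = (\<integral>Z. ?g Z *\<^sub>R (Z ** Q) \<partial>distr lborel borel uminus)"
      by (simp only: lborel_distr_uminus_matrix)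
    then show ?thesis by (subst (asm) integral_distr) auto
  qed
  then have "(\<integral>Z. ?g Z *\<^sub>R (Z ** Q) \<partial>lborel) = - (\<integral>Z. ?g Z *\<^sub>R (Z ** Q) \<partial>lborel)" unfolding odd by simp
  then have "2 *\<^sub>R (\<integral>Z. ?g Z *\<^sub>R (Z ** Q) \<partial>lborel) = 0" unfolding scaleR_2 eq_neg_iff_add_eq_0 .
  then have zero: "(\<integral>Z. ?g Z *\<^sub>R (Z ** Q) \<partial>lborel) = 0" unfolding scaleR_eq_0_iff by simp
  have tr: "lborel = distr lborel borel (\<lambda>\<Theta> :: real^'p^'m. \<Theta> - \<mu>)"
  proof -
    have "(\<lambda>\<Theta>. \<Theta> - \<mu>) = (+) (- \<mu>)" by (simp add: fun_eq_iff)
    then show ?thesis by (simp only: lborel_distr_plus)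
  qed
  have shift: "integrable lborel (\<lambda>\<Theta>. ?g (\<Theta> - \<mu>) *\<^sub>R ((\<Theta> - \<mu>) ** Q))"
    and shift0: "(\<integral>\<Theta>. ?g (\<Theta> - \<mu>) *\<^sub>R ((\<Theta> - \<mu>) ** Q) \<partial>lborel) = 0"
  proof -
    have "integrable (distr lborel borel (\<lambda>\<Theta> :: real^'p^'m. \<Theta> - \<mu>)) (\<lambda>Z. ?g Z *\<^sub>R (Z ** Q))" unfolding tr[symmetric] by (rule intZ)
    then show "integrable lborel (\<lambda>\<Theta>. ?g (\<Theta> - \<mu>) *\<^sub>R ((\<Theta> - \<mu>) ** Q))" by (subst (asm) integrable_distr_eq) auto
    have "(\<integral>Z. ?g Z *\<^sub>R (Z ** Q) \<partial>distr lborel borel (\<lambda>\<Theta> :: real^'p^'m. \<Theta> - \<mu>)) = 0" unfolding tr[symmetric] by (rule zero)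
    then show "(\<integral>\<Theta>. ?g (\<Theta> - \<mu>) *\<^sub>R ((\<Theta> - \<mu>) ** Q) \<partial>lborel) = 0" by (subst (asm) integral_distr) auto
  qed
  have "?g (\<Theta> - \<mu>) *\<^sub>R (\<Theta> ** Q) = ?g (\<Theta> - \<mu>) *\<^sub>R ((\<Theta> - \<mu>) ** Q) + ?g (\<Theta> - \<mu>) *\<^sub>R (\<mu> ** Q)" for \<Theta>
    by (simp add: matrix_diff_rdistrib scaleR_diff_right)
  then show "(\<integral>\<Theta>. ?g (\<Theta> - \<mu>) *\<^sub>R (\<Theta> ** Q) \<partial>lborel) = enn2real ?gm *\<^sub>R (\<mu> ** Q)"
    using shift shift0 int val by simp
qed

section \<open>The posterior density\<close>

text \<open>
  The mean of \<open>\<Theta>\<close> given \<open>\<Omega>\<close>, \<open>Q\<close> and the data.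
\<close>

definition posterior_center :: "real^'p^'m \<Rightarrow> real^'m^'m \<Rightarrow> real^'p^'m" where
  "posterior_center x \<Omega> = x - matrix_inv (mat 1 + \<Omega>) ** x"

text \<open>
  The inverse of the scale matrix of the Wishart law of \<open>Q\<close> given \<open>\<Omega>\<close> and the data.
\<close>

definition posterior_scale :: "real^'p^'m \<Rightarrow> real^'p^'p \<Rightarrow> real^'m^'m \<Rightarrow> real^'p^'p" where
  "posterior_scale x s \<Omega> = s + transpose x ** matrix_inv (mat 1 + \<Omega>) ** x"

text \<open>
  The joint density of \<open>\<Omega>\<close> and \<open>Q\<close> after the integration over \<open>\<Theta>\<close>, up to a constant.
\<close>

definition marginal_weight :: "real \<Rightarrow> real \<Rightarrow> real \<Rightarrow> real^'p^'m \<Rightarrow> real^'p^'p \<Rightarrow> real^'m^'m \<Rightarrow> real^'p^'p \<Rightarrow> real" where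
  "marginal_weight a c \<gamma> x s \<Omega> Q =
     (if pos_def \<Omega> then det (mat 1 + \<Omega>) powr (- a / 2 - real CARD('m) - real CARD('p) / 2) * det \<Omega> powr (c / 2) else 0) *
     cone_weight \<gamma> ((1 / 2) *\<^sub>R posterior_scale x s \<Omega>) Q"

lemma marginal_weight_nonneg [simp]: "0 \<le> marginal_weight a c \<gamma> x s \<Omega> Q"
  by (simp add: marginal_weight_def)

lemma borel_measurable_posterior_center [measurable (raw)]:
  fixes g :: "'a \<Rightarrow> real^'m^'m"
  assumes [measurable]: "g \<in> borel_measurable M"
  shows "(\<lambda>y. posterior_center x (g y)) \<in> borel_measurable M"
  unfolding posterior_center_def by measurable

lemma borel_measurable_posterior_scale [measurable (raw)]:
  fixes g :: "'a \<Rightarrow> real^'m^'m"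
  assumes [measurable]: "g \<in> borel_measurable M"
  shows "(\<lambda>y. posterior_scale x s (g y)) \<in> borel_measurable M"
  unfolding posterior_scale_def by measurable

lemma borel_measurable_marginal_weight [measurable (raw)]:
  fixes g :: "'a \<Rightarrow> real^'m^'m" and q :: "'a \<Rightarrow> real^'p^'p"
  assumes [measurable]: "g \<in> borel_measurable M" "q \<in> borel_measurable M"
  shows "(\<lambda>y. marginal_weight a c \<gamma> x s (g y) (q y)) \<in> borel_measurable M"
  unfolding marginal_weight_def by measurable

lemma marginal_weight_support: "marginal_weight a c \<gamma> x s \<Omega> Q \<noteq> 0 \<Longrightarrow> pos_def \<Omega> \<and> pos_def Q"
  by (auto simp: marginal_weight_def cone_weight_def split: if_splits)

text \<open>
  Likelihood and prior add up to the row precision \<open>I + \<Omega>\<^sup>-\<^sup>1\<close> of \<open>\<Theta>\<close>. The bound on the norm holds because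
  \<open>0 < (I + \<Omega>)\<^sup>-\<^sup>1 < I\<close>.
\<close>

lemma posterior_inverse:
  fixes \<Omega> :: "real^'m^'m"
  assumes O: "pos_def \<Omega>"
  shows "pos_def (mat 1 + \<Omega>)" and "pos_def (matrix_inv (mat 1 + \<Omega>))" and "pos_def (mat 1 + matrix_inv \<Omega>)"
    and "matrix_inv (mat 1 + matrix_inv \<Omega>) = mat 1 - matrix_inv (mat 1 + \<Omega>)"
    and "det (mat 1 + matrix_inv \<Omega>) = det (mat 1 + \<Omega>) / det \<Omega>"
    and "norm (matrix_inv (mat 1 + \<Omega>)) \<le> real CARD('m) ^ 3"
proof -
  let ?L = "matrix_inv (mat 1 + \<Omega>)"
  show O1: "pos_def (mat 1 + \<Omega>)" by (rule pos_def_add[OF pos_def_mat_1 O])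
  then show L: "pos_def ?L" by (rule pos_def_matrix_inv)
  show "pos_def (mat 1 + matrix_inv \<Omega>)" by (rule pos_def_add[OF pos_def_mat_1 pos_def_matrix_inv[OF O]])
  note iO = pos_def_invertible[OF O] and iO1 = pos_def_invertible[OF O1]
  have fact: "mat 1 + matrix_inv \<Omega> = matrix_inv \<Omega> ** (mat 1 + \<Omega>)"
    by (simp add: matrix_add_ldistrib matrix_inv_mult[OF iO])
  have "(mat 1 + \<Omega>) ** ?L = mat 1" by (rule matrix_inv_mult(1)[OF iO1])
  then have OL: "\<Omega> ** ?L = mat 1 - ?L" by (simp add: matrix_add_rdistrib eq_diff_eq add.commute)
  show "matrix_inv (mat 1 + matrix_inv \<Omega>) = mat 1 - ?L"
    unfolding fact matrix_inv_mult_distrib[OF invertible_matrix_inv(1)[OF iO] iO1] invertible_matrix_inv(2)[OF iO] OL[symmetric]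
  proof -
    have "?L ** \<Omega> = mat 1 - ?L"
      using matrix_inv_mult(2)[OF iO1] by (simp add: matrix_add_ldistrib eq_diff_eq add.commute)
    then show "?L ** \<Omega> = \<Omega> ** ?L" unfolding OL .
  qed
  show "det (mat 1 + matrix_inv \<Omega>) = det (mat 1 + \<Omega>) / det \<Omega>"
    unfolding fact by (simp add: det_mul det_matrix_inv[OF iO])
  have "pos_def (mat 1 - ?L)" using pos_def_diff_mat_1_iff[OF O1] O by simp
  from pos_def_trace_pos[OF this] have "trace ?L \<le> real CARD('m)" by (simp add: trace_sub trace_I)
  then have "(real CARD('m))\<^sup>2 * trace ?L \<le> (real CARD('m))\<^sup>2 * real CARD('m)" by (intro mult_left_mono) auto
  with pos_def_norm_le_trace[OF L] show "norm ?L \<le> real CARD('m) ^ 3"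
    by (simp only: power3_eq_cube power2_eq_square)
qed

text \<open>
  Completing the square in \<open>\<Theta>\<close>. The powers of \<open>det Q\<close> come from two matrix normal densities, the Wishart density and the
  prior; one of the two factors \<open>det Q\<^sup>m\<^sup>/\<^sup>2\<close> goes into the density of \<open>\<Theta>\<close>, the other one into \<open>\<gamma>\<close>. The condition
  \<open>p \<le> n\<close> makes the multivariate gamma function in the Wishart density positive.
\<close>

lemma posterior_kernel_factor:
  fixes x :: "real^'p^'m" and s :: "real^'p^'p" and n :: nat and a b c :: real
  assumes s: "pos_def s" and n: "CARD('p) \<le> n"
  defines "\<gamma> \<equiv> (real CARD('m) + real n + b - 1) / 2"
  obtains C where "C > 0" and "\<And>\<Theta> \<Omega> Q. posterior_kernel n a b c x s (\<Theta>, \<Omega>, Q) =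
    C * (marginal_weight a c \<gamma> x s \<Omega> Q * gaussian_density (mat 1 + matrix_inv \<Omega>) Q (\<Theta> - posterior_center x \<Omega>))"
proof -
  let ?m = "real CARD('m)" and ?p = "real CARD('p)"
  define k where "k = (2 * pi) powr (- real (CARD('m) * CARD('p)) / 2)"
  define w where "w = det s powr ((real n - ?p - 1) / 2) / (2 powr (real n * ?p / 2) * multivariate_Gamma CARD('p) (real n / 2))"
  have "multivariate_Gamma CARD('p) (real n / 2) > 0"
    unfolding multivariate_Gamma_def
  proof (intro mult_pos_pos prod_pos)
    fix j assume "j \<in> {1..CARD('p)}"
    then have "real j \<le> real n" using n by simp
    then show "0 < Gamma (real n / 2 + (1 - real j) / 2)" by (intro Gamma_real_pos) (simp add: field_simps)
  qed simp
  then have w: "w > 0" using pos_def_det_pos[OF s] by (simp add: w_def)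
  have k: "k > 0" by (simp add: k_def)
  have "posterior_kernel n a b c x s (\<Theta>, \<Omega>, Q) =
    (k * k * w) * (marginal_weight a c \<gamma> x s \<Omega> Q * gaussian_density (mat 1 + matrix_inv \<Omega>) Q (\<Theta> - posterior_center x \<Omega>))" for \<Theta> \<Omega> Q
  proof (cases "pos_def \<Omega> \<and> pos_def Q")
    case False
    then show ?thesis using marginal_weight_support[of a c \<gamma> x s \<Omega> Q]
      by (auto simp: posterior_kernel_def prior_Omega_def prior_precision_def)
  next
    case True
    then have O: "pos_def \<Omega>" and Q: "pos_def Q" by auto
    note iQ = pos_def_invertible[OF Q] and inv = posterior_inverse[OF O]
    note dQ = pos_def_det_pos[OF Q] and dO = pos_def_det_pos[OF O] and dO1 = pos_def_det_pos[OF inv(1)]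
    let ?L = "matrix_inv (mat 1 + \<Omega>)" and ?A = "mat 1 + matrix_inv \<Omega>" and ?\<mu> = "posterior_center x \<Omega>" and ?V = "posterior_scale x s \<Omega>"
    define t1 where "t1 = trace ((x - \<Theta>) ** Q ** transpose (x - \<Theta>))"
    define t2 where "t2 = trace (matrix_inv \<Omega> ** \<Theta> ** Q ** transpose \<Theta>)"
    define t3 where "t3 = trace (?A ** (\<Theta> - ?\<mu>) ** Q ** transpose (\<Theta> - ?\<mu>))"
    have A: "matrix_inv \<Omega> + transpose (mat 1) ** mat 1 ** mat 1 = ?A" by (simp add: add.commute)
    have "invertible ?A" by (rule pos_def_invertible[OF inv(3)])
    then have "trace (mat 1 ** (x - mat 1 ** \<Theta>) ** Q ** transpose (x - mat 1 ** \<Theta>)) + t2 =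
      trace (?A ** (\<Theta> - matrix_inv ?A ** transpose (mat 1) ** mat 1 ** x) ** Q ** transpose (\<Theta> - matrix_inv ?A ** transpose (mat 1) ** mat 1 ** x)) +
      trace ((mat 1 - mat 1 ** mat 1 ** matrix_inv ?A ** transpose (mat 1) ** mat 1) ** x ** Q ** transpose x)"
      unfolding t2_def A[symmetric]
      by (intro complete_square) (simp_all add: pos_def_symmetric[OF Q] pos_def_symmetric[OF pos_def_matrix_inv[OF O]])
    moreover have "matrix_inv ?A ** x = ?\<mu>" unfolding inv(4) by (simp add: posterior_center_def matrix_diff_rdistrib)
    ultimately have sq: "t1 + t2 = t3 + trace (?L ** x ** Q ** transpose x)"
      by (simp add: t1_def t3_def inv(4))
    have "trace (?L ** x ** Q ** transpose x) = trace (transpose x ** (?L ** x ** Q))" by (rule trace_mul_sym)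
    also have "\<dots> = trace (Q ** (transpose x ** ?L ** x))"
      using trace_mul_sym[of "transpose x ** ?L ** x" Q] by (simp add: matrix_mul_assoc)
    finally have tV: "trace (Q ** s) + trace (?L ** x ** Q ** transpose x) = trace (Q ** ?V)"
      by (simp add: posterior_scale_def matrix_add_ldistrib trace_add)
    have expo: "exp (- t1 / 2) * exp (- trace (Q ** s) / 2) * exp (- t2 / 2) = exp (- trace (Q ** ?V) / 2) * exp (- t3 / 2)"
      unfolding exp_add[symmetric] using sq tV by (simp add: field_simps)
    have dQi: "det (matrix_inv Q) powr (- r) = det Q powr r" for r
      using dQ by (simp add: det_matrix_inv[OF iQ] powr_divide powr_minus_divide)
    have 1: "matrix_normal_density \<Theta> (mat 1) (matrix_inv Q) x = k * det Q powr (?m / 2) * exp (- t1 / 2)"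
      using dQi[of "?m / 2"] by (simp add: matrix_normal_density_def k_def t1_def invertible_matrix_inv(2)[OF iQ])
    have 2: "wishart_density n (matrix_inv Q) s = w * det Q powr (real n / 2) * exp (- trace (Q ** s) / 2)"
      using dQi[of "real n / 2"] s dQ
      by (simp add: wishart_density_def w_def invertible_matrix_inv(2)[OF iQ] det_matrix_inv[OF iQ] powr_divide)
    have 3: "matrix_normal_density 0 \<Omega> (matrix_inv Q) \<Theta> = k * det \<Omega> powr (- ?p / 2) * det Q powr (?m / 2) * exp (- t2 / 2)"
      using dQi[of "?m / 2"] by (simp add: matrix_normal_density_def k_def t2_def invertible_matrix_inv(2)[OF iQ])
    have 4: "prior_Omega a c \<Omega> * prior_precision b Q = det (mat 1 + \<Omega>) powr (- a / 2 - ?m) * det \<Omega> powr (c / 2) * det Q powr ((b - 1) / 2)"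
      using O Q by (simp add: prior_Omega_def prior_precision_def)
    have pQ: "det Q powr (?m / 2) * det Q powr (real n / 2) * det Q powr (?m / 2) * det Q powr ((b - 1) / 2) = det Q powr \<gamma> * det Q powr (?m / 2)"
      unfolding powr_add[symmetric] \<gamma>_def by (rule arg_cong[where f="\<lambda>r. det Q powr r"]) (simp add: field_simps)
    have pO: "det \<Omega> powr (- ?p / 2) * det (mat 1 + \<Omega>) powr (- a / 2 - ?m) =
        det (mat 1 + \<Omega>) powr (- a / 2 - ?m - ?p / 2) * det ?A powr (?p / 2)"
    proof -
      have "det (mat 1 + \<Omega>) powr (- a / 2 - ?m) = det (mat 1 + \<Omega>) powr (- a / 2 - ?m - ?p / 2) * det (mat 1 + \<Omega>) powr (?p / 2)"
        unfolding powr_add[symmetric] by simp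
      then show ?thesis unfolding inv(5) using dO dO1 by (simp add: powr_divide powr_minus_divide)
    qed
    have "posterior_kernel n a b c x s (\<Theta>, \<Omega>, Q) = matrix_normal_density \<Theta> (mat 1) (matrix_inv Q) x * wishart_density n (matrix_inv Q) s *
        matrix_normal_density 0 \<Omega> (matrix_inv Q) \<Theta> * (prior_Omega a c \<Omega> * prior_precision b Q)"
      by (simp add: posterior_kernel_def)
    also have "\<dots> = (k * k * w) * (det \<Omega> powr (- ?p / 2) * det (mat 1 + \<Omega>) powr (- a / 2 - ?m)) * det \<Omega> powr (c / 2) *
        (det Q powr (?m / 2) * det Q powr (real n / 2) * det Q powr (?m / 2) * det Q powr ((b - 1) / 2)) *
        (exp (- t1 / 2) * exp (- trace (Q ** s) / 2) * exp (- t2 / 2))"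
      unfolding 1 2 3 4 by (simp only: ac_simps)
    also have "\<dots> = (k * k * w) * (marginal_weight a c \<gamma> x s \<Omega> Q * gaussian_density ?A Q (\<Theta> - ?\<mu>))"
    proof -
      have "trace (Q ** ((1 / 2) *\<^sub>R ?V)) = trace (Q ** ?V) / 2" by (simp add: matrix_mult_scaleR trace_scaleR)
      then have mw: "marginal_weight a c \<gamma> x s \<Omega> Q =
          det (mat 1 + \<Omega>) powr (- a / 2 - ?m - ?p / 2) * det \<Omega> powr (c / 2) * (det Q powr \<gamma> * exp (- trace (Q ** ?V) / 2))"
        using O Q by (simp add: marginal_weight_def cone_weight_def)
      have gd: "gaussian_density ?A Q (\<Theta> - ?\<mu>) = det ?A powr (?p / 2) * det Q powr (?m / 2) * exp (- t3 / 2)"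
        by (simp add: gaussian_density_def gaussian_kernel_def t3_def)
      show ?thesis unfolding pO pQ expo mw gd by (simp only: ac_simps)
    qed
    finally show ?thesis .
  qed
  moreover have "k * k * w > 0" using k w by simp
  ultimately show ?thesis using that by blast
qed

text \<open>
  The Woodbury identity with \<open>L = (I + \<Omega>)\<^sup>-\<^sup>1\<close>. Both \<open>V\<^sup>-\<^sup>1\<close> and \<open>(I - L) x V\<^sup>-\<^sup>1\<close> are affine in \<open>G\<close>, which is what
  reduces the two posterior means to the mean of \<open>G\<close>.
\<close>

lemma posterior_scale_facts:
  fixes x :: "real^'p^'m" and s :: "real^'p^'p" and \<Omega> :: "real^'m^'m"
  assumes s: "pos_def s" and O: "pos_def \<Omega>"
  defines "B \<equiv> x ** matrix_inv s ** transpose x"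
    and "G \<equiv> matrix_inv (mat 1 + x ** matrix_inv s ** transpose x + \<Omega>)"
  shows "pos_def (posterior_scale x s \<Omega>)" and "pos_def G"
    and "matrix_inv (posterior_scale x s \<Omega>) = matrix_inv s - matrix_inv s ** transpose x ** G ** x ** matrix_inv s"
    and "posterior_center x \<Omega> ** matrix_inv (posterior_scale x s \<Omega>) =
      x ** (matrix_inv s - matrix_inv s ** transpose x ** G ** x ** matrix_inv s) - G ** x ** matrix_inv s"
    and "trace (matrix_inv (posterior_scale x s \<Omega>)) \<le> trace (matrix_inv s)"
    and "det (posterior_scale x s \<Omega>) = det s * det (mat 1 + B + \<Omega>) / det (mat 1 + \<Omega>)"
proof -
  let ?L = "matrix_inv (mat 1 + \<Omega>)"
  note inv = posterior_inverse[OF O]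
  have Li: "matrix_inv ?L = mat 1 + \<Omega>" by (rule invertible_matrix_inv(2)[OF pos_def_invertible[OF inv(1)]])
  have H: "matrix_inv ?L + x ** matrix_inv s ** transpose x = mat 1 + x ** matrix_inv s ** transpose x + \<Omega>"
    unfolding Li by (simp add: algebra_simps)
  note wb = woodbury[OF inv(2) s, of x, folded posterior_scale_def, unfolded H, folded G_def]
  show "pos_def (posterior_scale x s \<Omega>)" "pos_def G" by (fact wb(1), fact wb(2))
  show Vi: "matrix_inv (posterior_scale x s \<Omega>) = matrix_inv s - matrix_inv s ** transpose x ** G ** x ** matrix_inv s" by (fact wb(4))
  show "posterior_center x \<Omega> ** matrix_inv (posterior_scale x s \<Omega>) =
      x ** (matrix_inv s - matrix_inv s ** transpose x ** G ** x ** matrix_inv s) - G ** x ** matrix_inv s"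
    unfolding posterior_center_def matrix_diff_rdistrib wb(3) unfolding Vi ..
  have sT: "transpose (matrix_inv s) = matrix_inv s" by (rule pos_def_symmetric[OF pos_def_matrix_inv[OF s]])
  have "0 \<le> trace (mat 1 ** (matrix_inv s ** transpose x) ** G ** transpose (matrix_inv s ** transpose x))"
    by (rule trace_quadratic_nonneg[OF pos_def_mat_1 wb(2)])
  then have "0 \<le> trace (matrix_inv s ** transpose x ** G ** x ** matrix_inv s)"
    by (simp add: matrix_transpose_mul sT matrix_mul_assoc)
  then show "trace (matrix_inv (posterior_scale x s \<Omega>)) \<le> trace (matrix_inv s)" unfolding Vi by (simp add: trace_sub)
  show "det (posterior_scale x s \<Omega>) = det s * det (mat 1 + B + \<Omega>) / det (mat 1 + \<Omega>)"
    using det_woodbury[OF inv(2) s, of x, folded posterior_scale_def, unfolded H]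
    by (simp add: B_def det_matrix_inv[OF pos_def_invertible[OF inv(1)]])
qed

text \<open>
  Integration over \<open>Q\<close>. The mass is the power \<open>- h\<close> of \<open>det V\<close>, which the determinant identity splits into the
  last factor of \<open>omega_weight\<close> and a power of \<open>det (I + \<Omega>)\<close>. The trace is bounded uniformly in \<open>\<Omega>\<close> because
  \<open>V\<^sup>-\<^sup>1 \<le> s\<^sup>-\<^sup>1\<close>.
\<close>

lemma marginal_weight_integrals:
  fixes x :: "real^'p^'m" and s :: "real^'p^'p" and \<Omega> :: "real^'m^'m" and a c \<gamma> :: real
  assumes s: "pos_def s" and g: "\<gamma> > - 1"
  defines "h \<equiv> \<gamma> + (real CARD('p) + 1) / 2"
  defines "ow \<equiv> omega_weight (h - a / 2 - real CARD('m) - real CARD('p) / 2) c h (x ** matrix_inv s ** transpose x)"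
    and "C \<equiv> ((1 / 2) ^ CARD('p) * det s) powr (- h)"
  shows "(\<integral>\<^sup>+Q. ennreal (marginal_weight a c \<gamma> x s \<Omega> Q) \<partial>sym_lborel) = ennreal (C * ow \<Omega>) * cone_mass TYPE('p) \<gamma>"
    and "integrable sym_lborel (\<lambda>Q. marginal_weight a c \<gamma> x s \<Omega> Q *\<^sub>R Q)"
    and "(\<integral>Q. marginal_weight a c \<gamma> x s \<Omega> Q *\<^sub>R Q \<partial>sym_lborel) =
      (2 * C * cone_mean TYPE('p) \<gamma> * ow \<Omega>) *\<^sub>R matrix_inv (posterior_scale x s \<Omega>)"
    and "(\<integral>\<^sup>+Q. ennreal (marginal_weight a c \<gamma> x s \<Omega> Q * trace Q) \<partial>sym_lborel) \<le>
      ennreal (2 * C * cone_mean TYPE('p) \<gamma> * trace (matrix_inv s)) * ennreal (ow \<Omega>)"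
proof -
  \<comment> \<open>The part of \<open>marginal_weight\<close> that does not depend on \<open>Q\<close>.\<close>
  define pf where "pf = (if pos_def \<Omega> then det (mat 1 + \<Omega>) powr (- a / 2 - real CARD('m) - real CARD('p) / 2) * det \<Omega> powr (c / 2) else 0)"
  define V where "V = posterior_scale x s \<Omega>"
  let ?V2 = "(1 / 2) *\<^sub>R V"
  have mw: "marginal_weight a c \<gamma> x s \<Omega> Q = pf * cone_weight \<gamma> ?V2 Q" for Q
    by (simp add: marginal_weight_def pf_def V_def)
  have pf0: "pf \<ge> 0" by (simp add: pf_def)
  have C: "C > 0" using pos_def_det_pos[OF s] by (simp add: C_def)
  have cm: "cone_mean TYPE('p) \<gamma> > 0" by (rule cone_mean_pos[OF g])
  show "(\<integral>\<^sup>+Q. ennreal (marginal_weight a c \<gamma> x s \<Omega> Q) \<partial>sym_lborel) = ennreal (C * ow \<Omega>) * cone_mass TYPE('p) \<gamma>"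
    and int: "integrable sym_lborel (\<lambda>Q. marginal_weight a c \<gamma> x s \<Omega> Q *\<^sub>R Q)"
    and val: "(\<integral>Q. marginal_weight a c \<gamma> x s \<Omega> Q *\<^sub>R Q \<partial>sym_lborel) = (2 * C * cone_mean TYPE('p) \<gamma> * ow \<Omega>) *\<^sub>R matrix_inv V"
    and "(\<integral>\<^sup>+Q. ennreal (marginal_weight a c \<gamma> x s \<Omega> Q * trace Q) \<partial>sym_lborel) \<le>
      ennreal (2 * C * cone_mean TYPE('p) \<gamma> * trace (matrix_inv s)) * ennreal (ow \<Omega>)"
  proof -
    consider "\<not> pos_def \<Omega>" | "pos_def \<Omega>" by blast
    then have "(\<integral>\<^sup>+Q. ennreal (marginal_weight a c \<gamma> x s \<Omega> Q) \<partial>sym_lborel) = ennreal (C * ow \<Omega>) * cone_mass TYPE('p) \<gamma> \<and>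
      integrable sym_lborel (\<lambda>Q. marginal_weight a c \<gamma> x s \<Omega> Q *\<^sub>R Q) \<and>
      (\<integral>Q. marginal_weight a c \<gamma> x s \<Omega> Q *\<^sub>R Q \<partial>sym_lborel) = (2 * C * cone_mean TYPE('p) \<gamma> * ow \<Omega>) *\<^sub>R matrix_inv V \<and>
      (\<integral>\<^sup>+Q. ennreal (marginal_weight a c \<gamma> x s \<Omega> Q * trace Q) \<partial>sym_lborel) \<le>
      ennreal (2 * C * cone_mean TYPE('p) \<gamma> * trace (matrix_inv s)) * ennreal (ow \<Omega>)"
    proof cases
      case 1
      then have "pf = 0" "ow \<Omega> = 0" by (simp_all add: pf_def ow_def omega_weight_def)
      then show ?thesis by (simp add: mw)
    next
      case O: 2
      note sc = posterior_scale_facts[OF s O, of x, folded V_def] and inv = posterior_inverse[OF O]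
      have V2: "pos_def ?V2" by (rule pos_def_scaleR[OF sc(1)]) simp
      have V2i: "matrix_inv ?V2 = 2 *\<^sub>R matrix_inv V"
        by (rule matrix_inv_eqI) (simp add: matrix_scaleR_mult matrix_mult_scaleR matrix_inv_mult[OF pos_def_invertible[OF sc(1)]])
      let ?B = "x ** matrix_inv s ** transpose x"
      have B1: "pos_def (mat 1 + ?B + \<Omega>)"
        using pos_def_add_congruence[OF inv(1) pos_def_matrix_inv[OF s], of x] by (simp add: algebra_simps)
      have detV2: "det ?V2 = ((1 / 2) ^ CARD('p) * det s) * (det (mat 1 + ?B + \<Omega>) / det (mat 1 + \<Omega>))"
      proof -
        have "?V2 = ((1 / 2) *\<^sub>R mat 1) ** V" by (simp add: matrix_scaleR_mult)
        moreover have "((1 / 2) *\<^sub>R mat 1 :: real^'p^'p) = diag_mat (\<lambda>_. 1 / 2)" unfolding mat_1_diag diag_mat_scaleR by simp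
        ultimately show ?thesis by (simp add: det_mul det_diag_mat sc(6))
      qed
      have pfd: "pf * det ?V2 powr (- h) = C * ow \<Omega>"
      proof -
        note pos = pos_def_det_pos[OF s] pos_def_det_pos[OF B1] pos_def_det_pos[OF inv(1)]
        have *: "det ?V2 powr (- h) = C * (det (mat 1 + ?B + \<Omega>) powr (- h) * det (mat 1 + \<Omega>) powr h)"
          unfolding detV2 C_def using pos by (simp add: powr_mult powr_divide powr_minus_divide)
        have **: "det (mat 1 + \<Omega>) powr (- a / 2 - real CARD('m) - real CARD('p) / 2) * det (mat 1 + \<Omega>) powr h =
            det (mat 1 + \<Omega>) powr (h - a / 2 - real CARD('m) - real CARD('p) / 2)"
          unfolding powr_add[symmetric] by (rule arg_cong[where f="\<lambda>r. det (mat 1 + \<Omega>) powr r"]) simp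
        show ?thesis
          unfolding pf_def if_P[OF O] ow_def omega_weight_def * **[symmetric] by (simp only: mult.assoc mult.commute mult.left_commute)
      qed
      have mh: "- \<gamma> - (real CARD('p) + 1) / 2 = - h" by (simp add: h_def)
      obtain D :: "real^'p^'p" where D: "invertible D" "D ** ?V2 ** transpose D = mat 1" using pos_def_congruent_mat_1[OF V2] .
      have "(\<integral>\<^sup>+Q. ennreal (cone_weight \<gamma> ?V2 Q) \<partial>sym_lborel) = ennreal (det ?V2 powr (- h)) * cone_mass TYPE('p) \<gamma>"
        using cone_weight_congruence[OF D, of "\<lambda>_. 1" \<gamma>] unfolding mh cone_mass_def by simp
      then have mass: "(\<integral>\<^sup>+Q. ennreal (marginal_weight a c \<gamma> x s \<Omega> Q) \<partial>sym_lborel) = ennreal (C * ow \<Omega>) * cone_mass TYPE('p) \<gamma>"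
        unfolding mw pfd[symmetric] using pf0
        by (simp add: ennreal_mult' nn_integral_cmult mult.assoc)
      note mean = cone_weight_mean[OF g V2, unfolded mh]
      have sc1: "marginal_weight a c \<gamma> x s \<Omega> Q *\<^sub>R Q = pf *\<^sub>R (cone_weight \<gamma> ?V2 Q *\<^sub>R Q)" for Q by (simp add: mw)
      have int: "integrable sym_lborel (\<lambda>Q. marginal_weight a c \<gamma> x s \<Omega> Q *\<^sub>R Q)"
        unfolding sc1 by (rule integrable_scaleR_right[OF mean(1)])
      have "(\<integral>Q. marginal_weight a c \<gamma> x s \<Omega> Q *\<^sub>R Q \<partial>sym_lborel) = (pf * det ?V2 powr (- h) * cone_mean TYPE('p) \<gamma> * 2) *\<^sub>R matrix_inv V"
        unfolding sc1 integral_scaleR_right mean(2) V2i by (simp add: mult.assoc)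
      then have val: "(\<integral>Q. marginal_weight a c \<gamma> x s \<Omega> Q *\<^sub>R Q \<partial>sym_lborel) = (2 * C * cone_mean TYPE('p) \<gamma> * ow \<Omega>) *\<^sub>R matrix_inv V"
        unfolding pfd by (simp only: ac_simps)
      have tr: "marginal_weight a c \<gamma> x s \<Omega> Q * trace Q = trace (marginal_weight a c \<gamma> x s \<Omega> Q *\<^sub>R Q)" for Q
        by (simp add: trace_scaleR)
      have tr0: "0 \<le> marginal_weight a c \<gamma> x s \<Omega> Q * trace Q" for Q
        using marginal_weight_support[of a c \<gamma> x s \<Omega> Q] pos_def_trace_pos[of Q]
        by (cases "marginal_weight a c \<gamma> x s \<Omega> Q = 0") (auto simp: less_imp_le)
      have "(\<integral>\<^sup>+Q. ennreal (marginal_weight a c \<gamma> x s \<Omega> Q * trace Q) \<partial>sym_lborel) =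
          ennreal (\<integral>Q. trace (marginal_weight a c \<gamma> x s \<Omega> Q *\<^sub>R Q) \<partial>sym_lborel)"
        using tr0 integrable_bounded_linear[OF bounded_linear_trace int]
        unfolding tr by (intro nn_integral_eq_integral) auto
      also have "(\<integral>Q. trace (marginal_weight a c \<gamma> x s \<Omega> Q *\<^sub>R Q) \<partial>sym_lborel) = (2 * C * cone_mean TYPE('p) \<gamma> * ow \<Omega>) * trace (matrix_inv V)"
        by (subst integral_bounded_linear[OF bounded_linear_trace int]) (simp only: val trace_scaleR)
      also have "\<dots> \<le> (2 * C * cone_mean TYPE('p) \<gamma> * ow \<Omega>) * trace (matrix_inv s)"
        using sc(5) C cm by (intro mult_left_mono) (auto simp: ow_def)
      also have "\<dots> = (2 * C * cone_mean TYPE('p) \<gamma> * trace (matrix_inv s)) * ow \<Omega>" by (simp only: ac_simps)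
      also have "ennreal \<dots> = ennreal (2 * C * cone_mean TYPE('p) \<gamma> * trace (matrix_inv s)) * ennreal (ow \<Omega>)"
        by (rule ennreal_mult'') (simp add: ow_def)
      finally show ?thesis using mass int val by (auto simp: ennreal_leI)
    qed
    then show "(\<integral>\<^sup>+Q. ennreal (marginal_weight a c \<gamma> x s \<Omega> Q) \<partial>sym_lborel) = ennreal (C * ow \<Omega>) * cone_mass TYPE('p) \<gamma>"
      and "integrable sym_lborel (\<lambda>Q. marginal_weight a c \<gamma> x s \<Omega> Q *\<^sub>R Q)"
      and "(\<integral>Q. marginal_weight a c \<gamma> x s \<Omega> Q *\<^sub>R Q \<partial>sym_lborel) = (2 * C * cone_mean TYPE('p) \<gamma> * ow \<Omega>) *\<^sub>R matrix_inv V"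
      and "(\<integral>\<^sup>+Q. ennreal (marginal_weight a c \<gamma> x s \<Omega> Q * trace Q) \<partial>sym_lborel) \<le>
        ennreal (2 * C * cone_mean TYPE('p) \<gamma> * trace (matrix_inv s)) * ennreal (ow \<Omega>)" by blast+
  qed
qed

section \<open>Integration over the posterior\<close>

lemma pair_sigma_finite_sym_lborel:
  "pair_sigma_finite (sym_lborel :: (real^'m^'m) measure) (sym_lborel :: (real^'p^'p) measure)"
  by (intro pair_sigma_finite.intro sigma_finite_sym_lborel)

lemma sigma_finite_pair_sym_lborel:
  "sigma_finite_measure (sym_lborel \<Otimes>\<^sub>M sym_lborel :: ((real^'m^'m) \<times> (real^'p^'p)) measure)"
  by (rule sigma_finite_pair_measure[OF sigma_finite_sym_lborel sigma_finite_sym_lborel])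

lemma norm_mult_le_trace:
  fixes A :: "real^'p^'k" and Q :: "real^'p^'p"
  assumes "norm A \<le> k" "pos_def Q"
  shows "norm (A ** Q) \<le> k * (real CARD('p))\<^sup>2 * trace Q"
proof -
  have "norm (A ** Q) \<le> norm A * norm Q" by (rule norm_matrix_mult_le)
  also have "\<dots> \<le> k * ((real CARD('p))\<^sup>2 * trace Q)"
    using assms order_trans[OF norm_ge_zero assms(1)] by (intro mult_mono pos_def_norm_le_trace) auto
  finally show ?thesis by (simp only: mult.assoc)
qed

text \<open>
  Integration over \<open>\<Omega>\<close> on top of the integration over \<open>Q\<close>. The bounded matrix function \<open>H\<close> stands for the constant \<open>I\<close>, which
  gives the mean of \<open>Q\<close>, and for the conditional mean of \<open>\<Theta>\<close>, which gives that of \<open>\<Theta> Q\<close>.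
\<close>

lemma marginal_weight_moments:
  fixes x :: "real^'p^'m" and s :: "real^'p^'p" and a c \<gamma> r :: real
  assumes s: "pos_def s" and g: "\<gamma> > - 1"
  defines "h \<equiv> \<gamma> + (real CARD('p) + 1) / 2"
  defines "ow \<equiv> omega_weight (h - a / 2 - real CARD('m) - real CARD('p) / 2) c h (x ** matrix_inv s ** transpose x)"
    and "C \<equiv> ((1 / 2) ^ CARD('p) * det s) powr (- h)"
    and "W \<equiv> \<lambda>y. marginal_weight a c \<gamma> x s (fst y) (snd y)"
  assumes r: "(\<integral>\<^sup>+\<Omega>. ennreal (ow \<Omega>) \<partial>sym_lborel) = ennreal r"
  shows "(\<integral>\<^sup>+y. ennreal (W y) \<partial>(sym_lborel \<Otimes>\<^sub>M sym_lborel)) = ennreal C * ennreal r * cone_mass TYPE('p) \<gamma>"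
    and "(\<integral>\<^sup>+y. ennreal (W y * trace (snd y)) \<partial>(sym_lborel \<Otimes>\<^sub>M sym_lborel)) < \<infinity>"
    and "\<And>H :: real^'m^'m \<Rightarrow> real^'p^'k. H \<in> borel_measurable borel \<Longrightarrow> (\<And>\<Omega>. pos_def \<Omega> \<Longrightarrow> norm (H \<Omega>) \<le> k) \<Longrightarrow>
      (\<integral>y. W y *\<^sub>R (H (fst y) ** snd y) \<partial>(sym_lborel \<Otimes>\<^sub>M sym_lborel)) =
      (\<integral>\<Omega>. (2 * C * cone_mean TYPE('p) \<gamma> * ow \<Omega>) *\<^sub>R (H \<Omega> ** matrix_inv (posterior_scale x s \<Omega>)) \<partial>sym_lborel)"
proof -
  interpret P: pair_sigma_finite "sym_lborel :: (real^'m^'m) measure" "sym_lborel :: (real^'p^'p) measure"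
    by (rule pair_sigma_finite_sym_lborel)
  note mi = marginal_weight_integrals[OF s g, of a c x, folded h_def, folded ow_def C_def]
  have [measurable]: "ow \<in> borel_measurable borel" unfolding ow_def by measurable
  have [measurable]: "W \<in> borel_measurable (sym_lborel \<Otimes>\<^sub>M sym_lborel)" unfolding W_def by measurable
  have W0: "W y \<ge> 0" for y unfolding W_def by simp
  have C: "C \<ge> 0" by (simp add: C_def)
  have "(\<integral>\<^sup>+y. ennreal (W y) \<partial>(sym_lborel \<Otimes>\<^sub>M sym_lborel)) =
      (\<integral>\<^sup>+\<Omega>. \<integral>\<^sup>+Q. ennreal (W (\<Omega>, Q)) \<partial>sym_lborel \<partial>sym_lborel)"
    by (rule sym_lborel.nn_integral_fst[symmetric]) measurable
  also have "\<dots> = (\<integral>\<^sup>+\<Omega>. ennreal C * ennreal (ow \<Omega>) * cone_mass TYPE('p) \<gamma> \<partial>sym_lborel)"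
    unfolding W_def fst_conv snd_conv mi(1) using C by (simp add: ennreal_mult ow_def)
  also have "\<dots> = ennreal C * ennreal r * cone_mass TYPE('p) \<gamma>"
    by (simp add: nn_integral_multc nn_integral_cmult r)
  finally show "(\<integral>\<^sup>+y. ennreal (W y) \<partial>(sym_lborel \<Otimes>\<^sub>M sym_lborel)) = ennreal C * ennreal r * cone_mass TYPE('p) \<gamma>" .
  have "(\<integral>\<^sup>+y. ennreal (W y * trace (snd y)) \<partial>(sym_lborel \<Otimes>\<^sub>M sym_lborel)) =
      (\<integral>\<^sup>+\<Omega>. \<integral>\<^sup>+Q. ennreal (W (\<Omega>, Q) * trace (snd (\<Omega>, Q))) \<partial>sym_lborel \<partial>sym_lborel)"
    by (rule sym_lborel.nn_integral_fst[symmetric]) measurable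
  also have "\<dots> \<le> (\<integral>\<^sup>+\<Omega>. ennreal (2 * C * cone_mean TYPE('p) \<gamma> * trace (matrix_inv s)) * ennreal (ow \<Omega>) \<partial>sym_lborel)"
    unfolding W_def fst_conv snd_conv by (rule nn_integral_mono, rule mi(4))
  also have "\<dots> = ennreal (2 * C * cone_mean TYPE('p) \<gamma> * trace (matrix_inv s)) * ennreal r"
    by (simp add: nn_integral_cmult r)
  also have "\<dots> < \<infinity>" by (simp add: ennreal_mult_less_top)
  finally show tr: "(\<integral>\<^sup>+y. ennreal (W y * trace (snd y)) \<partial>(sym_lborel \<Otimes>\<^sub>M sym_lborel)) < \<infinity>" .
  fix H :: "real^'m^'m \<Rightarrow> real^'p^'k"
  assume [measurable]: "H \<in> borel_measurable borel" and k: "\<And>\<Omega>. pos_def \<Omega> \<Longrightarrow> norm (H \<Omega>) \<le> k"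
  have int: "integrable (sym_lborel \<Otimes>\<^sub>M sym_lborel) (\<lambda>y. W y *\<^sub>R (H (fst y) ** snd y))"
  proof (rule integrableI_bounded)
    have bound: "norm (W y *\<^sub>R (H (fst y) ** snd y)) \<le> (k * (real CARD('p))\<^sup>2) * (W y * trace (snd y))" for y
    proof (cases "W y = 0")
      case False
      then have pd: "pos_def (fst y)" "pos_def (snd y)" using marginal_weight_support unfolding W_def by blast+
      have "W y * norm (H (fst y) ** snd y) \<le> W y * (k * (real CARD('p))\<^sup>2 * trace (snd y))"
        by (rule mult_left_mono[OF norm_mult_le_trace[OF k[OF pd(1)] pd(2)] W0])
      then show ?thesis using W0[of y] by (simp add: ac_simps)
    qed simp
    have k0: "k \<ge> 0" using k[OF pos_def_mat_1] norm_ge_zero order_trans by blast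
    have "(\<integral>\<^sup>+y. ennreal (norm (W y *\<^sub>R (H (fst y) ** snd y))) \<partial>(sym_lborel \<Otimes>\<^sub>M sym_lborel)) \<le>
        (\<integral>\<^sup>+y. ennreal (k * (real CARD('p))\<^sup>2) * ennreal (W y * trace (snd y)) \<partial>(sym_lborel \<Otimes>\<^sub>M sym_lborel))"
    proof (rule nn_integral_mono)
      fix y
      have "0 \<le> k * (real CARD('p))\<^sup>2" using k0 by simp
      from ennreal_mult'[OF this, symmetric]
      show "ennreal (norm (W y *\<^sub>R (H (fst y) ** snd y))) \<le> ennreal (k * (real CARD('p))\<^sup>2) * ennreal (W y * trace (snd y))"
        by (simp only: ennreal_leI[OF bound])
    qed
    also have "\<dots> < \<infinity>" using tr by (simp add: nn_integral_cmult ennreal_mult_less_top)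
    finally show "(\<integral>\<^sup>+y. ennreal (norm (W y *\<^sub>R (H (fst y) ** snd y))) \<partial>(sym_lborel \<Otimes>\<^sub>M sym_lborel)) < \<infinity>" .
  qed measurable
  have inner: "(\<integral>Q. W (\<Omega>, Q) *\<^sub>R (H \<Omega> ** Q) \<partial>sym_lborel) =
      (2 * C * cone_mean TYPE('p) \<gamma> * ow \<Omega>) *\<^sub>R (H \<Omega> ** matrix_inv (posterior_scale x s \<Omega>))" for \<Omega>
  proof -
    have "(\<integral>Q. W (\<Omega>, Q) *\<^sub>R (H \<Omega> ** Q) \<partial>sym_lborel) =
        (\<integral>Q. H \<Omega> ** (marginal_weight a c \<gamma> x s \<Omega> Q *\<^sub>R Q) ** mat 1 \<partial>sym_lborel)"
      by (simp add: W_def matrix_mult_scaleR)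
    also have "\<dots> = H \<Omega> ** (\<integral>Q. marginal_weight a c \<gamma> x s \<Omega> Q *\<^sub>R Q \<partial>sym_lborel) ** mat 1"
      by (rule integral_bounded_linear[OF bounded_linear_congruence[of "H \<Omega>" "mat 1"] mi(2)])
    finally show ?thesis unfolding mi(3) by (simp add: matrix_mult_scaleR)
  qed
  show "(\<integral>y. W y *\<^sub>R (H (fst y) ** snd y) \<partial>(sym_lborel \<Otimes>\<^sub>M sym_lborel)) =
      (\<integral>\<Omega>. (2 * C * cone_mean TYPE('p) \<gamma> * ow \<Omega>) *\<^sub>R (H \<Omega> ** matrix_inv (posterior_scale x s \<Omega>)) \<partial>sym_lborel)"
    unfolding P.integral_fst'[OF int, symmetric] fst_conv snd_conv inner ..
qed

definition gaussian_mixture ::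
    "(real^'m^'m \<Rightarrow> real^'p^'p \<Rightarrow> real) \<Rightarrow> (real^'m^'m \<Rightarrow> real^'p^'m) \<Rightarrow>
     (real^'p^'m) \<times> (real^'m^'m) \<times> (real^'p^'p) \<Rightarrow> real" where
  "gaussian_mixture w \<mu> = (\<lambda>(\<Theta>, \<Omega>, Q). w \<Omega> Q * gaussian_density (mat 1 + matrix_inv \<Omega>) Q (\<Theta> - \<mu> \<Omega>))"

lemma borel_measurable_gaussian_mixture:
  fixes w :: "real^'m^'m \<Rightarrow> real^'p^'p \<Rightarrow> real" and \<mu> :: "real^'m^'m \<Rightarrow> real^'p^'m"
  assumes [measurable]: "(\<lambda>y. w (fst y) (snd y)) \<in> borel_measurable (sym_lborel \<Otimes>\<^sub>M sym_lborel)" "\<mu> \<in> borel_measurable borel"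
  shows "gaussian_mixture w \<mu> \<in> borel_measurable (lborel \<Otimes>\<^sub>M sym_lborel \<Otimes>\<^sub>M sym_lborel)"
proof -
  have "(\<lambda>z. (\<lambda>y. w (fst y) (snd y)) (snd z) * gaussian_density (mat 1 + matrix_inv (fst (snd z))) (snd (snd z)) (fst z - \<mu> (fst (snd z)))) \<in>
    borel_measurable (lborel \<Otimes>\<^sub>M sym_lborel \<Otimes>\<^sub>M sym_lborel)" by measurable
  then show ?thesis by (simp add: gaussian_mixture_def case_prod_beta')
qed

text \<open>
  Given \<open>(\<Omega>, Q)\<close> the inner integral over \<open>\<Theta>\<close> has the same value everywhere on the support of \<open>w\<close>.
\<close>

lemma gaussian_mixture_mass:
  fixes w :: "real^'m^'m \<Rightarrow> real^'p^'p \<Rightarrow> real" and \<mu> :: "real^'m^'m \<Rightarrow> real^'p^'m"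
  assumes w [measurable]: "(\<lambda>y. w (fst y) (snd y)) \<in> borel_measurable (sym_lborel \<Otimes>\<^sub>M sym_lborel)"
    and mu [measurable]: "\<mu> \<in> borel_measurable borel" and w0: "\<And>\<Omega> Q. 0 \<le> w \<Omega> Q"
    and supp: "\<And>\<Omega> Q. w \<Omega> Q \<noteq> 0 \<Longrightarrow> pos_def \<Omega> \<and> pos_def Q"
  shows "(\<integral>\<^sup>+z. ennreal (gaussian_mixture w \<mu> z) \<partial>(lborel \<Otimes>\<^sub>M sym_lborel \<Otimes>\<^sub>M sym_lborel)) =
    (\<integral>\<^sup>+y. ennreal (w (fst y) (snd y)) \<partial>(sym_lborel \<Otimes>\<^sub>M sym_lborel)) * gaussian_mass TYPE('p) TYPE('m)"
proof -
  interpret P: sigma_finite_measure "sym_lborel \<Otimes>\<^sub>M sym_lborel :: ((real^'m^'m) \<times> (real^'p^'p)) measure"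
    by (rule sigma_finite_pair_sym_lborel)
  interpret N: pair_sigma_finite "lborel :: (real^'p^'m) measure" "sym_lborel \<Otimes>\<^sub>M sym_lborel :: ((real^'m^'m) \<times> (real^'p^'p)) measure"
    by unfold_locales
  note [measurable] = borel_measurable_gaussian_mixture[OF w mu]
  have inner: "(\<integral>\<^sup>+\<Theta>. ennreal (gaussian_mixture w \<mu> (\<Theta>, y)) \<partial>lborel) =
      ennreal (w (fst y) (snd y)) * gaussian_mass TYPE('p) TYPE('m)" for y
  proof -
    obtain \<Omega> Q where y: "y = (\<Omega>, Q)" by (cases y)
    show ?thesis
    proof (cases "w \<Omega> Q = 0")
      case True
      then show ?thesis by (simp add: y gaussian_mixture_def)
    next
      case False
      then have pd: "pos_def \<Omega>" "pos_def Q" using supp by blast+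
      have "(\<integral>\<^sup>+\<Theta>. ennreal (gaussian_mixture w \<mu> (\<Theta>, y)) \<partial>lborel) =
          (\<integral>\<^sup>+\<Theta>. ennreal (w \<Omega> Q) * ennreal (gaussian_density (mat 1 + matrix_inv \<Omega>) Q (\<Theta> - \<mu> \<Omega>)) \<partial>lborel)"
        by (simp add: y gaussian_mixture_def ennreal_mult w0)
      also have "\<dots> = ennreal (w \<Omega> Q) * (\<integral>\<^sup>+\<Theta>. ennreal (gaussian_density (mat 1 + matrix_inv \<Omega>) Q (\<Theta> - \<mu> \<Omega>)) \<partial>lborel)"
        by (rule nn_integral_cmult) measurable
      also have "(\<integral>\<^sup>+\<Theta>. ennreal (gaussian_density (mat 1 + matrix_inv \<Omega>) Q (\<Theta> - \<mu> \<Omega>)) \<partial>lborel) = gaussian_mass TYPE('p) TYPE('m)"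
        using lborel_translation[of "\<lambda>Z. ennreal (gaussian_density (mat 1 + matrix_inv \<Omega>) Q Z)" "\<mu> \<Omega>"]
          gaussian_density_integral[OF posterior_inverse(3)[OF pd(1)] pd(2)] by simp
      finally show ?thesis by (simp add: y)
    qed
  qed
  have "(\<integral>\<^sup>+z. ennreal (gaussian_mixture w \<mu> z) \<partial>(lborel \<Otimes>\<^sub>M sym_lborel \<Otimes>\<^sub>M sym_lborel)) =
      (\<integral>\<^sup>+y. \<integral>\<^sup>+\<Theta>. ennreal (gaussian_mixture w \<mu> (\<Theta>, y)) \<partial>lborel \<partial>(sym_lborel \<Otimes>\<^sub>M sym_lborel))"
    by (rule N.nn_integral_snd[symmetric]) measurable
  then show ?thesis unfolding inner by (simp add: nn_integral_multc)
qed

text \<open>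
  Integrating over \<open>\<Theta>\<close> first replaces \<open>\<Theta>\<close> by its conditional mean. For the integrability of \<open>\<Theta> Q\<close>, it is split
  into \<open>(\<Theta> - \<mu>) Q\<close> and \<open>\<mu> Q\<close>; both are controlled by the mass of \<open>w\<close> and its first moment in \<open>tr Q\<close>.
\<close>

lemma gaussian_mixture_moments:
  fixes w :: "real^'m^'m \<Rightarrow> real^'p^'p \<Rightarrow> real" and \<mu> :: "real^'m^'m \<Rightarrow> real^'p^'m"
  assumes w [measurable]: "(\<lambda>y. w (fst y) (snd y)) \<in> borel_measurable (sym_lborel \<Otimes>\<^sub>M sym_lborel)"
    and mu [measurable]: "\<mu> \<in> borel_measurable borel" and w0: "\<And>\<Omega> Q. 0 \<le> w \<Omega> Q"
    and supp: "\<And>\<Omega> Q. w \<Omega> Q \<noteq> 0 \<Longrightarrow> pos_def \<Omega> \<and> pos_def Q"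
    and k: "\<And>\<Omega>. pos_def \<Omega> \<Longrightarrow> norm (\<mu> \<Omega>) \<le> k"
    and mass: "(\<integral>\<^sup>+y. ennreal (w (fst y) (snd y)) \<partial>(sym_lborel \<Otimes>\<^sub>M sym_lborel)) < \<infinity>"
    and tr: "(\<integral>\<^sup>+y. ennreal (w (fst y) (snd y) * trace (snd y)) \<partial>(sym_lborel \<Otimes>\<^sub>M sym_lborel)) < \<infinity>"
  defines "gm \<equiv> enn2real (gaussian_mass TYPE('p) TYPE('m))" and "N \<equiv> lborel \<Otimes>\<^sub>M sym_lborel \<Otimes>\<^sub>M sym_lborel"
  shows "integrable N (\<lambda>z. gaussian_mixture w \<mu> z *\<^sub>R snd (snd z))"
    and "(\<integral>z. gaussian_mixture w \<mu> z *\<^sub>R snd (snd z) \<partial>N) =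
      gm *\<^sub>R (\<integral>y. w (fst y) (snd y) *\<^sub>R snd y \<partial>(sym_lborel \<Otimes>\<^sub>M sym_lborel))"
    and "integrable N (\<lambda>z. gaussian_mixture w \<mu> z *\<^sub>R (fst z ** snd (snd z)))"
    and "(\<integral>z. gaussian_mixture w \<mu> z *\<^sub>R (fst z ** snd (snd z)) \<partial>N) =
      gm *\<^sub>R (\<integral>y. w (fst y) (snd y) *\<^sub>R (\<mu> (fst y) ** snd y) \<partial>(sym_lborel \<Otimes>\<^sub>M sym_lborel))"
proof -
  let ?P = "sym_lborel \<Otimes>\<^sub>M sym_lborel :: ((real^'m^'m) \<times> (real^'p^'p)) measure"
  let ?gm = "gaussian_mass TYPE('p) TYPE('m)" and ?p2 = "(real CARD('p))\<^sup>2"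
  let ?g = "\<lambda>\<Omega>. gaussian_density (mat 1 + matrix_inv \<Omega>)"
  interpret P: sigma_finite_measure ?P by (rule sigma_finite_pair_sym_lborel)
  interpret N: pair_sigma_finite "lborel :: (real^'p^'m) measure" ?P by unfold_locales
  have [measurable]: "gaussian_mixture w \<mu> \<in> borel_measurable (lborel \<Otimes>\<^sub>M ?P)"
    by (rule borel_measurable_gaussian_mixture[OF w mu])
  have G0: "0 \<le> gaussian_mixture w \<mu> z" for z by (simp add: gaussian_mixture_def split_beta w0)
  have k0: "k \<ge> 0" using k[OF pos_def_mat_1] norm_ge_zero order_trans by blast
  have trQ: "0 \<le> w \<Omega> Q * trace Q" for \<Omega> Q
    using supp[of \<Omega> Q] w0[of \<Omega> Q] pos_def_trace_pos[of Q] by (cases "w \<Omega> Q = 0") (auto simp: less_imp_le)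
  have normQ: "w \<Omega> Q * norm Q \<le> ?p2 * (w \<Omega> Q * trace Q)" for \<Omega> Q
  proof (cases "w \<Omega> Q = 0")
    case False
    then have "w \<Omega> Q * norm Q \<le> w \<Omega> Q * (?p2 * trace Q)"
      using supp by (intro mult_left_mono pos_def_norm_le_trace w0) blast
    then show ?thesis by (simp only: ac_simps)
  qed simp
  have int_normQ: "(\<integral>\<^sup>+y. ennreal (w (fst y) (snd y) * norm (snd y)) \<partial>?P) < \<infinity>"
  proof -
    have "(\<integral>\<^sup>+y. ennreal (w (fst y) (snd y) * norm (snd y)) \<partial>?P) \<le>
        (\<integral>\<^sup>+y. ennreal ?p2 * ennreal (w (fst y) (snd y) * trace (snd y)) \<partial>?P)"
      by (intro nn_integral_mono) (simp add: ennreal_mult'[symmetric] ennreal_leI[OF normQ])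
    also have "\<dots> < \<infinity>" using tr by (simp add: nn_integral_cmult ennreal_mult_less_top)
    finally show ?thesis .
  qed
  show int1: "integrable N (\<lambda>z. gaussian_mixture w \<mu> z *\<^sub>R snd (snd z))" unfolding N_def
  proof (rule integrableI_bounded)
    have eq: "norm (gaussian_mixture w \<mu> z *\<^sub>R snd (snd z)) = gaussian_mixture (\<lambda>\<Omega> Q. w \<Omega> Q * norm Q) \<mu> z" for z
      using G0[of z] by (simp add: gaussian_mixture_def split_beta)
    have "(\<integral>\<^sup>+z. ennreal (norm (gaussian_mixture w \<mu> z *\<^sub>R snd (snd z))) \<partial>(lborel \<Otimes>\<^sub>M ?P)) =
        (\<integral>\<^sup>+y. ennreal (w (fst y) (snd y) * norm (snd y)) \<partial>?P) * ?gm"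
      unfolding eq by (rule gaussian_mixture_mass) (use w0 supp in auto)
    also have "\<dots> < \<infinity>" using int_normQ gaussian_mass_finite[where 'p='p and 'm='m] by (simp add: ennreal_mult_less_top)
    finally show "(\<integral>\<^sup>+z. ennreal (norm (gaussian_mixture w \<mu> z *\<^sub>R snd (snd z))) \<partial>(lborel \<Otimes>\<^sub>M ?P)) < \<infinity>" .
  qed measurable
  have in1: "(\<integral>\<Theta>. gaussian_mixture w \<mu> (\<Theta>, y) *\<^sub>R snd (snd (\<Theta>, y)) \<partial>lborel) = gm *\<^sub>R (w (fst y) (snd y) *\<^sub>R snd y)" for y
  proof -
    obtain \<Omega> Q where y: "y = (\<Omega>, Q)" by (cases y)
    show ?thesis
    proof (cases "w \<Omega> Q = 0")
      case True
      then show ?thesis by (simp add: y gaussian_mixture_def)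
    next
      case False
      then have pd: "pos_def (matrix_inv \<Omega>)" "pos_def Q" using supp pos_def_matrix_inv by blast+
      note gd = gaussian_density_mean[OF pd, of "\<mu> \<Omega>", folded gm_def]
      have "(\<integral>\<Theta>. gaussian_mixture w \<mu> (\<Theta>, y) *\<^sub>R snd (snd (\<Theta>, y)) \<partial>lborel) = (\<integral>\<Theta>. ?g \<Omega> Q (\<Theta> - \<mu> \<Omega>) *\<^sub>R (w \<Omega> Q *\<^sub>R Q) \<partial>lborel)"
        by (simp add: y gaussian_mixture_def mult.commute)
      also have "\<dots> = gm *\<^sub>R (w \<Omega> Q *\<^sub>R Q)"
        by (subst integral_scaleR_left) (use gd in auto)
      finally show ?thesis by (simp add: y)
    qed
  qed
  have "(\<integral>z. gaussian_mixture w \<mu> z *\<^sub>R snd (snd z) \<partial>N) =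
      (\<integral>y. \<integral>\<Theta>. gaussian_mixture w \<mu> (\<Theta>, y) *\<^sub>R snd (snd (\<Theta>, y)) \<partial>lborel \<partial>?P)"
    using N.integral_snd[of "\<lambda>\<Theta> y. gaussian_mixture w \<mu> (\<Theta>, y) *\<^sub>R snd (snd (\<Theta>, y))"] int1
    by (simp add: N_def case_prod_beta')
  then show "(\<integral>z. gaussian_mixture w \<mu> z *\<^sub>R snd (snd z) \<partial>N) = gm *\<^sub>R (\<integral>y. w (fst y) (snd y) *\<^sub>R snd y \<partial>?P)"
    unfolding in1 integral_scaleR_right .
  obtain K where K1: "K < \<infinity>" and K2: "\<And>(N :: real^'m^'m) (Q :: real^'p^'p). pos_def N \<Longrightarrow> pos_def Q \<Longrightarrow>
      (\<integral>\<^sup>+Z. ennreal (gaussian_density (mat 1 + N) Q Z * norm (Z ** Q)) \<partial>lborel) \<le> K * ennreal (1 + trace Q)"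
    using gaussian_density_moment_bound by blast
  have in2: "(\<integral>\<^sup>+\<Theta>. ennreal (norm (gaussian_mixture w \<mu> (\<Theta>, y) *\<^sub>R (\<Theta> ** snd y))) \<partial>lborel) \<le>
      K * ennreal (w (fst y) (snd y)) + (K + ?gm * ennreal (k * ?p2)) * ennreal (w (fst y) (snd y) * trace (snd y))" for y
  proof -
    obtain \<Omega> Q where y: "y = (\<Omega>, Q)" by (cases y)
    show ?thesis
    proof (cases "w \<Omega> Q = 0")
      case True
      then show ?thesis by (simp add: y gaussian_mixture_def)
    next
      case False
      then have pd: "pos_def \<Omega>" "pos_def Q" using supp by blast+
      note pdi = pos_def_matrix_inv[OF pd(1)]
      have tQ: "trace Q > 0" by (rule pos_def_trace_pos[OF pd(2)])
      have pw: "norm (gaussian_mixture w \<mu> (\<Theta>, y) *\<^sub>R (\<Theta> ** snd y)) \<le>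
          w \<Omega> Q * (?g \<Omega> Q (\<Theta> - \<mu> \<Omega>) * norm ((\<Theta> - \<mu> \<Omega>) ** Q)) + w \<Omega> Q * (k * ?p2 * trace Q) * ?g \<Omega> Q (\<Theta> - \<mu> \<Omega>)" for \<Theta>
      proof -
        have "norm (\<Theta> ** Q) \<le> norm ((\<Theta> - \<mu> \<Omega>) ** Q) + norm (\<mu> \<Omega> ** Q)"
          using norm_triangle_ineq[of "(\<Theta> - \<mu> \<Omega>) ** Q" "\<mu> \<Omega> ** Q"] by (simp add: matrix_diff_rdistrib)
        also have "\<dots> \<le> norm ((\<Theta> - \<mu> \<Omega>) ** Q) + k * ?p2 * trace Q"
          using norm_mult_le_trace[OF k[OF pd(1)] pd(2)] by simp
        finally have "w \<Omega> Q * ?g \<Omega> Q (\<Theta> - \<mu> \<Omega>) * norm (\<Theta> ** Q) \<le>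
            w \<Omega> Q * ?g \<Omega> Q (\<Theta> - \<mu> \<Omega>) * (norm ((\<Theta> - \<mu> \<Omega>) ** Q) + k * ?p2 * trace Q)"
          by (intro mult_left_mono) (simp_all add: w0)
        also have "\<dots> = w \<Omega> Q * (?g \<Omega> Q (\<Theta> - \<mu> \<Omega>) * norm ((\<Theta> - \<mu> \<Omega>) ** Q)) + w \<Omega> Q * (k * ?p2 * trace Q) * ?g \<Omega> Q (\<Theta> - \<mu> \<Omega>)"
          by (simp only: distrib_left ac_simps)
        finally show ?thesis by (simp add: y gaussian_mixture_def w0)
      qed
      have c0: "0 \<le> w \<Omega> Q * (k * ?p2 * trace Q)" using k0 tQ w0[of \<Omega> Q] by simp
      have "(\<integral>\<^sup>+\<Theta>. ennreal (norm (gaussian_mixture w \<mu> (\<Theta>, y) *\<^sub>R (\<Theta> ** snd y))) \<partial>lborel) \<le>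
          (\<integral>\<^sup>+\<Theta>. ennreal (w \<Omega> Q) * ennreal (?g \<Omega> Q (\<Theta> - \<mu> \<Omega>) * norm ((\<Theta> - \<mu> \<Omega>) ** Q)) +
            ennreal (w \<Omega> Q * (k * ?p2 * trace Q)) * ennreal (?g \<Omega> Q (\<Theta> - \<mu> \<Omega>)) \<partial>lborel)"
      proof (rule nn_integral_mono)
        fix \<Theta> :: "real^'p^'m"
        show "ennreal (norm (gaussian_mixture w \<mu> (\<Theta>, y) *\<^sub>R (\<Theta> ** snd y))) \<le>
            ennreal (w \<Omega> Q) * ennreal (?g \<Omega> Q (\<Theta> - \<mu> \<Omega>) * norm ((\<Theta> - \<mu> \<Omega>) ** Q)) +
            ennreal (w \<Omega> Q * (k * ?p2 * trace Q)) * ennreal (?g \<Omega> Q (\<Theta> - \<mu> \<Omega>))"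
          unfolding ennreal_mult'[OF w0, symmetric] ennreal_mult'[OF c0, symmetric]
          by (rule order_trans[OF ennreal_leI[OF pw] eq_refl[OF ennreal_plus]]) (simp_all only: mult_nonneg_nonneg w0 c0 gaussian_density_nonneg norm_ge_zero)
      qed
      also have "\<dots> = ennreal (w \<Omega> Q) * (\<integral>\<^sup>+\<Theta>. ennreal (?g \<Omega> Q (\<Theta> - \<mu> \<Omega>) * norm ((\<Theta> - \<mu> \<Omega>) ** Q)) \<partial>lborel) +
          ennreal (w \<Omega> Q * (k * ?p2 * trace Q)) * (\<integral>\<^sup>+\<Theta>. ennreal (?g \<Omega> Q (\<Theta> - \<mu> \<Omega>)) \<partial>lborel)"
        by (simp add: nn_integral_add nn_integral_cmult)
      also have "(\<integral>\<^sup>+\<Theta>. ennreal (?g \<Omega> Q (\<Theta> - \<mu> \<Omega>) * norm ((\<Theta> - \<mu> \<Omega>) ** Q)) \<partial>lborel) =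
          (\<integral>\<^sup>+Z. ennreal (?g \<Omega> Q Z * norm (Z ** Q)) \<partial>lborel)"
        by (rule lborel_translation) measurable
      also have "(\<integral>\<^sup>+\<Theta>. ennreal (?g \<Omega> Q (\<Theta> - \<mu> \<Omega>)) \<partial>lborel) = (\<integral>\<^sup>+Z. ennreal (?g \<Omega> Q Z) \<partial>lborel)"
        by (rule lborel_translation) measurable
      also have "\<dots> = ?gm" by (rule gaussian_density_integral[OF posterior_inverse(3)[OF pd(1)] pd(2)])
      also have "ennreal (w \<Omega> Q) * (\<integral>\<^sup>+Z. ennreal (?g \<Omega> Q Z * norm (Z ** Q)) \<partial>lborel) + ennreal (w \<Omega> Q * (k * ?p2 * trace Q)) * ?gm \<le>
          ennreal (w \<Omega> Q) * (K * ennreal (1 + trace Q)) + ennreal (w \<Omega> Q * (k * ?p2 * trace Q)) * ?gm"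
        by (intro add_mono mult_left_mono K2[OF pdi pd(2)]) auto
      also have "ennreal (w \<Omega> Q) * (K * ennreal (1 + trace Q)) = K * ennreal (w \<Omega> Q) + K * ennreal (w \<Omega> Q * trace Q)"
        using less_imp_le[OF tQ] w0 by (simp add: ennreal_mult distrib_left ac_simps)
      also have "ennreal (w \<Omega> Q * (k * ?p2 * trace Q)) * ?gm = ?gm * ennreal (k * ?p2) * ennreal (w \<Omega> Q * trace Q)"
      proof -
        have "w \<Omega> Q * (k * ?p2 * trace Q) = (k * ?p2) * (w \<Omega> Q * trace Q)" by (simp only: ac_simps)
        then show ?thesis using k0 by (simp only: ennreal_mult'[of "k * ?p2"] mult_nonneg_nonneg zero_le_power2) (simp only: ac_simps)
      qed
      finally show ?thesis by (simp add: y distrib_right add.assoc)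
    qed
  qed
  show int2: "integrable N (\<lambda>z. gaussian_mixture w \<mu> z *\<^sub>R (fst z ** snd (snd z)))" unfolding N_def
  proof (rule integrableI_bounded)
    have "(\<integral>\<^sup>+z. ennreal (norm (gaussian_mixture w \<mu> z *\<^sub>R (fst z ** snd (snd z)))) \<partial>(lborel \<Otimes>\<^sub>M ?P)) =
        (\<integral>\<^sup>+y. \<integral>\<^sup>+\<Theta>. ennreal (norm (gaussian_mixture w \<mu> (\<Theta>, y) *\<^sub>R (fst (\<Theta>, y) ** snd (snd (\<Theta>, y))))) \<partial>lborel \<partial>?P)"
      by (rule N.nn_integral_snd[symmetric]) measurable
    also have "\<dots> \<le> (\<integral>\<^sup>+y. K * ennreal (w (fst y) (snd y)) + (K + ?gm * ennreal (k * ?p2)) * ennreal (w (fst y) (snd y) * trace (snd y)) \<partial>?P)"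
      unfolding fst_conv snd_conv by (rule nn_integral_mono, rule in2)
    also have "\<dots> = K * (\<integral>\<^sup>+y. ennreal (w (fst y) (snd y)) \<partial>?P) +
        (K + ?gm * ennreal (k * ?p2)) * (\<integral>\<^sup>+y. ennreal (w (fst y) (snd y) * trace (snd y)) \<partial>?P)"
      by (simp add: nn_integral_add nn_integral_cmult)
    also have "\<dots> < \<infinity>" using mass tr K1 gaussian_mass_finite[where 'p='p and 'm='m] by (simp add: ennreal_mult_less_top)
    finally show "(\<integral>\<^sup>+z. ennreal (norm (gaussian_mixture w \<mu> z *\<^sub>R (fst z ** snd (snd z)))) \<partial>(lborel \<Otimes>\<^sub>M ?P)) < \<infinity>" .
  qed measurable
  have in3: "(\<integral>\<Theta>. gaussian_mixture w \<mu> (\<Theta>, y) *\<^sub>R (fst (\<Theta>, y) ** snd (snd (\<Theta>, y))) \<partial>lborel) =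
      gm *\<^sub>R (w (fst y) (snd y) *\<^sub>R (\<mu> (fst y) ** snd y))" for y
  proof -
    obtain \<Omega> Q where y: "y = (\<Omega>, Q)" by (cases y)
    show ?thesis
    proof (cases "w \<Omega> Q = 0")
      case True
      then show ?thesis by (simp add: y gaussian_mixture_def)
    next
      case False
      then have pd: "pos_def (matrix_inv \<Omega>)" "pos_def Q" using supp pos_def_matrix_inv by blast+
      have "(\<integral>\<Theta>. gaussian_mixture w \<mu> (\<Theta>, y) *\<^sub>R (fst (\<Theta>, y) ** snd (snd (\<Theta>, y))) \<partial>lborel) =
          (\<integral>\<Theta>. w \<Omega> Q *\<^sub>R (?g \<Omega> Q (\<Theta> - \<mu> \<Omega>) *\<^sub>R (\<Theta> ** Q)) \<partial>lborel)"
        by (simp add: y gaussian_mixture_def)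
      also have "\<dots> = w \<Omega> Q *\<^sub>R (gm *\<^sub>R (\<mu> \<Omega> ** Q))"
        unfolding integral_scaleR_right gaussian_density_mean(1)[OF pd, folded gm_def] ..
      finally show ?thesis by (simp add: y mult.commute)
    qed
  qed
  have "(\<integral>z. gaussian_mixture w \<mu> z *\<^sub>R (fst z ** snd (snd z)) \<partial>N) =
      (\<integral>y. \<integral>\<Theta>. gaussian_mixture w \<mu> (\<Theta>, y) *\<^sub>R (fst (\<Theta>, y) ** snd (snd (\<Theta>, y))) \<partial>lborel \<partial>?P)"
    using N.integral_snd[of "\<lambda>\<Theta> y. gaussian_mixture w \<mu> (\<Theta>, y) *\<^sub>R (fst (\<Theta>, y) ** snd (snd (\<Theta>, y)))"] int2
    by (simp add: N_def case_prod_beta')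
  then show "(\<integral>z. gaussian_mixture w \<mu> z *\<^sub>R (fst z ** snd (snd z)) \<partial>N) =
      gm *\<^sub>R (\<integral>y. w (fst y) (snd y) *\<^sub>R (\<mu> (fst y) ** snd y) \<partial>?P)"
    unfolding in3 integral_scaleR_right .
qed

section \<open>The generalized Bayes estimator\<close>

text \<open>
  Affine functions commute with averaging.
\<close>

lemma weighted_affine_mean:
  fixes w :: "'a \<Rightarrow> real" and G :: "'a \<Rightarrow> 'b::euclidean_space" and L :: "'b \<Rightarrow> 'c::euclidean_space"
  assumes w: "w \<in> borel_measurable M" "\<And>y. 0 \<le> w y" and r: "r \<ge> 0" "(\<integral>\<^sup>+y. ennreal (w y) \<partial>M) = ennreal r"
    and G: "integrable M (\<lambda>y. w y *\<^sub>R G y)" "(\<integral>y. w y *\<^sub>R G y \<partial>M) = r *\<^sub>R m" and L: "bounded_linear L"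
  shows "(\<integral>y. w y *\<^sub>R (A + L (G y)) \<partial>M) = r *\<^sub>R (A + L m)"
proof -
  have int: "integrable M w" using w r by (intro integrableI_nonneg) auto
  have val: "(\<integral>y. w y \<partial>M) = r" using w r by (subst integral_eq_nn_integral) auto
  have eq: "w y *\<^sub>R (A + L (G y)) = w y *\<^sub>R A + L (w y *\<^sub>R G y)" for y
    by (simp add: scaleR_add_right linear_simps(5)[OF L])
  have "(\<integral>y. w y *\<^sub>R (A + L (G y)) \<partial>M) = (\<integral>y. w y *\<^sub>R A \<partial>M) + (\<integral>y. L (w y *\<^sub>R G y) \<partial>M)"
    unfolding eq by (rule Bochner_Integration.integral_add[OF integrable_scaleR_left[OF int] integrable_bounded_linear[OF L G(1)]])
  also have "(\<integral>y. w y *\<^sub>R A \<partial>M) = r *\<^sub>R A" using int val by simp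
  also have "(\<integral>y. L (w y *\<^sub>R G y) \<partial>M) = r *\<^sub>R L m"
    by (subst integral_bounded_linear[OF L G(1)]) (simp add: G(2) linear_simps(5)[OF L])
  finally show ?thesis by (simp add: scaleR_add_right)
qed

text \<open>
  The constant \<open>\<kappa>\<close> collects the normalizing constants of all three integrations. It is the same in both means,
  hence it cancels in the estimator.
\<close>

lemma posterior_means:
  fixes x :: "real^'p^'m" and s :: "real^'p^'p" and R :: "real^'m^'m" and f e :: "'m \<Rightarrow> real" and n :: nat and a b c :: real
  assumes n: "CARD('p) \<le> n" and s: "pos_def s" and R: "R ** transpose R = mat 1"
    and B: "x ** matrix_inv s ** transpose x = R ** diag_mat f ** transpose R"
    and f: "\<And>i. f i > 0" and c: "- 2 < c" "c < a + real CARD('p)" and b: "b > - real n - real CARD('m) - 1"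
    and e: "(\<integral>\<Lambda>. \<Lambda> \<partial>Lambda_law CARD('p) n a b c (diag_mat f :: real^'m^'m)) = diag_mat e"
  defines "m \<equiv> R ** diag_mat (\<lambda>i. e i / (1 + f i)) ** transpose R"
  obtains \<kappa> where "\<kappa> > 0" and "prob_space (posterior n a b c x s)"
    and "integrable (posterior n a b c x s) (\<lambda>(\<Theta>, \<Omega>, Q). \<Theta> ** Q)"
    and "integrable (posterior n a b c x s) (\<lambda>(\<Theta>, \<Omega>, Q). Q)"
    and "(\<integral>(\<Theta>, \<Omega>, Q). Q \<partial>posterior n a b c x s) =
      \<kappa> *\<^sub>R (matrix_inv s - matrix_inv s ** transpose x ** m ** (x ** matrix_inv s))"
    and "(\<integral>(\<Theta>, \<Omega>, Q). \<Theta> ** Q \<partial>posterior n a b c x s) =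
      \<kappa> *\<^sub>R (x ** matrix_inv s - (mat 1 + x ** matrix_inv s ** transpose x) ** m ** (x ** matrix_inv s))"
proof -
  define \<gamma> where "\<gamma> = (real CARD('m) + real n + b - 1) / 2"
  define h where "h = \<gamma> + (real CARD('p) + 1) / 2"
  let ?B = "x ** matrix_inv s ** transpose x"
  define ow where "ow = omega_weight (h - a / 2 - real CARD('m) - real CARD('p) / 2) c h ?B"
  define C where "C = ((1 / 2) ^ CARD('p) * det s) powr (- h)"
  let ?P = "sym_lborel \<Otimes>\<^sub>M sym_lborel :: ((real^'m^'m) \<times> (real^'p^'p)) measure"
  let ?N = "lborel \<Otimes>\<^sub>M ?P :: ((real^'p^'m) \<times> (real^'m^'m) \<times> (real^'p^'p)) measure"
  let ?G = "\<lambda>\<Omega>. matrix_inv (mat 1 + ?B + \<Omega>)" and ?V = "posterior_scale x s" and ?\<mu> = "posterior_center x"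
  let ?w = "marginal_weight a c \<gamma> x s" and ?gm = "gaussian_mass TYPE('p) TYPE('m)"
  have g: "\<gamma> > - 1" using b by (simp add: \<gamma>_def)
  have h: "h = (real CARD('m) + real n + b + real CARD('p)) / 2" by (simp add: h_def \<gamma>_def field_simps)
  have beta: "h - a / 2 - real CARD('m) - real CARD('p) / 2 = (b - a - real CARD('m) + real n) / 2"
    unfolding h by (simp add: field_simps)
  have ow': "ow = omega_weight ((b - a - real CARD('m) + real n) / 2) c ((real CARD('m) + real n + b + real CARD('p)) / 2)
      (R ** diag_mat f ** transpose R)"
    unfolding ow_def beta unfolding h B ..
  obtain r where r: "r > 0" "(\<integral>\<^sup>+\<Omega>. ennreal (ow \<Omega>) \<partial>sym_lborel) = ennreal r"
    "integrable sym_lborel (\<lambda>\<Omega>. ow \<Omega> *\<^sub>R ?G \<Omega>)" "(\<integral>\<Omega>. ow \<Omega> *\<^sub>R ?G \<Omega> \<partial>sym_lborel) = r *\<^sub>R m"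
    using omega_mean[where f=f and R=R and n=n and b=b, OF f R c e, folded ow' B m_def] by blast
  note mw = marginal_weight_moments[OF s g, of a c x, folded h_def, folded ow_def C_def, OF r(2)]
  have C: "C > 0" using pos_def_det_pos[OF s] by (simp add: C_def)
  have cm: "cone_mean TYPE('p) \<gamma> > 0" by (rule cone_mean_pos[OF g])
  obtain C0 where C0: "C0 > 0" and fac: "\<And>\<Theta> \<Omega> Q. posterior_kernel n a b c x s (\<Theta>, \<Omega>, Q) =
    C0 * (?w \<Omega> Q * gaussian_density (mat 1 + matrix_inv \<Omega>) Q (\<Theta> - ?\<mu> \<Omega>))"
    using posterior_kernel_factor[OF s n, of a b c x, folded \<gamma>_def] by blast
  have K: "posterior_kernel n a b c x s = (\<lambda>z. C0 * gaussian_mixture ?w ?\<mu> z)"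
    by (simp add: fun_eq_iff fac gaussian_mixture_def)
  have wm [measurable]: "(\<lambda>y. ?w (fst y) (snd y)) \<in> borel_measurable ?P" by measurable
  have mm [measurable]: "?\<mu> \<in> borel_measurable borel" by measurable
  note supp = marginal_weight_support[of a c \<gamma> x s]
  have nm: "norm (?\<mu> \<Omega>) \<le> norm x + real CARD('m) ^ 3 * norm x" if "pos_def \<Omega>" for \<Omega>
  proof -
    have "norm (?\<mu> \<Omega>) \<le> norm x + norm (matrix_inv (mat 1 + \<Omega>) ** x)"
      unfolding posterior_center_def by (rule norm_triangle_ineq4)
    also have "norm (matrix_inv (mat 1 + \<Omega>) ** x) \<le> norm (matrix_inv (mat 1 + \<Omega>)) * norm x" by (rule norm_matrix_mult_le)
    also have "\<dots> \<le> real CARD('m) ^ 3 * norm x" by (intro mult_right_mono posterior_inverse(6)[OF that]) simp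
    finally show ?thesis by simp
  qed
  have massW: "(\<integral>\<^sup>+y. ennreal (?w (fst y) (snd y)) \<partial>?P) < \<infinity>" "(\<integral>\<^sup>+y. ennreal (?w (fst y) (snd y)) \<partial>?P) > 0"
    using mw(1) C r(1) cone_mass_finite[OF g, where 'n='p] cone_mass_pos[of \<gamma>, where 'n='p]
    by (simp_all add: ennreal_mult_less_top ennreal_zero_less_mult_iff)
  have gmx: "(\<integral>\<^sup>+z. ennreal (gaussian_mixture ?w ?\<mu> z) \<partial>?N) = (\<integral>\<^sup>+y. ennreal (?w (fst y) (snd y)) \<partial>?P) * ?gm"
    by (rule gaussian_mixture_mass[OF wm mm marginal_weight_nonneg]) (rule supp)
  have gmm: "integrable ?N (\<lambda>z. gaussian_mixture ?w ?\<mu> z *\<^sub>R snd (snd z))"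
    "(\<integral>z. gaussian_mixture ?w ?\<mu> z *\<^sub>R snd (snd z) \<partial>?N) = enn2real ?gm *\<^sub>R (\<integral>y. ?w (fst y) (snd y) *\<^sub>R snd y \<partial>?P)"
    "integrable ?N (\<lambda>z. gaussian_mixture ?w ?\<mu> z *\<^sub>R (fst z ** snd (snd z)))"
    "(\<integral>z. gaussian_mixture ?w ?\<mu> z *\<^sub>R (fst z ** snd (snd z)) \<partial>?N) =
      enn2real ?gm *\<^sub>R (\<integral>y. ?w (fst y) (snd y) *\<^sub>R (?\<mu> (fst y) ** snd y) \<partial>?P)"
    by (rule gaussian_mixture_moments[OF wm mm marginal_weight_nonneg _ _ massW(1) mw(2)]; (rule supp | rule nm); assumption)+
  have [measurable]: "gaussian_mixture ?w ?\<mu> \<in> borel_measurable ?N" by (rule borel_measurable_gaussian_mixture[OF wm mm])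
  have Km: "posterior_kernel n a b c x s \<in> borel_measurable ?N" unfolding K by measurable
  have G0: "0 \<le> gaussian_mixture ?w ?\<mu> z" for z by (simp add: gaussian_mixture_def split_beta)
  have K0: "0 \<le> posterior_kernel n a b c x s z" for z using C0 G0 by (simp add: K)
  have "(\<integral>\<^sup>+z. ennreal (posterior_kernel n a b c x s z) \<partial>?N) = ennreal C0 * (\<integral>\<^sup>+y. ennreal (?w (fst y) (snd y)) \<partial>?P) * ?gm"
    unfolding K using C0 by (simp add: ennreal_mult' nn_integral_cmult gmx mult.assoc)
  then have Kmass: "0 < (\<integral>\<^sup>+z. ennreal (posterior_kernel n a b c x s z) \<partial>?N)" "(\<integral>\<^sup>+z. ennreal (posterior_kernel n a b c x s z) \<partial>?N) < \<infinity>"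
    using massW C0 gaussian_mass_pos[where 'p='p and 'm='m] gaussian_mass_finite[where 'p='p and 'm='m]
    by (simp_all add: ennreal_mult_less_top ennreal_zero_less_mult_iff)
  obtain z where z: "z > 0" "(\<integral>\<^sup>+y. ennreal (posterior_kernel n a b c x s y) \<partial>?N) = ennreal z" "prob_space (posterior n a b c x s)"
    "\<And>\<phi> :: _ \<Rightarrow> real^'p^'p. \<phi> \<in> borel_measurable ?N \<Longrightarrow>
      integrable (posterior n a b c x s) \<phi> \<longleftrightarrow> integrable ?N (\<lambda>y. posterior_kernel n a b c x s y *\<^sub>R \<phi> y)"
    "\<And>\<phi> :: _ \<Rightarrow> real^'p^'p. \<phi> \<in> borel_measurable ?N \<Longrightarrow>
      (\<integral>y. \<phi> y \<partial>posterior n a b c x s) = (1 / z) *\<^sub>R (\<integral>y. posterior_kernel n a b c x s y *\<^sub>R \<phi> y \<partial>?N)"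
    unfolding posterior_def by (rule normalized_density[OF Km K0 Kmass]) auto
  obtain z' where z': "z' > 0" "(\<integral>\<^sup>+y. ennreal (posterior_kernel n a b c x s y) \<partial>?N) = ennreal z'"
    "\<And>\<phi> :: _ \<Rightarrow> real^'p^'m. \<phi> \<in> borel_measurable ?N \<Longrightarrow>
      integrable (posterior n a b c x s) \<phi> \<longleftrightarrow> integrable ?N (\<lambda>y. posterior_kernel n a b c x s y *\<^sub>R \<phi> y)"
    "\<And>\<phi> :: _ \<Rightarrow> real^'p^'m. \<phi> \<in> borel_measurable ?N \<Longrightarrow>
      (\<integral>y. \<phi> y \<partial>posterior n a b c x s) = (1 / z') *\<^sub>R (\<integral>y. posterior_kernel n a b c x s y *\<^sub>R \<phi> y \<partial>?N)"
    unfolding posterior_def by (rule normalized_density[OF Km K0 Kmass]) auto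
  \<comment> \<open>The normalization lemma is applied once for each of the two matrix types; both times it yields the total mass.\<close>
  have zz: "z' = z" using z(1,2) z'(1,2) by simp
  define \<kappa> where "\<kappa> = (1 / z) * C0 * enn2real ?gm * (2 * C * cone_mean TYPE('p) \<gamma>) * r"
  have "enn2real ?gm > 0" using gaussian_mass_pos[where 'p='p and 'm='m] gaussian_mass_finite[where 'p='p and 'm='m]
    by (simp add: enn2real_positive_iff)
  then have k: "\<kappa> > 0" using z(1) C0 C cm r(1) by (simp add: \<kappa>_def)
  have Keq: "posterior_kernel n a b c x s y *\<^sub>R \<phi> = C0 *\<^sub>R (gaussian_mixture ?w ?\<mu> y *\<^sub>R \<phi>)" for y and \<phi> :: "real^'p^'p"
    by (simp add: K)
  have Keq': "posterior_kernel n a b c x s y *\<^sub>R \<phi> = C0 *\<^sub>R (gaussian_mixture ?w ?\<mu> y *\<^sub>R \<phi>)" for y and \<phi> :: "real^'p^'m"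
    by (simp add: K)
  have caseQ: "(\<lambda>(\<Theta> :: real^'p^'m, \<Omega> :: real^'m^'m, Q :: real^'p^'p). Q) = (\<lambda>z. snd (snd z))"
    and caseT: "(\<lambda>(\<Theta> :: real^'p^'m, \<Omega> :: real^'m^'m, Q :: real^'p^'p). \<Theta> ** Q) = (\<lambda>z. fst z ** snd (snd z))"
    by (simp_all add: case_prod_beta')
  have mQ: "(\<lambda>z. snd (snd z)) \<in> borel_measurable ?N" and mT: "(\<lambda>z. fst z ** snd (snd z)) \<in> borel_measurable ?N"
    by measurable
  have i1: "integrable (posterior n a b c x s) (\<lambda>(\<Theta>, \<Omega>, Q). Q)"
    unfolding caseQ z(4)[OF mQ] Keq by (rule integrable_scaleR_right[OF gmm(1)])
  have i2: "integrable (posterior n a b c x s) (\<lambda>(\<Theta>, \<Omega>, Q). \<Theta> ** Q)"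
    unfolding caseT z'(3)[OF mT] Keq' by (rule integrable_scaleR_right[OF gmm(3)])
  have owm: "ow \<in> borel_measurable sym_lborel" unfolding ow_def by measurable
  have ow0: "0 \<le> ow \<Omega>" for \<Omega> unfolding ow_def by simp
  note mean = weighted_affine_mean[OF owm ow0 less_imp_le[OF r(1)] r(2,3,4)]
  let ?A = "matrix_inv s ** transpose x" and ?D = "x ** matrix_inv s" and ?B1 = "mat 1 + ?B"
  have eQ: "(2 * C * cone_mean TYPE('p) \<gamma> * ow \<Omega>) *\<^sub>R (mat 1 ** matrix_inv (?V \<Omega>)) =
      (2 * C * cone_mean TYPE('p) \<gamma>) *\<^sub>R (ow \<Omega> *\<^sub>R (matrix_inv s + - (?A ** ?G \<Omega> ** ?D)))" for \<Omega>
  proof (cases "pos_def \<Omega>")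
    case True
    show ?thesis unfolding posterior_scale_facts(3)[OF s True] by (simp add: matrix_mul_assoc)
  qed (simp add: ow_def omega_weight_def)
  have eT: "(2 * C * cone_mean TYPE('p) \<gamma> * ow \<Omega>) *\<^sub>R (?\<mu> \<Omega> ** matrix_inv (?V \<Omega>)) =
      (2 * C * cone_mean TYPE('p) \<gamma>) *\<^sub>R (ow \<Omega> *\<^sub>R (?D + - (?B1 ** ?G \<Omega> ** ?D)))" for \<Omega>
  proof (cases "pos_def \<Omega>")
    case True
    show ?thesis unfolding posterior_scale_facts(4)[OF s True]
      by (simp add: matrix_mul_assoc matrix_diff_ldistrib matrix_add_rdistrib algebra_simps)
  qed (simp add: ow_def omega_weight_def)
  have H1: "(\<lambda>\<Omega> :: real^'m^'m. mat 1 :: real^'p^'p) \<in> borel_measurable borel" by simp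
  have "(\<integral>y. ?w (fst y) (snd y) *\<^sub>R (mat 1 ** snd y) \<partial>?P) =
      (\<integral>\<Omega>. (2 * C * cone_mean TYPE('p) \<gamma> * ow \<Omega>) *\<^sub>R (mat 1 ** matrix_inv (?V \<Omega>)) \<partial>sym_lborel)"
    by (rule mw(3)[OF H1]) (rule order_refl)
  also have "\<dots> = (2 * C * cone_mean TYPE('p) \<gamma>) *\<^sub>R (r *\<^sub>R (matrix_inv s + - (?A ** m ** ?D)))"
    unfolding eQ integral_scaleR_right
    by (subst mean[OF bounded_linear_minus[OF bounded_linear_congruence[of ?A ?D]]]) (rule refl)
  finally have v1: "(\<integral>y. ?w (fst y) (snd y) *\<^sub>R snd y \<partial>?P) = (2 * C * cone_mean TYPE('p) \<gamma>) *\<^sub>R (r *\<^sub>R (matrix_inv s - ?A ** m ** ?D))"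
    by simp
  have "(\<integral>y. ?w (fst y) (snd y) *\<^sub>R (?\<mu> (fst y) ** snd y) \<partial>?P) =
      (\<integral>\<Omega>. (2 * C * cone_mean TYPE('p) \<gamma> * ow \<Omega>) *\<^sub>R (?\<mu> \<Omega> ** matrix_inv (?V \<Omega>)) \<partial>sym_lborel)"
    by (rule mw(3)[OF mm]) (rule nm)
  also have "\<dots> = (2 * C * cone_mean TYPE('p) \<gamma>) *\<^sub>R (r *\<^sub>R (?D + - (?B1 ** m ** ?D)))"
    unfolding eT integral_scaleR_right
    by (subst mean[OF bounded_linear_minus[OF bounded_linear_congruence[of ?B1 ?D]]]) (rule refl)
  finally have v2: "(\<integral>y. ?w (fst y) (snd y) *\<^sub>R (?\<mu> (fst y) ** snd y) \<partial>?P) = (2 * C * cone_mean TYPE('p) \<gamma>) *\<^sub>R (r *\<^sub>R (?D - ?B1 ** m ** ?D))"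
    by simp
  have e1: "(\<integral>(\<Theta>, \<Omega>, Q). Q \<partial>posterior n a b c x s) = \<kappa> *\<^sub>R (matrix_inv s - ?A ** m ** ?D)"
    unfolding caseQ z(5)[OF mQ] Keq integral_scaleR_right gmm(2) v1 unfolding \<kappa>_def scaleR_scaleR
    by (simp only: ac_simps)
  have e2: "(\<integral>(\<Theta>, \<Omega>, Q). \<Theta> ** Q \<partial>posterior n a b c x s) = \<kappa> *\<^sub>R (?D - ?B1 ** m ** ?D)"
    unfolding caseT z'(4)[OF mT] Keq' integral_scaleR_right gmm(4) v2 unfolding \<kappa>_def scaleR_scaleR zz
    by (simp only: ac_simps)
  show ?thesis by (rule that[OF k z(3) i2 i1 e1 e2])
qed

text \<open>
  The inverse of the mean of \<open>Q\<close> is guessed as a multiple of \<open>s + x\<^sup>T H x\<close>. The equation for \<open>H\<close> is precisely what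
  verifies it, because it turns \<open>m x s\<^sup>-\<^sup>1 (s + x\<^sup>T H x)\<close> into \<open>H x\<close>.
\<close>

lemma shrinkage_algebra:
  fixes x :: "real^'p^'m" and s :: "real^'p^'p" and m H :: "real^'m^'m" and \<kappa> :: real
  assumes s: "invertible s" and H: "m + m ** (x ** matrix_inv s ** transpose x) ** H = H" and k: "\<kappa> > 0"
  defines "T \<equiv> matrix_inv s - matrix_inv s ** transpose x ** m ** (x ** matrix_inv s)"
    and "Y \<equiv> x ** matrix_inv s - (mat 1 + x ** matrix_inv s ** transpose x) ** m ** (x ** matrix_inv s)"
  shows "invertible (\<kappa> *\<^sub>R T)" and "(\<kappa> *\<^sub>R Y) ** matrix_inv (\<kappa> *\<^sub>R T) = x - H ** x"
proof -
  let ?B = "x ** matrix_inv s ** transpose x" and ?W = "s + transpose x ** H ** x"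
  have mW: "m ** (x ** matrix_inv s) ** ?W = H ** x"
  proof -
    have "m ** (x ** matrix_inv s) ** ?W = m ** x ** (matrix_inv s ** s) + m ** ?B ** H ** x"
      by (simp add: matrix_add_ldistrib matrix_mul_assoc)
    also have "\<dots> = (m + m ** ?B ** H) ** x" by (simp add: matrix_inv_mult[OF s] matrix_add_rdistrib)
    finally show ?thesis unfolding H .
  qed
  have DW: "x ** matrix_inv s ** ?W = x + ?B ** H ** x"
    using matrix_cancel_right(2)[OF s, of x] by (simp add: matrix_add_ldistrib matrix_mul_assoc)
  have "T ** ?W = matrix_inv s ** ?W - matrix_inv s ** transpose x ** (m ** (x ** matrix_inv s) ** ?W)"
    by (simp add: T_def matrix_diff_rdistrib matrix_mul_assoc)
  also have "matrix_inv s ** ?W = mat 1 + matrix_inv s ** transpose x ** (H ** x)"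
    by (simp add: matrix_add_ldistrib matrix_inv_mult[OF s] matrix_mul_assoc)
  finally have TW: "T ** ?W = mat 1" unfolding mW by simp
  have "(\<kappa> *\<^sub>R T) ** ((1 / \<kappa>) *\<^sub>R ?W) = mat 1"
    using k by (simp add: matrix_scaleR_mult matrix_mult_scaleR TW)
  note inv = matrix_inv_eqI[OF this]
  show "invertible (\<kappa> *\<^sub>R T)" by (rule inv(2))
  have "Y ** ?W = x ** matrix_inv s ** ?W - (mat 1 + ?B) ** (m ** (x ** matrix_inv s) ** ?W)"
    by (simp add: Y_def matrix_diff_rdistrib matrix_mul_assoc)
  also have "\<dots> = x - H ** x" unfolding mW DW by (simp add: matrix_add_rdistrib matrix_mul_assoc)
  finally show "(\<kappa> *\<^sub>R Y) ** matrix_inv (\<kappa> *\<^sub>R T) = x - H ** x"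
    unfolding inv(1) using k by (simp add: matrix_scaleR_mult matrix_mult_scaleR)
qed

lemma conjugated_mult:
  fixes R A C :: "real^'m^'m"
  assumes "transpose R ** R = mat 1"
  shows "(R ** A ** transpose R) ** (R ** C ** transpose R) = R ** (A ** C) ** transpose R"
proof -
  have "(R ** A ** transpose R) ** (R ** C ** transpose R) = R ** A ** (transpose R ** R) ** C ** transpose R"
    by (simp only: matrix_mul_assoc)
  then show ?thesis unfolding assms by (simp add: matrix_mul_assoc)
qed

text \<open>
  All matrices in the equation \<open>m + m B H = H\<close> are diagonal in the basis \<open>R\<close>, where it reads
  \<open>g + g f h = h\<close> with \<open>g = e / (1 + f)\<close> and has the solution \<open>h = e / (1 + f - f e)\<close>.
\<close>

lemma gen_bayes_shrinkage:
  fixes x :: "real^'p^'m" and s :: "real^'p^'p" and R :: "real^'m^'m" and f e :: "'m \<Rightarrow> real" and n :: nat and a b c :: real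
  assumes n: "CARD('p) \<le> n" and s: "pos_def s" and R: "orthogonal_matrix R"
    and B: "x ** matrix_inv s ** transpose x = R ** diag_mat f ** transpose R"
    and f: "\<And>i. f i > 0" and c: "- 2 < c" "c < a + real CARD('p)" and b: "b > - real n - real CARD('m) - 1"
    and e: "(\<integral>\<Lambda>. \<Lambda> \<partial>Lambda_law CARD('p) n a b c (diag_mat f :: real^'m^'m)) = diag_mat e" "\<And>i. e i < 1"
  shows "gen_bayes_exists n a b c x s"
    and "gen_bayes n a b c x s = x - R ** diag_mat (\<lambda>i. e i / (1 + f i - f i * e i)) ** transpose R ** x"
proof -
  have RR: "R ** transpose R = mat 1" and RR': "transpose R ** R = mat 1"
    using R unfolding orthogonal_matrix_def by simp_all
  define m where "m = R ** diag_mat (\<lambda>i. e i / (1 + f i)) ** transpose R"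
  define H where "H = R ** diag_mat (\<lambda>i. e i / (1 + f i - f i * e i)) ** transpose R"
  let ?B = "x ** matrix_inv s ** transpose x"
  obtain \<kappa> where k: "\<kappa> > 0" and P: "prob_space (posterior n a b c x s)"
      "integrable (posterior n a b c x s) (\<lambda>(\<Theta>, \<Omega>, Q). \<Theta> ** Q)"
      "integrable (posterior n a b c x s) (\<lambda>(\<Theta>, \<Omega>, Q). Q)"
    and EQ: "(\<integral>(\<Theta>, \<Omega>, Q). Q \<partial>posterior n a b c x s) =
      \<kappa> *\<^sub>R (matrix_inv s - matrix_inv s ** transpose x ** m ** (x ** matrix_inv s))"
    and ET: "(\<integral>(\<Theta>, \<Omega>, Q). \<Theta> ** Q \<partial>posterior n a b c x s) =
      \<kappa> *\<^sub>R (x ** matrix_inv s - (mat 1 + x ** matrix_inv s ** transpose x) ** m ** (x ** matrix_inv s))"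
    using posterior_means[OF n s RR B f c b e(1), folded m_def] by blast
  have pos: "1 + f i - f i * e i > 0" for i
  proof -
    have "f i * e i < f i" using f[of i] e(2)[of i] by simp
    then show ?thesis by simp
  qed
  have eq: "e i / (1 + f i) + e i / (1 + f i) * f i * (e i / (1 + f i - f i * e i)) = e i / (1 + f i - f i * e i)" for i
  proof -
    have "1 + f i > 0" using f[of i] by simp
    then show ?thesis using pos[of i] by (simp add: divide_simps) (simp add: algebra_simps)
  qed
  have Hm: "m + m ** ?B ** H = H"
    unfolding B m_def H_def conjugated_mult[OF RR'] diag_mat_mult matrix_add_rdistrib[symmetric] matrix_add_ldistrib[symmetric] diag_mat_add eq ..
  note sh = shrinkage_algebra[OF pos_def_invertible[OF s] Hm k]
  show "gen_bayes_exists n a b c x s" unfolding gen_bayes_exists_def EQ using P sh(1) by simp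
  show "gen_bayes n a b c x s = x - R ** diag_mat (\<lambda>i. e i / (1 + f i - f i * e i)) ** transpose R ** x"
    unfolding gen_bayes_def EQ ET sh(2) H_def ..
qed

text \<open>
  The factor in the theorem is the diagonal matrix \<open>f\<^sup>-\<^sup>1 e / (f\<^sup>-\<^sup>1 (1 + f) - e) = e / (1 + f - f e)\<close>.
\<close>

lemma gen_bayes_spectral:
  fixes x :: "real^'p^'m" and s :: "real^'p^'p" and R :: "real^'m^'m" and f :: "'m \<Rightarrow> real" and n :: nat and a b c :: real
  assumes n: "CARD('p) \<le> n" and s: "pos_def s" and R: "orthogonal_matrix R"
    and B: "x ** matrix_inv s ** transpose x = R ** diag_mat f ** transpose R"
    and f: "\<And>i. f i > 0" and c: "- 2 < c" "c < a + real CARD('p)" and b: "b > - real n - real CARD('m) - 1"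
  defines "F \<equiv> diag_mat f :: real^'m^'m"
  defines "\<L> \<equiv> Lambda_law CARD('p) n a b c F"
  defines "E \<equiv> (\<integral>\<Lambda>. \<Lambda> \<partial>\<L>)"
  shows "gen_bayes_exists n a b c x s \<and> prob_space \<L> \<and> integrable \<L> (\<lambda>\<Lambda>. \<Lambda>) \<and>
    invertible (matrix_inv F ** (mat 1 + F) - E) \<and>
    gen_bayes n a b c x s =
      x - R ** matrix_inv F ** E ** matrix_inv (matrix_inv F ** (mat 1 + F) - E) ** transpose R ** x"
proof -
  have f0: "f i \<noteq> 0" for i using f[of i] by simp
  let ?F = "diag_mat f :: real^'m^'m"
  let ?L = "Lambda_law CARD('p) n a b c ?F"
  obtain e where e: "prob_space ?L" "integrable ?L (\<lambda>\<Lambda>. \<Lambda>)" "(\<integral>\<Lambda>. \<Lambda> \<partial>?L) = diag_mat e"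
      "\<And>i. e i < 1"
    and "b = a + real CARD('m) - real n \<Longrightarrow>
      e = (\<lambda>_. (a - c + real CARD('p) + real CARD('m) - 1) / (a + 2 * real CARD('m) + real CARD('p)))"
    using that by (rule Lambda_mean[where f=f and a=a and b=b and c=c and n=n and p="CARD('p)", OF f c])
  have Finv: "matrix_inv ?F = diag_mat (\<lambda>i. 1 / f i)" by (rule matrix_inv_diag_mat(1)[OF f0])
  have D: "matrix_inv ?F ** (mat 1 + ?F) - diag_mat e = diag_mat (\<lambda>i. 1 / f i * (1 + f i) - e i)"
    unfolding Finv mat_1_diag diag_mat_add diag_mat_mult diag_mat_diff ..
  have dpos: "1 / f i * (1 + f i) - e i > 0" for i
  proof -
    have "1 / f i * (1 + f i) = 1 / f i + 1" using f0[of i] by (simp add: distrib_left)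
    moreover have "1 / f i > 0" using f[of i] by simp
    ultimately show ?thesis using e(4)[of i] by linarith
  qed
  note Di = matrix_inv_diag_mat[where f="\<lambda>i. 1 / f i * (1 + f i) - e i", OF less_imp_neq[OF dpos, symmetric]]
  have ratio: "1 / f i * e i * (1 / (1 / f i * (1 + f i) - e i)) = e i / (1 + f i - f i * e i)" for i
  proof -
    have "1 / f i * e i * (1 / (1 / f i * (1 + f i) - e i)) = e i / (f i * (1 / f i * (1 + f i) - e i))" by simp
    also have "f i * (1 / f i * (1 + f i) - e i) = 1 + f i - f i * e i" using f0[of i] by (simp add: right_diff_distrib)
    finally show ?thesis .
  qed
  have est: "R ** matrix_inv ?F ** diag_mat e ** matrix_inv (matrix_inv ?F ** (mat 1 + ?F) - diag_mat e) ** transpose R ** x =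
      R ** diag_mat (\<lambda>i. e i / (1 + f i - f i * e i)) ** transpose R ** x"
  proof -
    have "R ** matrix_inv ?F ** diag_mat e ** matrix_inv (matrix_inv ?F ** (mat 1 + ?F) - diag_mat e) =
        R ** (diag_mat (\<lambda>i. 1 / f i) ** diag_mat e ** diag_mat (\<lambda>i. 1 / (1 / f i * (1 + f i) - e i)))"
      unfolding D Di(1) unfolding Finv by (simp only: matrix_mul_assoc)
    then show ?thesis unfolding diag_mat_mult ratio by (simp only:)
  qed
  show ?thesis
    unfolding F_def \<L>_def E_def e(3) est unfolding D
    using gen_bayes_shrinkage[OF n s R B f c b e(3,4)] e(1,2) Di(2) by simp
qed

text \<open>
  Now \<open>e i = k\<close> for all \<open>i\<close>, and \<open>k / (1 + f - f k)\<close> is the eigenvalue of \<open>k U\<^sup>-\<^sup>1\<close> belonging to \<open>f\<close>. The second form follows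
  from \<open>U x = x V\<close>. The condition on \<open>a\<close> is the one on \<open>b\<close> in the general case.
\<close>

lemma gen_bayes_closed_form:
  fixes x :: "real^'p^'m" and s :: "real^'p^'p" and R :: "real^'m^'m" and f :: "'m \<Rightarrow> real" and n :: nat and a b c :: real
  assumes n: "CARD('p) \<le> n" and s: "pos_def s" and R: "orthogonal_matrix R"
    and B: "x ** matrix_inv s ** transpose x = R ** diag_mat f ** transpose R"
    and f: "\<And>i. f i > 0" and c: "- 2 < c" "c < a + real CARD('p)" and b: "b = a + real CARD('m) - real n" and a: "a > - 2 * real CARD('m) - 1"
  defines "k \<equiv> (a - c + real CARD('p) + real CARD('m) - 1) / (a + 2 * real CARD('m) + real CARD('p))"
  defines "U \<equiv> mat 1 + (1 - k) *\<^sub>R (x ** matrix_inv s ** transpose x)"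
    and "V \<equiv> mat 1 + (1 - k) *\<^sub>R (matrix_inv s ** transpose x ** x)"
  shows "gen_bayes_exists n a b c x s \<and> invertible U \<and> invertible V \<and>
    gen_bayes n a b c x s = x - k *\<^sub>R (matrix_inv U ** x) \<and>
    x - k *\<^sub>R (matrix_inv U ** x) = x - k *\<^sub>R (x ** matrix_inv V)"
proof -
  have RR: "R ** transpose R = mat 1" and RR': "transpose R ** R = mat 1"
    using R unfolding orthogonal_matrix_def by simp_all
  have b': "b > - real n - real CARD('m) - 1" using a b by linarith
  let ?L = "Lambda_law CARD('p) n a b c (diag_mat f :: real^'m^'m)"
  obtain e where "prob_space ?L" and "integrable ?L (\<lambda>\<Lambda>. \<Lambda>)" and e1: "(\<integral>\<Lambda>. \<Lambda> \<partial>?L) = diag_mat e"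
    and e2: "\<And>i. e i < 1"
    and e3: "b = a + real CARD('m) - real n \<Longrightarrow>
      e = (\<lambda>_. (a - c + real CARD('p) + real CARD('m) - 1) / (a + 2 * real CARD('m) + real CARD('p)))"
    using that by (rule Lambda_mean[where f=f and a=a and b=b and c=c and n=n and p="CARD('p)", OF f c])
  have ek: "e = (\<lambda>_. k)" unfolding k_def by (rule e3[OF b])
  have k1: "k < 1" using e2 unfolding ek by simp
  define D where "D = (diag_mat (\<lambda>i. 1 + (1 - k) * f i) :: real^'m^'m)"
  have dpos: "1 + (1 - k) * f i > 0" for i using f[of i] k1 by (simp add: add_pos_pos)
  note Di = matrix_inv_diag_mat[where f="\<lambda>i. 1 + (1 - k) * f i", OF less_imp_neq[OF dpos, symmetric], folded D_def]
  have U: "U = R ** D ** transpose R"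
  proof -
    have "R ** D ** transpose R = R ** mat 1 ** transpose R + (1 - k) *\<^sub>R (R ** diag_mat f ** transpose R)"
      unfolding D_def diag_mat_add[symmetric] mat_1_diag[symmetric] diag_mat_scaleR[symmetric]
        matrix_add_ldistrib matrix_add_rdistrib matrix_mult_scaleR matrix_scaleR_mult ..
    then show ?thesis by (simp add: U_def B RR)
  qed
  have "U ** (R ** matrix_inv D ** transpose R) = mat 1"
    unfolding U conjugated_mult[OF RR'] matrix_inv_mult(1)[OF Di(2)] by (simp add: RR)
  note Ui = matrix_inv_eqI[OF this]
  have V: "invertible V"
  proof -
    have pd: "pos_def (s + transpose x ** ((1 - k) *\<^sub>R mat 1) ** transpose (transpose x))"
      using k1 by (intro pos_def_add_congruence s pos_def_scaleR pos_def_mat_1) simp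
    have "V = matrix_inv s ** (s + transpose x ** ((1 - k) *\<^sub>R mat 1) ** transpose (transpose x))"
      by (simp add: V_def matrix_add_ldistrib matrix_mult_scaleR matrix_scaleR_mult matrix_mul_assoc matrix_inv_mult[OF pos_def_invertible[OF s]])
    then show ?thesis
      using invertible_mult[OF invertible_matrix_inv(1)[OF pos_def_invertible[OF s]] pos_def_invertible[OF pd]] by simp
  qed
  have UV: "U ** x = x ** V"
    by (simp add: U_def V_def matrix_add_ldistrib matrix_add_rdistrib matrix_mult_scaleR matrix_scaleR_mult matrix_mul_assoc)
  have swap: "matrix_inv U ** x = x ** matrix_inv V"
  proof -
    have "matrix_inv U ** x = matrix_inv U ** (x ** V ** matrix_inv V)" by (simp only: matrix_cancel_right(1)[OF V])
    also have "\<dots> = matrix_inv U ** (U ** x) ** matrix_inv V" by (simp only: UV matrix_mul_assoc)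
    finally show ?thesis unfolding matrix_cancel_left(1)[OF Ui(2)] .
  qed
  have kU: "R ** diag_mat (\<lambda>i. k / (1 + f i - f i * k)) ** transpose R ** x = k *\<^sub>R (matrix_inv U ** x)"
  proof -
    have eq: "1 + f i - f i * k = 1 + (1 - k) * f i" for i by (simp add: algebra_simps)
    have "diag_mat (\<lambda>i. k / (1 + f i - f i * k)) = k *\<^sub>R matrix_inv D"
      unfolding Di(1) diag_mat_scaleR eq by simp
    then show ?thesis unfolding Ui(1) by (simp only: matrix_mult_scaleR matrix_scaleR_mult)
  qed
  show ?thesis
    unfolding swap[symmetric]
    using gen_bayes_shrinkage[OF n s R B f c b' e1 e2] Ui(2) V unfolding ek kU by simp
qed

theorem theorem2p1:
  fixes M :: "'a measure"
    and X :: "'a \<Rightarrow> real^'p^'m::{finite,linorder}"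
    and S :: "'a \<Rightarrow> real^'p^'p"
    and \<Theta> :: "real^'p^'m::{finite,linorder}" and \<Sigma> :: "real^'p^'p"
    and n :: nat and a b c :: real
    and \<omega> :: 'a and R :: "real^('m::{finite,linorder})^('m::{finite,linorder})" and f :: "'m \<Rightarrow> real"
  assumes "CARD('m) < CARD('p)" and "CARD('p) \<le> n"
    and "pos_def \<Sigma>"
    and "prob_space M"
    and "distributed M lborel X (\<lambda>x. ennreal (matrix_normal_density \<Theta> (mat 1) \<Sigma> x))"
    and "distributed M sym_lborel S (\<lambda>s. ennreal (wishart_density n \<Sigma> s))"
    and "prob_space.indep_set M {X -` A \<inter> space M |A. A \<in> sets borel}
           {S -` B \<inter> space M |B. B \<in> sets borel}"
    and "\<omega> \<in> space M" and "pos_def (S \<omega>)"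
    and "orthogonal_matrix R"
    and "X \<omega> ** matrix_inv (S \<omega>) ** transpose (X \<omega>) = R ** diag_mat f ** transpose R"
    and "\<And>i j. i < j \<Longrightarrow> f i > f j" and "\<And>i. f i > 0"
  shows
    "(- 2 < c \<and> c < a + real CARD('p) \<and> b > - real n - real CARD('m) - 1 \<longrightarrow>
       (let F = diag_mat f;
            \<L> = Lambda_law CARD('p) n a b c F;
            E = (\<integral>\<Lambda>. \<Lambda> \<partial>\<L>)
        in gen_bayes_exists n a b c (X \<omega>) (S \<omega>) \<and>
           prob_space \<L> \<and> integrable \<L> (\<lambda>\<Lambda>. \<Lambda>) \<and>
           invertible (matrix_inv F ** (mat 1 + F) - E) \<and>
           gen_bayes n a b c (X \<omega>) (S \<omega>) =
             X \<omega> - R ** matrix_inv F ** E ** matrix_inv (matrix_inv F ** (mat 1 + F) - E) **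
               transpose R ** X \<omega>))
     \<and>
     (b = a + real CARD('m) - real n \<and> - 2 < c \<and> c < a + real CARD('p) \<and>
      a > - 2 * real CARD('m) - 1 \<longrightarrow>
       (let k\<^sub>0 = (a - c + real CARD('p) + real CARD('m) - 1) /
                 (a + 2 * real CARD('m) + real CARD('p));
            U = mat 1 + (1 - k\<^sub>0) *\<^sub>R (X \<omega> ** matrix_inv (S \<omega>) ** transpose (X \<omega>));
            V = mat 1 + (1 - k\<^sub>0) *\<^sub>R (matrix_inv (S \<omega>) ** transpose (X \<omega>) ** X \<omega>)
        in gen_bayes_exists n a b c (X \<omega>) (S \<omega>) \<and> invertible U \<and> invertible V \<and>
           gen_bayes n a b c (X \<omega>) (S \<omega>) = X \<omega> - k\<^sub>0 *\<^sub>R (matrix_inv U ** X \<omega>) \<and>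
           X \<omega> - k\<^sub>0 *\<^sub>R (matrix_inv U ** X \<omega>) = X \<omega> - k\<^sub>0 *\<^sub>R (X \<omega> ** matrix_inv V)))"
proof (intro conjI impI, goal_cases)
  case 1
  then have c: "- 2 < c" "c < a + real CARD('p)" and b: "b > - real n - real CARD('m) - 1" by auto
  show ?case unfolding Let_def by (rule gen_bayes_spectral[OF assms(2,9,10,11,13) c b])
next
  case 2
  then have b: "b = a + real CARD('m) - real n" and c: "- 2 < c" "c < a + real CARD('p)" and a: "a > - 2 * real CARD('m) - 1" by auto
  show ?case unfolding Let_def by (rule gen_bayes_closed_form[OF assms(2,9,10,11,13) c b a])
qed

end
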